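(* Let $k\ge2$ if $n$ is odd and $k\ge3$ if $n$ is even. Define $\sigma=k+\frac{n+1}{2}$ and assume that $x_0$ is an exponentially stable equilibrium of $\dot x=f(x)$ with basin of attraction $\mathcal A(x_0)$, where $f\in C^{\sigma+1}(\mathbb R^n;\mathbb R^n)$. Let $C\in\mathbb S^{n\times n}$ be a positive definite matrix and let $M\in C^{\sigma}(\mathcal A(x_0);\mathbb S^{n\times n})$ be the unique solution of $$Df(x)^TM(x)+M(x)Df(x)+M'_+(x)=-C\qquad\text{for all }x\in\mathcal A(x_0).$$ Let $\Omega\subset\mathcal A(x_0)$ be open and bounded with Lipschitz boundary, and let $\mathcal D\subset\Omega$ be a positively invariant open set with $C^1$ boundary such that $x_0\in\mathcal D$ and $\overline{\mathcal D}\subset\Omega$. Fix a compact set $\widetilde K\subset\mathcal D$ and constants $$d\ge2\sqrt n,\qquad B^*\ge\max_{x\in\overline{\mathcal D},\ i,j,m=1,\dots,n}\Big|\frac{\partial^2f_m}{\partial x_i\partial x_j}(x)\Big|,\qquad B_3^*\ge\max_{x\in\overline{\mathcal D},\ i,j,m,p=1,\dots,n}\Big|\frac{\partial^3f_p}{\partial x_i\partial x_j\partial x_m}(x)\Big|.$$ Then there exist constants $h^*_{X,\Omega},h^*>0$ such that for any set of collocation points $X\subset\Omega$ with fill distance $h_{X,\Omega}\le h^*_{X,\Omega}$ and any $(h,d)$-bounded triangulation $\mathcal T$ with $\widetilde K\subset\mathcal D_{\mathcal T}^\circ\subset\mathcal D_{\mathcal T}\subset\mathcal D$ and $h<h^*$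 the following holds. Suppose that $S$ is the optimal recovery of $M$ based on $X$ with kernel given by the Wendland function $\psi_{l,k}$ with $l=\lfloor\frac n2\rfloor+k+1$ (see context). Fix the constants and variables of the Verification Problem (see context) as follows, for all $\mathfrak S_\nu\in\mathcal T$, all vertices $y\in\mathcal V_{\mathcal T}$, and $1\le i\le j\le n$: $$P_{ij}(y)=S_{ij}(y),\qquad C_\nu=\max\{\|P(x)\|_2: x\text{ a vertex of }\mathfrak S_\nu\},\qquad D_\nu=\max_{1\le i\le j\le n}\|w^\nu_{ij}\|_1,$$ $$B^*\ge B_\nu\ge\max_{x\in\mathfrak S_\nu,\ i,j,m=1,\dots,n}\Big|\frac{\partial^2f_m}{\partial x_i\partial x_j}(x)\Big|,\qquad B_3^*\ge B_{3,\nu}\ge\max_{x\in\mathfrak S_\nu,\ i,j,m,p=1,\dots,n}\Big|\frac{\partial^3f_p}{\partial x_i\partial x_j\partial x_m}(x)\Big|,$$ and $$\epsilon_0=\tfrac13\min(\lambda_0,\lambda_1)>0,\quad\text{where}\quad\lambda_0I\preceq M(x)\ \text{ for all }x\in\overline\Omega\quad\text{and}\quad\lambda_1I\preceq C.$$ Then the constraints of the Verification Problem are fulfilled by these values. In particular, the CPA interpolation $P$ of $S$ on $\mathcal T$ is a contraction metric on $\widetilde K$.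
   Context: Consider the ODE $\dot x=f(x)$ on $\mathbb R^n$; the solution with $x(0)=\xi$ is denoted $S_t\xi$ and is assumed to exist for all $t\ge0$. An equilibrium $x_0$ ($f(x_0)=0$) is exponentially stable if there are $\alpha,\beta,\delta>0$ such that $\|x(0)-x_0\|_2<\delta$ implies $\|x(t)-x_0\|_2\le\alpha\|x(0)-x_0\|_2e^{-\beta t}$ for all $t\ge0$; its basin of attraction is $\mathcal A(x_0)=\{x:\lim_{t\to\infty}S_tx=x_0\}$. $\mathbb S^{n\times n}$ denotes the real symmetric $n\times n$ matrices, $A\preceq B$ means that $A-B$ is negative semidefinite, $Df$ is the Jacobian matrix, $A^\circ$ is the interior of $A$. **Orbital derivative and operator $F$.** For a matrix-valued function $M$, $M'_+(x)=\limsup_{h\to0^+}\frac{M(S_hx)-M(x)}{h}$ (entrywise); for $M\in C^1$ it is $(\nabla M_{ij}(x)\cdot f(x))_{ij}$. Put $F(M)(x)=Df(x)^TM(x)+M(x)Df(x)+M'_+(x)$. It is a known fact that the equation $F(M)=-C$ on $\mathcal A(x_0)$ has a unique solution $M$, which is positive definite at each point and of class $C^{s-1}$ if $f\in C^s$, $s\ge2$. **Contraction metric.** For $G\subset\mathbb R^n$ open, a Riemannian metric is a locally Lipschitz continuous $M:G\to\mathbb S^{n\times n}$ with $M(x)$ positive definite for all $x\in G$. It is a contraction metric on the compact set $K\subset G$ if there is $\nu>0$ such that for all $x\in K$: $\max_{v^TM(x)v=1}\frac12v^T[M(x)Df(x)+Df(x)^TM(x)+M'_+(x)]v\le-\nu$.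 **Wendland functions.** $\psi_{l,0}(r)=(1-r)_+^l$ and $\psi_{l,k+1}(r)=\int_r^1t\,\psi_{l,k}(t)\,dt$ for $r\ge0$, where $x_+=\max(x,0)$. With a fixed $c>0$ and $l=\lfloor\frac n2\rfloor+k+1$, $\phi(x,y)=\psi_{l,k}(c\|x-y\|_2)$ is the reproducing kernel of a Hilbert space of functions on $\Omega$ that is norm-equivalent to the Sobolev space $H^\sigma(\Omega)$, $\sigma=k+\frac{n+1}2$. **Optimal recovery.** Let $\mathcal H(\Omega;\mathbb S^{n\times n})$ be the Hilbert space of all $\mathbb S^{n\times n}$-valued functions on $\Omega$ whose entries lie in the reproducing kernel Hilbert space of $\phi$, with inner product the sum over all $n^2$ entries of the scalar inner products (so it is $H^\sigma(\Omega;\mathbb S^{n\times n})$ with an equivalent norm; its reproducing kernel is $\Phi(x,y)_{ijm\ell}=\phi(x,y)\delta_{im}\delta_{j\ell}$). For a set of pairwise distinct collocation points $X=\{x_1,\dots,x_N\}\subset\Omega$, the optimal recovery $S$ of $M$ is the unique element of minimal norm in $\mathcal H(\Omega;\mathbb S^{n\times n})$ among all $s$ satisfying $F(s)(x_q)=-C$ for $q=1,\dots,N$. The fill distance is $h_{X,\Omega}=\sup_{x\in\Omega}\min_{x_i\in X}\|x-x_i\|_2$. **Triangulation.** A triangulation is a finite set $\mathcal T=\{\mathfrak S_\nu\}_\nu$ of $n$-simplices (convex hulls $\operatorname{co}(x_0,\dots,x_n)$ of affinely independent points) such that any two different simplices intersect in a common face or not at all; $\mathcal D_{\mathcal T}=\bigcup_\nu\mathfrak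 S_\nu$, and $\mathcal V_{\mathcal T}$ is the set of all vertices. It is $(h,d)$-bounded if for each $\mathfrak S_\nu=\operatorname{co}(x_0^\nu,\dots,x_n^\nu)\in\mathcal T$: $h_\nu:=\operatorname{diam}(\mathfrak S_\nu)=\max_{x,y\in\mathfrak S_\nu}\|x-y\|_2<h$ and $h_\nu\|X_\nu^{-1}\|_1\le d$, where $X_\nu=(x_1^\nu-x_0^\nu,\dots,x_n^\nu-x_0^\nu)^T$ and $\|\cdot\|_1$ is the matrix norm induced by the vector $1$-norm. **CPA interpolation.** The CPA interpolation on $\mathcal T$ of a matrix-valued function $S$ is the unique continuous $P:\mathcal D_{\mathcal T}\to\mathbb R^{n\times n}$ that is affine on each simplex and satisfies $P(y)=S(y)$ for all $y\in\mathcal V_{\mathcal T}$. The constant gradient of $P_{ij}$ on $\mathfrak S_\nu$ is denoted $w^\nu_{ij}\in\mathbb R^n$. **Verification Problem.** Given constants $\epsilon_0>0$, $h_\nu$, and bounds $B_\nu$, $B_{3,\nu}$ on the absolute values of all second-order, respectively third-order, partial derivatives of the components of $f$ on $\mathfrak S_\nu$; symmetric matrices $P(y)$, $y\in\mathcal V_{\mathcal T}$; and $C_\nu,D_\nu\ge0$ for $\mathfrak S_\nu\in\mathcal T$, the constraints are: 1. $P(y)\succeq\epsilon_0I$ for each $y\in\mathcal V_{\mathcal T}$. 2. $P(y)\preceq C_\nu I$ for each simplex $\mathfrak S_\nu$ and each vertex $y$ of $\mathfrak S_\nu$. 3. $\|w^\nu_{ij}\|_1\le D_\nu$ for each simplex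 $\mathfrak S_\nu$ and all $1\le i\le j\le n$. 4. For each simplex $\mathfrak S_\nu$ and each vertex $y$ of $\mathfrak S_\nu$: $A_\nu(y)+h_\nu^2E_\nu I\preceq-\epsilon_0I$, where $$A_\nu(y)=P(y)Df(y)+Df(y)^TP(y)+\big(w^\nu_{ij}\cdot f(y)\big)_{i,j=1,\dots,n},$$ $$E_\nu=n^2(1+4\sqrt n)B_\nu D_\nu+2n^3B_{3,\nu}C_\nu.$$ *)

theory Defs
  imports "HOL-Analysis.Analysis"
begin

section \<open>Smoothness and domains\<close>

definition pdiff :: "'n \<Rightarrow> (real^'n \<Rightarrow> real) \<Rightarrow> real^'n \<Rightarrow> real" where
  "pdiff i g x = frechet_derivative g (at x) (axis i 1)"

text \<open>To be used on open sets \<open>U\<close>: all partial derivatives up to the given order exist and are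
  continuous.\<close>

fun Ck_on :: "nat \<Rightarrow> (real^'n \<Rightarrow> real) \<Rightarrow> (real^'n) set \<Rightarrow> bool" where
  "Ck_on 0 g U \<longleftrightarrow> continuous_on U g"
| "Ck_on (Suc m) g U \<longleftrightarrow>
     (\<forall>x\<in>U. g differentiable (at x)) \<and> (\<forall>i. Ck_on m (pdiff i g) U)"

text \<open>For real \<open>s \<ge> 0\<close>, class \<open>C\<^sup>s\<close> means \<open>s\<close> rounded up to an integer, which gives local membership
  in the Sobolev space of order \<open>s\<close> (this fails for the fractional Hoelder class of order \<open>s\<close>).
  For integer \<open>s\<close> it is the usual notion.\<close>

definition class_C :: "real \<Rightarrow> (real^'n \<Rightarrow> real) \<Rightarrow> (real^'n) set \<Rightarrow> bool" where
  "class_C s g U \<longleftrightarrow> Ck_on (nat \<lceil>s\<rceil>) g U"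

text \<open>Near each boundary point, \<open>A\<close> lies strictly on one side of the graph of a function over a
  hyperplane orthogonal to a unit vector \<open>e\<close>. The function on the hyperplane is represented
  by some \<open>\<gamma>\<close> on the whole space, only evaluated on the hyperplane.\<close>

definition graph_boundary :: "((real^'n \<Rightarrow> real) \<Rightarrow> bool) \<Rightarrow> (real^'n) set \<Rightarrow> bool" where
  "graph_boundary cls A \<longleftrightarrow>
     (\<forall>p\<in>frontier A. \<exists>e \<gamma> r. norm e = 1 \<and> 0 < r \<and> cls \<gamma> \<and>
        A \<inter> ball p r = {y \<in> ball p r. \<gamma> (y - (e \<bullet> y) *\<^sub>R e) < e \<bullet> y})"

definition Lipschitz_boundary :: "(real^'n) set \<Rightarrow> bool" where
  "Lipschitz_boundary = graph_boundary (\<lambda>\<gamma>. \<exists>L. L-lipschitz_on UNIV \<gamma>)"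

definition C1_boundary :: "(real^'n) set \<Rightarrow> bool" where
  "C1_boundary = graph_boundary (\<lambda>\<gamma>. Ck_on 1 \<gamma> UNIV)"

section \<open>Matrices\<close>

definition symmetric_mat :: "real^'n^'n \<Rightarrow> bool" where
  "symmetric_mat A \<longleftrightarrow> transpose A = A"

definition pos_def :: "real^'n^'n \<Rightarrow> bool" where
  "pos_def A \<longleftrightarrow> symmetric_mat A \<and> (\<forall>v. v \<noteq> 0 \<longrightarrow> 0 < v \<bullet> (A *v v))"

definition neg_semidef :: "real^'n^'n \<Rightarrow> bool" where
  "neg_semidef A \<longleftrightarrow> symmetric_mat A \<and> (\<forall>v. v \<bullet> (A *v v) \<le> 0)"

definition loewner_le :: "real^'n^'n \<Rightarrow> real^'n^'n \<Rightarrow> bool" (infix \<open>\<preceq>\<^sub>L\<close> 50) where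
  "A \<preceq>\<^sub>L B \<longleftrightarrow> neg_semidef (A - B)"

definition norm1 :: "real^'n \<Rightarrow> real" where
  "norm1 v = (\<Sum>i\<in>UNIV. \<bar>v $ i\<bar>)"

definition mat_norm1 :: "real^'n^'n \<Rightarrow> real" where
  "mat_norm1 A = (SUP v\<in>{v. v \<noteq> 0}. norm1 (A *v v) / norm1 v)"

definition mat_norm2 :: "real^'n^'n \<Rightarrow> real" where
  "mat_norm2 A = onorm (\<lambda>v. A *v v)"

section \<open>Dynamics\<close>

definition solution_flow :: "(real^'n \<Rightarrow> real^'n) \<Rightarrow> (real \<Rightarrow> real^'n \<Rightarrow> real^'n) \<Rightarrow> bool" where
  "solution_flow f fl \<longleftrightarrow>
     (\<forall>\<xi>. fl 0 \<xi> = \<xi> \<and>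
        (\<forall>t\<ge>0. ((\<lambda>u. fl u \<xi>) has_vector_derivative f (fl t \<xi>)) (at t within {0..})))"

definition exp_stable_equilibrium ::
  "(real^'n \<Rightarrow> real^'n) \<Rightarrow> (real \<Rightarrow> real^'n \<Rightarrow> real^'n) \<Rightarrow> real^'n \<Rightarrow> bool" where
  "exp_stable_equilibrium f fl x0 \<longleftrightarrow>
     f x0 = 0 \<and>
     (\<exists>\<alpha>>0. \<exists>\<beta>>0. \<exists>\<delta>>0. \<forall>\<xi>. norm (\<xi> - x0) < \<delta> \<longrightarrow>
        (\<forall>t\<ge>0. norm (fl t \<xi> - x0) \<le> \<alpha> * norm (\<xi> - x0) * exp (- \<beta> * t)))"

definition basin :: "(real \<Rightarrow> real^'n \<Rightarrow> real^'n) \<Rightarrow> real^'n \<Rightarrow> (real^'n) set" where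
  "basin fl x0 = {x. ((\<lambda>t. fl t x) \<longlongrightarrow> x0) at_top}"

definition positively_invariant ::
  "(real \<Rightarrow> real^'n \<Rightarrow> real^'n) \<Rightarrow> (real^'n) set \<Rightarrow> bool" where
  "positively_invariant fl A \<longleftrightarrow> (\<forall>x\<in>A. \<forall>t\<ge>0. fl t x \<in> A)"

text \<open>The limsup is finite wherever \<open>M\<close> is locally Lipschitz, which is the case in all uses. (An
  infinite limsup would be mapped to 0.) On an open set it only depends on \<open>M\<close> in that set.\<close>

definition orbital_derivative ::
  "(real \<Rightarrow> real^'n \<Rightarrow> real^'n) \<Rightarrow> (real^'n \<Rightarrow> real^'n^'n) \<Rightarrow> real^'n \<Rightarrow> real^'n^'n" where
  "orbital_derivative fl M x =
     (\<chi> i j. real_of_ereal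
        (Limsup (at_right 0) (\<lambda>h. ereal ((M (fl h x) $ i $ j - M x $ i $ j) / h))))"

definition Df :: "(real^'n \<Rightarrow> real^'n) \<Rightarrow> real^'n \<Rightarrow> real^'n^'n" where
  "Df f x = jacobian f (at x)"

definition F_op ::
  "(real^'n \<Rightarrow> real^'n) \<Rightarrow> (real \<Rightarrow> real^'n \<Rightarrow> real^'n) \<Rightarrow> (real^'n \<Rightarrow> real^'n^'n)
     \<Rightarrow> real^'n \<Rightarrow> real^'n^'n" where
  "F_op f fl M x =
     transpose (Df f x) ** M x + M x ** Df f x + orbital_derivative fl M x"

definition riemannian_metric :: "(real^'n) set \<Rightarrow> (real^'n \<Rightarrow> real^'n^'n) \<Rightarrow> bool" where
  "riemannian_metric G M \<longleftrightarrow>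
     open G \<and> (\<forall>x\<in>G. pos_def (M x)) \<and>
     (\<forall>x\<in>G. \<exists>u>0. \<exists>L. L-lipschitz_on (cball x u \<inter> G) M)"

definition contraction_metric ::
  "(real^'n \<Rightarrow> real^'n) \<Rightarrow> (real \<Rightarrow> real^'n \<Rightarrow> real^'n) \<Rightarrow> (real^'n) set \<Rightarrow> (real^'n) set
     \<Rightarrow> (real^'n \<Rightarrow> real^'n^'n) \<Rightarrow> bool" where
  "contraction_metric f fl G K M \<longleftrightarrow>
     riemannian_metric G M \<and> compact K \<and> K \<subseteq> G \<and>
     (\<exists>\<nu>>0. \<forall>x\<in>K. \<forall>v. v \<bullet> (M x *v v) = 1 \<longrightarrow> 1/2 * (v \<bullet> (F_op f fl M x *v v)) \<le> - \<nu>)"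

section \<open>Wendland functions and optimal recovery\<close>

text \<open>For \<open>r > 1\<close> the interval is empty and the value 0 is the correct one, since all the functions
  with \<open>l > 0\<close> vanish on \<open>[1, \<infinity>)\<close>.\<close>

fun wendland :: "nat \<Rightarrow> nat \<Rightarrow> real \<Rightarrow> real" where
  "wendland l 0 r = (max (1 - r) 0) ^ l"
| "wendland l (Suc k) r = integral {r..1} (\<lambda>t. t * wendland l k t)"

definition wendland_kernel :: "nat \<Rightarrow> real \<Rightarrow> real^'n \<Rightarrow> real^'n \<Rightarrow> real" where
  "wendland_kernel k c x y = wendland (CARD('n) div 2 + k + 1) k (c * norm (x - y))"

text \<open>\<open>(H, ip)\<close> is the Hilbert space of functions on \<open>\<Omega>\<close> with reproducing kernel \<open>K\<close>; it is determined
  by \<open>\<Omega>\<close> and \<open>K\<close> up to the values of \<open>ip\<close> outside \<open>H\<close>. A function on \<open>\<Omega>\<close> is represented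
  by its extension by 0.\<close>

definition rkhs :: "'a set \<Rightarrow> ('a \<Rightarrow> 'a \<Rightarrow> real) \<Rightarrow> ('a \<Rightarrow> real) set
     \<Rightarrow> (('a \<Rightarrow> real) \<Rightarrow> ('a \<Rightarrow> real) \<Rightarrow> real) \<Rightarrow> bool" where
  "rkhs \<Omega> K H ip \<longleftrightarrow>
     \<comment> \<open>vector space of functions on \<open>\<Omega>\<close>\<close>
     (\<forall>g\<in>H. \<forall>x. x \<notin> \<Omega> \<longrightarrow> g x = 0) \<and>
     (\<lambda>x. 0) \<in> H \<and>
     (\<forall>g\<in>H. \<forall>g'\<in>H. (\<lambda>x. g x + g' x) \<in> H) \<and>
     (\<forall>g\<in>H. \<forall>a. (\<lambda>x. a * g x) \<in> H) \<and>
     \<comment> \<open>inner product\<close>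
     (\<forall>g\<in>H. \<forall>g'\<in>H. ip g g' = ip g' g) \<and>
     (\<forall>g\<in>H. \<forall>g'\<in>H. \<forall>u\<in>H. ip (\<lambda>x. g x + g' x) u = ip g u + ip g' u) \<and>
     (\<forall>g\<in>H. \<forall>u\<in>H. \<forall>a. ip (\<lambda>x. a * g x) u = a * ip g u) \<and>
     (\<forall>g\<in>H. g \<noteq> (\<lambda>x. 0) \<longrightarrow> 0 < ip g g) \<and>
     \<comment> \<open>completeness\<close>
     (\<forall>G. (\<forall>p. G p \<in> H) \<and>
          (\<forall>e>0. \<exists>N. \<forall>p\<ge>N. \<forall>q\<ge>N.
             sqrt (ip (\<lambda>x. G p x - G q x) (\<lambda>x. G p x - G q x)) < e) \<longrightarrow>
          (\<exists>g\<in>H. (\<lambda>p::nat. sqrt (ip (\<lambda>x. G p x - g x) (\<lambda>x. G p x - g x))) \<longlonglongrightarrow> 0)) \<and>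
     \<comment> \<open>reproducing kernel\<close>
     (\<forall>y\<in>\<Omega>. (\<lambda>x. if x \<in> \<Omega> then K x y else 0) \<in> H \<and>
        (\<forall>g\<in>H. ip g (\<lambda>x. if x \<in> \<Omega> then K x y else 0) = g y))"

definition mat_space :: "(real^'n \<Rightarrow> real) set \<Rightarrow> (real^'n \<Rightarrow> real^'n^'n) set" where
  "mat_space H = {s. (\<forall>x. symmetric_mat (s x)) \<and> (\<forall>i j. (\<lambda>x. s x $ i $ j) \<in> H)}"

definition mat_ip :: "((real^'n \<Rightarrow> real) \<Rightarrow> (real^'n \<Rightarrow> real) \<Rightarrow> real)
     \<Rightarrow> (real^'n \<Rightarrow> real^'n^'n) \<Rightarrow> (real^'n \<Rightarrow> real^'n^'n) \<Rightarrow> real" where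
  "mat_ip ip s t = (\<Sum>i\<in>UNIV. \<Sum>j\<in>UNIV. ip (\<lambda>x. s x $ i $ j) (\<lambda>x. t x $ i $ j))"

definition optimal_recovery ::
  "(real^'n \<Rightarrow> real^'n) \<Rightarrow> (real \<Rightarrow> real^'n \<Rightarrow> real^'n) \<Rightarrow> real^'n^'n
     \<Rightarrow> (real^'n \<Rightarrow> real) set \<Rightarrow> ((real^'n \<Rightarrow> real) \<Rightarrow> (real^'n \<Rightarrow> real) \<Rightarrow> real)
     \<Rightarrow> (real^'n) set \<Rightarrow> (real^'n \<Rightarrow> real^'n^'n) \<Rightarrow> bool" where
  "optimal_recovery f fl C H ip X S \<longleftrightarrow>
     is_arg_min (\<lambda>s. sqrt (mat_ip ip s s))
       (\<lambda>s. s \<in> mat_space H \<and> (\<forall>x\<in>X. F_op f fl s x = - C)) S"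

definition fill_distance :: "(real^'n) set \<Rightarrow> (real^'n) set \<Rightarrow> real" where
  "fill_distance X \<Omega> = (SUP x\<in>\<Omega>. Min ((\<lambda>y. norm (x - y)) ` X))"

section \<open>Triangulations, interpolation and the verification problem\<close>

definition verts :: "(real^'n) set \<Rightarrow> (real^'n) set" where
  "verts \<nu> = {y. y extreme_point_of \<nu>}"

text \<open>An enumeration \<open>x\<^sub>0, \<dots>, x\<^sub>n\<close> of the vertices of an \<open>n\<close>-simplex is a map \<open>v\<close> on \<open>'n option\<close>, with
  \<open>v None\<close> for \<open>x\<^sub>0\<close>. The rows of the shape matrix are \<open>x\<^sub>i - x\<^sub>0\<close>.\<close>

definition shape_matrix :: "('n option \<Rightarrow> real^'n) \<Rightarrow> real^'n^'n" where
  "shape_matrix v = (\<chi> i. v (Some i) - v None)"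

definition n_triangulation :: "(real^'n) set set \<Rightarrow> bool" where
  "n_triangulation \<T> \<longleftrightarrow> triangulation \<T> \<and> (\<forall>\<nu>\<in>\<T>. int CARD('n) simplex \<nu>)"

definition hd_bounded :: "real \<Rightarrow> real \<Rightarrow> (real^'n) set set \<Rightarrow> bool" where
  "hd_bounded h d \<T> \<longleftrightarrow>
     (\<forall>\<nu>\<in>\<T>. diameter \<nu> < h \<and>
        (\<exists>v. bij_betw v UNIV (verts \<nu>) \<and>
             diameter \<nu> * mat_norm1 (matrix_inv (shape_matrix v)) \<le> d))"

definition cpa_interpolation ::
  "(real^'n) set set \<Rightarrow> (real^'n \<Rightarrow> real^'n^'n) \<Rightarrow> (real^'n \<Rightarrow> real^'n^'n) \<Rightarrow> bool" where
  "cpa_interpolation \<T> S P \<longleftrightarrow>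
     continuous_on (\<Union>\<T>) P \<and>
     (\<forall>\<nu>\<in>\<T>. \<exists>L b. linear L \<and> (\<forall>x\<in>\<nu>. P x = L x + b)) \<and>
     (\<forall>\<nu>\<in>\<T>. \<forall>y\<in>verts \<nu>. P y = S y)"

definition cpa_gradient ::
  "(real^'n \<Rightarrow> real^'n^'n) \<Rightarrow> (real^'n) set \<Rightarrow> 'n \<Rightarrow> 'n \<Rightarrow> real^'n" where
  "cpa_gradient P \<nu> i j =
     (THE w. \<forall>x\<in>\<nu>. \<forall>y\<in>\<nu>. P x $ i $ j - P y $ i $ j = w \<bullet> (x - y))"

definition A_mat ::
  "(real^'n \<Rightarrow> real^'n) \<Rightarrow> (real^'n \<Rightarrow> real^'n^'n) \<Rightarrow> (real^'n) set \<Rightarrow> real^'n \<Rightarrow> real^'n^'n" where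
  "A_mat f P \<nu> y =
     P y ** Df f y + transpose (Df f y) ** P y + (\<chi> i j. cpa_gradient P \<nu> i j \<bullet> f y)"

definition E_const :: "real \<Rightarrow> real \<Rightarrow> real \<Rightarrow> real \<Rightarrow> real \<Rightarrow> real" where
  "E_const n b b3 cc dd = n^2 * (1 + 4 * sqrt n) * b * dd + 2 * n^3 * b3 * cc"

text \<open>The index pairs range over all \<open>i, j\<close> instead of \<open>i \<le> j\<close>; this is the same because \<open>P\<close> is
  symmetric.\<close>

definition verification_constraints ::
  "(real^'n \<Rightarrow> real^'n) \<Rightarrow> (real^'n) set set \<Rightarrow> (real^'n \<Rightarrow> real^'n^'n) \<Rightarrow> real
     \<Rightarrow> ((real^'n) set \<Rightarrow> real) \<Rightarrow> ((real^'n) set \<Rightarrow> real)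
     \<Rightarrow> ((real^'n) set \<Rightarrow> real) \<Rightarrow> ((real^'n) set \<Rightarrow> real) \<Rightarrow> bool" where
  "verification_constraints f \<T> P \<epsilon>0 B B3 Cc Dd \<longleftrightarrow>
     (\<forall>\<nu>\<in>\<T>. 0 \<le> Cc \<nu> \<and> 0 \<le> Dd \<nu>) \<and>
     (\<forall>\<nu>\<in>\<T>. \<forall>y\<in>verts \<nu>. mat \<epsilon>0 \<preceq>\<^sub>L P y) \<and>
     (\<forall>\<nu>\<in>\<T>. \<forall>y\<in>verts \<nu>. P y \<preceq>\<^sub>L mat (Cc \<nu>)) \<and>
     (\<forall>\<nu>\<in>\<T>. \<forall>i j. norm1 (cpa_gradient P \<nu> i j) \<le> Dd \<nu>) \<and>
     (\<forall>\<nu>\<in>\<T>. \<forall>y\<in>verts \<nu>.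
        A_mat f P \<nu> y
          + mat ((diameter \<nu>)^2 * E_const (real CARD('n)) (B \<nu>) (B3 \<nu>) (Cc \<nu>) (Dd \<nu>))
        \<preceq>\<^sub>L mat (- \<epsilon>0))"

end

theory Submission
  imports Defs
begin

text \<open>The Fourier transform of a Wendland function is bounded below by the power of the frequency
  that belongs to its smoothness. Hence every function with \<open>n div 2 + k + 1\<close> continuous derivatives
  near the closure of \<open>\<Omega>\<close> lies in the native space. This applies to \<open>M\<close>, so that \<open>S\<close> is bounded
  in norm independently of \<open>X\<close>. The kernel is smooth enough on the diagonal for the norm to control
  values, gradients and quadratic Taylor remainders; hence \<open>F(S)\<close> is Lipschitz with a uniform
  constant, and \<open>F(S) = -C\<close> on a fine set \<open>X\<close> gives \<open>F(S) \<preceq>\<^sub>L -C/2\<close> on \<open>D\<close>. A Lyapunov argument along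
  the flow yields \<open>M/2 \<preceq>\<^sub>L S\<close> on \<open>D\<close>, and on an \<open>(h, d)\<close>-bounded triangulation the interpolation
  changes values and gradients only by \<open>O(h)\<close>.\<close>

section \<open>The Fourier transform of Wendland functions\<close>

text \<open>The native space is given by its kernel alone, so the obstacle is to recognise its
  elements. The criterion is that combinations of point values are bounded by the quadratic form of
  the kernel; it is checked with trigonometric polynomials with nonnegative coefficients in place of
  Fourier integrals and then passes to the limit. What enters is the transform of the kernel: in odd
  dimension, for \<open>l = n div 2 + k + 1\<close>, it is exactly a convolution power of
  \<open>1 - cos\<close> divided by a power of the frequency, so that positivity and growth follow
  by induction over convolutions. Since \<open>M\<close> is smooth on the whole open basin, a cutoff
  replaces an extension from \<open>\<Omega>\<close>. The error \<open>S - M\<close> is never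
  estimated: \<open>F(S) \<preceq>\<^sub>L -C/2\<close> and \<open>F(M/2) = -C/2\<close> make
  \<open>F(S - M/2)\<close> negative semidefinite, which is where the factor 1/2 comes from. The
  margin is split: one half of \<open>C\<close> pays for the distance to \<open>X\<close>, a sixth
  for interpolation together with \<open>E_const\<close>, and the remaining third covers
  \<open>\<epsilon>0\<close>.\<close>

definition egf :: "(nat \<Rightarrow> real) \<Rightarrow> real \<Rightarrow> real" where
  "egf e x = (\<Sum>m. e m / fact m * x ^ m)"

text \<open>A geometric bound on the coefficients makes the exponential series entire, so termwise
  calculus involves no radius of convergence. Base 2 fits the binomial coefficients in
  \<open>wave_coeff\<close>, which are bounded by powers of 2.\<close>

definition geom_bounded :: "(nat \<Rightarrow> real) \<Rightarrow> bool" where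
  "geom_bounded e \<longleftrightarrow> (\<exists>c. \<forall>m. \<bar>e m\<bar> \<le> c * 2 ^ m)"

lemma geom_bounded_summable:
  assumes "geom_bounded e"
  shows "summable (\<lambda>m. e m / fact m * x ^ m)"
proof -
  obtain c where c: "\<And>m. \<bar>e m\<bar> \<le> c * 2 ^ m" using assms by (auto simp: geom_bounded_def)
  have "summable (\<lambda>m. c * (inverse (fact m) * (2 * \<bar>x\<bar>) ^ m))"
    by (intro summable_mult summable_exp)
  then show ?thesis
  proof (rule summable_comparison_test'[where N=0])
    fix m :: nat
    have "norm (e m / fact m * x ^ m) = \<bar>e m\<bar> * (\<bar>x\<bar> ^ m / fact m)"
      by (simp add: abs_mult power_abs)
    also have "\<dots> \<le> (c * 2 ^ m) * (\<bar>x\<bar> ^ m / fact m)"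
      by (rule mult_right_mono[OF c]) simp
    finally show "norm (e m / fact m * x ^ m) \<le> c * (inverse (fact m) * (2 * \<bar>x\<bar>) ^ m)"
      by (simp add: power_mult_distrib field_simps)
  qed
qed

lemma egf_DERIV:
  assumes "geom_bounded e"
  shows "(egf e has_real_derivative egf (\<lambda>m. e (Suc m)) x) (at x)"
proof -
  have "((\<lambda>x. \<Sum>m. (e m / fact m) * x ^ m) has_field_derivative
          (\<Sum>m. diffs (\<lambda>m. e m / fact m) m * x ^ m)) (at x)"
    by (rule termdiffs_strong_converges_everywhere) (rule geom_bounded_summable[OF assms])
  moreover have "diffs (\<lambda>m. e m / fact m) m = e (Suc m) / fact m" for m
    by (simp add: diffs_def field_simps del: of_nat_Suc)
  ultimately show ?thesis by (simp add: egf_def[abs_def])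
qed

lemma egf_add:
  assumes "geom_bounded e" "geom_bounded e'"
  shows "egf e x + egf e' x = egf (\<lambda>m. e m + e' m) x"
  unfolding egf_def
  by (subst suminf_add[OF geom_bounded_summable[OF assms(1)] geom_bounded_summable[OF assms(2)]])
     (simp add: add_divide_distrib distrib_right)

text \<open>Multiplication by \<open>x\<close> shifts the series by one place, and the factorials
  turn the shift into the factor \<open>m\<close>. The truncated \<open>m - 1\<close> at
  \<open>m = 0\<close> is harmless because of that factor.\<close>

lemma egf_mult_arg:
  assumes "geom_bounded e"
  shows "x * egf e x = egf (\<lambda>m. real m * e (m - 1)) x"
proof -
  let ?t = "\<lambda>m. real m * e (m - 1) / fact m * x ^ m"
  have "(\<lambda>m. x * (e m / fact m * x ^ m)) sums (x * egf e x)"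
    unfolding egf_def by (intro sums_mult summable_sums geom_bounded_summable assms)
  moreover have "x * (e m / fact m * x ^ m) = ?t (Suc m)" for m
    by (simp add: field_simps del: of_nat_Suc)
  ultimately have "(\<lambda>m. ?t (Suc m)) sums (x * egf e x)" by (simp only:)
  then have "?t sums (x * egf e x + ?t 0)" by (rule sums_Suc_iff[THEN iffD1, rotated])
  then show ?thesis unfolding egf_def by (simp add: sums_iff)
qed

lemma egf_0: "egf e 0 = e 0"
  unfolding egf_def using powser_zero[of "\<lambda>m. e m / fact m"] by simp

text \<open>\<open>wave a q\<close> is the inverse Laplace transform of \<open>s powr (2 * q + 1 - a) / (s\<^sup>2 + 1) ^ (q + 1)\<close>.\<close>

definition wave_coeff :: "nat \<Rightarrow> nat \<Rightarrow> nat \<Rightarrow> real" where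
  "wave_coeff a q m =
     (if a \<le> m \<and> even (m - a) then (-1) ^ ((m - a) div 2) * real (((m - a) div 2 + q) choose q) else 0)"

definition wave :: "nat \<Rightarrow> nat \<Rightarrow> real \<Rightarrow> real" where
  "wave a q = egf (wave_coeff a q)"

lemma geom_bounded_wave: "geom_bounded (wave_coeff a q)"
proof -
  have "\<bar>wave_coeff a q m\<bar> \<le> 2 ^ q * 2 ^ m" for m
  proof (cases "a \<le> m \<and> even (m - a)")
    case True
    let ?i = "(m - a) div 2"
    have "real ((?i + q) choose q) \<le> 2 ^ (?i + q)"
      using binomial_le_pow2[of "?i + q" q] by (metis of_nat_le_iff of_nat_numeral of_nat_power)
    also have "\<dots> \<le> 2 ^ (m + q)" by (intro power_increasing) auto
    finally show ?thesis using True by (simp add: wave_coeff_def abs_mult power_add mult.commute)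
  qed (auto simp: wave_coeff_def)
  then show ?thesis unfolding geom_bounded_def by blast
qed

lemma wave_DERIV [derivative_intros]:
  "(wave (Suc a) q has_real_derivative wave a q x) (at x)"
proof -
  have "(\<lambda>m. wave_coeff (Suc a) q (Suc m)) = wave_coeff a q"
    by (auto simp: wave_coeff_def fun_eq_iff)
  then show ?thesis using egf_DERIV[OF geom_bounded_wave[of "Suc a" q]] by (simp add: wave_def)
qed

lemma continuous_on_wave: "continuous_on A (wave a q)"
  unfolding wave_def
  by (rule continuous_at_imp_continuous_on) (auto intro: DERIV_isCont egf_DERIV geom_bounded_wave)

lemma wave_Suc_0: "wave (Suc a) q 0 = 0"
  by (simp add: wave_def egf_0 wave_coeff_def)

text \<open>On the side of Laplace transforms the sum carries the numerator
  \<open>s\<^sup>2 + 1\<close>, which cancels one factor of the denominator. On coefficients this is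
  Pascal's rule.\<close>

lemma wave_eq: "wave a (Suc q) x + wave (Suc (Suc a)) (Suc q) x = wave a q x"
proof -
  have "wave_coeff a (Suc q) m + wave_coeff (Suc (Suc a)) (Suc q) m = wave_coeff a q m" for m
  proof (cases "a \<le> m \<and> even (m - a)")
    case True
    then obtain i where m: "m = a + 2 * i"
      by (metis evenE le_add_diff_inverse)
    show ?thesis
    proof (cases i)
      case 0
      then show ?thesis by (simp add: m wave_coeff_def)
    next
      case (Suc i')
      then have "m - Suc (Suc a) = 2 * i'" "m - a = 2 * Suc i'" by (auto simp: m)
      then show ?thesis using Suc m by (simp add: wave_coeff_def algebra_simps)
    qed
  next
    case False
    moreover have "\<not> (Suc (Suc a) \<le> m \<and> even (m - Suc (Suc a)))"
      using False by presburger
    ultimately show ?thesis using False by (simp only: wave_coeff_def if_False)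
  qed
  then show ?thesis unfolding wave_def by (simp add: egf_add geom_bounded_wave)
qed

text \<open>Multiplication by \<open>x\<close> is minus differentiation of the Laplace transform,
  here of \<open>1 / (s\<^sup>2 + 1) ^ (q + 1)\<close>. Up to a constant,
  \<open>wave (2 * q + 1) q\<close> is \<open>x powr (q + 1/2)\<close> times the Bessel function of
  order \<open>q + 1/2\<close>.\<close>

lemma wave_mult_arg: "x * wave (2 * q + 1) q x = 2 * real (Suc q) * wave (2 * q + 2) (Suc q) x"
proof -
  have "real m * wave_coeff (2 * q + 1) q (m - 1) = 2 * real (Suc q) * wave_coeff (2 * q + 2) (Suc q) m" for m
  proof (cases "2 * q + 2 \<le> m \<and> even m")
    case True
    then obtain i where m: "m = 2 * q + 2 + 2 * i"
      by (metis add.assoc evenE even_mult_iff even_numeral le_add_diff_inverse odd_add odd_even_add even_diff_nat)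
    have "(m - 1 - (2 * q + 1)) = 2 * i" "m - (2 * q + 2) = 2 * i" using m by auto
    moreover have "(Suc (i + q)) * ((i + q) choose q) = (Suc (i + q) choose (Suc q)) * Suc q"
      using Suc_times_binomial_eq by auto
    then have "real (Suc (i + q)) * real ((i + q) choose q) = real (Suc (i + q) choose (Suc q)) * real (Suc q)"
      by (metis of_nat_mult)
    moreover have "real m = 2 * real (Suc (i + q))" using m by simp
    ultimately show ?thesis using m by (simp add: wave_coeff_def del: of_nat_Suc binomial_Suc_Suc)
  next
    case False
    then show ?thesis by (cases m) (auto simp: wave_coeff_def)
  qed
  then show ?thesis
    unfolding wave_def egf_mult_arg[OF geom_bounded_wave]
    unfolding egf_def
    by (subst suminf_mult[symmetric, OF geom_bounded_summable[OF geom_bounded_wave]]) (simp add: mult.assoc)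
qed

lemma wave_0_0: "wave 0 0 = cos"
proof
  fix x :: real
  have "wave_coeff 0 0 m / fact m = cos_coeff m" for m
    by (simp add: wave_coeff_def cos_coeff_def)
  then show "wave 0 0 x = cos x" by (simp add: wave_def egf_def cos_def)
qed

lemma real_fun_eqI:
  fixes g h :: "real \<Rightarrow> real"
  assumes "\<And>x. (g has_real_derivative d x) (at x)" "\<And>x. (h has_real_derivative d x) (at x)" "g 0 = h 0"
  shows "g x = h x"
proof -
  have "((\<lambda>x. g x - h x) has_real_derivative 0) (at x)" for x
    using DERIV_diff[OF assms(1)[of x] assms(2)[of x]] by simp
  then have "g x - h x = g 0 - h 0" using DERIV_isconst_all[of "\<lambda>x. g x - h x" x 0] by blast
  then show ?thesis using assms(3) by simp
qed

lemma wave_1_0: "wave (Suc 0) 0 x = sin x"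
  by (rule real_fun_eqI[where d=cos])
     (use wave_DERIV[of 0 0] in \<open>auto simp: wave_0_0 wave_Suc_0 intro: derivative_eq_intros\<close>)

lemma wave_2_0: "wave (Suc (Suc 0)) 0 x = 1 - cos x"
proof (rule real_fun_eqI[where d=sin and g="wave (Suc (Suc 0)) 0" and h="\<lambda>x. 1 - cos x"])
  show "(wave (Suc (Suc 0)) 0 has_real_derivative sin x) (at x)" for x
    using wave_DERIV[of "Suc 0" 0 x] by (simp add: wave_1_0)
  show "((\<lambda>x. 1 - cos x) has_real_derivative sin x) (at x)" for x
    by (auto intro!: derivative_eq_intros)
qed (simp add: wave_Suc_0 numeral_2_eq_2)

section \<open>Positivity and growth of the convolution powers of \<open>1 - cos\<close>\<close>

text \<open>Its Laplace transform is \<open>1 / (s * (s\<^sup>2 + 1)) ^ (q + 1)\<close>, so this is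
  the \<open>(q + 1)\<close>-fold convolution power of \<open>1 - cos\<close>.\<close>

definition askey :: "nat \<Rightarrow> real \<Rightarrow> real" where
  "askey q = wave (3 * q + 2) q"

lemma continuous_on_askey: "continuous_on A (askey q)"
  by (simp add: askey_def continuous_on_wave)

text \<open>The next function \<open>y\<close> solves \<open>y''' + y' = askey q\<close> with zero
  initial data, and \<open>1 - cos\<close> is the fundamental solution of that equation. The
  antiderivative \<open>?H\<close> is Lagrange's identity for the equation; its boundary terms
  reduce to the value of \<open>y\<close> at \<open>R\<close>.\<close>

lemma askey_Suc:
  assumes "0 \<le> R"
  shows "((\<lambda>s. (1 - cos (R - s)) * askey q s) has_integral askey (Suc q) R) {0..R}"
proof -
  let ?y = "askey (Suc q)" and ?y1 = "wave (3 * q + 4) (Suc q)" and ?y2 = "wave (3 * q + 3) (Suc q)"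
    and ?y3 = "wave (3 * q + 2) (Suc q)"
  let ?H = "\<lambda>s. ?y2 s * (1 - cos (R - s)) + ?y1 s * sin (R - s) + ?y s"
  have d: "(?y has_real_derivative ?y1 x) (at x)" "(?y1 has_real_derivative ?y2 x) (at x)"
     "(?y2 has_real_derivative ?y3 x) (at x)" for x
    using wave_DERIV[of "3 * q + 4" "Suc q" x] wave_DERIV[of "3 * q + 3" "Suc q" x]
      wave_DERIV[of "3 * q + 2" "Suc q" x] by (simp_all add: askey_def eval_nat_numeral)
  have d2: "(?y2 has_field_derivative ?y3 x) (at x)" "(?y1 has_field_derivative ?y2 x) (at x)" "(?y has_field_derivative ?y1 x) (at x)" for x
    using d by auto
  have eq: "?y3 s + ?y1 s = askey q s" for s
    using wave_eq[of "3 * q + 2" q s] by (simp add: askey_def eval_nat_numeral)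
  have "(?H has_real_derivative (1 - cos (R - s)) * askey q s) (at s within {0..R})" for s
    unfolding eq[symmetric]
    by (rule DERIV_subset[OF _ subset_UNIV])
       (rule derivative_eq_intros d2 refl | simp add: algebra_simps)+
  then have "((\<lambda>s. (1 - cos (R - s)) * askey q s) has_integral ?H R - ?H 0) {0..R}"
    using assms by (intro fundamental_theorem_of_calculus) (auto simp: has_real_derivative_iff_has_vector_derivative)
  moreover have "?H R = ?y R" by simp
  moreover have "?H 0 = 0" by (simp add: askey_def wave_Suc_0 eval_nat_numeral)
  ultimately show ?thesis by simp
qed

lemma askey_nonneg: "0 \<le> R \<Longrightarrow> 0 \<le> askey q R"
proof (induction q arbitrary: R)
  case 0
  then show ?case by (simp add: askey_def wave_2_0 numeral_2_eq_2)
next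
  case (Suc q)
  show ?case
    by (rule has_integral_nonneg[OF askey_Suc[OF Suc.prems]]) (use Suc in auto)
qed

text \<open>A nonnegative continuous integrand with zero integral vanishes everywhere, so one point
  with a positive integrand suffices. The claim starts at \<open>Suc q\<close> because
  \<open>askey 0 = 1 - cos\<close> has zeros at the multiples of \<open>2 * pi\<close>.\<close>

lemma askey_pos: "0 < R \<Longrightarrow> 0 < askey (Suc q) R"
proof (induction q arbitrary: R)
  have *: "0 < askey (Suc q) R"
    if "0 < R" and s: "0 < s" "s < R" "0 < (1 - cos (R - s)) * askey q s" for q s R
  proof (rule ccontr)
    assume "\<not> 0 < askey (Suc q) R"
    then have "((\<lambda>s. (1 - cos (R - s)) * askey q s) has_integral 0) (cbox 0 R)"
      using askey_Suc[of R q] askey_nonneg[of R "Suc q"] \<open>0 < R\<close> by simp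
    then have "(1 - cos (R - s)) * askey q s = 0"
      by (rule has_integral_0_cbox_imp_0[rotated 2])
         (use that in \<open>auto intro!: continuous_intros continuous_on_askey mult_nonneg_nonneg askey_nonneg\<close>)
    with s show False by simp
  qed
  have cos1: "0 < 1 - cos u" if "0 < u" "u \<le> 1" for u :: real
    using that cos_monotone_0_pi[of 0 u] pi_gt3 by simp
  {
    case 0
    define s where "s = min 1 (R / 2)"
    have s: "0 < s" "s \<le> 1" "s \<le> R / 2" using 0 by (auto simp: s_def)
    have c0: "0 < askey 0 u" if "0 < u" "u \<le> 1" for u
      using cos1[OF that] by (simp add: askey_def wave_2_0 numeral_2_eq_2)
    \<comment> \<open>\<open>R - s\<close> and \<open>R - s / 2\<close> differ by a number in
      \<open>(0, 1/2]\<close>, hence they cannot both be multiples of \<open>2 * pi\<close>.\<close>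
    consider "cos (R - s) \<noteq> 1" | "cos (R - s / 2) \<noteq> 1"
    proof (rule ccontr)
      assume "\<not> thesis"
      with that have c: "cos (R - s) = 1" "cos (R - s / 2) = 1" by auto
      then have "sin (R - s) = 0" by (rule_tac cos_one_sin_zero)
      then have "cos ((R - s / 2) - (R - s)) = 1" using c unfolding cos_diff[of "R - s / 2"] by simp
      with cos1[of "s / 2"] s show False by (simp add: field_simps)
    qed
    then show ?case
    proof cases
      case 1
      then have "0 < 1 - cos (R - s)" using cos_le_one[of "R - s"] by linarith
      then show ?thesis using 0 s by (intro *[of R s 0]) (auto intro!: mult_pos_pos c0)
    next
      case 2
      then have "0 < 1 - cos (R - s / 2)" using cos_le_one[of "R - s / 2"] by linarith
      then show ?thesis using 0 s by (intro *[of R "s / 2" 0]) (auto intro!: mult_pos_pos c0)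
    qed
  next
    case (Suc q)
    show ?case
      by (rule *[of R "R - min 1 (R / 2)"])
         (use Suc.prems in \<open>auto intro!: mult_pos_pos cos1 Suc.IH\<close>)
  }
qed

text \<open>Convolution with \<open>1 - cos\<close>, whose mean is 1, over the upper half of the
  interval gains one power of \<open>r\<close>. The induction starts at \<open>askey 1\<close>
  because \<open>askey 0\<close> has no positive lower bound.\<close>

lemma askey_growth_large: "\<exists>c>0. \<exists>r0>0. \<forall>r\<ge>r0. c * r ^ Suc q \<le> askey (Suc q) r"
proof (induction q)
  case 0
  have eq: "askey 1 r = r - 2 * sin r + (r * cos r + sin r) / 2" if "0 \<le> r" for r
  proof -
    let ?h = "\<lambda>s. s + sin (r - s) - sin s + (s * cos r - sin (r - 2 * s) / 2) / 2"
    have cc: "2 * (cos (r - s) * cos s) = cos r + cos (r - 2 * s)" for s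
      using cos_times_cos[of "r - s" s] by (simp add: algebra_simps)
    have cc': "(1 - cos (r - s)) * (1 - cos s) = 1 - cos (r - s) - cos s + (cos r + cos (r - 2 * s)) / 2" for s
      unfolding cc[symmetric] by (simp add: algebra_simps)
    have "(?h has_real_derivative (1 - cos (r - s)) * askey 0 s) (at s within {0..r})" for s
      unfolding askey_def
      by (rule DERIV_subset[OF _ subset_UNIV])
         (auto intro!: derivative_eq_intros simp: cc' wave_2_0 numeral_2_eq_2)
    then have "((\<lambda>s. (1 - cos (r - s)) * askey 0 s) has_integral ?h r - ?h 0) {0..r}"
      using that by (intro fundamental_theorem_of_calculus) (auto simp: has_real_derivative_iff_has_vector_derivative)
    from has_integral_unique[OF askey_Suc[OF that, of 0] this]
    show ?thesis by (simp add: field_simps)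
  qed
  \<comment> \<open>In the explicit formula \<open>r * cos r / 2\<close> takes away at most half of
    the leading term \<open>r\<close>; the sine terms amount to at most \<open>3 / 2\<close>, which
    is \<open>r / 4\<close> at \<open>r = 6\<close>.\<close>
  have "1/4 * r ^ Suc 0 \<le> askey (Suc 0) r" if "6 \<le> r" for r
  proof -
    have "r * cos r \<ge> r * (-1)" using that by (intro mult_left_mono) auto
    moreover have "askey 1 r = r - 2 * sin r + (r * cos r) / 2 + sin r / 2"
      using eq[of r] that by (simp add: add_divide_distrib)
    ultimately have "1/4 * r \<le> askey 1 r" using that sin_le_one[of r] by linarith
    then show ?thesis by simp
  qed
  then show ?case by (intro exI[of _ "1/4"] conjI exI[of _ 6]) auto
next
  case (Suc q)
  then obtain c r0 where c: "c > 0" "r0 > 0" "\<And>r. r \<ge> r0 \<Longrightarrow> c * r ^ Suc q \<le> askey (Suc q) r" by blast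
  define r1 where "r1 = max (2 * r0) 4"
  have "(c / 2 ^ Suc q / 4) * r ^ Suc (Suc q) \<le> askey (Suc (Suc q)) r" if "r1 \<le> r" for r
  proof -
    have r: "0 < r" "r \<ge> 4" "r / 2 \<ge> r0" using that by (auto simp: r1_def)
    define A where "A = c * (r / 2) ^ Suc q"
    let ?g = "\<lambda>s. (1 - cos (r - s)) * askey (Suc q) s"
    have h: "((\<lambda>s. (1 - cos (r - s)) * A) has_integral (r + sin (r - r)) * A - (r / 2 + sin (r - r / 2)) * A) {r / 2..r}"
      using r
      by (intro fundamental_theorem_of_calculus)
         (auto intro!: derivative_eq_intros simp: has_real_derivative_iff_has_vector_derivative[symmetric] algebra_simps)
    have int: "?g integrable_on {0..r}" using askey_Suc[of r "Suc q"] r by (auto simp: has_integral_integrable)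
    have int2: "?g integrable_on {r/2..r}" by (rule integrable_on_subinterval[OF int]) (use r in auto)
    have "(r + sin (r - r)) * A - (r / 2 + sin (r - r / 2)) * A \<le> integral {r/2..r} ?g"
    proof (rule has_integral_le[OF h integrable_integral[OF int2]])
      fix s assume s: "s \<in> {r/2..r}"
      have "A \<le> c * s ^ Suc q" unfolding A_def using s r c by (intro mult_left_mono power_mono) auto
      also have "\<dots> \<le> askey (Suc q) s" using s r by (intro c) auto
      finally show "(1 - cos (r - s)) * A \<le> ?g s" by (intro mult_left_mono) auto
    qed
    also have "\<dots> \<le> integral {0..r} ?g"
      using r by (intro integral_subset_le int int2) (auto intro!: mult_nonneg_nonneg askey_nonneg)
    also have "\<dots> = askey (Suc (Suc q)) r" using askey_Suc[of r "Suc q"] r by (intro integral_unique) auto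
    finally have "(r / 2 - sin (r / 2)) * A \<le> askey (Suc (Suc q)) r" by (simp add: algebra_simps)
    moreover have "(r / 4) * A \<le> (r / 2 - sin (r / 2)) * A"
      using r c order_trans[OF sin_le_one[of "r/2"], of "r / 4"] by (intro mult_right_mono) (simp_all add: A_def)
    ultimately show ?thesis by (simp add: A_def power_divide field_simps)
  qed
  then show ?case using c by (intro exI[of _ "c / 2 ^ Suc q / 4"] conjI exI[of _ r1]) (auto simp: r1_def)
qed

text \<open>Below the threshold of \<open>askey_growth_large\<close> the function is continuous and
  positive on a compact interval, which only lowers the constant. The starting point is left free
  because the smallest relevant frequency is fixed later, by the period in
  \<open>fourier_domination\<close>.\<close>

lemma askey_growth:
  assumes "x0 > 0"
  shows "\<exists>c>0. \<forall>r\<ge>x0. c * r ^ Suc q \<le> askey (Suc q) r"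
proof -
  obtain c r0 where c: "c > 0" "r0 > 0" "\<And>r. r \<ge> r0 \<Longrightarrow> c * r ^ Suc q \<le> askey (Suc q) r"
    using askey_growth_large[of q] by blast
  define r1 where "r1 = max r0 x0"
  obtain y where y: "y \<in> {x0..r1}" "\<And>x. x \<in> {x0..r1} \<Longrightarrow> askey (Suc q) y \<le> askey (Suc q) x"
    using continuous_attains_inf[of "{x0..r1}" "askey (Suc q)"] by (auto simp: continuous_on_askey r1_def)
  define c' where "c' = min c (askey (Suc q) y / r1 ^ Suc q)"
  have ay: "askey (Suc q) y > 0" using y(1) assms by (intro askey_pos) auto
  have r1: "r1 > 0" using c by (auto simp: r1_def)
  have "c' * r ^ Suc q \<le> askey (Suc q) r" if "r \<ge> x0" for r
  proof (cases "r \<ge> r1")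
    case True
    have "c' * r ^ Suc q \<le> c * r ^ Suc q" using assms that by (intro mult_right_mono) (auto simp: c'_def)
    also have "\<dots> \<le> askey (Suc q) r" using True by (intro c) (auto simp: r1_def)
    finally show ?thesis .
  next
    case False
    have "c' * r ^ Suc q \<le> (askey (Suc q) y / r1 ^ Suc q) * r1 ^ Suc q"
      using assms that False ay r1 c by (intro mult_mono power_mono) (auto simp: c'_def)
    also have "\<dots> = askey (Suc q) y" using r1 by simp
    also have "\<dots> \<le> askey (Suc q) r" using that False by (intro y) auto
    finally show ?thesis .
  qed
  moreover have "c' > 0" using c ay r1 by (simp add: c'_def)
  ultimately show ?thesis by blast
qed

section \<open>Integral identities for \<open>wave\<close>\<close>

lemma wave_scaled_DERIV:
  "((\<lambda>s. wave (Suc a) q (L * s)) has_real_derivative L * wave a q (L * s)) (at s within S)"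
proof -
  have "((\<lambda>s. L * s) has_real_derivative L) (at s within S)" by (auto intro!: derivative_eq_intros)
  from DERIV_chain2[OF wave_DERIV this, of a q] show ?thesis by (simp add: mult.commute[of L])
qed

lemma DERIV_power_fact:
  "((\<lambda>s::real. (1 - s) ^ Suc m / fact (Suc m)) has_real_derivative - ((1 - s) ^ m / fact m)) (at s within S)"
proof -
  have "((\<lambda>r::real. 1 - r) has_real_derivative -1) (at s within S)" by (auto intro!: derivative_eq_intros)
  from DERIV_cdivide[OF DERIV_power[OF this, of "Suc m"], of "fact (Suc m)"]
  have "((\<lambda>s::real. (1 - s) ^ Suc m / fact (Suc m)) has_real_derivative
      (1 + real m) * - ((1 - s) ^ m) / fact (Suc m)) (at s within S)" by simp
  moreover have "(1 + real m) * - ((1 - s) ^ m) / fact (Suc m) = - ((1 - s) ^ m / fact m)"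
    by (simp add: divide_simps)
  ultimately show ?thesis by (simp only:)
qed

text \<open>Cauchy's formula for repeated integration: the weight
  \<open>(1 - s) ^ m / fact m\<close> integrates \<open>m + 1\<close> times from 0, and each
  integration raises the first index of \<open>wave\<close> by one. The powers of \<open>L\<close>
  come from rescaling to the unit interval.\<close>

lemma wave_iterated_integral:
  assumes "L > 0"
  shows "((\<lambda>s. (1 - s) ^ m / fact m * wave a q (L * s)) has_integral
           wave (a + Suc m) q L / L ^ Suc m) {0..1}"
proof (induction m arbitrary: a)
  case 0
  have "((\<lambda>s. L * wave a q (L * s)) has_integral wave (Suc a) q (L * 1) - wave (Suc a) q (L * 0)) {0..1}"
    by (intro fundamental_theorem_of_calculus)
       (auto simp: has_real_derivative_iff_has_vector_derivative[symmetric] intro: wave_scaled_DERIV)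
  from has_integral_mult_right[OF this, of "1 / L"] show ?case using assms by (simp add: wave_Suc_0)
next
  case (Suc m)
  let ?u = "\<lambda>s::real. (1 - s) ^ Suc m / fact (Suc m)" and ?u' = "\<lambda>s::real. (1 - s) ^ m / fact m"
  let ?g = "\<lambda>s. - ?u' s * wave (Suc a) q (L * s) + L * wave a q (L * s) * ?u s"
  have "((\<lambda>s. ?u s * wave (Suc a) q (L * s)) has_real_derivative ?g s) (at s within {0..1})" for s
    by (rule DERIV_mult[OF DERIV_power_fact wave_scaled_DERIV])
  then have "(?g has_integral ?u 1 * wave (Suc a) q (L * 1) - ?u 0 * wave (Suc a) q (L * 0)) {0..1}"
    by (intro fundamental_theorem_of_calculus) (auto simp: has_real_derivative_iff_has_vector_derivative)
  then have "(?g has_integral 0) {0..1}" by (simp add: wave_Suc_0)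
  from has_integral_mult_right[OF has_integral_add[OF this Suc.IH[of "Suc a"]], of "1 / L"]
  have "((\<lambda>s. 1 / L * (?g s + ?u' s * wave (Suc a) q (L * s))) has_integral
     1 / L * (0 + wave (Suc a + Suc m) q L / L ^ Suc m)) {0..1}" .
  moreover have "1 / L * (?g s + ?u' s * wave (Suc a) q (L * s)) = ?u s * wave a q (L * s)" for s
    using assms by simp
  ultimately show ?case by simp
qed

text \<open>This is the three-term recurrence of the Bessel functions of orders
  \<open>j - 1/2\<close>, \<open>j + 1/2\<close> and \<open>j + 3/2\<close>, multiplied by powers of
  \<open>r\<close>. Both sides vanish at 0, so it is enough to compare derivatives.\<close>

lemma wave_recurrence:
  "2 * real (j + 1) * wave (2 * j + 3) (j + 1) r = real (2 * j + 1) * wave (2 * j + 1) j r - r * wave (2 * j) j r"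
proof (rule real_fun_eqI[where g="\<lambda>r. 2 * real (j + 1) * wave (2 * j + 3) (j + 1) r"
        and h="\<lambda>r. real (2 * j + 1) * wave (2 * j + 1) j r - r * wave (2 * j) j r"
        and d="\<lambda>r. 2 * real (j + 1) * wave (2 * j + 2) (j + 1) r"])
  show "((\<lambda>r. 2 * real (j + 1) * wave (2 * j + 3) (j + 1) r) has_real_derivative
          2 * real (j + 1) * wave (2 * j + 2) (j + 1) x) (at x)" for x
    using DERIV_cmult[OF wave_DERIV[of "2 * j + 2" "j + 1" x], of "2 * real (j + 1)"]
    by (simp add: eval_nat_numeral)
  show "((\<lambda>r. real (2 * j + 1) * wave (2 * j + 1) j r - r * wave (2 * j) j r) has_real_derivative
          2 * real (j + 1) * wave (2 * j + 2) (j + 1) x) (at x)" for x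
  \<comment> \<open>For \<open>j = 0\<close> the derivative of \<open>wave 0 0 = cos\<close> is not
    of the form \<open>wave a q\<close> with a natural number \<open>a\<close>, so this case is
    computed directly.\<close>
  proof (cases j)
    case 0
    have "x * sin x = 2 * wave (2 * j + 2) (j + 1) x" using wave_mult_arg[of x j] wave_1_0 by (simp add: 0)
    moreover have "((\<lambda>r. sin r - r * cos r) has_real_derivative x * sin x) (at x)"
      by (auto intro!: derivative_eq_intros)
    ultimately have "((\<lambda>r. sin r - r * cos r) has_real_derivative 2 * wave (2 * j + 2) (j + 1) x) (at x)"
      by (simp only:)
    then show ?thesis using 0 by (simp add: wave_0_0 wave_1_0 numeral_2_eq_2)
  next
    case (Suc i)
    have d: "(wave (2 * j + 1) j has_real_derivative wave (2 * j) j x) (at x)"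
      using wave_DERIV[of "2 * j" j x] by simp
    have d': "(wave (2 * j) j has_real_derivative wave (2 * i + 1) j x) (at x)"
      using wave_DERIV[of "2 * i + 1" j x] by (simp add: Suc)
    have *: "((\<lambda>r. real (2 * j + 1) * wave (2 * j + 1) j r - r * wave (2 * j) j r) has_real_derivative
       real (2 * j + 1) * wave (2 * j) j x - (1 * wave (2 * j) j x + wave (2 * i + 1) j x * x)) (at x)"
      by (intro DERIV_diff DERIV_cmult DERIV_mult d d' DERIV_ident)
    have "wave (2 * i + 1) j x + wave (2 * j + 1) j x = wave (2 * i + 1) i x"
      using wave_eq[of "2 * i + 1" i x] by (simp add: Suc)
    then have "x * wave (2 * i + 1) j x + x * wave (2 * j + 1) j x = x * wave (2 * i + 1) i x"
      by (metis distrib_left)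
    moreover have "x * wave (2 * i + 1) i x = 2 * real j * wave (2 * j) j x"
      using wave_mult_arg[of x i] by (simp add: Suc)
    moreover have "x * wave (2 * j + 1) j x = 2 * real (j + 1) * wave (2 * j + 2) (j + 1) x"
      using wave_mult_arg[of x j] by simp
    ultimately have "real (2 * j + 1) * wave (2 * j) j x - (1 * wave (2 * j) j x + wave (2 * i + 1) j x * x)
       = 2 * real (j + 1) * wave (2 * j + 2) (j + 1) x" by (simp add: algebra_simps)
    with * show ?thesis by (simp only:)
  qed
qed (simp add: wave_Suc_0 eval_nat_numeral)

definition slice_const :: "nat \<Rightarrow> real" where
  "slice_const j = 4 ^ j * (fact j) ^ 2"

text \<open>Poisson's integral representation of the Bessel function of order
  \<open>j + 1/2\<close>. Integrating by parts twice expresses the exponent \<open>j\<close> by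
  \<open>j - 1\<close> and \<open>j - 2\<close>, which matches \<open>wave_recurrence\<close>
  because \<open>slice_const\<close> gains the factor \<open>4 * j\<^sup>2\<close> in step
  \<open>j\<close>.\<close>

lemma cos_slice_integral_aux:
  assumes "0 \<le> r"
  shows "((\<lambda>t. cos t * (r\<^sup>2 - t\<^sup>2) ^ j) has_integral slice_const j * wave (2 * j + 1) j r) {0..r}"
proof (induction j rule: nat_less_induct)
  case (1 j)
  note IH = 1[rule_format]
  consider "j = 0" | "j = 1" | i where "j = Suc (Suc i)" by (metis One_nat_def not0_implies_Suc)
  then show ?case
  proof cases
    case 1
    have "(cos has_integral sin r - sin 0) {0..r}"
      using assms by (intro fundamental_theorem_of_calculus)
        (auto simp: has_real_derivative_iff_has_vector_derivative[symmetric] intro!: derivative_eq_intros)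
    then show ?thesis by (simp add: 1 wave_1_0 slice_const_def)
  next
    case 2
    let ?F = "\<lambda>t. sin t * (r\<^sup>2 - t\<^sup>2) - 2 * (t * cos t) + 2 * sin t"
    have "((\<lambda>t. cos t * (r\<^sup>2 - t\<^sup>2)) has_integral ?F r - ?F 0) {0..r}"
      using assms by (intro fundamental_theorem_of_calculus)
        (auto simp: has_real_derivative_iff_has_vector_derivative[symmetric] algebra_simps power2_eq_square
          intro!: derivative_eq_intros)
    moreover have "2 * wave 3 1 r = sin r - r * cos r"
      using wave_recurrence[of 0 r] by (simp add: wave_0_0 wave_1_0)
    ultimately have "?F r - ?F 0 = 4 * wave 3 1 r" "((\<lambda>t. cos t * (r\<^sup>2 - t\<^sup>2)) has_integral ?F r - ?F 0) {0..r}"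
      by simp_all
    moreover have "slice_const 1 * wave (2 * 1 + 1) 1 r = 4 * wave 3 1 r"
      by (simp add: slice_const_def numeral_3_eq_3)
    ultimately show ?thesis unfolding 2 by (simp only: power_one_right)
  next
    case (3 i)
    define m where "m = Suc i"
    define u where "u = (\<lambda>t. r\<^sup>2 - t\<^sup>2)"
    let ?F = "\<lambda>t. sin t * u t ^ Suc m - 2 * (real m + 1) * (t * cos t * u t ^ m)"
    let ?g = "\<lambda>t. cos t * u t ^ Suc m - 2 * (real m + 1) * (2 * real m + 1) * (cos t * u t ^ m)
        + 4 * real m * (real m + 1) * r\<^sup>2 * (cos t * u t ^ i)"
    have du: "((\<lambda>t. u t ^ Suc p) has_real_derivative (- 2 * (real p + 1) * t * u t ^ p)) (at t within S)" for t p S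
      unfolding u_def by (rule derivative_eq_intros refl | simp)+ (simp add: algebra_simps)
    have "(?F has_real_derivative ?g t) (at t within {0..r})" for t
    proof -
      have "(?F has_real_derivative
          (cos t * u t ^ Suc m + (- 2 * (real m + 1) * t * u t ^ m) * sin t)
          - 2 * (real m + 1) * ((1 * cos t + - sin t * t) * u t ^ m + (- 2 * (real i + 1) * t * u t ^ i) * (t * cos t)))
          (at t within {0..r})"
        unfolding m_def
        by (intro DERIV_diff DERIV_mult DERIV_cmult du DERIV_subset[OF DERIV_sin] DERIV_subset[OF DERIV_cos] DERIV_ident subset_UNIV)
      moreover have "(cos t * u t ^ Suc m + (- 2 * (real m + 1) * t * u t ^ m) * sin t)
          - 2 * (real m + 1) * ((1 * cos t + - sin t * t) * u t ^ m + (- 2 * (real i + 1) * t * u t ^ i) * (t * cos t)) = ?g t"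
      proof -
        have r2: "r\<^sup>2 = t * t + u t" by (simp add: u_def power2_eq_square)
        show ?thesis unfolding r2 m_def by (simp add: algebra_simps)
      qed
      ultimately show ?thesis by (simp only:)
    qed
    then have "(?g has_integral ?F r - ?F 0) {0..r}"
      using assms by (intro fundamental_theorem_of_calculus) (auto simp: has_real_derivative_iff_has_vector_derivative)
    then have g0: "(?g has_integral 0) {0..r}" by (simp add: u_def m_def)
    have "i < j" "m < j" using 3 by (auto simp: m_def)
    note I = has_integral_mult_right[OF IH[OF \<open>m < j\<close>], of "2 * (real m + 1) * (2 * real m + 1)"]
      has_integral_mult_right[OF IH[OF \<open>i < j\<close>], of "4 * real m * (real m + 1) * r\<^sup>2"]
    have main: "((\<lambda>t. cos t * u t ^ Suc m) has_integral
       2 * (real m + 1) * (2 * real m + 1) * (slice_const m * wave (2 * m + 1) m r)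
        - 4 * real m * (real m + 1) * r\<^sup>2 * (slice_const i * wave (2 * i + 1) i r)) {0..r}"
      using has_integral_diff[OF has_integral_add[OF g0 I(1)] I(2)] by (simp add: u_def)
    have r1: "r * wave (2 * i + 1) i r = 2 * real m * wave (2 * m) m r"
      using wave_mult_arg[of r i] by (simp add: m_def)
    have r2: "2 * (real m + 1) * wave (2 * j - 1 + 2) j r
       = (2 * real m + 1) * wave (2 * m + 1) m r - r * wave (2 * m) m r"
      using wave_recurrence[of m r] by (simp add: m_def 3 eval_nat_numeral)
    have c1: "slice_const m = 4 * (real m)\<^sup>2 * slice_const i"
      by (simp add: slice_const_def m_def power_mult_distrib)
    have c2: "slice_const j = 4 * (real m + 1)\<^sup>2 * slice_const m"
    proof -
      have "j = Suc m" by (simp add: m_def 3)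
      then show ?thesis by (simp add: slice_const_def power_mult_distrib add.commute)
    qed
    have "4 * real m * (real m + 1) * r\<^sup>2 * (slice_const i * wave (2 * i + 1) i r)
      = 4 * real m * (real m + 1) * r * slice_const i * (r * wave (2 * i + 1) i r)"
      by (simp add: power2_eq_square)
    also have "\<dots> = 2 * (real m + 1) * slice_const m * (r * wave (2 * m) m r)"
      unfolding r1 c1 by (simp add: power2_eq_square)
    finally have e1: "4 * real m * (real m + 1) * r\<^sup>2 * (slice_const i * wave (2 * i + 1) i r)
      = 2 * (real m + 1) * slice_const m * (r * wave (2 * m) m r)" .
    have "2 * (real m + 1) * (2 * real m + 1) * (slice_const m * wave (2 * m + 1) m r)
        - 4 * real m * (real m + 1) * r\<^sup>2 * (slice_const i * wave (2 * i + 1) i r)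
       = 2 * (real m + 1) * slice_const m * ((2 * real m + 1) * wave (2 * m + 1) m r - r * wave (2 * m) m r)"
      unfolding e1 by (simp add: right_diff_distrib)
    also have "\<dots> = slice_const j * wave (2 * j - 1 + 2) j r"
      unfolding r2[symmetric] c2 by (simp add: power2_eq_square) (simp add: algebra_simps)
    finally show ?thesis using main 3 by (simp add: u_def m_def eval_nat_numeral)
  qed
qed

section \<open>The Fourier transform of a ball in odd dimension\<close>

text \<open>The ball is sliced orthogonally to \<open>b\<close>: the slice at height
  \<open>t\<close> is a ball of dimension \<open>2 * j\<close> and radius
  \<open>sqrt (s\<^sup>2 - t\<^sup>2)\<close>. Because the total dimension is odd, its volume is a
  polynomial in \<open>t\<close>.\<close>

lemma ball_cos_integral_axis:
  fixes b :: "'a::euclidean_space"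
  assumes b: "b \<in> Basis" and s: "s > 0" and dim: "DIM('a) = 2 * j + 1"
  shows "(LINT x|lborel. indicator (cball 0 s) x * cos (\<rho> * (b \<bullet> x))) =
     unit_ball_vol (2 * real j) * (LINT t|lborel. indicator {-s..s} t * (cos (\<rho> * t) * (s\<^sup>2 - t\<^sup>2) ^ j))"
proof -
  interpret product_sigma_finite "\<lambda>_::'a. lborel :: real measure"
    by standard
  define A where "A = (Basis :: 'a set) - {b}"
  have A: "finite A" "b \<notin> A" "insert b A = Basis" "card A = 2 * j"
    using b dim by (auto simp: A_def)
  let ?M = "\<lambda>B. Pi\<^sub>M B (\<lambda>_::'a. lborel :: real measure)"
  let ?G = "\<lambda>f. indicator {f. sqrt (\<Sum>i\<in>insert b A. (f i)\<^sup>2) \<le> s} f * cos (\<rho> * f b)"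
  define H where "H = (\<lambda>t f. if sqrt (t\<^sup>2 + (\<Sum>i\<in>A. (f i)\<^sup>2)) \<le> s then cos (\<rho> * t) else 0)"
  interpret MA: finite_product_sigma_finite "\<lambda>_::'a. lborel :: real measure" A by standard (rule A)
  have Hmeas: "(\<lambda>t. LINT f|?M A. H t f) \<in> borel_measurable lborel"
    by (rule MA.borel_measurable_lebesgue_integral) (simp add: H_def)
  have norm_eq: "norm (\<Sum>i\<in>Basis. f i *\<^sub>R i :: 'a) = sqrt (\<Sum>i\<in>Basis. (f i)\<^sup>2)" for f
    by (subst norm_eq_sqrt_inner, subst euclidean_inner) (simp add: power2_eq_square)
  have "(LINT x|lborel. indicator (cball 0 s) x * cos (\<rho> * (b \<bullet> x)))
      = (LINT x|distr (?M Basis) borel (\<lambda>f. \<Sum>i\<in>Basis. f i *\<^sub>R i). indicator (cball 0 s) x * cos (\<rho> * (b \<bullet> x)))"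
    by (simp only: lborel_eq[where 'a='a, symmetric])
  also have "\<dots> = (LINT f|?M Basis. indicator (cball 0 s) (\<Sum>i\<in>Basis. f i *\<^sub>R i) * cos (\<rho> * (b \<bullet> (\<Sum>i\<in>Basis. f i *\<^sub>R i))))"
  proof (rule integral_distr)
    have "(\<lambda>x. cos (\<rho> * (b \<bullet> x))) \<in> borel_measurable borel"
      by (intro borel_measurable_continuous_onI continuous_intros)
    then show "(\<lambda>x. indicator (cball 0 s) x * cos (\<rho> * (b \<bullet> x))) \<in> borel_measurable borel"
      by (intro borel_measurable_times borel_measurable_indicator) auto
  qed auto
  also have "\<dots> = (LINT f|?M (insert b A). ?G f)"
    unfolding A(3) using b
    by (intro Bochner_Integration.integral_cong)
       (auto simp: norm_eq inner_sum_right inner_Basis sum.delta' if_distrib[of "\<lambda>x. _ * x"] cong: if_cong split: split_indicator)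
  also have "\<dots> = (LINT t|lborel. (LINT f|?M A. H t f))"
  proof -
    have meas: "{f \<in> space (?M (insert b A)). sqrt (\<Sum>i\<in>insert b A. (f i)\<^sup>2) \<le> s} \<in> sets (?M (insert b A))"
      by measurable
    have em: "emeasure (?M (insert b A)) {f \<in> space (?M (insert b A)). sqrt (\<Sum>i\<in>insert b A. (f i)\<^sup>2) \<le> s} < \<infinity>"
      using emeasure_cball_aux[of "insert b A" s] A(1) s by (simp add: Int_def conj_commute)
    have int: "integrable (?M (insert b A)) ?G"
    proof (rule Bochner_Integration.integrable_bound)
      show "integrable (?M (insert b A)) (indicator {f \<in> space (?M (insert b A)). sqrt (\<Sum>i\<in>insert b A. (f i)\<^sup>2) \<le> s} :: _ \<Rightarrow> real)"
        using meas em by (intro integrable_real_indicator)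
      show "?G \<in> borel_measurable (?M (insert b A))" by measurable
      show "AE f in ?M (insert b A). norm (?G f) \<le>
         norm (indicator {f \<in> space (?M (insert b A)). sqrt (\<Sum>i\<in>insert b A. (f i)\<^sup>2) \<le> s} f :: real)"
        by (intro AE_I2) (auto split: split_indicator)
    qed
    have "(LINT f|?M (insert b A). ?G f) = (LINT x|?M {b}. (LINT f|?M A. ?G (merge {b} A (x, f))))"
      using product_integral_fold[of "{b}" A ?G] A int by simp
    also have "\<dots> = (LINT x|?M {b}. (LINT f|?M A. H (x b) f))"
    proof (intro Bochner_Integration.integral_cong refl)
      fix x f :: "'a \<Rightarrow> real"
      have "(\<Sum>i\<in>insert b A. ((merge {b} A (x, f)) i)\<^sup>2) = (x b)\<^sup>2 + (\<Sum>i\<in>A. (f i)\<^sup>2)"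
      proof -
        have "(\<Sum>i\<in>A. ((merge {b} A (x, f)) i)\<^sup>2) = (\<Sum>i\<in>A. (f i)\<^sup>2)"
          using A(2) by (intro sum.cong) (auto simp: merge_def)
        then show ?thesis using A(1,2) by (simp add: merge_def)
      qed
      moreover have "merge {b} A (x, f) b = x b" by (simp add: merge_def)
      ultimately show "?G (merge {b} A (x, f)) = H (x b) f" by (simp add: H_def)
    qed
    also have "\<dots> = (LINT t|lborel. (LINT f|?M A. H t f))"
      by (rule product_integral_singleton) (rule Hmeas)
    finally show ?thesis .
  qed
  also have "\<dots> = (LINT t|lborel. unit_ball_vol (2 * real j) * (indicator {-s..s} t * (cos (\<rho> * t) * (s\<^sup>2 - t\<^sup>2) ^ j)))"
  proof (rule integral_cong_AE)
    \<comment> \<open>At these two heights the slice degenerates to radius 0, whereas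
      \<open>emeasure_cball_aux\<close> is applied with a positive radius; they form a null
      set.\<close>
    have "AE t in lborel. t \<noteq> s \<and> t \<noteq> - s"
      by (intro AE_conjI AE_lborel_singleton)
    then show "AE t in lborel. (LINT f|?M A. H t f) = unit_ball_vol (2 * real j) * (indicator {-s..s} t * (cos (\<rho> * t) * (s\<^sup>2 - t\<^sup>2) ^ j))"
    proof eventually_elim
      case (elim t)
      show ?case
      proof (cases "t \<in> {-s..s}")
        case False
        then have "s < \<bar>t\<bar>" by auto
        then have "s\<^sup>2 < \<bar>t\<bar>\<^sup>2" using s by (intro power_strict_mono) auto
        then have "s\<^sup>2 < t\<^sup>2" by simp
        then have "H t f = 0" for f
        proof -
          have "s\<^sup>2 < t\<^sup>2 + (\<Sum>i\<in>A. (f i)\<^sup>2)" using \<open>s\<^sup>2 < t\<^sup>2\<close> sum_nonneg[of A "\<lambda>i. (f i)\<^sup>2"] by simp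
          then have "\<not> sqrt (t\<^sup>2 + (\<Sum>i\<in>A. (f i)\<^sup>2)) \<le> s"
            using s real_less_rsqrt by (auto simp: not_le)
          then show ?thesis by (simp add: H_def)
        qed
        then have "(LINT f|?M A. H t f) = 0" by simp
        then show ?thesis using False by simp
      next
        case True
        define r where "r = sqrt (s\<^sup>2 - t\<^sup>2)"
        have "\<bar>t\<bar> < s" using True elim by auto
        then have "\<bar>t\<bar>\<^sup>2 < s\<^sup>2" by (intro power_strict_mono) auto
        then have "t\<^sup>2 < s\<^sup>2" by simp
        then have r: "r > 0" "r\<^sup>2 = s\<^sup>2 - t\<^sup>2" by (auto simp: r_def)
        let ?E = "{f. sqrt (\<Sum>i\<in>A. (f i)\<^sup>2) \<le> r} \<inter> space (?M A)"
        have iff: "sqrt (t\<^sup>2 + X) \<le> s \<longleftrightarrow> sqrt X \<le> r" if "X \<ge> 0" for X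
        proof -
          have "s = sqrt (s\<^sup>2)" "r = sqrt (r\<^sup>2)" using s r(1) by simp_all
          then have "sqrt (t\<^sup>2 + X) \<le> s \<longleftrightarrow> t\<^sup>2 + X \<le> s\<^sup>2" by (metis real_sqrt_le_iff)
          also have "\<dots> \<longleftrightarrow> X \<le> r\<^sup>2" using r by auto
          also have "\<dots> \<longleftrightarrow> sqrt X \<le> r" using \<open>r = sqrt (r\<^sup>2)\<close> by (metis real_sqrt_le_iff)
          finally show ?thesis .
        qed
        have "(LINT f|?M A. H t f) = (LINT f|?M A. indicator ?E f * cos (\<rho> * t))"
          by (intro Bochner_Integration.integral_cong) (simp_all add: iff sum_nonneg indicator_def H_def)
        also have "\<dots> = measure (?M A) ?E * cos (\<rho> * t)" by simp
        also have "measure (?M A) ?E = unit_ball_vol (2 * real j) * r ^ (2 * j)"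
          using emeasure_cball_aux[OF A(1) r(1)] r A(4) by (simp add: measure_def)
        also have "r ^ (2 * j) = (s\<^sup>2 - t\<^sup>2) ^ j" by (simp add: power_mult r)
        finally show ?thesis using True by simp
      qed
    qed
    show "(\<lambda>t. LINT f|?M A. H t f) \<in> borel_measurable lborel" by (rule Hmeas)
    have "(\<lambda>t::real. cos (\<rho> * t) * (s\<^sup>2 - t\<^sup>2) ^ j) \<in> borel_measurable borel"
      by (intro borel_measurable_continuous_onI continuous_intros)
    then show "(\<lambda>t. unit_ball_vol (2 * real j) * (indicator {- s..s} t * (cos (\<rho> * t) * (s\<^sup>2 - t\<^sup>2) ^ j))) \<in> borel_measurable lborel"
      by (simp add: borel_measurable_indicator borel_measurable_times)
  qed
  also have "\<dots> = unit_ball_vol (2 * real j) * (LINT t|lborel. indicator {-s..s} t * (cos (\<rho> * t) * (s\<^sup>2 - t\<^sup>2) ^ j))"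
    by (rule integral_mult_right_zero)
  finally show ?thesis .
qed

text \<open>The library states the invariance of Lebesgue measure under orthogonal maps only for \<open>real^'m\<close>
  with a well-ordered index type \<open>'m\<close>.\<close>

typedef 'a wo = "UNIV :: 'a set" ..

definition wo_rank :: "'a::finite wo \<Rightarrow> nat" where
  "wo_rank x = (SOME f. inj f) (Rep_wo x)"

lemma inj_wo_rank: "inj (wo_rank :: 'a::finite wo \<Rightarrow> nat)"
proof -
  have "\<exists>f :: 'a \<Rightarrow> nat. inj f"
    using finite_imp_inj_to_nat_seg[of "UNIV :: 'a set"] by auto
  then have "inj (SOME f :: 'a \<Rightarrow> nat. inj f)" by (rule someI_ex)
  moreover have "inj (Rep_wo :: 'a wo \<Rightarrow> 'a)" by (rule injI) (simp add: Rep_wo_inject)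
  ultimately have "inj ((SOME f :: 'a \<Rightarrow> nat. inj f) \<circ> Rep_wo)" by (rule inj_compose)
  then show ?thesis by (simp add: wo_rank_def[abs_def] comp_def)
qed

instance wo :: (finite) finite
proof
  have "finite (Abs_wo ` (UNIV :: 'a set))" by (intro finite_imageI finite)
  moreover have "Abs_wo ` (UNIV :: 'a set) = UNIV"
    by (rule type_definition.Abs_image[OF type_definition_wo])
  ultimately show "finite (UNIV :: 'a wo set)" by metis
qed

instantiation wo :: (finite) wellorder
begin
definition "less_eq_wo (x :: 'a wo) (y :: 'a wo) \<longleftrightarrow> wo_rank x \<le> wo_rank y"
definition "less_wo (x :: 'a wo) (y :: 'a wo) \<longleftrightarrow> wo_rank x < wo_rank y"
instance
proof
  fix P :: "'a wo \<Rightarrow> bool" and a :: "'a wo"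
  assume *: "\<And>x. (\<And>y. y < x \<Longrightarrow> P y) \<Longrightarrow> P x"
  show "P a"
  proof (induction "wo_rank a" arbitrary: a rule: less_induct)
    case less
    show ?case by (rule *) (use less in \<open>simp add: less_wo_def\<close>)
  qed
next
  fix x y :: "'a wo"
  assume "x \<le> y" "y \<le> x"
  then have "wo_rank x = wo_rank y" by (simp add: less_eq_wo_def)
  then show "x = y" by (rule injD[OF inj_wo_rank])
qed (auto simp: less_eq_wo_def less_wo_def)
end

lemma card_wo: "CARD('a::finite wo) = CARD('a)"
  by (rule type_definition.card[OF type_definition_wo])

text \<open>An orthogonal map that takes a multiple of a coordinate vector to
  \<open>\<omega>\<close> preserves the ball and reduces the integral to
  \<open>ball_cos_integral_axis\<close>; scaling by \<open>norm \<omega>\<close> then leads to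
  Poisson's integral.\<close>

lemma ball_cos_integral_aux:
  fixes \<omega> :: "real^'m::{finite,wellorder}"
  assumes s: "s > 0" and \<omega>: "\<omega> \<noteq> 0" and dim: "CARD('m) = 2 * j + 1"
  shows "(LINT x|lborel. indicator (cball 0 s) x * cos (\<omega> \<bullet> x)) =
     unit_ball_vol (2 * real j) * (2 * slice_const j) * (wave (2 * j + 1) j (norm \<omega> * s) / norm \<omega> ^ (2 * j + 1))"
proof -
  define \<rho> where "\<rho> = norm \<omega>"
  have \<rho>: "\<rho> > 0" using \<omega> by (simp add: \<rho>_def)
  obtain k :: 'm where True by simp
  define b where "b = axis k (1::real)"
  have b: "b \<in> Basis" by (simp add: b_def)
  obtain T where T: "orthogonal_transformation T" "T (\<rho> *\<^sub>R b) = \<omega>"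
    using orthogonal_transformation_exists[of "\<rho> *\<^sub>R b" \<omega>] b \<rho> by (auto simp: \<rho>_def)
  have linT: "linear T" using T(1) by (rule orthogonal_transformation_linear)
  have Timg: "T ` cball 0 s = cball 0 s"
    using image_orthogonal_transformation_cball[OF T(1), of 0 s] linear_0[OF linT] by simp
  have det: "\<bar>det (matrix T)\<bar> = 1" using orthogonal_transformation_det[OF T(1)] .
  have inner: "\<omega> \<bullet> T x = \<rho> * (b \<bullet> x)" for x
    using T unfolding orthogonal_transformation_def by (metis inner_scaleR_left)
  have leb: "(LINT x|lborel. indicator (cball 0 s) x * cos (v \<bullet> x)) = integral (cball 0 s) (\<lambda>x. cos (v \<bullet> x))"
     "(\<lambda>x. cos (v \<bullet> x)) absolutely_integrable_on cball 0 s" for v :: "(real, 'm) vec"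
  proof -
    have "set_integrable lborel (cball 0 s) (\<lambda>x. cos (v \<bullet> x))"
      unfolding set_integrable_def by (rule borel_integrable_compact) (auto intro!: continuous_intros)
    moreover have meas: "(\<lambda>x. indicator (cball 0 s) x *\<^sub>R cos (v \<bullet> x)) \<in> borel_measurable lborel"
      by (intro borel_measurable_scaleR borel_measurable_indicator borel_measurable_continuous_onI continuous_intros) auto
    ultimately show ai: "(\<lambda>x. cos (v \<bullet> x)) absolutely_integrable_on cball 0 s"
      unfolding set_integrable_def
      using meas by (subst integrable_completion) auto
    show "(LINT x|lborel. indicator (cball 0 s) x * cos (v \<bullet> x)) = integral (cball 0 s) (\<lambda>x. cos (v \<bullet> x))"
      using set_borel_integral_eq_integral(2)[of "cball 0 s" "\<lambda>x. cos (v \<bullet> x)"] borel_integrable_compact[of "cball 0 s" "\<lambda>x. cos (v \<bullet> x)"]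
      by (simp add: set_integrable_def set_lebesgue_integral_def continuous_intros)
  qed
  note cos_ai = leb(2)
  have vec_scaleR: "a *\<^sub>R (1 :: real^1) = vec a" for a :: real by (simp add: vec_eq_iff)
  have absolutely_integrable_vec: "(\<lambda>x. vec (g x) :: real^1) absolutely_integrable_on A"
    if "g absolutely_integrable_on A" for g :: "(real, 'm) vec \<Rightarrow> real" and A
    using absolutely_integrable_linear[OF that bounded_linear_scaleR_left[of "1 :: real^1"]]
    by (simp add: o_def vec_scaleR)
  have vint: "(\<lambda>x. vec (cos (v \<bullet> x)) :: real^1) integrable_on cball 0 s" for v :: "(real, 'm) vec"
    using absolutely_integrable_vec[OF cos_ai[of v]] by (simp add: absolutely_integrable_on_def)
  have vint': "(\<lambda>x. vec (cos (\<rho> * (b \<bullet> x))) :: real^1) integrable_on cball 0 s"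
    using vint[of "\<rho> *\<^sub>R b"] by simp
  \<comment> \<open>\<open>integral_change_of_variables_linear\<close> speaks about vector-valued
    integrands, so the scalar function is read as a function into \<open>real^1\<close>.\<close>
  let ?F = "\<lambda>x. vec (cos (\<omega> \<bullet> x)) :: real^1"
  have "integral (cball 0 s) ?F = integral (T ` cball 0 s) ?F" by (simp add: Timg)
  also have "\<dots> = \<bar>det (matrix T)\<bar> *\<^sub>R integral (cball 0 s) (?F \<circ> T)"
    by (rule integral_change_of_variables_linear[OF linT], intro disjI1)
       (simp add: Timg, intro absolutely_integrable_vec cos_ai)
  finally have e: "integral (cball 0 s) ?F = integral (cball 0 s) (\<lambda>x. vec (cos (\<rho> * (b \<bullet> x))))"
    by (simp add: det o_def inner)
  have "integral (cball 0 s) (\<lambda>x. ?F x $ 1) = integral (cball 0 s) (\<lambda>x. (vec (cos (\<rho> * (b \<bullet> x))) :: real^1) $ 1)"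
    unfolding integral_component_eq_cart[OF vint] integral_component_eq_cart[OF vint'] e ..
  then have "integral (cball 0 s) (\<lambda>x. cos (\<omega> \<bullet> x)) = integral (cball 0 s) (\<lambda>x. cos ((\<rho> *\<^sub>R b) \<bullet> x))"
    by simp
  then have "(LINT x|lborel. indicator (cball 0 s) x * cos (\<omega> \<bullet> x)) = (LINT x|lborel. indicator (cball 0 s) x * cos (\<rho> * (b \<bullet> x)))"
    using leb(1)[of \<omega>] leb(1)[of "\<rho> *\<^sub>R b"] by simp
  also have "\<dots> = unit_ball_vol (2 * real j) * (LINT t|lborel. indicator {-s..s} t * (cos (\<rho> * t) * (s\<^sup>2 - t\<^sup>2) ^ j))"
    by (rule ball_cos_integral_axis[OF b s]) (simp add: dim)
  also have "(LINT t|lborel. indicator {-s..s} t * (cos (\<rho> * t) * (s\<^sup>2 - t\<^sup>2) ^ j))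
     = integral {-s..s} (\<lambda>t. cos (\<rho> * t) * (s\<^sup>2 - t\<^sup>2) ^ j)"
      using set_borel_integral_eq_integral(2)[of "{-s..s}" "\<lambda>t. cos (\<rho> * t) * (s\<^sup>2 - t\<^sup>2) ^ j"]
        borel_integrable_compact[of "{-s..s}" "\<lambda>t. cos (\<rho> * t) * (s\<^sup>2 - t\<^sup>2) ^ j"]
      by (simp add: set_integrable_def set_lebesgue_integral_def continuous_intros)
  also have "\<dots> = 2 * slice_const j * (wave (2 * j + 1) j (\<rho> * s) / \<rho> ^ (2 * j + 1))"
  proof (rule integral_unique)
    let ?h = "\<lambda>t. cos (\<rho> * t) * (s\<^sup>2 - t\<^sup>2) ^ j"
    let ?I = "slice_const j * (wave (2 * j + 1) j (\<rho> * s) / \<rho> ^ (2 * j + 1))"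
    have *: "((\<lambda>t. cos t * ((\<rho> * s)\<^sup>2 - t\<^sup>2) ^ j) has_integral slice_const j * wave (2 * j + 1) j (\<rho> * s)) {0..\<rho> * s}"
      by (rule cos_slice_integral_aux) (use s \<rho> in auto)
    have "((\<lambda>t. cos (\<rho> * t) * ((\<rho> * s)\<^sup>2 - (\<rho> * t)\<^sup>2) ^ j) has_integral (1 / \<rho>) * (slice_const j * wave (2 * j + 1) j (\<rho> * s))) {0..s}"
    proof -
      have "inverse \<rho> * (\<rho> * s) = s" using \<rho> by simp
      moreover have "((\<lambda>t. cos (\<rho> * t) * ((\<rho> * s)\<^sup>2 - (\<rho> * t)\<^sup>2) ^ j) has_integral (1 / \<rho>) * (slice_const j * wave (2 * j + 1) j (\<rho> * s))) {0..inverse \<rho> * (\<rho> * s)}"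
        using has_integral_affinity'[of "\<lambda>t. cos t * ((\<rho> * s)\<^sup>2 - t\<^sup>2) ^ j" "slice_const j * wave (2 * j + 1) j (\<rho> * s)" 0 "\<rho> * s" \<rho> 0] \<rho> s *
        by (simp add: divide_inverse)
      ultimately show ?thesis by (simp only:)
    qed
    moreover have "cos (\<rho> * t) * ((\<rho> * s)\<^sup>2 - (\<rho> * t)\<^sup>2) ^ j = \<rho> ^ (2 * j) * ?h t" for t
      by (simp add: power_mult_distrib right_diff_distrib[symmetric] power_mult)
    ultimately have "((\<lambda>t. \<rho> ^ (2 * j) * ?h t) has_integral (1 / \<rho>) * (slice_const j * wave (2 * j + 1) j (\<rho> * s))) {0..s}"
      by (simp only:)
    from has_integral_mult_right[OF this, of "1 / \<rho> ^ (2 * j)"]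
    have 0: "((\<lambda>t. 1 / \<rho> ^ (2 * j) * (\<rho> ^ (2 * j) * ?h t)) has_integral
      1 / \<rho> ^ (2 * j) * ((1 / \<rho>) * (slice_const j * wave (2 * j + 1) j (\<rho> * s)))) {0..s}" .
    have "1 / \<rho> ^ (2 * j) * (\<rho> ^ (2 * j) * ?h t) = ?h t" for t using \<rho> by simp
    moreover have "1 / \<rho> ^ (2 * j) * ((1 / \<rho>) * (slice_const j * wave (2 * j + 1) j (\<rho> * s))) = ?I" by simp
    ultimately have 1: "(?h has_integral ?I) {0..s}" using 0 by (simp only:)
    then have "((\<lambda>t. ?h (- t)) has_integral ?I) {-s..-0}" by (subst has_integral_reflect_real) (use s in auto)
    then have 2: "(?h has_integral ?I) {-s..0}" by simp
    show "(?h has_integral 2 * slice_const j * (wave (2 * j + 1) j (\<rho> * s) / \<rho> ^ (2 * j + 1))) {-s..s}"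
      using has_integral_combine[OF _ _ 2 1] s by (simp add: mult.assoc)
  qed
  finally show ?thesis by (simp add: \<rho>_def)
qed

section \<open>Calculus and Fourier transform of Wendland functions\<close>

lemma wendland_outside: "l > 0 \<Longrightarrow> 1 \<le> r \<Longrightarrow> wendland l k r = 0"
proof (cases k)
  case (Suc k')
  assume "1 \<le> r"
  then show ?thesis by (cases "r = 1") (simp_all add: Suc)
qed simp

text \<open>The fundamental theorem of calculus in the lower limit, one-sided at 0. Continuity of
  the preceding function is an assumption because \<open>wendland_continuous\<close> obtains it
  inductively from this lemma.\<close>

lemma wendland_DERIV_aux:
  assumes "l > 0" "0 \<le> r" and c: "continuous_on {0..} (wendland l k)"
  shows "(wendland l (Suc k) has_real_derivative - (r * wendland l k r)) (at r within {0..})"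
  proof -
    \<comment> \<open>An end point that is at least 1 and larger than \<open>r\<close>: the
      integrand vanishes beyond 1, so the upper limit may be moved to \<open>R\<close>, and
      \<open>r\<close> is not the right end of \<open>{0..R}\<close>.\<close>
    define R where "R = r + 1"
    let ?g = "\<lambda>t. t * wendland l k t"
    have R: "1 \<le> R" "r < R" using \<open>0 \<le> r\<close> by (auto simp: R_def)
    have cg: "continuous_on {a..b} ?g" if "0 \<le> a" for a b
      by (intro continuous_intros continuous_on_subset[OF c]) (use that in auto)
    have gi: "?g integrable_on {a..b}" if "0 \<le> a" for a b using cg[OF that] by (rule integrable_continuous_real)
    have eq: "wendland l (Suc k) u = integral {0..R} ?g - integral {0..u} ?g" if u: "u \<in> {0..R}" for u
    proof -
      have z: "integral {1..v} ?g = 0" for v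
        using integral_cong[of "{1..v}" ?g "\<lambda>_. 0"] wendland_outside[OF \<open>l > 0\<close>] by auto
      have z': "integral {u..v} ?g = 0" if "1 \<le> u" for v
        using integral_cong[of "{u..v}" ?g "\<lambda>_. 0"] wendland_outside[OF \<open>l > 0\<close>] that by auto
      have "integral {u..R} ?g = integral {u..1} ?g"
      proof (cases "u \<le> 1")
        case True
        have "integral {u..1} ?g + integral {1..R} ?g = integral {u..R} ?g"
          using u True R by (intro Henstock_Kurzweil_Integration.integral_combine gi) auto
        then show ?thesis by (simp add: z)
      qed (auto simp: z')
      moreover have "integral {0..u} ?g + integral {u..R} ?g = integral {0..R} ?g"
        using u by (intro Henstock_Kurzweil_Integration.integral_combine gi) auto
      ultimately show ?thesis by simp
    qed
    have "((\<lambda>u. integral {0..u} ?g) has_real_derivative ?g r) (at r within {0..R})"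
      using \<open>0 \<le> r\<close> R by (intro integral_has_real_derivative cg) auto
    then have "((\<lambda>u. integral {0..R} ?g - integral {0..u} ?g) has_real_derivative - ?g r) (at r within {0..R})"
      using DERIV_diff[OF DERIV_const] by fastforce
    then have "(wendland l (Suc k) has_real_derivative - ?g r) (at r within {0..R})"
    proof (rule has_field_derivative_transform_within[where d=1])
      show "r \<in> {0..R}" using \<open>0 \<le> r\<close> R by simp
      show "integral {0..R} ?g - integral {0..u} ?g = wendland l (Suc k) u" if "u \<in> {0..R}" for u
        by (rule eq[OF that, symmetric])
    qed auto
    moreover have "at r within {0..R} = at r within {0..}"
      using R by (intro at_within_nhd[of _ "{..<R}"]) auto
    ultimately show ?thesis by simp
  qed
lemma wendland_continuous:
  assumes "l > 0"
  shows "continuous_on {0..} (wendland l k)"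
proof (induction k)
  case 0
  have "continuous_on {0..} (\<lambda>r::real. max (1 - r) 0 ^ l)" by (intro continuous_intros)
  then show ?case by simp
next
  case (Suc k)
  show ?case
    by (rule DERIV_continuous_on) (rule wendland_DERIV_aux, use Suc assms in auto)
qed

lemma wendland_DERIV:
  assumes "l > 0" "0 \<le> r"
  shows "(wendland l (Suc k) has_real_derivative - (r * wendland l k r)) (at r within {0..})"
  using assms by (intro wendland_DERIV_aux wendland_continuous)

lemma wendland_pos: "l > 0 \<Longrightarrow> 0 \<le> r \<Longrightarrow> r < 1 \<Longrightarrow> 0 < wendland l k r"
proof (induction k arbitrary: r)
  case 0
  then show ?case by simp
next
  case (Suc k)
  have nn: "0 \<le> t * wendland l k t" if "r \<le> t" "t \<le> 1" for t
  proof -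
    have "0 \<le> wendland l k t"
      using that Suc.prems Suc.IH[of t] wendland_outside[of l 1 k] by (cases "t = 1") auto
    then show ?thesis using that Suc.prems by simp
  qed
  have c: "continuous_on {r..1} (\<lambda>t. t * wendland l k t)"
    using Suc.prems by (intro continuous_intros continuous_on_subset[OF wendland_continuous]) auto
  have int: "(\<lambda>t. t * wendland l k t) integrable_on {r..1}" using c by (rule integrable_continuous_real)
  have "integral {r..1} (\<lambda>t. t * wendland l k t) \<noteq> 0"
  proof
    assume "integral {r..1} (\<lambda>t. t * wendland l k t) = 0"
    then have "((\<lambda>t. t * wendland l k t) has_integral 0) (cbox r 1)" using integrable_integral[OF int] by simp
    then have "(r + 1) / 2 * wendland l k ((r + 1) / 2) = 0"
      using Suc.prems by (intro has_integral_0_cbox_imp_0[of r 1 "\<lambda>t. t * wendland l k t" "(r + 1) / 2"]) (use c nn in auto)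
    then show False using Suc.IH[of "(r + 1) / 2"] Suc.prems by simp
  qed
  moreover have "0 \<le> integral {r..1} (\<lambda>t. t * wendland l k t)"
    using int by (rule integral_nonneg) (use nn in auto)
  ultimately show ?case by simp
qed

lemma wendland_nonneg: "l > 0 \<Longrightarrow> 0 \<le> r \<Longrightarrow> 0 \<le> wendland l k r"
  using wendland_pos[of l r k] wendland_outside[of l r k] by (cases "r < 1") auto

text \<open>Integration by parts trades \<open>wendland l (Suc k)\<close>, whose derivative is
  \<open>- (s * wendland l k s)\<close>, for \<open>wendland l k\<close> and raises \<open>q\<close>
  by one, because by \<open>wave_mult_arg\<close> the factor
  \<open>s * wave (2 * q + 1) q (L * s)\<close> is a multiple of the derivative of
  \<open>wave (2 * q + 3) (Suc q) (L * s)\<close>. At \<open>k = 0\<close> the integral is an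
  instance of \<open>wave_iterated_integral\<close>. The constant \<open>B\<close> does not depend
  on \<open>L\<close>.\<close>

lemma wendland_wave_integral:
  "l > 0 \<Longrightarrow> \<exists>B>0. \<forall>L>0. ((\<lambda>s. s * wendland l k s * wave (2 * q + 1) q (L * s)) has_integral
      B * wave (2 * (q + k) + 3 + l) (q + k + 1) L / L ^ (l + 2 + 2 * k)) {0..1}"
proof (induction k arbitrary: q)
  case 0
  have "((\<lambda>s. s * wendland l 0 s * wave (2 * q + 1) q (L * s)) has_integral
      (2 * real (Suc q) * fact l) * wave (2 * q + 3 + l) (q + 1) L / L ^ (l + 2)) {0..1}" if "L > 0" for L
  proof -
    have eq: "s * (1 - s) ^ l * wave (2 * q + 1) q (L * s) = (2 * real (Suc q) * fact l / L) * ((1 - s) ^ l / fact l * wave (2 * q + 2) (Suc q) (L * s))" for s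
    proof -
      have "s * wave (2 * q + 1) q (L * s) = 2 * real (Suc q) / L * wave (2 * q + 2) (Suc q) (L * s)"
        using wave_mult_arg[of "L * s" q] that by (simp add: field_simps)
      moreover have "s * (1 - s) ^ l * wave (2 * q + 1) q (L * s) = (1 - s) ^ l * (s * wave (2 * q + 1) q (L * s))"
        by simp
      ultimately have "s * (1 - s) ^ l * wave (2 * q + 1) q (L * s) = (1 - s) ^ l * (2 * real (Suc q) / L * wave (2 * q + 2) (Suc q) (L * s))"
        by (simp only:)
      then show ?thesis by simp
    qed
    have "((\<lambda>s. s * (1 - s) ^ l * wave (2 * q + 1) q (L * s)) has_integral
        (2 * real (Suc q) * fact l / L) * (wave (2 * q + 2 + Suc l) (Suc q) L / L ^ Suc l)) {0..1}"
      unfolding eq by (intro has_integral_mult_right wave_iterated_integral that)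
    moreover have "(2 * real (Suc q) * fact l / L) * (wave (2 * q + 2 + Suc l) (Suc q) L / L ^ Suc l)
      = (2 * real (Suc q) * fact l) * wave (2 * q + 3 + l) (q + 1) L / L ^ (l + 2)"
      by (simp add: eval_nat_numeral)
    ultimately have "((\<lambda>s. s * (1 - s) ^ l * wave (2 * q + 1) q (L * s)) has_integral
       (2 * real (Suc q) * fact l) * wave (2 * q + 3 + l) (q + 1) L / L ^ (l + 2)) {0..1}" by (simp only:)
    then show ?thesis by (rule has_integral_eq[rotated]) simp
  qed
  then show ?case by (intro exI[of _ "2 * real (Suc q) * fact l"]) auto
next
  case (Suc k)
  obtain B where B: "B > 0" "\<And>L. L > 0 \<Longrightarrow> ((\<lambda>s. s * wendland l k s * wave (2 * Suc q + 1) (Suc q) (L * s)) has_integral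
      B * wave (2 * (Suc q + k) + 3 + l) (Suc q + k + 1) L / L ^ (l + 2 + 2 * k)) {0..1}"
    using Suc.IH[OF Suc.prems, of "Suc q"] by blast
  have "((\<lambda>s. s * wendland l (Suc k) s * wave (2 * q + 1) q (L * s)) has_integral
      (2 * real (Suc q) * B) * wave (2 * (q + Suc k) + 3 + l) (q + Suc k + 1) L / L ^ (l + 2 + 2 * Suc k)) {0..1}" if "L > 0" for L
  proof -
    let ?W = "\<lambda>s. wave (2 * q + 3) (Suc q) (L * s)"
    let ?g = "\<lambda>s. - (s * wendland l k s) * ?W s + L * wave (2 * q + 2) (Suc q) (L * s) * wendland l (Suc k) s"
    have "((\<lambda>s. wendland l (Suc k) s * ?W s) has_real_derivative ?g s) (at s within {0..1})" if "s \<in> {0..1}" for s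
    proof (rule DERIV_mult)
      show "(wendland l (Suc k) has_real_derivative - (s * wendland l k s)) (at s within {0..1})"
        using that Suc.prems by (intro DERIV_subset[OF wendland_DERIV]) auto
      show "(?W has_real_derivative L * wave (2 * q + 2) (Suc q) (L * s)) (at s within {0..1})"
        using wave_scaled_DERIV[of "2 * q + 2" "Suc q" L s] by (simp add: eval_nat_numeral)
    qed
    then have "(?g has_integral wendland l (Suc k) 1 * ?W 1 - wendland l (Suc k) 0 * ?W 0) {0..1}"
      by (intro fundamental_theorem_of_calculus) (auto simp del: wendland.simps simp: has_real_derivative_iff_has_vector_derivative)
    then have g0: "(?g has_integral 0) {0..1}"
      using Suc.prems by (simp add: wendland_outside wave_Suc_0 eval_nat_numeral del: wendland.simps)
    have W: "(\<lambda>s. s * wendland l k s * ?W s) = (\<lambda>s. s * wendland l k s * wave (2 * Suc q + 1) (Suc q) (L * s))"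
      by (simp add: eval_nat_numeral)
    have "((\<lambda>s. L * wave (2 * q + 2) (Suc q) (L * s) * wendland l (Suc k) s) has_integral
       B * wave (2 * (Suc q + k) + 3 + l) (Suc q + k + 1) L / L ^ (l + 2 + 2 * k)) {0..1}"
      using has_integral_add[OF g0 B(2)[OF that, folded W]] by (simp del: wendland.simps)
    from has_integral_mult_right[OF this, of "2 * real (Suc q) / L\<^sup>2"]
    have I: "((\<lambda>s. 2 * real (Suc q) / L\<^sup>2 * (L * wave (2 * q + 2) (Suc q) (L * s) * wendland l (Suc k) s)) has_integral
       2 * real (Suc q) / L\<^sup>2 * (B * wave (2 * (Suc q + k) + 3 + l) (Suc q + k + 1) L / L ^ (l + 2 + 2 * k))) {0..1}" .
    have e1: "2 * real (Suc q) / L\<^sup>2 * (L * wave (2 * q + 2) (Suc q) (L * s) * wendland l (Suc k) s) = s * wendland l (Suc k) s * wave (2 * q + 1) q (L * s)" for s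
    proof -
      have "s * wave (2 * q + 1) q (L * s) = 2 * real (Suc q) / L * wave (2 * q + 2) (Suc q) (L * s)"
        using wave_mult_arg[of "L * s" q] that by (simp add: field_simps)
      moreover have "s * wendland l (Suc k) s * wave (2 * q + 1) q (L * s) = (s * wave (2 * q + 1) q (L * s)) * wendland l (Suc k) s"
        by (simp only: mult_ac)
      ultimately have "s * wendland l (Suc k) s * wave (2 * q + 1) q (L * s) = 2 * real (Suc q) / L * wave (2 * q + 2) (Suc q) (L * s) * wendland l (Suc k) s"
        by (simp only:)
      then show ?thesis using that by (simp add: power2_eq_square del: wendland.simps)
    qed
    have e2: "2 * real (Suc q) / L\<^sup>2 * (B * wave (2 * (Suc q + k) + 3 + l) (Suc q + k + 1) L / L ^ (l + 2 + 2 * k))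
      = (2 * real (Suc q) * B) * wave (2 * (q + Suc k) + 3 + l) (q + Suc k + 1) L / L ^ (l + 2 + 2 * Suc k)"
      by (simp add: power2_eq_square)
    show ?thesis using I unfolding e1 e2 .
  qed
  then show ?case using B(1) by (intro exI[of _ "2 * real (Suc q) * B"]) (auto simp del: wendland.simps)
qed

lemma wendland_radial_continuous:
  fixes A :: "'a::euclidean_space set"
  assumes "l > 0" "c > 0"
  shows "continuous_on A (\<lambda>x. wendland l k (c * norm x))"
  by (rule continuous_on_compose2[OF wendland_continuous[OF assms(1)]])
     (use assms in \<open>auto intro!: continuous_intros\<close>)

lemma wendland_radial_integrable:
  fixes u :: "'a::euclidean_space \<Rightarrow> real"
  assumes "l > 0" "c > 0" "continuous_on UNIV u"
  shows "integrable lborel (\<lambda>x. wendland l k (c * norm x) * u x)"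
proof -
  have "integrable lborel (\<lambda>x. indicator (cball 0 (1 / c)) x *\<^sub>R (wendland l k (c * norm x) * u x))"
    by (intro borel_integrable_compact compact_cball continuous_on_mult wendland_radial_continuous assms
          continuous_on_subset[OF assms(3)]) auto
  moreover have "indicator (cball 0 (1 / c)) x *\<^sub>R (wendland l k (c * norm x) * u x) = wendland l k (c * norm x) * u x" for x
    using assms wendland_outside[of l "c * norm x" k] by (auto simp: indicator_def field_simps)
  ultimately show ?thesis by (simp only:)
qed

text \<open>Layer-cake form: the radial function is a superposition of indicators of balls with
  weight \<open>s * wendland l k s\<close>, so its Fourier transform reduces to that of
  balls.\<close>

lemma wendland_layers:
  assumes "l > 0" "0 \<le> r"
  shows "wendland l (Suc k) r = (LINT s|lborel. indicator {0..1} s * (s * wendland l k s) * indicator {r..} s)"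
proof -
  have "set_integrable lborel {r..1} (\<lambda>s. s * wendland l k s)"
    unfolding set_integrable_def using assms
    by (intro borel_integrable_compact continuous_intros continuous_on_subset[OF wendland_continuous]) auto
  then have "wendland l (Suc k) r = (LINT s|lborel. indicator {r..1} s * (s * wendland l k s))"
    using set_borel_integral_eq_integral(2)[of "{r..1}" "\<lambda>s. s * wendland l k s"]
    by (simp add: set_lebesgue_integral_def)
  also have "\<dots> = (LINT s|lborel. indicator {0..1} s * (s * wendland l k s) * indicator {r..} s)"
    using assms by (intro Bochner_Integration.integral_cong) (auto simp: indicator_def)
  finally show ?thesis .
qed

text \<open>Fubini on the layers turns the transform into \<open>wendland_wave_integral\<close> at
  \<open>q = j\<close>. The choice \<open>l = j + Suc k + 1\<close> makes the resulting index
  \<open>2 * (j + k) + 3 + l\<close> equal to \<open>3 * (j + Suc k) + 2\<close>, which is how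
  \<open>askey\<close> appears.\<close>

lemma wendland_fourier:
  fixes \<omega> :: "real^'m::{finite,wellorder}"
  assumes dim: "CARD('m) = 2 * j + 1" and l: "l = j + Suc k + 1" and c: "c > 0"
  shows "\<exists>A>0. \<forall>\<omega> :: (real, 'm) vec. \<omega> \<noteq> 0 \<longrightarrow>
     (LINT x|lborel. wendland l (Suc k) (c * norm x) * cos (\<omega> \<bullet> x)) =
       A * askey (j + Suc k) (norm \<omega> / c) / norm \<omega> ^ (3 * l - 1)"
proof -
  have l0: "l > 0" using l by simp
  obtain B where B: "B > 0" "\<And>L. L > 0 \<Longrightarrow> ((\<lambda>s. s * wendland l k s * wave (2 * j + 1) j (L * s)) has_integral
      B * wave (2 * (j + k) + 3 + l) (j + k + 1) L / L ^ (l + 2 + 2 * k)) {0..1}"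
    using wendland_wave_integral[OF l0, of k j] by blast
  define V where "V = unit_ball_vol (2 * real j) * (2 * slice_const j)"
  have V: "V > 0" unfolding V_def slice_const_def by (intro mult_pos_pos unit_ball_vol_pos) simp_all
  define A where "A = V * B * c ^ (l + 2 + 2 * k)"
  have "(LINT x|lborel. wendland l (Suc k) (c * norm x) * cos (\<omega> \<bullet> x)) =
       A * askey (j + Suc k) (norm \<omega> / c) / norm \<omega> ^ (3 * l - 1)" if \<omega>: "\<omega> \<noteq> 0" for \<omega> :: "(real, 'm) vec"
  proof -
    define \<rho> where "\<rho> = norm \<omega>"
    have \<rho>: "\<rho> > 0" using \<omega> by (simp add: \<rho>_def)
    define g where "g = (\<lambda>s. indicator {0..1} s * (s * wendland l k s))"
    define F where "F = (\<lambda>(x :: (real, 'm) vec) s. g s * indicator {c * norm x..} s * cos (\<omega> \<bullet> x))"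
    have g_meas: "g \<in> borel_measurable borel"
      unfolding g_def
      using borel_measurable_continuous_on_indicator[of "{0..1}" "\<lambda>s. s * wendland l k s"]
        continuous_on_subset[OF wendland_continuous[OF l0, of k], of "{0..1}"]
      by (simp add: continuous_intros)
    have "\<exists>C. \<forall>s\<in>{0..1}. \<bar>s * wendland l k s\<bar> \<le> C"
    proof -
      have "compact ((\<lambda>s. s * wendland l k s) ` {0..1})"
        by (intro compact_continuous_image continuous_intros continuous_on_subset[OF wendland_continuous[OF l0]]) auto
      then obtain C where "\<forall>y\<in>(\<lambda>s. s * wendland l k s) ` {0..1}. norm y \<le> C"
        using compact_imp_bounded bounded_iff by blast
      then show ?thesis by auto
    qed
    then obtain C where C: "\<And>s. s \<in> {0..1} \<Longrightarrow> \<bar>s * wendland l k s\<bar> \<le> C" by blast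
    have gC: "\<bar>g s\<bar> \<le> C * indicator {0..1} s" for s using C[of s] by (auto simp: g_def indicator_def)
    have int: "integrable (lborel \<Otimes>\<^sub>M lborel) (\<lambda>(x, s). F x s)"
    proof (rule Bochner_Integration.integrable_bound)
      have "emeasure (lborel \<Otimes>\<^sub>M lborel) (cball (0 :: (real, 'm) vec) (1 / c) \<times> {0..1::real}) < \<infinity>"
        using emeasure_bounded_finite[of "cball (0 :: (real, 'm) vec) (1 / c)"]
        by (subst lborel.emeasure_pair_measure_Times) (auto simp: ennreal_mult_less_top)
      then show "integrable (lborel \<Otimes>\<^sub>M lborel) (\<lambda>p. C * indicator (cball (0 :: (real, 'm) vec) (1 / c) \<times> {0..1::real}) p)"
        by (intro integrable_mult_right integrable_real_indicator) auto
      have [measurable]: "(\<lambda>p. indicator {c * norm (fst p)..} (snd p) :: real) \<in> borel_measurable (borel \<Otimes>\<^sub>M borel)"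
      proof -
        have "{p :: (real, 'm) vec \<times> real. c * norm (fst p) \<le> snd p} \<in> sets borel"
          by (intro borel_closed closed_Collect_le continuous_intros)
        then have "indicator {p :: (real, 'm) vec \<times> real. c * norm (fst p) \<le> snd p} \<in> borel_measurable (borel \<Otimes>\<^sub>M borel)"
          by (simp add: borel_prod)
        then show ?thesis by (simp add: indicator_def atLeast_def)
      qed
      note g_meas [measurable]
      have "(\<lambda>p. g (snd p) * indicator {c * norm (fst p)..} (snd p) * cos (\<omega> \<bullet> fst p)) \<in> borel_measurable (borel \<Otimes>\<^sub>M borel)"
        by measurable
      then show "(\<lambda>(x, s). F x s) \<in> borel_measurable (lborel \<Otimes>\<^sub>M lborel)"
        by (simp add: F_def case_prod_beta' cong: measurable_cong_sets)
      show "AE p in lborel \<Otimes>\<^sub>M lborel. norm (case p of (x, s) \<Rightarrow> F x s) \<le> norm (C * indicator (cball 0 (1 / c) \<times> {0..1}) p)"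
      proof (intro AE_I2, clarify)
        fix x :: "(real, 'm) vec" and s :: real
        have C0: "0 \<le> C" using C[of 0] by simp
        show "norm (F x s) \<le> norm (C * indicator (cball 0 (1 / c) \<times> {0..1}) (x, s))"
        proof (cases "s \<in> {0..1} \<and> c * norm x \<le> s")
          case True
          then have "c * norm x \<le> 1" by simp
          then have "norm x \<le> 1 / c" using c by (simp add: pos_le_divide_eq mult.commute)
          then have "indicator (cball 0 (1 / c) \<times> {0..1}) (x, s) = (1::real)" using True by simp
          moreover have "\<bar>g s\<bar> * \<bar>cos (\<omega> \<bullet> x)\<bar> \<le> C * 1" using gC[of s] True C0 by (intro mult_mono) auto
          ultimately show ?thesis using True C0 by (simp add: F_def abs_mult)
        next
          case False
          then have "F x s = 0" by (auto simp: F_def g_def indicator_def)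
          then show ?thesis by simp
        qed
      qed
    qed
    have "(LINT x|lborel. wendland l (Suc k) (c * norm x) * cos (\<omega> \<bullet> x)) = (LINT x|lborel. (LINT s|lborel. F x s))"
    proof (intro Bochner_Integration.integral_cong refl)
      fix x :: "(real, 'm) vec"
      show "wendland l (Suc k) (c * norm x) * cos (\<omega> \<bullet> x) = (LINT s|lborel. F x s)"
        using wendland_layers[OF l0, of "c * norm x" k] c
        by (simp add: F_def g_def del: wendland.simps)
    qed
    also have "\<dots> = (LINT s|lborel. (LINT x|lborel. F x s))"
      by (rule lborel_pair.Fubini_integral[OF int, symmetric])
    also have "\<dots> = (LINT s|lborel. indicator {0..1} s *\<^sub>R (V / \<rho> ^ (2 * j + 1) * (s * wendland l k s * wave (2 * j + 1) j (\<rho> / c * s))))"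
    proof (intro Bochner_Integration.integral_cong refl)
      fix s :: real
      have "(LINT x|lborel. F x s) = g s * (LINT x|lborel. indicator {c * norm x..} s * cos (\<omega> \<bullet> x))"
        unfolding F_def mult.assoc by (rule integral_mult_right_zero)
      also have "(LINT x|lborel. indicator {c * norm x..} s * cos (\<omega> \<bullet> x)) = (LINT x|lborel. indicator (cball 0 (s / c)) x * cos (\<omega> \<bullet> x))"
        using c by (intro Bochner_Integration.integral_cong refl) (auto simp: indicator_def pos_le_divide_eq mult.commute)
      also have "g s * \<dots> = indicator {0..1} s *\<^sub>R (V / \<rho> ^ (2 * j + 1) * (s * wendland l k s * wave (2 * j + 1) j (\<rho> / c * s)))"
      proof (cases "s \<in> {0<..1}")
        case True
        then have "0 < s / c" using c by simp
        from ball_cos_integral_aux[OF this \<omega> dim] show ?thesis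
          using True by (simp add: g_def V_def \<rho>_def)
      next
        case False
        then show ?thesis by (cases "s = 0") (auto simp: g_def indicator_def)
      qed
      finally show "(LINT x|lborel. F x s) = indicator {0..1} s *\<^sub>R (V / \<rho> ^ (2 * j + 1) * (s * wendland l k s * wave (2 * j + 1) j (\<rho> / c * s)))" .
    qed
    also have "\<dots> = integral {0..1} (\<lambda>s. V / \<rho> ^ (2 * j + 1) * (s * wendland l k s * wave (2 * j + 1) j (\<rho> / c * s)))"
    proof -
      have "set_integrable lborel {0..1} (\<lambda>s. V / \<rho> ^ (2 * j + 1) * (s * wendland l k s * wave (2 * j + 1) j (\<rho> / c * s)))"
        unfolding set_integrable_def
        by (intro borel_integrable_compact continuous_intros continuous_on_subset[OF wendland_continuous[OF l0]]
              continuous_on_compose2[OF continuous_on_wave[of UNIV]]) auto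
      then show ?thesis
        using set_borel_integral_eq_integral(2) unfolding set_lebesgue_integral_def by blast
    qed
    also have "\<dots> = V / \<rho> ^ (2 * j + 1) * (B * wave (2 * (j + k) + 3 + l) (j + k + 1) (\<rho> / c) / (\<rho> / c) ^ (l + 2 + 2 * k))"
      using \<rho> c by (intro integral_unique has_integral_mult_right B) simp
    also have "wave (2 * (j + k) + 3 + l) (j + k + 1) (\<rho> / c) = askey (j + Suc k) (\<rho> / c)"
    proof -
      have "2 * (j + k) + 3 + l = 3 * (j + Suc k) + 2" using l by simp
      then show ?thesis by (simp only: askey_def) simp
    qed
    also have "V / \<rho> ^ (2 * j + 1) * (B * askey (j + Suc k) (\<rho> / c) / (\<rho> / c) ^ (l + 2 + 2 * k))
       = A * askey (j + Suc k) (\<rho> / c) / (\<rho> ^ (2 * j + 1) * \<rho> ^ (l + 2 + 2 * k))"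
      using c by (simp add: A_def power_divide)
    also have "\<rho> ^ (2 * j + 1) * \<rho> ^ (l + 2 + 2 * k) = \<rho> ^ (3 * l - 1)"
    proof -
      have "(2 * j + 1) + (l + 2 + 2 * k) = 3 * l - 1" using l by simp
      then show ?thesis by (simp only: power_add[symmetric])
    qed
    finally show ?thesis by (simp add: \<rho>_def)
  qed
  moreover have "A > 0" using V B c by (simp add: A_def)
  ultimately show ?thesis by blast
qed

text \<open>\<open>askey (j + Suc k)\<close> grows at least like the power \<open>l - 1\<close>,
  which lowers the exponent \<open>3 * l - 1\<close> to \<open>2 * l\<close>: the decay that belongs
  to Sobolev order \<open>l\<close>. Among the frequencies below \<open>r0\<close> only 0 will
  occur; it is covered by \<open>wendland_integral_pos\<close>.\<close>

lemma wendland_fourier_lower_bound: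
  assumes dim: "CARD('m::{finite,wellorder}) = 2 * j + 1" and l: "l = j + Suc k + 1" and c: "c > 0" and r0: "r0 > 0"
  shows "\<exists>A>0. \<forall>\<omega> :: (real, 'm) vec. r0 \<le> norm \<omega> \<longrightarrow>
     A / norm \<omega> ^ (2 * l) \<le> (LINT x|lborel. wendland l (Suc k) (c * norm x) * cos (\<omega> \<bullet> x))"
proof -
  obtain A where A: "A > 0" "\<And>\<omega> :: (real, 'm) vec. \<omega> \<noteq> 0 \<Longrightarrow>
     (LINT x|lborel. wendland l (Suc k) (c * norm x) * cos (\<omega> \<bullet> x)) =
       A * askey (j + Suc k) (norm \<omega> / c) / norm \<omega> ^ (3 * l - 1)"
    using wendland_fourier[OF dim l c] by blast
  obtain a where a: "a > 0" "\<And>r. r \<ge> r0 / c \<Longrightarrow> a * r ^ Suc (j + k) \<le> askey (Suc (j + k)) r"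
    using askey_growth[of "r0 / c" "j + k"] r0 c by auto
  have "A * (a / c ^ Suc (j + k)) / norm \<omega> ^ (2 * l) \<le> (LINT x|lborel. wendland l (Suc k) (c * norm x) * cos (\<omega> \<bullet> x))"
    if \<omega>: "r0 \<le> norm \<omega>" for \<omega> :: "(real, 'm) vec"
  proof -
    define \<rho> where "\<rho> = norm \<omega>"
    have \<rho>: "\<rho> > 0" "\<rho> \<ge> r0" "\<omega> \<noteq> 0" using \<omega> r0 by (auto simp: \<rho>_def)
    have "3 * l - 1 = Suc (j + k) + 2 * l" using l by simp
    then have p: "\<rho> ^ (3 * l - 1) = \<rho> ^ Suc (j + k) * \<rho> ^ (2 * l)" by (simp only: power_add)
    have "A * (a / c ^ Suc (j + k)) / \<rho> ^ (2 * l) = A * (a * (\<rho> / c) ^ Suc (j + k)) / \<rho> ^ (3 * l - 1)"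
      unfolding p power_divide using \<rho> by simp
    also have "\<dots> \<le> A * askey (Suc (j + k)) (\<rho> / c) / \<rho> ^ (3 * l - 1)"
      using \<rho> c A(1) by (intro divide_right_mono mult_left_mono a) (auto simp: divide_right_mono)
    also have "\<dots> = (LINT x|lborel. wendland l (Suc k) (c * norm x) * cos (\<omega> \<bullet> x))"
      using A(2)[OF \<rho>(3)] by (simp add: \<rho>_def)
    finally show ?thesis by (simp add: \<rho>_def)
  qed
  moreover have "A * (a / c ^ Suc (j + k)) > 0" using A(1) a(1) c by simp
  ultimately show ?thesis by blast
qed

lemma wendland_integral_pos:
  assumes "l > 0" "c > 0"
  shows "0 < (LINT x|lborel. wendland l k (c * norm (x :: 'a::euclidean_space)))"
proof -
  define m where "m = wendland l k 0 / 2"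
  have m: "m > 0" using wendland_pos[OF assms(1), of 0 k] by (simp add: m_def)
  have "isCont (\<lambda>x :: 'a. wendland l k (c * norm x)) 0"
    using wendland_radial_continuous[OF assms, of "UNIV :: 'a set" k] by (simp add: continuous_on_eq_continuous_at)
  then obtain e where e: "e > 0" "\<And>x :: 'a. norm x < e \<Longrightarrow> \<bar>wendland l k (c * norm x) - wendland l k 0\<bar> < m"
    using m by (auto simp: continuous_at_eps_delta dist_norm dest!: spec[of _ m])
  have ge: "m * indicator (ball 0 e) x \<le> wendland l k (c * norm x)" for x :: 'a
    using e(2)[of x] wendland_nonneg[of l "c * norm x" k] assms
    by (auto simp: indicator_def m_def abs_if split: if_splits)
  have "0 < m * measure lborel (ball (0 :: 'a) e)"
    using m e(1) content_ball_pos by simp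
  also have "\<dots> = (LINT x|lborel. m * indicator (ball (0 :: 'a) e) x)" by simp
  also have "\<dots> \<le> (LINT x|lborel. wendland l k (c * norm (x :: 'a)))"
  proof (rule integral_mono)
    show "integrable lborel (\<lambda>x. m * indicator (ball (0 :: 'a) e) x :: real)"
      using emeasure_bounded_finite[of "ball (0::'a) e"] by (intro integrable_mult_right integrable_real_indicator) auto
    show "integrable lborel (\<lambda>x :: 'a. wendland l k (c * norm x))"
      using wendland_radial_integrable[OF assms, of "\<lambda>_. 1" k] by simp
  qed (rule ge)
  finally show ?thesis .
qed

section \<open>Domination of point evaluations by positive definite functions\<close>

text \<open>The support radius is kept explicit because it decides which period box contains a
  translate of the support.\<close>

definition ccs :: "real \<Rightarrow> ('a::euclidean_space \<Rightarrow> real) \<Rightarrow> bool" where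
  "ccs R v \<longleftrightarrow> continuous_on UNIV v \<and> (\<forall>x. R < norm x \<longrightarrow> v x = 0)"

lemma ccs_mult:
  "ccs R v \<Longrightarrow> continuous_on UNIV u \<Longrightarrow> ccs R (\<lambda>x. v x * u x)"
  by (auto simp: ccs_def intro: continuous_intros)

lemma ccs_translate:
  assumes "ccs R v"
  shows "ccs (R + norm a) (\<lambda>x. v (a + x))"
  unfolding ccs_def
proof (intro conjI allI impI)
  show "continuous_on UNIV (\<lambda>x. v (a + x))"
    using assms by (auto simp: ccs_def intro!: continuous_on_compose2[of UNIV v] continuous_intros)
  fix x :: 'a assume "R + norm a < norm x"
  moreover have "norm x \<le> norm (a + x) + norm a" using norm_triangle_ineq4[of "a + x" a] by simp
  ultimately show "v (a + x) = 0" using assms by (auto simp: ccs_def)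
qed

lemma ccs_integrable:
  assumes "ccs R v"
  shows "integrable lborel v"
proof -
  have "integrable lborel (\<lambda>x. indicator (cball 0 R) x *\<^sub>R v x)"
    using assms by (intro borel_integrable_compact) (auto simp: ccs_def intro: continuous_on_subset)
  moreover have "indicator (cball 0 R) x *\<^sub>R v x = v x" for x
    using assms by (auto simp: ccs_def indicator_def)
  ultimately show ?thesis by (simp only:)
qed

lemma ccs_bounded:
  assumes "ccs R v"
  shows "\<exists>B\<ge>0. \<forall>x. \<bar>v x\<bar> \<le> B"
proof -
  have "compact (v ` cball 0 R)"
    using assms by (intro compact_continuous_image) (auto simp: ccs_def intro: continuous_on_subset)
  then obtain B where B: "\<forall>y\<in>v ` cball 0 R. norm y \<le> B" using compact_imp_bounded bounded_iff by metis
  have "\<bar>v x\<bar> \<le> max B 0" for x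
    using assms B by (cases "norm x \<le> R") (auto simp: ccs_def intro: le_max_iff_disj[THEN iffD2])
  then show ?thesis by (intro exI[of _ "max B 0"]) auto
qed

lemma lborel_integral_translate:
  fixes v :: "'a::euclidean_space \<Rightarrow> real"
  assumes "v \<in> borel_measurable borel"
  shows "(LINT x|lborel. v (a + x)) = (LINT x|lborel. v x)"
proof -
  have "(LINT x|lborel. v x) = (LINT x|distr lborel borel ((+) a). v x)" by (simp add: lborel_distr_plus)
  also have "\<dots> = (LINT x|lborel. v (a + x))" using assms by (intro integral_distr) auto
  finally show ?thesis by simp
qed

lemma lborel_integral_reflect:
  fixes v :: "'a::euclidean_space \<Rightarrow> real"
  assumes "v \<in> borel_measurable borel"
  shows "(LINT x|lborel. v (- x)) = (LINT x|lborel. v x)"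
proof -
  have "(LINT x|lborel. v x) = (LINT x|distr lborel borel uminus. v x)"
    using lborel_affine[of "-1" "0 :: 'a"] by (simp add: density_1)
  also have "\<dots> = (LINT x|lborel. v (- x))" using assms by (intro integral_distr) auto
  finally show ?thesis by simp
qed

lemma ccs_measurable: "ccs R v \<Longrightarrow> v \<in> borel_measurable borel"
  by (auto simp: ccs_def intro: borel_measurable_continuous_onI)

text \<open>Averaging the fundamental theorem of calculus over translates avoids Fubini in coordinates.\<close>

lemma integral_directional_derivative_eq_0:
  fixes h h' :: "'a::euclidean_space \<Rightarrow> real"
  assumes h: "ccs R h" and h': "ccs R h'"
    and d: "\<And>x. ((\<lambda>t. h (x + t *\<^sub>R e)) has_real_derivative h' x) (at 0)"
  shows "(LINT x|lborel. h' x) = 0"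
proof -
  define G where "G = (\<lambda>(x :: 'a) (t :: real). indicator {0..1} t * h' (t *\<^sub>R e + x))"
  have h'c: "continuous_on UNIV h'" using h' by (simp add: ccs_def)
  have d': "((\<lambda>t. h (x + t *\<^sub>R e)) has_real_derivative h' (s *\<^sub>R e + x)) (at s)" for x s
  proof -
    have "((\<lambda>t. h ((x + s *\<^sub>R e) + t *\<^sub>R e)) has_real_derivative h' (s *\<^sub>R e + x)) (at (s + (- s)))"
      using d[of "x + s *\<^sub>R e"] by (simp add: add.commute)
    from this[unfolded DERIV_shift]
    show ?thesis by (simp add: algebra_simps)
  qed
  have int: "integrable (lborel \<Otimes>\<^sub>M lborel) (\<lambda>(x, t). G x t)"
  proof -
    have "integrable lborel (\<lambda>p. indicator (cball (0::'a) (R + norm e) \<times> {0..1::real}) p *\<^sub>R h' (snd p *\<^sub>R e + fst p))"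
      by (intro borel_integrable_compact compact_Times continuous_on_compose2[OF h'c] continuous_intros) auto
    moreover have "indicator (cball (0::'a) (R + norm e) \<times> {0..1::real}) p *\<^sub>R h' (snd p *\<^sub>R e + fst p) = (case p of (x, t) \<Rightarrow> G x t)" for p
    proof (cases p)
      case (Pair x t)
      have "h' (t *\<^sub>R e + x) = 0" if "t \<in> {0..1}" "R + norm e < norm x"
      proof -
        have "norm (t *\<^sub>R e) \<le> 1 * norm e" using that by (simp add: mult_left_le_one_le)
        moreover have "norm x \<le> norm (t *\<^sub>R e + x) + norm (t *\<^sub>R e)"
          using norm_triangle_ineq4[of "t *\<^sub>R e + x" "t *\<^sub>R e"] by simp
        ultimately show ?thesis using that h' by (auto simp: ccs_def)
      qed
      then show ?thesis by (auto simp: G_def Pair indicator_def not_le)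
    qed
    ultimately show ?thesis by (simp only: lborel_prod)
  qed
  have "(LINT t|lborel. G x t) = h (x + e) - h x" for x
  proof -
    have hi: "((\<lambda>t. h' (t *\<^sub>R e + x)) has_integral h (x + 1 *\<^sub>R e) - h (x + 0 *\<^sub>R e)) {0..1}"
      by (intro fundamental_theorem_of_calculus)
         (auto simp: has_real_derivative_iff_has_vector_derivative[symmetric] intro: DERIV_subset[OF d'])
    have "set_integrable lborel {0..1::real} (\<lambda>t. h' (t *\<^sub>R e + x))"
      unfolding set_integrable_def
      by (intro borel_integrable_compact continuous_on_compose2[OF h'c] continuous_intros) auto
    from set_borel_integral_eq_integral(2)[OF this] integral_unique[OF hi]
    show ?thesis by (simp add: G_def set_lebesgue_integral_def)
  qed
  then have "(LINT x|lborel. (LINT t|lborel. G x t)) = (LINT x|lborel. h (x + e) - h x)" by simp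
  also have "\<dots> = (LINT x|lborel. h (e + x)) - (LINT x|lborel. h x)"
    using ccs_integrable[OF ccs_translate[OF h], of e] ccs_integrable[OF h]
    by (simp add: add.commute[of _ e])
  also have "\<dots> = 0" using lborel_integral_translate[OF ccs_measurable[OF h]] by simp
  finally have "(LINT t|lborel. (LINT x|lborel. G x t)) = 0"
    using lborel_pair.Fubini_integral[OF int] by simp
  moreover have "(LINT x|lborel. G x t) = indicator {0..1} t * (LINT x|lborel. h' x)" for t
    unfolding G_def using lborel_integral_translate[OF ccs_measurable[OF h']] by simp
  ultimately show ?thesis by simp
qed

definition cosT :: "('a::euclidean_space \<Rightarrow> real) \<Rightarrow> 'a \<Rightarrow> real" where
  "cosT v \<kappa> = (LINT x|lborel. v x * cos (\<kappa> \<bullet> x))"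

definition sinT :: "('a::euclidean_space \<Rightarrow> real) \<Rightarrow> 'a \<Rightarrow> real" where
  "sinT v \<kappa> = (LINT x|lborel. v x * sin (\<kappa> \<bullet> x))"

lemma ccs_cos: "ccs R v \<Longrightarrow> ccs R (\<lambda>x. v x * cos (\<kappa> \<bullet> x))"
  and ccs_sin: "ccs R v \<Longrightarrow> ccs R (\<lambda>x. v x * sin (\<kappa> \<bullet> x))"
  by (intro ccs_mult continuous_intros; assumption)+

text \<open>Integration by parts: the derivative of \<open>v\<close> times a cosine or a sine has
  integral zero by \<open>integral_directional_derivative_eq_0\<close>, and the product rule splits
  it into the two transforms.\<close>

lemma transform_derivative:
  assumes v: "ccs R v" and v': "ccs R v'"
    and d: "\<And>x. ((\<lambda>t. v (x + t *\<^sub>R e)) has_real_derivative v' x) (at 0)"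
  shows "cosT v' \<kappa> = (\<kappa> \<bullet> e) * sinT v \<kappa>" and "sinT v' \<kappa> = - (\<kappa> \<bullet> e) * cosT v \<kappa>"
proof -
  note i = ccs_integrable[OF ccs_cos[OF v]] ccs_integrable[OF ccs_sin[OF v]]
    ccs_integrable[OF ccs_cos[OF v']] ccs_integrable[OF ccs_sin[OF v']]
  have v0: "v' x * u = v' x * u" for x u by simp
  have c: "ccs R (\<lambda>x. v' x * cos (\<kappa> \<bullet> x) - (\<kappa> \<bullet> e) * (v x * sin (\<kappa> \<bullet> x)))"
    "ccs R (\<lambda>x. v' x * sin (\<kappa> \<bullet> x) + (\<kappa> \<bullet> e) * (v x * cos (\<kappa> \<bullet> x)))"
    using v v' by (auto simp: ccs_def intro!: continuous_intros)
  have "(LINT x|lborel. v' x * cos (\<kappa> \<bullet> x) - (\<kappa> \<bullet> e) * (v x * sin (\<kappa> \<bullet> x))) = 0"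
    by (rule integral_directional_derivative_eq_0[OF ccs_cos[OF v, of \<kappa>] c(1)])
       (auto intro!: derivative_eq_intros d simp: inner_add_right)
  then show "cosT v' \<kappa> = (\<kappa> \<bullet> e) * sinT v \<kappa>"
    using i by (simp add: cosT_def sinT_def)
  have "(LINT x|lborel. v' x * sin (\<kappa> \<bullet> x) + (\<kappa> \<bullet> e) * (v x * cos (\<kappa> \<bullet> x))) = 0"
    by (rule integral_directional_derivative_eq_0[OF ccs_sin[OF v, of \<kappa>] c(2)])
       (auto intro!: derivative_eq_intros d simp: inner_add_right)
  then show "sinT v' \<kappa> = - (\<kappa> \<bullet> e) * cosT v \<kappa>"
    using i by (simp add: cosT_def sinT_def)
qed

text \<open>The squared modulus of the complex Fourier transform.\<close>

definition powT :: "('a::euclidean_space \<Rightarrow> real) \<Rightarrow> 'a \<Rightarrow> real" where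
  "powT v \<kappa> = (cosT v \<kappa>)\<^sup>2 + (sinT v \<kappa>)\<^sup>2"

lemma powT_nonneg: "0 \<le> powT v \<kappa>"
  by (simp add: powT_def)

lemma powT_iterated_derivative:
  assumes "\<And>r. r \<le> l \<Longrightarrow> ccs R (u r)"
    and "\<And>r x. r < l \<Longrightarrow> ((\<lambda>t. u r (x + t *\<^sub>R e)) has_real_derivative u (Suc r) x) (at 0)"
  shows "powT (u l) \<kappa> = (\<kappa> \<bullet> e) ^ (2 * l) * powT (u 0) \<kappa>"
  using assms
proof (induction l)
  case (Suc l)
  have "powT (u (Suc l)) \<kappa> = (\<kappa> \<bullet> e)\<^sup>2 * powT (u l) \<kappa>"
    using transform_derivative[of R "u l" "u (Suc l)" e \<kappa>] Suc.prems
    by (simp add: powT_def power_mult_distrib algebra_simps)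
  also have "powT (u l) \<kappa> = (\<kappa> \<bullet> e) ^ (2 * l) * powT (u 0) \<kappa>"
    using Suc by simp
  finally show ?case by (simp add: power2_eq_square)
qed simp

lemma translate_cos_integral:
  assumes v: "ccs R v"
  shows "(LINT z|lborel. v (x + z) * cos (\<kappa> \<bullet> z)) = cosT v \<kappa> * cos (\<kappa> \<bullet> x) + sinT v \<kappa> * sin (\<kappa> \<bullet> x)"
proof -
  have "ccs R (\<lambda>y. v y * cos (\<kappa> \<bullet> (y - x)))" by (intro ccs_mult v continuous_intros)
  from lborel_integral_translate[OF ccs_measurable[OF this], of x]
  have "(LINT z|lborel. v (x + z) * cos (\<kappa> \<bullet> z)) = (LINT y|lborel. v y * cos (\<kappa> \<bullet> (y - x)))" by simp
  also have "\<dots> = (LINT y|lborel. v y * cos (\<kappa> \<bullet> y) * cos (\<kappa> \<bullet> x) + v y * sin (\<kappa> \<bullet> y) * sin (\<kappa> \<bullet> x))"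
    by (simp add: inner_diff_right cos_diff algebra_simps)
  also have "\<dots> = cosT v \<kappa> * cos (\<kappa> \<bullet> x) + sinT v \<kappa> * sin (\<kappa> \<bullet> x)"
    unfolding cosT_def sinT_def
    using ccs_integrable[OF ccs_cos[OF v, of \<kappa>]] ccs_integrable[OF ccs_sin[OF v, of \<kappa>]] by simp
  finally show ?thesis .
qed

section \<open>Trigonometric polynomials and the de la Vallee-Poussin kernel\<close>

text \<open>Nonnegativity of the coefficients is the point: they become weights in a Cauchy-Schwarz
  inequality. Products of cosines keep it, provided \<open>\<Lambda>\<close> is closed under sums
  and differences.\<close>

inductive cospoly :: "'a::euclidean_space set \<Rightarrow> ('a \<Rightarrow> real) \<Rightarrow> bool" for \<Lambda> where
  cos: "\<kappa> \<in> \<Lambda> \<Longrightarrow> 0 \<le> b \<Longrightarrow> cospoly \<Lambda> (\<lambda>z. b * cos (\<kappa> \<bullet> z))"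
| add: "cospoly \<Lambda> f \<Longrightarrow> cospoly \<Lambda> g \<Longrightarrow> cospoly \<Lambda> (\<lambda>z. f z + g z)"

lemma cospoly_mult:
  assumes \<Lambda>: "\<And>\<kappa> \<kappa>'. \<kappa> \<in> \<Lambda> \<Longrightarrow> \<kappa>' \<in> \<Lambda> \<Longrightarrow> \<kappa> + \<kappa>' \<in> \<Lambda> \<and> \<kappa> - \<kappa>' \<in> \<Lambda>"
    and f: "cospoly \<Lambda> f" and g: "cospoly \<Lambda> g"
  shows "cospoly \<Lambda> (\<lambda>z. f z * g z)"
  using f
proof induction
  case (cos \<kappa> b)
  show ?case
    using g
  proof induction
    case (cos \<kappa>' b')
    have eq: "b * cos (\<kappa> \<bullet> z) * (b' * cos (\<kappa>' \<bullet> z)) = (b * b' / 2) * cos ((\<kappa> - \<kappa>') \<bullet> z) + (b * b' / 2) * cos ((\<kappa> + \<kappa>') \<bullet> z)" for z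
    proof -
      have "cos (\<kappa> \<bullet> z) * cos (\<kappa>' \<bullet> z) = (cos ((\<kappa> - \<kappa>') \<bullet> z) + cos ((\<kappa> + \<kappa>') \<bullet> z)) / 2"
        using cos_times_cos[of "\<kappa> \<bullet> z" "\<kappa>' \<bullet> z"] by (simp add: inner_add_left inner_diff_left)
      moreover have "b * cos (\<kappa> \<bullet> z) * (b' * cos (\<kappa>' \<bullet> z)) = (b * b') * (cos (\<kappa> \<bullet> z) * cos (\<kappa>' \<bullet> z))"
        by simp
      ultimately show ?thesis by (simp only:) (simp add: distrib_left)
    qed
    show ?case unfolding eq
      using cos \<open>\<kappa> \<in> \<Lambda>\<close> \<open>0 \<le> b\<close> \<Lambda> by (intro cospoly.intros) auto
  next
    case (add f g)
    then show ?case by (simp add: distrib_left cospoly.add)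
  qed
next
  case (add f g)
  then show ?case by (simp add: distrib_right cospoly.add)
qed

lemma cospoly_repr:
  assumes "cospoly \<Lambda> f"
  shows "\<exists>xs. (\<forall>(b, \<kappa>)\<in>set xs. 0 \<le> b \<and> \<kappa> \<in> \<Lambda>) \<and> (\<forall>z. f z = (\<Sum>(b, \<kappa>)\<leftarrow>xs. b * cos (\<kappa> \<bullet> z)))"
  using assms
proof induction
  case (cos \<kappa> b)
  then show ?case by (intro exI[of _ "[(b, \<kappa>)]"]) auto
next
  case (add f g)
  then obtain xs ys where "\<forall>(b, \<kappa>)\<in>set xs. 0 \<le> b \<and> \<kappa> \<in> \<Lambda>" "\<forall>z. f z = (\<Sum>(b, \<kappa>)\<leftarrow>xs. b * cos (\<kappa> \<bullet> z))"
     "\<forall>(b, \<kappa>)\<in>set ys. 0 \<le> b \<and> \<kappa> \<in> \<Lambda>" "\<forall>z. g z = (\<Sum>(b, \<kappa>)\<leftarrow>ys. b * cos (\<kappa> \<bullet> z))"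
    by blast
  then show ?case by (intro exI[of _ "xs @ ys"]) auto
qed

lemma cospoly_repr_sum:
  assumes "cospoly \<Lambda> f"
  obtains n :: nat and b \<kappa> where "\<And>i. i < n \<Longrightarrow> 0 \<le> b i" "\<And>i. i < n \<Longrightarrow> \<kappa> i \<in> \<Lambda>"
    "\<And>z. f z = (\<Sum>i<n. b i * cos (\<kappa> i \<bullet> z))"
proof -
  obtain xs where xs: "\<forall>(b, \<kappa>)\<in>set xs. 0 \<le> b \<and> \<kappa> \<in> \<Lambda>" "\<forall>z. f z = (\<Sum>(b, \<kappa>)\<leftarrow>xs. b * cos (\<kappa> \<bullet> z))"
    using cospoly_repr[OF assms] by blast
  show thesis
  proof (rule that[of "length xs" "\<lambda>i. fst (xs ! i)" "\<lambda>i. snd (xs ! i)"])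
    show "0 \<le> fst (xs ! i)" "snd (xs ! i) \<in> \<Lambda>" if "i < length xs" for i
      using xs(1) that by (auto simp: case_prod_beta' dest!: bspec[of _ _ "xs ! i"])
    show "f z = (\<Sum>i<length xs. fst (xs ! i) * cos (snd (xs ! i) \<bullet> z))" for z
      using xs(2) by (simp add: sum_list_sum_nth case_prod_beta' atLeast0LessThan)
  qed
qed

text \<open>The frequencies of functions with period \<open>2 * T\<close> in every coordinate. Its
  nonzero elements have norm at least \<open>pi / T\<close>, so a lower bound for the transform away
  from 0 covers all of them.\<close>

definition lattice :: "real \<Rightarrow> 'a::euclidean_space set" where
  "lattice T = {\<kappa>. \<forall>b\<in>Basis. \<exists>m::int. \<kappa> \<bullet> b = of_int m * pi / T}"

lemma lattice_0: "0 \<in> lattice T"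
  by (auto simp: lattice_def intro: exI[of _ 0])

lemma lattice_add_diff:
  "\<kappa> \<in> lattice T \<Longrightarrow> \<kappa>' \<in> lattice T \<Longrightarrow> \<kappa> + \<kappa>' \<in> lattice T \<and> \<kappa> - \<kappa>' \<in> lattice T"
  unfolding lattice_def
proof (intro conjI CollectI ballI)
  fix b :: 'a assume "\<kappa> \<in> {\<kappa>. \<forall>b\<in>Basis. \<exists>m::int. \<kappa> \<bullet> b = of_int m * pi / T}"
    "\<kappa>' \<in> {\<kappa>. \<forall>b\<in>Basis. \<exists>m::int. \<kappa> \<bullet> b = of_int m * pi / T}" "b \<in> Basis"
  then obtain m m' :: int where m: "\<kappa> \<bullet> b = of_int m * pi / T" "\<kappa>' \<bullet> b = of_int m' * pi / T" by blast
  show "\<exists>m::int. (\<kappa> + \<kappa>') \<bullet> b = of_int m * pi / T"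
    by (intro exI[of _ "m + m'"]) (simp add: m inner_add_left add_divide_distrib distrib_right)
  show "\<exists>m::int. (\<kappa> - \<kappa>') \<bullet> b = of_int m * pi / T"
    by (intro exI[of _ "m - m'"]) (simp add: m inner_diff_left diff_divide_distrib left_diff_distrib)
qed

lemma lattice_norm_ge:
  assumes "\<kappa> \<in> lattice T" "\<kappa> \<noteq> 0" "T > 0"
  shows "pi / T \<le> norm \<kappa>"
proof -
  obtain b where b: "b \<in> Basis" "\<kappa> \<bullet> b \<noteq> 0" using assms(2) euclidean_all_zero_iff by blast
  then obtain m :: int where m: "\<kappa> \<bullet> b = of_int m * pi / T" using assms(1) by (auto simp: lattice_def)
  then have "m \<noteq> 0" using b by auto
  then have "1 \<le> \<bar>real_of_int m\<bar>" by linarith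
  then have "1 * (pi / T) \<le> \<bar>real_of_int m\<bar> * (pi / T)" using assms by (intro mult_right_mono) auto
  also have "\<dots> = \<bar>\<kappa> \<bullet> b\<bar>" using assms(3) by (simp add: m abs_mult)
  also have "\<dots> \<le> norm \<kappa>" using b(1) by (rule Basis_le_norm)
  finally show ?thesis by simp
qed

text \<open>Since \<open>(1 + cos t) / 2\<close> is the square of \<open>cos (t / 2)\<close>, the
  powers of this product are, up to normalisation, de la Vallee-Poussin kernels: trigonometric
  polynomials with nonnegative coefficients that concentrate at 0 within one period box.\<close>

definition bump :: "real \<Rightarrow> 'a::euclidean_space \<Rightarrow> real" where
  "bump T z = (\<Prod>b\<in>Basis. (1 + cos (pi / T * (z \<bullet> b))) / 2)"

lemma cospoly_bump: "cospoly (lattice T) (bump T :: 'a::euclidean_space \<Rightarrow> real)"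
proof -
  have "cospoly (lattice T) (\<lambda>z :: 'a. \<Prod>b\<in>A. (1 + cos (pi / T * (z \<bullet> b))) / 2)" if "finite A" "A \<subseteq> Basis" for A
    using that
  proof (induction A)
    case empty
    show ?case using cospoly.cos[OF lattice_0, of 1] by simp
  next
    case (insert b A)
    have "(pi / T) *\<^sub>R b \<in> lattice T"
      unfolding lattice_def
    proof (intro CollectI ballI)
      fix b' :: 'a assume b': "b' \<in> Basis"
      show "\<exists>m::int. ((pi / T) *\<^sub>R b) \<bullet> b' = of_int m * pi / T"
        by (rule exI[of _ "if b = b' then 1 else 0"]) (use b' insert in \<open>auto simp: inner_Basis\<close>)
    qed
    then have "cospoly (lattice T) (\<lambda>z. 1 / 2 * cos (0 \<bullet> z) + 1 / 2 * cos (((pi / T) *\<^sub>R b) \<bullet> z))"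
      by (intro cospoly.intros lattice_0) auto
    then have "cospoly (lattice T) (\<lambda>z. (1 + cos (pi / T * (z \<bullet> b))) / 2)"
      by (simp add: inner_commute add_divide_distrib)
    from cospoly_mult[OF lattice_add_diff this, of "\<lambda>z. \<Prod>b\<in>A. (1 + cos (pi / T * (z \<bullet> b))) / 2"] insert
    show ?case by simp
  qed
  from this[of Basis] show ?thesis by (simp add: bump_def[abs_def])
qed

lemma cospoly_bump_power: "cospoly (lattice T) (\<lambda>z :: 'a::euclidean_space. bump T z ^ p)"
proof (induction p)
  case 0
  show ?case using cospoly.cos[OF lattice_0, of 1] by simp
next
  case (Suc p)
  from cospoly_mult[OF lattice_add_diff cospoly_bump this] show ?case by simp
qed

lemma bump_continuous: "continuous_on A (bump T)"
  unfolding bump_def[abs_def] by (intro continuous_intros) auto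

lemma bump_factor: "0 \<le> (1 + cos t) / 2" "(1 + cos t) / 2 \<le> (1::real)"
  using cos_ge_minus_one[of t] cos_le_one[of t] by (simp_all add: pos_le_divide_eq pos_divide_le_eq del: cos_ge_minus_one cos_le_one)

lemma bump_nonneg: "0 \<le> bump T z" and bump_le_1: "bump T z \<le> 1"
  unfolding bump_def by (auto intro!: prod_nonneg prod_le_1 bump_factor)

lemma bump_0: "bump T 0 = 1"
  by (simp add: bump_def)

definition tbox :: "real \<Rightarrow> 'a::euclidean_space set" where
  "tbox T = cbox (- (T *\<^sub>R One)) (T *\<^sub>R One)"

lemma mem_tbox: "z \<in> tbox T \<longleftrightarrow> (\<forall>b\<in>Basis. \<bar>z \<bullet> b\<bar> \<le> T)"
  by (auto simp: tbox_def mem_box abs_le_iff)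

lemma compact_tbox: "compact (tbox T)"
  by (simp add: tbox_def)

lemma not_tbox_norm: "z \<notin> tbox T \<Longrightarrow> T < norm z"
  unfolding mem_tbox by (auto simp: not_le intro: less_le_trans[OF _ Basis_le_norm])

lemma norm_le_tbox: "norm z \<le> T \<Longrightarrow> z \<in> tbox T"
  using not_tbox_norm by fastforce

lemma bump_less_1:
  assumes "z \<in> tbox T" "z \<noteq> 0" "T > 0"
  shows "bump T z < 1"
proof -
  obtain b where b: "b \<in> Basis" "z \<bullet> b \<noteq> 0" using assms(2) euclidean_all_zero_iff by blast
  define y where "y = pi / T * \<bar>z \<bullet> b\<bar>"
  have "\<bar>z \<bullet> b\<bar> \<le> T" using assms(1) b by (simp add: mem_tbox)
  then have "y \<le> pi / T * T" unfolding y_def using assms(3) by (intro mult_left_mono) auto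
  moreover have "0 < y" using b assms(3) by (simp add: y_def)
  ultimately have "cos y < cos 0" using assms(3) by (intro cos_monotone_0_pi) auto
  moreover have "cos y = cos (pi / T * (z \<bullet> b))"
  proof -
    have "y = \<bar>pi / T * (z \<bullet> b)\<bar>" using assms(3) by (simp add: y_def abs_mult)
    then show ?thesis by (simp only: cos_abs_real)
  qed
  ultimately have "(1 + cos (pi / T * (z \<bullet> b))) / 2 < 1" by simp
  moreover have "bump T z \<le> (1 + cos (pi / T * (z \<bullet> b))) / 2 * 1"
    unfolding bump_def prod.remove[OF finite_Basis b(1)]
    by (intro mult_left_mono bump_factor prod_le_1 conjI)
  ultimately show ?thesis by simp
qed

definition bump_mass :: "'a::euclidean_space itself \<Rightarrow> real \<Rightarrow> nat \<Rightarrow> real" where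
  "bump_mass _ T p = (LINT z|lborel. indicator (tbox T :: 'a set) z * bump T z ^ p)"

lemma tbox_integrable:
  fixes h :: "'a::euclidean_space \<Rightarrow> real"
  assumes "continuous_on (tbox T) h"
  shows "integrable lborel (\<lambda>z. indicator (tbox T) z * h z)"
  using borel_integrable_compact[OF compact_tbox assms] by simp

text \<open>On a small ball around 0 the bump is at least \<open>q\<close>, and \<open>\<mu>\<close>
  is the measure of that ball. For \<open>q\<close> close to 1 this lower bound beats the decay of
  the powers away from 0.\<close>

lemma bump_mass_ge:
  assumes "T > 0" "0 \<le> q" "q < 1"
  shows "\<exists>\<mu>>0. \<forall>p. \<mu> * q ^ p \<le> bump_mass TYPE('a::euclidean_space) T p"
proof -
  have "isCont (bump T) (0 :: 'a)"
    using bump_continuous[of "UNIV :: 'a set" T] by (simp add: continuous_on_eq_continuous_at)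
  then obtain e where e: "e > 0" "\<And>z :: 'a. norm z < e \<Longrightarrow> \<bar>bump T z - 1\<bar> < 1 - q"
    using assms(3) unfolding continuous_at_eps_delta
    by (auto simp: dist_norm bump_0 dest!: spec[of _ "1 - q"])
  define A where "A = ball (0 :: 'a) (min e T)"
  define \<mu> where "\<mu> = measure lborel A"
  have "\<mu> > 0" using e(1) assms(1) content_ball_pos[of "min e T" "0 :: 'a"] by (simp add: \<mu>_def A_def)
  moreover have "\<mu> * q ^ p \<le> bump_mass TYPE('a) T p" for p
  proof -
    have "\<mu> * q ^ p = (LINT z|lborel. indicator A z * q ^ p)" by (simp add: \<mu>_def)
    also have "\<dots> \<le> (LINT z|lborel. indicator (tbox T :: 'a set) z * bump T z ^ p)"
    proof (rule integral_mono)
      show "integrable lborel (\<lambda>z. indicator A z * q ^ p)"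
        unfolding A_def using emeasure_bounded_finite[of "ball (0::'a) (min e T)"]
        by (intro integrable_mult_left integrable_real_indicator) auto
      show "integrable lborel (\<lambda>z. indicator (tbox T :: 'a set) z * bump T z ^ p)"
        by (intro tbox_integrable continuous_intros bump_continuous)
      fix z :: 'a
      show "indicator A z * q ^ p \<le> indicator (tbox T) z * bump T z ^ p"
      proof (cases "z \<in> A")
        case True
        then have "norm z < e" "norm z \<le> T" by (auto simp: A_def)
        then have "q \<le> bump T z" "z \<in> tbox T" using e(2)[of z] norm_le_tbox[of z T] by auto
        then show ?thesis using True assms by (auto intro!: power_mono)
      qed (simp add: bump_nonneg)
    qed
    finally show ?thesis by (simp add: bump_mass_def)
  qed
  ultimately show ?thesis by blast
qed

lemma bump_mass_pos: "T > 0 \<Longrightarrow> 0 < bump_mass TYPE('a::euclidean_space) T p"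
proof -
  assume "T > 0"
  then obtain \<mu> where \<mu>: "\<mu> > 0" "\<And>p. \<mu> * (1 / 2) ^ p \<le> bump_mass TYPE('a) T p"
    using bump_mass_ge[of T "1 / 2", where 'a='a] by auto
  have "0 < \<mu> * (1 / 2) ^ p" using \<mu>(1) by simp
  then show ?thesis using \<mu>(2)[of p] by linarith
qed

text \<open>Outside a ball the bump is at most some \<open>q < 1\<close> by compactness, while its
  mass is at least a multiple of \<open>q' ^ p\<close> for a \<open>q'\<close> strictly between
  \<open>q\<close> and 1. After division by the mass the outer part is therefore negligible.\<close>

lemma bump_approximate_identity:
  fixes h :: "'a::euclidean_space \<Rightarrow> real"
  assumes T: "T > 0" and h: "continuous_on (tbox T) h"
  shows "(\<lambda>p. (LINT z|lborel. indicator (tbox T) z * (h z * bump T z ^ p)) / bump_mass TYPE('a) T p) \<longlonglongrightarrow> h 0"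
proof (rule LIMSEQ_I)
  fix \<epsilon> :: real assume \<epsilon>: "\<epsilon> > 0"
  have z0: "(0 :: 'a) \<in> tbox T" using T by (simp add: mem_tbox)
  obtain \<delta> where \<delta>: "\<delta> > 0" "\<And>z. z \<in> tbox T \<Longrightarrow> norm z < \<delta> \<Longrightarrow> \<bar>h z - h 0\<bar> < \<epsilon> / 2"
    using h z0 \<epsilon> unfolding continuous_on_iff dist_norm by (metis diff_zero half_gt_zero real_norm_def)
  have "compact (h ` tbox T)" using h by (intro compact_continuous_image compact_tbox) auto
  then obtain B0 where B0: "\<forall>y\<in>h ` tbox T. norm y \<le> B0" using compact_imp_bounded bounded_iff by metis
  define B where "B = 2 * B0"
  have B: "\<bar>h z - h 0\<bar> \<le> B" if "z \<in> tbox T" for z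
  proof -
    have "\<bar>h z\<bar> \<le> B0" "\<bar>h 0\<bar> \<le> B0" using B0 that z0 by auto
    then show ?thesis by (simp add: B_def abs_le_iff)
  qed
  have "\<exists>q. 0 \<le> q \<and> q < 1 \<and> (\<forall>z\<in>tbox T - ball (0 :: 'a) \<delta>. bump T z \<le> q)"
  proof (cases "tbox T - ball (0 :: 'a) \<delta> = {}")
    case False
    have "compact (tbox T - ball (0 :: 'a) \<delta>)" by (intro compact_diff compact_tbox) auto
    from continuous_attains_sup[OF this False bump_continuous[of _ T]]
    obtain y where y: "y \<in> tbox T - ball (0 :: 'a) \<delta>" "\<forall>z\<in>tbox T - ball (0 :: 'a) \<delta>. bump T z \<le> bump T y"
      by (elim bexE) (rule that)
    then have "y \<noteq> 0" using \<delta>(1) by auto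
    then have "bump T y < 1" using y T by (intro bump_less_1) auto
    then show ?thesis using y(2) bump_nonneg by blast
  qed (intro exI[of _ 0], auto)
  then obtain q where q01: "0 \<le> q" "q < 1" and q2: "\<forall>z\<in>tbox T - ball (0 :: 'a) \<delta>. bump T z \<le> q" by blast
  have q3: "bump T z \<le> q" if "z \<in> tbox T" "\<delta> \<le> norm z" for z :: 'a
    using bspec[OF q2, of z] that by simp
  note q = q01 q3
  define q' where "q' = (1 + q) / 2"
  have q': "0 < q'" "q' < 1" "q < q'" using q by (auto simp: q'_def)
  obtain \<mu> where \<mu>: "\<mu> > 0" "\<And>p. \<mu> * q' ^ p \<le> bump_mass TYPE('a) T p"
    using bump_mass_ge[OF T, of q'] q' by (metis less_imp_le)
  define V where "V = measure lborel (tbox T :: 'a set)"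
  have "(\<lambda>p. B * V / \<mu> * (q / q') ^ p) \<longlonglongrightarrow> B * V / \<mu> * 0"
    using q q' by (intro tendsto_mult_left LIMSEQ_realpow_zero) auto
  then have "\<forall>\<^sub>F p in sequentially. B * V / \<mu> * (q / q') ^ p < \<epsilon> / 2"
    using \<epsilon> by (intro order_tendstoD(2)[where y=0]) auto
  then obtain P where P: "\<And>p. p \<ge> P \<Longrightarrow> B * V / \<mu> * (q / q') ^ p < \<epsilon> / 2"
    by (auto simp: eventually_sequentially)
  show "\<exists>P. \<forall>p\<ge>P. norm ((LINT z|lborel. indicator (tbox T) z * (h z * bump T z ^ p)) / bump_mass TYPE('a) T p - h 0) < \<epsilon>"
  proof (intro exI[of _ P] allI impI)
    fix p assume p: "p \<ge> P"
    let ?m = "bump_mass TYPE('a) T p"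
    have m: "?m > 0" by (rule bump_mass_pos[OF T])
    have i1: "integrable lborel (\<lambda>z. indicator (tbox T) z * (h z * bump T z ^ p))"
      and i2: "integrable lborel (\<lambda>z :: 'a. indicator (tbox T) z * bump T z ^ p)"
      and i3: "integrable lborel (\<lambda>z. indicator (tbox T) z * ((h z - h 0) * bump T z ^ p))"
      by (intro tbox_integrable continuous_intros h bump_continuous)+
    have i4: "integrable lborel (\<lambda>z :: 'a. indicator (tbox T) z * (B * q ^ p))"
      by (intro tbox_integrable continuous_intros)
    have "\<bar>(LINT z|lborel. indicator (tbox T) z * (h z * bump T z ^ p)) - h 0 * ?m\<bar>
       = \<bar>LINT z|lborel. indicator (tbox T) z * (h z * bump T z ^ p) - h 0 * (indicator (tbox T) z * bump T z ^ p)\<bar>"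
      using i1 i2 by (simp add: bump_mass_def)
    also have "\<dots> = \<bar>LINT z|lborel. indicator (tbox T) z * ((h z - h 0) * bump T z ^ p)\<bar>"
      by (intro arg_cong[where f=abs] Bochner_Integration.integral_cong refl) (simp add: algebra_simps)
    also have "\<dots> \<le> (LINT z|lborel. \<bar>indicator (tbox T) z * ((h z - h 0) * bump T z ^ p)\<bar>)"
      by (rule integral_abs_bound)
    also have "\<dots> \<le> (LINT z|lborel. \<epsilon> / 2 * (indicator (tbox T :: 'a set) z * bump T z ^ p) + indicator (tbox T) z * (B * q ^ p))"
    proof (rule integral_mono)
      show "integrable lborel (\<lambda>z. \<bar>indicator (tbox T) z * ((h z - h 0) * bump T z ^ p)\<bar>)"
        using i3 by (rule integrable_abs)
      show "integrable lborel (\<lambda>z :: 'a. \<epsilon> / 2 * (indicator (tbox T) z * bump T z ^ p) + indicator (tbox T) z * (B * q ^ p))"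
        using i2 i4 by simp
      fix z :: 'a
      show "\<bar>indicator (tbox T) z * ((h z - h 0) * bump T z ^ p)\<bar> \<le> \<epsilon> / 2 * (indicator (tbox T) z * bump T z ^ p) + indicator (tbox T) z * (B * q ^ p)"
      proof (cases "z \<in> tbox T")
        case True
        have B0': "0 \<le> B" using B[OF True] by linarith
        show ?thesis
        proof (cases "norm z < \<delta>")
          case True': True
          have "\<bar>h z - h 0\<bar> * bump T z ^ p \<le> \<epsilon> / 2 * bump T z ^ p"
            using \<delta>(2)[OF True True'] by (intro mult_right_mono) (auto simp: bump_nonneg)
          moreover have "0 \<le> B * q ^ p" using B0' q by simp
          ultimately show ?thesis using True by (simp add: abs_mult bump_nonneg)
        next
          case False
          have "\<bar>h z - h 0\<bar> * bump T z ^ p \<le> B * q ^ p"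
            using B[OF True] q(3)[OF True] False B0' by (intro mult_mono power_mono) (auto simp: bump_nonneg)
          moreover have "0 \<le> \<epsilon> / 2 * bump T z ^ p" using \<epsilon> by (simp add: bump_nonneg)
          ultimately show ?thesis using True by (simp add: abs_mult bump_nonneg)
        qed
      qed simp
    qed
    also have "\<dots> = \<epsilon> / 2 * ?m + B * q ^ p * V"
      using i2 i4 by (simp add: bump_mass_def V_def)
    finally have "\<bar>(LINT z|lborel. indicator (tbox T) z * (h z * bump T z ^ p)) - h 0 * ?m\<bar> \<le> \<epsilon> / 2 * ?m + B * q ^ p * V" .
    moreover have "B * q ^ p * V \<le> (B * V / \<mu> * (q / q') ^ p) * ?m"
    proof -
      have BV: "0 \<le> B * V" using B[OF z0] by (simp add: V_def)
      have "B * q ^ p * V = (B * V / \<mu> * (q / q') ^ p) * (\<mu> * q' ^ p)"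
        using \<mu>(1) q' by (simp add: power_divide)
      also have "\<dots> \<le> (B * V / \<mu> * (q / q') ^ p) * ?m"
      proof (rule mult_left_mono[OF \<mu>(2)])
        have "0 \<le> B * V / \<mu>" using BV \<mu>(1) by simp
        moreover have "0 \<le> (q / q') ^ p" using q(1) q'(1) by simp
        ultimately show "0 \<le> B * V / \<mu> * (q / q') ^ p" by (rule mult_nonneg_nonneg)
      qed
      finally show ?thesis .
    qed
    moreover have "(B * V / \<mu> * (q / q') ^ p) * ?m < \<epsilon> / 2 * ?m"
      using P[OF p] m by (intro mult_strict_right_mono)
    ultimately have "\<bar>(LINT z|lborel. indicator (tbox T) z * (h z * bump T z ^ p)) - h 0 * ?m\<bar> < \<epsilon> * ?m"
      by linarith
    moreover have "(LINT z|lborel. indicator (tbox T) z * (h z * bump T z ^ p)) / ?m - h 0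
       = ((LINT z|lborel. indicator (tbox T) z * (h z * bump T z ^ p)) - h 0 * ?m) / ?m"
      using m by (simp add: field_simps)
    ultimately show "norm ((LINT z|lborel. indicator (tbox T) z * (h z * bump T z ^ p)) / ?m - h 0) < \<epsilon>"
      using m by (simp add: abs_divide pos_divide_less_eq)
  qed
qed

lemma tbox_support_integral:
  fixes v :: "'a::euclidean_space \<Rightarrow> real"
  assumes "ccs R v" "norm x + R \<le> T"
  shows "indicator (tbox T) z * (v (x + z) * w) = v (x + z) * w"
proof (cases "z \<in> tbox T")
  case False
  then have "T < norm z" by (rule not_tbox_norm)
  moreover have "norm z \<le> norm (x + z) + norm x" using norm_triangle_ineq4[of "x + z" x] by simp
  ultimately have "v (x + z) = 0" using assms by (auto simp: ccs_def)
  then show ?thesis by simp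
qed simp

section \<open>Smoothing by trigonometric polynomials\<close>

text \<open>The integral runs over the whole space although the bump is periodic: a \<open>v\<close>
  supported in the ball of radius \<open>R\<close> selects a single period box as long as
  \<open>norm x + R \<le> T\<close>.\<close>

definition smoothed :: "real \<Rightarrow> nat \<Rightarrow> ('a::euclidean_space \<Rightarrow> real) \<Rightarrow> 'a \<Rightarrow> real" where
  "smoothed T p v x = (LINT z|lborel. v (x + z) * bump T z ^ p)"

lemma smoothed_limit:
  fixes v :: "'a::euclidean_space \<Rightarrow> real"
  assumes v: "ccs R v" and T: "norm x + R \<le> T" "T > 0"
  shows "(\<lambda>p. smoothed T p v x / bump_mass TYPE('a) T p) \<longlonglongrightarrow> v x"
proof -
  have "continuous_on (tbox T) (\<lambda>z. v (x + z))"
    using v by (auto simp: ccs_def intro!: continuous_on_compose2[of UNIV v] continuous_intros)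
  from bump_approximate_identity[OF T(2) this]
  show ?thesis by (simp add: smoothed_def tbox_support_integral[OF v T(1)])
qed

lemma smoothed_bound:
  fixes v :: "'a::euclidean_space \<Rightarrow> real"
  assumes v: "ccs R v" and T: "norm x + R \<le> T" "T > 0" and B: "\<And>y. \<bar>v y\<bar> \<le> B"
  shows "\<bar>smoothed T p v x\<bar> \<le> B * bump_mass TYPE('a) T p"
proof -
  have c: "continuous_on (tbox T) (\<lambda>z. v (x + z))"
    using v by (auto simp: ccs_def intro!: continuous_on_compose2[of UNIV v] continuous_intros)
  have "smoothed T p v x = (LINT z|lborel. indicator (tbox T) z * (v (x + z) * bump T z ^ p))"
    by (simp add: smoothed_def tbox_support_integral[OF v T(1)])
  also have "\<bar>\<dots>\<bar> \<le> (LINT z|lborel. \<bar>indicator (tbox T) z * (v (x + z) * bump T z ^ p)\<bar>)"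
    by (rule integral_abs_bound)
  also have "\<dots> \<le> (LINT z|lborel. B * (indicator (tbox T :: 'a set) z * bump T z ^ p))"
  proof (rule integral_mono)
    show "integrable lborel (\<lambda>z. \<bar>indicator (tbox T) z * (v (x + z) * bump T z ^ p)\<bar>)"
      by (intro integrable_abs tbox_integrable continuous_intros c bump_continuous)
    show "integrable lborel (\<lambda>z. B * (indicator (tbox T :: 'a set) z * bump T z ^ p))"
      by (intro integrable_mult_right tbox_integrable continuous_intros bump_continuous)
    show "\<bar>indicator (tbox T) z * (v (x + z) * bump T z ^ p)\<bar> \<le> B * (indicator (tbox T) z * bump T z ^ p)" for z
      using B[of "x + z"] by (auto simp: indicator_def abs_mult bump_nonneg intro!: mult_right_mono)
  qed
  finally show ?thesis by (simp add: bump_mass_def)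
qed

text \<open>This takes the place of Fourier inversion: smoothing by a trigonometric polynomial
  involves only finitely many values of the transforms of \<open>v\<close>.\<close>

lemma smoothed_expand:
  fixes v :: "'a::euclidean_space \<Rightarrow> real"
  assumes v: "ccs R v" and rep: "\<And>z. bump T z ^ p = (\<Sum>i<n. b i * cos (\<kappa> i \<bullet> z))"
  shows "smoothed T p v x = (\<Sum>i<n. b i * (cosT v (\<kappa> i) * cos (\<kappa> i \<bullet> x) + sinT v (\<kappa> i) * sin (\<kappa> i \<bullet> x)))"
proof -
  have int: "integrable lborel (\<lambda>z. v (x + z) * cos (\<kappa> i \<bullet> z))" for i
    by (rule ccs_integrable[OF ccs_cos[OF ccs_translate[OF v]]])
  have "smoothed T p v x = (LINT z|lborel. (\<Sum>i<n. b i * (v (x + z) * cos (\<kappa> i \<bullet> z))))"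
    unfolding smoothed_def rep sum_distrib_left by (simp only: mult_ac)
  also have "\<dots> = (\<Sum>i<n. b i * (LINT z|lborel. v (x + z) * cos (\<kappa> i \<bullet> z)))"
    using int by simp
  finally show ?thesis by (simp only: translate_cos_integral[OF v])
qed

text \<open>A Parseval-type bound: the weighted sum of \<open>powT\<close> equals the integral of
  \<open>v\<close> times its smoothing. The constant \<open>E\<close> serves all powers
  \<open>p\<close> and all representations of the bump.\<close>

lemma smoothed_energy:
  fixes v :: "'a::euclidean_space \<Rightarrow> real"
  assumes v: "ccs R v" and T: "2 * R \<le> T" "T > 0"
  shows "\<exists>E\<ge>0. \<forall>p (n :: nat) b \<kappa>. (\<forall>z. bump T z ^ p = (\<Sum>i<n. b i * cos (\<kappa> i \<bullet> z))) \<longrightarrow>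
     (\<Sum>i<n. b i * powT v (\<kappa> i)) \<le> E * bump_mass TYPE('a) T p"
proof -
  obtain B where B: "B \<ge> 0" "\<And>x. \<bar>v x\<bar> \<le> B" using ccs_bounded[OF v] by blast
  define E where "E = (LINT x|lborel. indicator (cball (0::'a) R) x * (B * B))"
  have main: "(\<Sum>i<n. b i * powT v (\<kappa> i)) \<le> E * bump_mass TYPE('a) T p"
    if rep: "\<And>z. bump T z ^ p = (\<Sum>i<n. b i * cos (\<kappa> i \<bullet> z))" for p and n :: nat and b \<kappa>
  proof -
    let ?m = "bump_mass TYPE('a) T p"
    have ic: "integrable lborel (\<lambda>x. v x * cos (\<kappa> i \<bullet> x))" and isn: "integrable lborel (\<lambda>x. v x * sin (\<kappa> i \<bullet> x))" for i
      by (rule ccs_integrable[OF ccs_cos[OF v]], rule ccs_integrable[OF ccs_sin[OF v]])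
    have eq: "v x * smoothed T p v x = (\<Sum>i<n. b i * (cosT v (\<kappa> i) * (v x * cos (\<kappa> i \<bullet> x)) + sinT v (\<kappa> i) * (v x * sin (\<kappa> i \<bullet> x))))" for x
      unfolding smoothed_expand[OF v rep] sum_distrib_left by (intro sum.cong refl) (simp add: algebra_simps)
    have int: "integrable lborel (\<lambda>x. v x * smoothed T p v x)" unfolding eq using ic isn by simp
    have "(\<Sum>i<n. b i * powT v (\<kappa> i)) = (LINT x|lborel. v x * smoothed T p v x)"
      unfolding eq using ic isn by (simp add: powT_def cosT_def sinT_def power2_eq_square)
    also have "\<dots> \<le> (LINT x|lborel. indicator (cball (0::'a) R) x * (B * B) * ?m)"
    proof (rule integral_mono[OF int])
      show "integrable lborel (\<lambda>x. indicator (cball (0::'a) R) x * (B * B) * ?m)"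
        using borel_integrable_compact[of "cball (0::'a) R" "\<lambda>_. B * B * ?m"] by (simp add: mult.assoc)
      fix x :: 'a
      show "v x * smoothed T p v x \<le> indicator (cball 0 R) x * (B * B) * ?m"
      proof (cases "norm x \<le> R")
        case True
        have "\<bar>smoothed T p v x\<bar> \<le> B * ?m" using True T by (intro smoothed_bound[OF v] B) auto
        then have "\<bar>v x\<bar> * \<bar>smoothed T p v x\<bar> \<le> B * (B * ?m)" using B by (intro mult_mono) auto
        then have "v x * smoothed T p v x \<le> B * (B * ?m)" by (metis abs_ge_self abs_mult order_trans)
        then show ?thesis using True by simp
      next
        case False
        then have "v x = 0" using v by (auto simp: ccs_def)
        then show ?thesis using False by simp
      qed
    qed
    also have "\<dots> = E * ?m" by (simp add: E_def)
    finally show ?thesis .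
  qed
  have "0 \<le> E" unfolding E_def by (intro integral_nonneg_AE AE_I2) (simp add: B)
  show ?thesis
  proof (intro exI[of _ E] conjI allI impI)
    fix p and n :: nat and b and \<kappa> :: "nat \<Rightarrow> 'a"
    assume "\<forall>z. bump T z ^ p = (\<Sum>i<n. b i * cos (\<kappa> i \<bullet> z))"
    then show "(\<Sum>i<n. b i * powT v (\<kappa> i)) \<le> E * bump_mass TYPE('a) T p"
      using main[of p b \<kappa> n] by simp
  qed fact
qed

text \<open>The complex Cauchy-Schwarz inequality in real form, with \<open>(gc, gs)\<close> and
  \<open>(Ac, As)\<close> as real and imaginary parts; the weight \<open>\<phi>\<close> divides one
  factor and multiplies the other.\<close>

lemma cauchy_schwarz_weighted:
  fixes b \<phi> gc gs Ac As :: "nat \<Rightarrow> real"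
  assumes b: "\<And>i. i < n \<Longrightarrow> 0 \<le> b i" and \<phi>: "\<And>i. i < n \<Longrightarrow> 0 < \<phi> i"
  shows "(\<Sum>i<n. b i * (gc i * Ac i + gs i * As i))\<^sup>2 \<le>
    (\<Sum>i<n. b i * ((gc i)\<^sup>2 + (gs i)\<^sup>2) / \<phi> i) * (\<Sum>i<n. b i * \<phi> i * ((Ac i)\<^sup>2 + (As i)\<^sup>2))"
proof -
  define x where "x = (\<lambda>i. sqrt (b i * ((gc i)\<^sup>2 + (gs i)\<^sup>2) / \<phi> i))"
  define y where "y = (\<lambda>i. sqrt (b i * \<phi> i * ((Ac i)\<^sup>2 + (As i)\<^sup>2)))"
  have termwise: "\<bar>b i * (gc i * Ac i + gs i * As i)\<bar> \<le> x i * y i" if i: "i < n" for i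
  proof -
    have "(gc i * Ac i + gs i * As i)\<^sup>2 \<le> ((gc i)\<^sup>2 + (gs i)\<^sup>2) * ((Ac i)\<^sup>2 + (As i)\<^sup>2)"
      using zero_le_power2[of "gc i * As i - gs i * Ac i"] by (simp add: power2_eq_square algebra_simps)
    then have "(b i)\<^sup>2 * (gc i * Ac i + gs i * As i)\<^sup>2 \<le> (b i)\<^sup>2 * (((gc i)\<^sup>2 + (gs i)\<^sup>2) * ((Ac i)\<^sup>2 + (As i)\<^sup>2))"
      by (rule mult_left_mono) simp
    then have "sqrt ((b i * (gc i * Ac i + gs i * As i))\<^sup>2) \<le> sqrt ((b i)\<^sup>2 * (((gc i)\<^sup>2 + (gs i)\<^sup>2) * ((Ac i)\<^sup>2 + (As i)\<^sup>2)))"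
      by (simp add: power_mult_distrib)
    also have "(b i)\<^sup>2 * (((gc i)\<^sup>2 + (gs i)\<^sup>2) * ((Ac i)\<^sup>2 + (As i)\<^sup>2)) =
       (b i * ((gc i)\<^sup>2 + (gs i)\<^sup>2) / \<phi> i) * (b i * \<phi> i * ((Ac i)\<^sup>2 + (As i)\<^sup>2))"
      using \<phi>[OF i] by (simp add: power2_eq_square)
    also have "sqrt \<dots> = x i * y i" by (simp only: x_def y_def real_sqrt_mult)
    finally show ?thesis by simp
  qed
  have "\<bar>\<Sum>i<n. b i * (gc i * Ac i + gs i * As i)\<bar> \<le> (\<Sum>i<n. x i * y i)"
    using termwise by (intro order_trans[OF sum_abs] sum_mono) auto
  then have "(\<Sum>i<n. b i * (gc i * Ac i + gs i * As i))\<^sup>2 \<le> (\<Sum>i<n. x i * y i)\<^sup>2"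
    by (metis abs_le_square_iff abs_of_nonneg abs_ge_zero order_trans)
  also have "\<dots> \<le> (\<Sum>i<n. (x i)\<^sup>2) * (\<Sum>i<n. (y i)\<^sup>2)" by (rule Cauchy_Schwarz_ineq_sum)
  also have "(\<Sum>i<n. (x i)\<^sup>2) = (\<Sum>i<n. b i * ((gc i)\<^sup>2 + (gs i)\<^sup>2) / \<phi> i)"
    by (intro sum.cong refl) (auto simp: x_def intro!: real_sqrt_pow2 divide_nonneg_pos mult_nonneg_nonneg b \<phi>)
  also have "(\<Sum>i<n. (y i)\<^sup>2) = (\<Sum>i<n. b i * \<phi> i * ((Ac i)\<^sup>2 + (As i)\<^sup>2))"
    by (intro sum.cong refl) (auto simp: y_def less_imp_le[OF \<phi>] intro!: real_sqrt_pow2 mult_nonneg_nonneg b)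
  finally show ?thesis .
qed

lemma norm_power_le_sum_components:
  fixes \<kappa> :: "'a::euclidean_space"
  shows "norm \<kappa> ^ q \<le> real DIM('a) ^ q * (\<Sum>b\<in>Basis. \<bar>\<kappa> \<bullet> b\<bar> ^ q)"
proof -
  define m where "m = Max ((\<lambda>b. \<bar>\<kappa> \<bullet> b\<bar>) ` Basis)"
  have "m \<in> (\<lambda>b. \<bar>\<kappa> \<bullet> b\<bar>) ` Basis" unfolding m_def by (intro Max_in) auto
  then obtain b where b: "b \<in> Basis" "m = \<bar>\<kappa> \<bullet> b\<bar>" by auto
  have "norm \<kappa> \<le> (\<Sum>b\<in>Basis. \<bar>\<kappa> \<bullet> b\<bar>)" by (rule norm_le_l1)
  also have "\<dots> \<le> (\<Sum>b\<in>(Basis :: 'a set). m)" unfolding m_def by (intro sum_mono Max_ge) auto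
  finally have "norm \<kappa> \<le> real DIM('a) * m" by simp
  then have "norm \<kappa> ^ q \<le> (real DIM('a) * m) ^ q" by (intro power_mono) auto
  also have "\<dots> = real DIM('a) ^ q * m ^ q" by (rule power_mult_distrib)
  also have "m ^ q \<le> (\<Sum>b\<in>Basis. \<bar>\<kappa> \<bullet> b\<bar> ^ q)"
    unfolding b(2) by (intro member_le_sum b) auto
  finally show ?thesis by (simp add: mult_left_mono)
qed

text \<open>After smoothing, both sides are finite sums over the frequencies of the bump, and
  Cauchy-Schwarz with the weight \<open>cosT \<phi>\<close> separates \<open>g\<close> from the
  coefficients \<open>a\<close>. The reciprocal weight is at most a multiple of 1 plus the sum of
  all \<open>(\<kappa> \<bullet> b) ^ (2 * l)\<close>, so the factor with \<open>g\<close> consists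
  of the energies of \<open>g\<close> and of its pure \<open>l\<close>-th derivatives
  \<open>u b l\<close>. Division by the mass and the limit in \<open>p\<close> remove the smoothing.
  The constant depends neither on the points nor on their number, as \<open>membership\<close>
  requires.\<close>

theorem fourier_domination:
  fixes \<phi> g :: "'a::euclidean_space \<Rightarrow> real" and u :: "'a \<Rightarrow> nat \<Rightarrow> 'a \<Rightarrow> real"
  assumes R: "R > 0" and \<phi>: "ccs R \<phi>" and even: "\<And>x. \<phi> (- x) = \<phi> x"
    and low: "\<And>r0. 0 < r0 \<Longrightarrow> \<exists>A>0. \<forall>\<kappa>. r0 \<le> norm \<kappa> \<longrightarrow> A / norm \<kappa> ^ (2 * l) \<le> cosT \<phi> \<kappa>"
    and low0: "0 < cosT \<phi> 0"
    and u0: "\<And>b. b \<in> Basis \<Longrightarrow> u b 0 = g" and g: "ccs R g"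
    and u: "\<And>b r. b \<in> Basis \<Longrightarrow> r \<le> l \<Longrightarrow> ccs R (u b r)"
    and du: "\<And>b r x. b \<in> Basis \<Longrightarrow> r < l \<Longrightarrow> ((\<lambda>t. u b r (x + t *\<^sub>R b)) has_real_derivative u b (Suc r) x) (at 0)"
  shows "\<exists>C. \<forall>(I :: 'i set) X a. finite I \<and> (\<forall>i\<in>I. norm (X i) \<le> R) \<longrightarrow>
     (\<Sum>i\<in>I. a i * g (X i))\<^sup>2 \<le> C * (\<Sum>i\<in>I. \<Sum>j\<in>I. a i * a j * \<phi> (X i - X j))"
proof -
  \<comment> \<open>Two points of norm at most \<open>R\<close> have a difference of norm at most
    \<open>2 * R\<close>, and \<open>\<phi>\<close> has support radius \<open>R\<close>; the period
    box must therefore contain the ball of radius \<open>3 * R\<close>.\<close>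
  define T where "T = 4 * R"
  have T: "T > 0" "\<And>x :: 'a. norm x \<le> R \<Longrightarrow> norm x + R \<le> T" "\<And>x :: 'a. norm x \<le> 2 * R \<Longrightarrow> norm x + R \<le> T" "2 * R \<le> T"
    using R by (auto simp: T_def)
  have "pi / T > 0" using T by simp
  from low[OF this] obtain A where A: "A > 0" "\<And>\<kappa>. pi / T \<le> norm \<kappa> \<Longrightarrow> A / norm \<kappa> ^ (2 * l) \<le> cosT \<phi> \<kappa>" by blast
  \<comment> \<open>The two entries take care of the frequency 0 and of the nonzero lattice
    frequencies.\<close>
  define C0 where "C0 = max (1 / cosT \<phi> 0) (real DIM('a) ^ (2 * l) / A)"
  have C0: "C0 > 0" using low0 by (simp add: C0_def less_max_iff_disj)
  have pos: "0 < cosT \<phi> \<kappa>" if "\<kappa> \<in> lattice T" for \<kappa>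
  proof (cases "\<kappa> = 0")
    case False
    then have "0 < A / norm \<kappa> ^ (2 * l)" using A(1) by simp
    then show ?thesis using A(2)[OF lattice_norm_ge[OF that False T(1)]] by linarith
  qed (simp add: low0)
  have inv: "1 / cosT \<phi> \<kappa> \<le> C0 * (1 + (\<Sum>b\<in>Basis. (\<kappa> \<bullet> b) ^ (2 * l)))" if "\<kappa> \<in> lattice T" for \<kappa>
  proof -
    let ?s = "\<Sum>b\<in>Basis. (\<kappa> \<bullet> b) ^ (2 * l)"
    have s: "?s \<ge> 0" by (intro sum_nonneg) (simp add: power_mult)
    show ?thesis
    proof (cases "\<kappa> = 0")
      case True
      have "1 / cosT \<phi> 0 \<le> C0 * 1" by (simp add: C0_def)
      also have "\<dots> \<le> C0 * (1 + ?s)" using C0 s by (intro mult_left_mono) auto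
      finally show ?thesis using True by simp
    next
      case False
      have n: "norm \<kappa> ^ (2 * l) > 0" using False by simp
      have "A \<le> cosT \<phi> \<kappa> * norm \<kappa> ^ (2 * l)"
        using A(2)[OF lattice_norm_ge[OF that False T(1)]] n by (simp add: pos_divide_le_eq)
      then have "1 / cosT \<phi> \<kappa> \<le> norm \<kappa> ^ (2 * l) / A"
        using pos[OF that] A(1) by (simp add: divide_simps mult.commute)
      also have "\<dots> \<le> real DIM('a) ^ (2 * l) * (\<Sum>b\<in>Basis. \<bar>\<kappa> \<bullet> b\<bar> ^ (2 * l)) / A"
        using A(1) by (intro divide_right_mono norm_power_le_sum_components) auto
      also have "(\<Sum>b\<in>Basis. \<bar>\<kappa> \<bullet> b\<bar> ^ (2 * l)) = ?s" by (simp add: power_mult)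
      also have "real DIM('a) ^ (2 * l) * ?s / A \<le> C0 * ?s"
        using s mult_right_mono[of "real DIM('a) ^ (2 * l) / A" C0 ?s] by (simp add: C0_def)
      also have "\<dots> \<le> C0 * (1 + ?s)" using C0 by simp
      finally show ?thesis .
    qed
  qed
  define en where "en = (\<lambda>v E. \<forall>p (n :: nat) c \<kappa>. (\<forall>z :: 'a. bump T z ^ p = (\<Sum>i<n. c i * cos (\<kappa> i \<bullet> z))) \<longrightarrow>
     (\<Sum>i<n. c i * powT v (\<kappa> i)) \<le> E * bump_mass TYPE('a) T p)"
  have enD: "(\<Sum>i<n. c i * powT v (\<kappa> i)) \<le> E * bump_mass TYPE('a) T p"
    if "en v E" "\<And>z :: 'a. bump T z ^ p = (\<Sum>i<n. c i * cos (\<kappa> i \<bullet> z))" for v E p and n :: nat and c \<kappa>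
    using that unfolding en_def by simp
  have en_ex: "\<exists>E. en v E" if "ccs R v" for v
    using smoothed_energy[OF that T(4,1)] unfolding en_def by (elim exE conjE) (rule exI)
  have "\<forall>b\<in>Basis. \<exists>E. en (u b l) E" by (intro ballI en_ex u order_refl)
  from bchoice[OF this] obtain E where "\<forall>b\<in>Basis. en (u b l) (E b)" ..
  then have E: "en (u b l) (E b)" if "b \<in> Basis" for b using that by simp
  from en_ex[OF g] obtain E0 where E0: "en g E0" ..
  define C where "C = C0 * (E0 + (\<Sum>b\<in>Basis. E b))"
  \<comment> \<open>Evenness leaves only cosines, so that the smoothed quadratic form becomes a
    weighted sum of squares.\<close>
  have "sinT \<phi> \<kappa> = 0" for \<kappa>
  proof -
    have "sinT \<phi> \<kappa> = (LINT x|lborel. \<phi> (- x) * sin (\<kappa> \<bullet> - x))"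
      unfolding sinT_def by (rule lborel_integral_reflect[symmetric]) (rule ccs_measurable[OF ccs_sin[OF \<phi>]])
    also have "\<dots> = - sinT \<phi> \<kappa>" by (simp add: even sinT_def)
    finally show ?thesis by simp
  qed
  note sin0 = this
  have "(\<Sum>i\<in>I. a i * g (X i))\<^sup>2 \<le> C * (\<Sum>i\<in>I. \<Sum>j\<in>I. a i * a j * \<phi> (X i - X j))"
    if I: "finite I" "\<And>i. i \<in> I \<Longrightarrow> norm (X i) \<le> R" for I :: "'i set" and X a
  proof -
    let ?m = "bump_mass TYPE('a) T"
    let ?L = "\<lambda>p. \<Sum>i\<in>I. a i * smoothed T p g (X i)"
    let ?Q = "\<lambda>p. \<Sum>i\<in>I. \<Sum>j\<in>I. a i * a j * smoothed T p \<phi> (X i - X j)"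
    have step: "(?L p)\<^sup>2 \<le> C * ?m p * ?Q p" for p
    proof -
      obtain n :: nat and b \<kappa> where rep: "\<And>i. i < n \<Longrightarrow> 0 \<le> b i" "\<And>i. i < n \<Longrightarrow> \<kappa> i \<in> lattice T"
        "\<And>z :: 'a. bump T z ^ p = (\<Sum>i<n. b i * cos (\<kappa> i \<bullet> z))"
        using cospoly_repr_sum[OF cospoly_bump_power[of T p]] by metis
      define Ac where "Ac = (\<lambda>k. \<Sum>i\<in>I. a i * cos (\<kappa> k \<bullet> X i))"
      define As where "As = (\<lambda>k. \<Sum>i\<in>I. a i * sin (\<kappa> k \<bullet> X i))"
      have L: "?L p = (\<Sum>k<n. b k * (cosT g (\<kappa> k) * Ac k + sinT g (\<kappa> k) * As k))"
      proof -
        have "?L p = (\<Sum>i\<in>I. \<Sum>k<n. a i * (b k * (cosT g (\<kappa> k) * cos (\<kappa> k \<bullet> X i) + sinT g (\<kappa> k) * sin (\<kappa> k \<bullet> X i))))"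
          unfolding smoothed_expand[OF g rep(3)] sum_distrib_left ..
        also have "\<dots> = (\<Sum>k<n. \<Sum>i\<in>I. a i * (b k * (cosT g (\<kappa> k) * cos (\<kappa> k \<bullet> X i) + sinT g (\<kappa> k) * sin (\<kappa> k \<bullet> X i))))"
          by (rule sum.swap)
        also have "\<dots> = (\<Sum>k<n. b k * (cosT g (\<kappa> k) * Ac k + sinT g (\<kappa> k) * As k))"
          unfolding Ac_def As_def sum_distrib_left sum.distrib[symmetric]
          by (intro sum.cong refl) (simp add: algebra_simps)
        finally show ?thesis .
      qed
      have Q: "?Q p = (\<Sum>k<n. b k * cosT \<phi> (\<kappa> k) * ((Ac k)\<^sup>2 + (As k)\<^sup>2))"
      proof -
        have "?Q p = (\<Sum>i\<in>I. \<Sum>j\<in>I. \<Sum>k<n. a i * a j * (b k * (cosT \<phi> (\<kappa> k) * cos (\<kappa> k \<bullet> (X i - X j)))))"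
          unfolding smoothed_expand[OF \<phi> rep(3)] sum_distrib_left by (simp add: sin0)
        also have "\<dots> = (\<Sum>k<n. \<Sum>i\<in>I. \<Sum>j\<in>I. a i * a j * (b k * (cosT \<phi> (\<kappa> k) * cos (\<kappa> k \<bullet> (X i - X j)))))"
          by (subst (2) sum.swap, subst sum.swap) (rule refl)
        also have "\<dots> = (\<Sum>k<n. b k * cosT \<phi> (\<kappa> k) * ((Ac k)\<^sup>2 + (As k)\<^sup>2))"
        proof (intro sum.cong refl)
          fix k
          have "(Ac k)\<^sup>2 + (As k)\<^sup>2 = (\<Sum>i\<in>I. \<Sum>j\<in>I. a i * a j * cos (\<kappa> k \<bullet> (X i - X j)))"
            unfolding Ac_def As_def power2_eq_square sum_product sum.distrib[symmetric]
            by (intro sum.cong refl) (simp add: inner_diff_right cos_diff algebra_simps)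
          then show "(\<Sum>i\<in>I. \<Sum>j\<in>I. a i * a j * (b k * (cosT \<phi> (\<kappa> k) * cos (\<kappa> k \<bullet> (X i - X j)))))
             = b k * cosT \<phi> (\<kappa> k) * ((Ac k)\<^sup>2 + (As k)\<^sup>2)"
            by (simp only:) (simp add: sum_distrib_left mult_ac)
        qed
        finally show ?thesis .
      qed
      have Q0: "0 \<le> ?Q p"
        unfolding Q using rep(1,2) pos
        by (intro sum_nonneg mult_nonneg_nonneg) (auto intro!: less_imp_le[OF pos])
      \<comment> \<open>The powers of the components of \<open>\<kappa> k\<close> that bound the
        reciprocal weight are absorbed by \<open>powT_iterated_derivative\<close> into the spectra
        of the derivatives.\<close>
      have "(\<Sum>k<n. b k * ((cosT g (\<kappa> k))\<^sup>2 + (sinT g (\<kappa> k))\<^sup>2) / cosT \<phi> (\<kappa> k)) \<le>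
         (\<Sum>k<n. C0 * (b k * powT g (\<kappa> k) + (\<Sum>c\<in>Basis. b k * powT (u c l) (\<kappa> k))))"
      proof (intro sum_mono)
        fix k assume "k \<in> {..<n}"
        then have k: "k < n" by simp
        have "b k * ((cosT g (\<kappa> k))\<^sup>2 + (sinT g (\<kappa> k))\<^sup>2) / cosT \<phi> (\<kappa> k) = (b k * powT g (\<kappa> k)) * (1 / cosT \<phi> (\<kappa> k))"
          by (simp add: powT_def)
        also have "\<dots> \<le> (b k * powT g (\<kappa> k)) * (C0 * (1 + (\<Sum>c\<in>Basis. (\<kappa> k \<bullet> c) ^ (2 * l))))"
          using rep(1,2)[OF k] by (intro mult_left_mono inv mult_nonneg_nonneg powT_nonneg)
        also have "\<dots> = C0 * (b k * powT g (\<kappa> k) + (\<Sum>c\<in>Basis. b k * ((\<kappa> k \<bullet> c) ^ (2 * l) * powT g (\<kappa> k))))"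
          by (simp add: sum_distrib_left sum_distrib_right algebra_simps)
        also have "(\<Sum>c\<in>Basis. b k * ((\<kappa> k \<bullet> c) ^ (2 * l) * powT g (\<kappa> k))) = (\<Sum>c\<in>Basis. b k * powT (u c l) (\<kappa> k))"
        proof (intro sum.cong refl)
          fix c :: 'a assume c: "c \<in> Basis"
          show "b k * ((\<kappa> k \<bullet> c) ^ (2 * l) * powT g (\<kappa> k)) = b k * powT (u c l) (\<kappa> k)"
            using powT_iterated_derivative[of l R "u c" c "\<kappa> k"] u[OF c] du[OF c] by (simp add: u0[OF c])
        qed
        finally show "b k * ((cosT g (\<kappa> k))\<^sup>2 + (sinT g (\<kappa> k))\<^sup>2) / cosT \<phi> (\<kappa> k) \<le>
           C0 * (b k * powT g (\<kappa> k) + (\<Sum>c\<in>Basis. b k * powT (u c l) (\<kappa> k)))" .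
      qed
      also have "\<dots> = C0 * ((\<Sum>k<n. b k * powT g (\<kappa> k)) + (\<Sum>c\<in>Basis. \<Sum>k<n. b k * powT (u c l) (\<kappa> k)))"
        by (subst sum.swap) (simp only: sum_distrib_left[symmetric] sum.distrib)
      also have "\<dots> \<le> C0 * (E0 * ?m p + (\<Sum>c\<in>Basis. E c * ?m p))"
        using C0 rep(3) by (intro mult_left_mono add_mono sum_mono enD[OF E0] enD[OF E]) auto
      also have "\<dots> = C * ?m p" by (simp add: C_def sum_distrib_right algebra_simps)
      finally have *: "(\<Sum>k<n. b k * ((cosT g (\<kappa> k))\<^sup>2 + (sinT g (\<kappa> k))\<^sup>2) / cosT \<phi> (\<kappa> k)) \<le> C * ?m p" .
      have "(?L p)\<^sup>2 \<le> (\<Sum>k<n. b k * ((cosT g (\<kappa> k))\<^sup>2 + (sinT g (\<kappa> k))\<^sup>2) / cosT \<phi> (\<kappa> k)) * ?Q p"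
        unfolding L Q using rep(1,2) pos by (intro cauchy_schwarz_weighted) auto
      also have "\<dots> \<le> C * ?m p * ?Q p" using * Q0 by (rule mult_right_mono)
      finally show ?thesis .
    qed
    have m: "?m p > 0" for p by (rule bump_mass_pos[OF T(1)])
    have "(\<lambda>p. (\<Sum>i\<in>I. a i * (smoothed T p g (X i) / ?m p))\<^sup>2) \<longlonglongrightarrow> (\<Sum>i\<in>I. a i * g (X i))\<^sup>2"
      by (intro tendsto_intros smoothed_limit[OF g] T I(2))
    moreover have "(\<lambda>p. C * (\<Sum>i\<in>I. \<Sum>j\<in>I. a i * a j * (smoothed T p \<phi> (X i - X j) / ?m p))) \<longlonglongrightarrow>
       C * (\<Sum>i\<in>I. \<Sum>j\<in>I. a i * a j * \<phi> (X i - X j))"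
    proof (intro tendsto_intros smoothed_limit[OF \<phi> _ T(1)] T(3))
      fix i j assume "i \<in> I" "j \<in> I"
      then show "norm (X i - X j) \<le> 2 * R"
        using I(2)[of i] I(2)[of j] norm_triangle_ineq4[of "X i" "X j"] by linarith
    qed
    moreover have "(\<Sum>i\<in>I. a i * (smoothed T p g (X i) / ?m p))\<^sup>2 \<le> C * (\<Sum>i\<in>I. \<Sum>j\<in>I. a i * a j * (smoothed T p \<phi> (X i - X j) / ?m p))" for p
    proof -
      have "(\<Sum>i\<in>I. a i * (smoothed T p g (X i) / ?m p)) = ?L p / ?m p"
        by (simp add: sum_divide_distrib)
      then have "(\<Sum>i\<in>I. a i * (smoothed T p g (X i) / ?m p))\<^sup>2 = (?L p)\<^sup>2 / (?m p)\<^sup>2"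
        by (simp add: power_divide)
      also have "\<dots> \<le> C * ?m p * ?Q p / (?m p)\<^sup>2" using step by (intro divide_right_mono) auto
      also have "\<dots> = C * (?Q p / ?m p)" using m[of p] by (simp add: power2_eq_square)
      also have "?Q p / ?m p = (\<Sum>i\<in>I. \<Sum>j\<in>I. a i * a j * (smoothed T p \<phi> (X i - X j) / ?m p))"
        by (simp add: sum_divide_distrib)
      finally show ?thesis .
    qed
    ultimately show ?thesis by (intro LIMSEQ_le) auto
  qed
  then show ?thesis by (intro exI[of _ C]) auto
qed

section \<open>Reproducing kernel Hilbert spaces\<close>

locale reproducing_kernel_space =
  fixes \<Omega> :: "'a set" and K :: "'a \<Rightarrow> 'a \<Rightarrow> real" and H :: "('a \<Rightarrow> real) set"
    and ip :: "('a \<Rightarrow> real) \<Rightarrow> ('a \<Rightarrow> real) \<Rightarrow> real"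
  assumes rk: "rkhs \<Omega> K H ip"
begin

definition kern :: "'a \<Rightarrow> 'a \<Rightarrow> real" where
  "kern y = (\<lambda>x. if x \<in> \<Omega> then K x y else 0)"

lemma H_outside: "g \<in> H \<Longrightarrow> x \<notin> \<Omega> \<Longrightarrow> g x = 0"
  and H_0: "(\<lambda>x. 0) \<in> H"
  and H_add: "g \<in> H \<Longrightarrow> g' \<in> H \<Longrightarrow> (\<lambda>x. g x + g' x) \<in> H"
  and H_mult: "g \<in> H \<Longrightarrow> (\<lambda>x. a * g x) \<in> H"
  and ip_commute: "g \<in> H \<Longrightarrow> g' \<in> H \<Longrightarrow> ip g g' = ip g' g"
  and ip_add_left: "g \<in> H \<Longrightarrow> g' \<in> H \<Longrightarrow> u \<in> H \<Longrightarrow> ip (\<lambda>x. g x + g' x) u = ip g u + ip g' u"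
  and ip_mult_left: "g \<in> H \<Longrightarrow> u \<in> H \<Longrightarrow> ip (\<lambda>x. a * g x) u = a * ip g u"
  and kern_H: "y \<in> \<Omega> \<Longrightarrow> kern y \<in> H"
  and ip_kern: "y \<in> \<Omega> \<Longrightarrow> g \<in> H \<Longrightarrow> ip g (kern y) = g y"
  using rk unfolding rkhs_def kern_def by blast+

lemma H_complete:
  assumes "\<And>p. G p \<in> H"
    "\<And>e. e > 0 \<Longrightarrow> \<exists>N. \<forall>p\<ge>N. \<forall>q\<ge>N. sqrt (ip (\<lambda>x. G p x - G q x) (\<lambda>x. G p x - G q x)) < e"
  shows "\<exists>g\<in>H. (\<lambda>p::nat. sqrt (ip (\<lambda>x. G p x - g x) (\<lambda>x. G p x - g x))) \<longlonglongrightarrow> 0"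
  using rk assms unfolding rkhs_def by blast

lemma ip_nonneg: "g \<in> H \<Longrightarrow> 0 \<le> ip g g"
proof (cases "g = (\<lambda>x. 0)")
  case True
  have "ip (\<lambda>x. 0 * 0) (\<lambda>x. 0) = 0 * ip (\<lambda>x. 0) (\<lambda>x. 0)"
    by (rule ip_mult_left) (rule H_0)+
  then show ?thesis by (simp add: True)
next
  case False
  assume "g \<in> H"
  then show ?thesis using rk False unfolding rkhs_def by (simp add: less_imp_le)
qed

lemma H_diff: "g \<in> H \<Longrightarrow> g' \<in> H \<Longrightarrow> (\<lambda>x. g x - g' x) \<in> H"
  using H_add[of g "\<lambda>x. (-1) * g' x"] H_mult[of g' "-1"] by simp

lemma ip_add_right: "g \<in> H \<Longrightarrow> g' \<in> H \<Longrightarrow> u \<in> H \<Longrightarrow> ip u (\<lambda>x. g x + g' x) = ip u g + ip u g'"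
  using ip_add_left[of g g' u] ip_commute H_add by metis

lemma ip_mult_right: "g \<in> H \<Longrightarrow> u \<in> H \<Longrightarrow> ip u (\<lambda>x. a * g x) = a * ip u g"
  using ip_mult_left[of g u a] ip_commute H_mult by metis

lemma ip_combination:
  assumes "g \<in> H" "h \<in> H"
  shows "ip (\<lambda>x. a * g x + b * h x) (\<lambda>x. a * g x + b * h x) = a\<^sup>2 * ip g g + 2 * a * b * ip g h + b\<^sup>2 * ip h h"
proof -
  have "ip (\<lambda>x. a * g x + b * h x) (\<lambda>x. a * g x + b * h x)
      = a * (a * ip g g + b * ip g h) + b * (a * ip h g + b * ip h h)"
    using assms by (simp add: ip_add_left ip_add_right ip_mult_left ip_mult_right H_mult H_add distrib_left)
  then show ?thesis using ip_commute[OF assms] by (simp add: power2_eq_square algebra_simps)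
qed

lemma ip_diff:
  assumes "g \<in> H" "h \<in> H"
  shows "ip (\<lambda>x. g x - h x) (\<lambda>x. g x - h x) = ip g g - 2 * ip g h + ip h h"
  using ip_combination[OF assms, of 1 "-1"] by simp

lemma ip_Cauchy_Schwarz:
  assumes g: "g \<in> H" and h: "h \<in> H"
  shows "(ip g h)\<^sup>2 \<le> ip g g * ip h h"
proof (cases "ip h h = 0")
  case False
  then have h0: "ip h h > 0" using ip_nonneg[OF h] by simp
  have "0 \<le> ip (\<lambda>x. ip h h * g x + (- ip g h) * h x) (\<lambda>x. ip h h * g x + (- ip g h) * h x)"
    by (intro ip_nonneg H_add H_mult g h)
  also have "\<dots> = ip h h * (ip g g * ip h h - (ip g h)\<^sup>2)"
    unfolding ip_combination[OF g h] by (simp add: power2_eq_square algebra_simps)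
  finally show ?thesis using h0 by (simp add: zero_le_mult_iff)
next
  case True
  have *: "0 \<le> ip g g + 2 * b * ip g h" for b
    using ip_nonneg[OF H_add[OF H_mult[OF g, of 1] H_mult[OF h, of b]]]
    unfolding ip_combination[OF g h] by (simp add: True)
  have "ip g h = 0"
  proof (rule ccontr)
    assume n: "ip g h \<noteq> 0"
    have "2 * (- (ip g g + 1) / (2 * ip g h)) * ip g h = - (ip g g + 1)" using n by simp
    with *[of "- (ip g g + 1) / (2 * ip g h)"] show False by linarith
  qed
  then show ?thesis by (simp add: True)
qed

lemma H_sum: "finite I \<Longrightarrow> (\<And>i. i \<in> I \<Longrightarrow> v i \<in> H) \<Longrightarrow> (\<lambda>x. \<Sum>i\<in>I. a i * v i x) \<in> H"
  by (induction I rule: finite_induct) (simp_all add: H_0 H_add H_mult)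

lemma ip_0_right: "g \<in> H \<Longrightarrow> ip g (\<lambda>x. 0) = 0"
  using ip_mult_right[OF H_0, of g 0] by simp

lemma ip_sum_right:
  "finite I \<Longrightarrow> (\<And>i. i \<in> I \<Longrightarrow> v i \<in> H) \<Longrightarrow> g \<in> H \<Longrightarrow> ip g (\<lambda>x. \<Sum>i\<in>I. a i * v i x) = (\<Sum>i\<in>I. a i * ip g (v i))"
  by (induction I rule: finite_induct) (auto simp: ip_0_right ip_add_right ip_mult_right H_mult H_sum)

lemma ip_kern_sum:
  assumes "finite I" "\<And>i. i \<in> I \<Longrightarrow> X i \<in> \<Omega>"
  shows "g \<in> H \<Longrightarrow> ip g (\<lambda>x. \<Sum>i\<in>I. a i * kern (X i) x) = (\<Sum>i\<in>I. a i * g (X i))"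
    and "ip (\<lambda>x. \<Sum>i\<in>I. a i * kern (X i) x) (\<lambda>x. \<Sum>i\<in>I. a i * kern (X i) x) =
      (\<Sum>i\<in>I. \<Sum>j\<in>I. a i * a j * K (X i) (X j))"
proof -
  show *: "ip g (\<lambda>x. \<Sum>i\<in>I. a i * kern (X i) x) = (\<Sum>i\<in>I. a i * g (X i))" if "g \<in> H" for g
    using assms that by (simp add: ip_sum_right kern_H ip_kern)
  have "(\<lambda>x. \<Sum>i\<in>I. a i * kern (X i) x) \<in> H" using assms by (intro H_sum kern_H) auto
  from *[OF this] show "ip (\<lambda>x. \<Sum>i\<in>I. a i * kern (X i) x) (\<lambda>x. \<Sum>i\<in>I. a i * kern (X i) x) =
      (\<Sum>i\<in>I. \<Sum>j\<in>I. a i * a j * K (X i) (X j))"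
    using assms by (simp add: kern_def sum_distrib_left mult.assoc)
qed

text \<open>Cauchy-Schwarz against a combination of kernels. The regularity of the native space
  comes from this inequality with one, two and three points, and \<open>membership\<close> is its
  converse.\<close>

lemma evaluation_bound:
  assumes "finite I" "\<And>i. i \<in> I \<Longrightarrow> X i \<in> \<Omega>" "g \<in> H"
  shows "(\<Sum>i\<in>I. a i * g (X i))\<^sup>2 \<le> ip g g * (\<Sum>i\<in>I. \<Sum>j\<in>I. a i * a j * K (X i) (X j))"
proof -
  have "(\<lambda>x. \<Sum>i\<in>I. a i * kern (X i) x) \<in> H" using assms by (intro H_sum kern_H) auto
  from ip_Cauchy_Schwarz[OF assms(3) this] show ?thesis
    using ip_kern_sum[of I X] assms by simp
qed

lemma point_evaluation_bound:
  assumes "g \<in> H" "y \<in> \<Omega>"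
  shows "(g y)\<^sup>2 \<le> ip g g * K y y"
  using evaluation_bound[of "{()}" "\<lambda>_. y" g "\<lambda>_. 1"] assms by simp

text \<open>The Riesz representer of the functional \<open>kern y \<mapsto> g y\<close> is found by maximising
  \<open>2 * c - ip v v\<close> over the span of the kernels, where \<open>c\<close> is the value of the functional at \<open>v\<close>.\<close>

inductive span_pair :: "('a \<Rightarrow> real) \<Rightarrow> ('a \<Rightarrow> real) \<Rightarrow> real \<Rightarrow> bool" for g where
  zero: "span_pair g (\<lambda>x. 0) 0"
| step: "span_pair g v c \<Longrightarrow> y \<in> \<Omega> \<Longrightarrow> span_pair g (\<lambda>x. v x + b * kern y x) (c + b * g y)"

lemma span_pair_H: "span_pair g v c \<Longrightarrow> v \<in> H"
  by (induction rule: span_pair.induct) (simp_all add: H_0 H_add H_mult kern_H)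

lemma span_pair_add:
  assumes v: "span_pair g v c" and w: "span_pair g w d"
  shows "span_pair g (\<lambda>x. v x + w x) (c + d)"
  using w
proof induction
  case zero
  then show ?case using v by simp
next
  case (step w d y b)
  from span_pair.step[OF step(3,2), of b] show ?case by (simp add: add.assoc)
qed

lemma span_pair_mult:
  assumes "span_pair g v c"
  shows "span_pair g (\<lambda>x. a * v x) (a * c)"
  using assms
proof induction
  case zero
  then show ?case using span_pair.zero by simp
next
  case (step v c y b)
  from span_pair.step[OF step(3,2), of "a * b"] show ?case by (simp add: distrib_left mult.assoc)
qed

lemma span_pair_repr:
  assumes "span_pair g v c"
  shows "\<exists>(n::nat) b X. (\<forall>i<n. X i \<in> \<Omega>) \<and> v = (\<lambda>x. \<Sum>i<n. b i * kern (X i) x) \<and> c = (\<Sum>i<n. b i * g (X i))"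
  using assms
proof induction
  case zero
  show ?case by (rule exI[of _ 0]) auto
next
  case (step v c y b0)
  then obtain n b X where *: "\<forall>i<(n::nat). X i \<in> \<Omega>" "v = (\<lambda>x. \<Sum>i<n. b i * kern (X i) x)" "c = (\<Sum>i<n. b i * g (X i))"
    by blast
  show ?case
    by (rule exI[of _ "Suc n"], rule exI[of _ "b(n := b0)"], rule exI[of _ "X(n := y)"])
       (use * step in \<open>auto simp: less_Suc_eq\<close>)
qed

text \<open>The assumed bound says that the functional is continuous on the span of the kernels,
  which keeps the quadratic expression bounded above. A maximising sequence is Cauchy, and its limit
  has the values of \<open>g\<close>.\<close>

theorem membership:
  assumes out: "\<And>x. x \<notin> \<Omega> \<Longrightarrow> g x = 0"
    and bound: "\<And>(n::nat) X a. (\<And>i. i < n \<Longrightarrow> X i \<in> \<Omega>) \<Longrightarrow>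
      (\<Sum>i<n. a i * g (X i))\<^sup>2 \<le> C * (\<Sum>i<n. \<Sum>j<n. a i * a j * K (X i) (X j))"
  shows "g \<in> H"
proof -
  \<comment> \<open>Positive whatever the sign of \<open>C\<close>, so that it can be divided
    by.\<close>
  define C' where "C' = max C 1"
  have C': "C' > 0" by (simp add: C'_def)
  have le: "2 * c - ip v v \<le> C'" if V: "span_pair g v c" for v c
  proof -
    obtain n b X where r: "\<forall>i<(n::nat). X i \<in> \<Omega>" "v = (\<lambda>x. \<Sum>i<n. b i * kern (X i) x)" "c = (\<Sum>i<n. b i * g (X i))"
      using span_pair_repr[OF V] by blast
    have "c\<^sup>2 \<le> C * ip v v"
      using bound[of n X b] r ip_kern_sum(2)[of "{..<n}" X b] by simp
    also have "\<dots> \<le> C' * ip v v" using ip_nonneg[OF span_pair_H[OF V]] by (intro mult_right_mono) (auto simp: C'_def)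
    finally have "c\<^sup>2 / C' \<le> ip v v" using C' by (simp add: pos_divide_le_eq mult.commute)
    moreover have "2 * c \<le> c\<^sup>2 / C' + C'"
    proof -
      have "0 \<le> (c - C')\<^sup>2 / C'" using C' by simp
      also have "\<dots> = c\<^sup>2 / C' + C' - 2 * c" using C' by (simp add: field_simps power2_eq_square)
      finally show ?thesis by simp
    qed
    ultimately show ?thesis by linarith
  qed
  define S where "S = {2 * c - ip v v | v c. span_pair g v c}"
  have S: "S \<noteq> {}" "bdd_above S" using span_pair.zero le unfolding S_def by (blast, intro bdd_aboveI[of _ C']) blast
  define s where "s = Sup S"
  have upper: "2 * c - ip v v \<le> s" if "span_pair g v c" for v c
    unfolding s_def using that S by (intro cSup_upper) (auto simp: S_def)
  have "\<forall>p::nat. \<exists>vc. span_pair g (fst vc) (snd vc) \<and> s - 1 / real (Suc p) < 2 * snd vc - ip (fst vc) (fst vc)"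
  proof
    fix p :: nat
    have "s - 1 / real (Suc p) < Sup S" by (simp add: s_def)
    then obtain y where "y \<in> S" "s - 1 / real (Suc p) < y" using less_cSup_iff[OF S] by blast
    then show "\<exists>vc. span_pair g (fst vc) (snd vc) \<and> s - 1 / real (Suc p) < 2 * snd vc - ip (fst vc) (fst vc)"
      by (auto simp: S_def)
  qed
  then obtain vc where vc: "\<And>p::nat. span_pair g (fst (vc p)) (snd (vc p))"
     "\<And>p::nat. s - 1 / real (Suc p) < 2 * snd (vc p) - ip (fst (vc p)) (fst (vc p))"
    by metis
  define v where "v = (\<lambda>p. fst (vc p))"
  define c where "c = (\<lambda>p. snd (vc p))"
  have V: "span_pair g (v p) (c p)" and J: "s - 1 / real (Suc p) < 2 * c p - ip (v p) (v p)" for p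
    using vc[of p] by (auto simp: v_def c_def)
  have vH: "v p \<in> H" for p using V by (rule span_pair_H)
  have cauchy: "ip (\<lambda>x. v p x - v q x) (\<lambda>x. v p x - v q x) \<le> 2 / real (Suc p) + 2 / real (Suc q)" for p q
  proof -
    \<comment> \<open>The midpoint competes as well; by the parallelogram identity two nearly
      optimal elements are close to each other.\<close>
    have "span_pair g (\<lambda>x. 1/2 * (v p x + v q x)) (1/2 * (c p + c q))"
      by (intro span_pair_mult span_pair_add V)
    from upper[OF this]
    have "c p + c q - ip (\<lambda>x. 1/2 * v p x + 1/2 * v q x) (\<lambda>x. 1/2 * v p x + 1/2 * v q x) \<le> s"
      by (simp add: distrib_left)
    then have "c p + c q - (1/4 * ip (v p) (v p) + 1/2 * ip (v p) (v q) + 1/4 * ip (v q) (v q)) \<le> s"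
      unfolding ip_combination[OF vH vH] by (simp add: power2_eq_square)
    moreover have "2 / real (Suc p) = 2 * (1 / real (Suc p))" "2 / real (Suc q) = 2 * (1 / real (Suc q))" by simp_all
    ultimately show ?thesis
      unfolding ip_diff[OF vH vH] using J[of p] J[of q] by linarith
  qed
  have "\<exists>u\<in>H. (\<lambda>p. sqrt (ip (\<lambda>x. v p x - u x) (\<lambda>x. v p x - u x))) \<longlonglongrightarrow> 0"
  proof (rule H_complete[OF vH])
    fix e :: real assume e: "e > 0"
    then obtain N :: nat where N: "4 / e\<^sup>2 < real N" using reals_Archimedean2 by blast
    show "\<exists>N. \<forall>p\<ge>N. \<forall>q\<ge>N. sqrt (ip (\<lambda>x. v p x - v q x) (\<lambda>x. v p x - v q x)) < e"
    proof (intro exI[of _ N] allI impI)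
      fix p q assume "N \<le> p" "N \<le> q"
      have b: "2 / real (Suc i) < e\<^sup>2 / 2" if "N \<le> i" for i
      proof -
        have "4 / e\<^sup>2 < real (Suc i)" using N that by linarith
        then show ?thesis using e by (simp add: field_simps del: of_nat_Suc)
      qed
      have "ip (\<lambda>x. v p x - v q x) (\<lambda>x. v p x - v q x) < e\<^sup>2"
        using cauchy[of p q] b[OF \<open>N \<le> p\<close>] b[OF \<open>N \<le> q\<close>] by linarith
      then show "sqrt (ip (\<lambda>x. v p x - v q x) (\<lambda>x. v p x - v q x)) < e"
        using e real_less_lsqrt by (smt (verit) real_sqrt_less_iff real_sqrt_abs)
    qed
  qed
  then obtain u where u: "u \<in> H" "(\<lambda>p. sqrt (ip (\<lambda>x. v p x - u x) (\<lambda>x. v p x - u x))) \<longlonglongrightarrow> 0" by blast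
  have "g y = u y" if y: "y \<in> \<Omega>" for y
  proof -
    have k0: "0 \<le> K y y"
      using ip_nonneg[OF kern_H[OF y]] ip_kern[OF y kern_H[OF y]] y by (simp add: kern_def)
    have "(\<lambda>p. sqrt (ip (\<lambda>x. v p x - u x) (\<lambda>x. v p x - u x)) * sqrt (K y y)) \<longlonglongrightarrow> 0"
      using tendsto_mult[OF u(2) tendsto_const[of "sqrt (K y y)"]] by simp
    then have "(\<lambda>p. v p y - u y) \<longlonglongrightarrow> 0"
    proof (rule Lim_null_comparison[rotated])
      show "\<forall>\<^sub>F p in sequentially. norm (v p y - u y) \<le> sqrt (ip (\<lambda>x. v p x - u x) (\<lambda>x. v p x - u x)) * sqrt (K y y)"
      proof (intro always_eventually allI)
        fix p
        have "(v p y - u y)\<^sup>2 \<le> ip (\<lambda>x. v p x - u x) (\<lambda>x. v p x - u x) * K y y"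
          using point_evaluation_bound[OF H_diff[OF vH u(1)] y] .
        then show "norm (v p y - u y) \<le> sqrt (ip (\<lambda>x. v p x - u x) (\<lambda>x. v p x - u x)) * sqrt (K y y)"
          using real_sqrt_le_mono by (fastforce simp: real_sqrt_mult)
      qed
    qed
    then have vy: "(\<lambda>p. v p y) \<longlonglongrightarrow> u y" by (simp add: LIM_zero_iff)
    \<comment> \<open>Optimality of the limit against perturbations by a multiple of
      \<open>kern y\<close>. The left side is linear in \<open>t\<close> and the right side
      quadratic, which forces \<open>g y = u y\<close>.\<close>
    have t: "2 * t * (g y - u y) \<le> t\<^sup>2 * K y y" for t
    proof -
      have *: "2 * t * (g y - v p y) - t\<^sup>2 * K y y \<le> inverse (real (Suc p))" for p
      proof -
        have "ip (\<lambda>x. v p x + t * kern y x) (\<lambda>x. v p x + t * kern y x) = ip (v p) (v p) + 2 * t * v p y + t\<^sup>2 * K y y"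
          using ip_combination[OF vH kern_H[OF y], of 1 p t] ip_kern[OF y vH] ip_kern[OF y kern_H[OF y]] y
          by (simp add: kern_def)
        then show ?thesis
          using upper[OF span_pair.step[OF V y, of p t]] J[of p] by (simp add: algebra_simps inverse_eq_divide del: of_nat_Suc)
      qed
      have "2 * t * (g y - u y) - t\<^sup>2 * K y y \<le> 0"
      proof (rule LIMSEQ_le[OF _ LIMSEQ_inverse_real_of_nat])
        show "(\<lambda>p. 2 * t * (g y - v p y) - t\<^sup>2 * K y y) \<longlonglongrightarrow> 2 * t * (g y - u y) - t\<^sup>2 * K y y"
          by (intro tendsto_intros vy)
      qed (simp only: *, blast)
      then show ?thesis by simp
    qed
    define d where "d = g y - u y"
    \<comment> \<open>A multiple of \<open>d\<close> small enough for the quadratic term to lose;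
      the summand 1 covers the case \<open>K y y = 0\<close>.\<close>
    have "2 * (d / (K y y + 1)) * d \<le> (d / (K y y + 1))\<^sup>2 * K y y" using t[of "d / (K y y + 1)"] by (simp add: d_def)
    also have "\<dots> \<le> (d / (K y y + 1))\<^sup>2 * (K y y + 1)" by (intro mult_left_mono) auto
    also have "\<dots> = (d / (K y y + 1)) * d" using k0 by (simp add: power2_eq_square)
    finally have "d * d / (K y y + 1) \<le> 0" by simp
    then have "d = 0" using k0 by (auto simp: divide_le_0_iff mult_le_0_iff)
    then show ?thesis by (simp add: d_def)
  qed
  then have "g = u" using out H_outside[OF u(1)] by (metis ext)
  then show ?thesis using u(1) by simp
qed

end

section \<open>Regularity of the native space\<close>

text \<open>The quotients satisfy a Cauchy condition as the increments tend to 0. \<open>P\<close>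
  describes the admissible increments: all small ones are admissible, and the bound survives for
  every admissible \<open>t\<close>, however large. This is how sets that are not convex are dealt
  with.\<close>

lemma limit_of_quotients:
  fixes \<phi> :: "real \<Rightarrow> real"
  assumes \<rho>: "\<rho> > 0" and C: "C \<ge> 0"
    and Q: "\<And>t r. t \<noteq> 0 \<Longrightarrow> r \<noteq> 0 \<Longrightarrow> P t \<Longrightarrow> P r \<Longrightarrow> \<bar>\<phi> t - \<phi> r\<bar> \<le> C * (\<bar>t\<bar> + \<bar>r\<bar>)"
    and P: "\<And>t. \<bar>t\<bar> < \<rho> \<Longrightarrow> P t"
  shows "\<exists>d. \<forall>t. t \<noteq> 0 \<longrightarrow> P t \<longrightarrow> \<bar>\<phi> t - d\<bar> \<le> C * \<bar>t\<bar>"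
proof -
  define r where "r = (\<lambda>n::nat. \<rho> / 2 / real (Suc n))"
  have r: "r n > 0" "P (r n)" for n
  proof -
    show pos: "r n > 0" unfolding r_def using \<rho> by (intro divide_pos_pos) simp_all
    have "\<rho> / 2 * 1 \<le> \<rho> / 2 * real (Suc n)" using \<rho> by (intro mult_left_mono) simp_all
    then have "r n \<le> \<rho> / 2" unfolding r_def by (subst pos_divide_le_eq) simp_all
    then have "\<bar>r n\<bar> < \<rho>" using \<rho> pos by linarith
    then show "P (r n)" by (rule P)
  qed
  have rlim: "r \<longlonglongrightarrow> 0"
  proof -
    have eq: "r = (\<lambda>n. \<rho> / 2 * inverse (real (Suc n)))" by (rule ext) (simp only: r_def divide_inverse)
    have "(\<lambda>n. \<rho> / 2 * inverse (real (Suc n))) \<longlonglongrightarrow> \<rho> / 2 * 0"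
      by (rule tendsto_mult[OF tendsto_const LIMSEQ_inverse_real_of_nat])
    then show ?thesis by (simp only: eq mult_zero_right)
  qed
  have "Cauchy (\<lambda>n. \<phi> (r n))"
  proof (rule metric_CauchyI)
    fix e :: real assume "e > 0"
    have C1: "C + 1 > 0" using C by linarith
    then have "e / (2 * (C + 1)) > 0" using \<open>e > 0\<close> by simp
    from order_tendstoD(2)[OF rlim this] obtain N where N: "\<And>n. n \<ge> N \<Longrightarrow> r n < e / (2 * (C + 1))"
      by (auto simp: eventually_sequentially)
    show "\<exists>N. \<forall>m\<ge>N. \<forall>n\<ge>N. dist (\<phi> (r m)) (\<phi> (r n)) < e"
    proof (intro exI[of _ N] allI impI)
      fix m n assume "N \<le> m" "N \<le> n"
      have "dist (\<phi> (r m)) (\<phi> (r n)) \<le> C * (r m + r n)"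
        using Q[of "r m" "r n"] r[of m] r[of n] by (simp add: dist_real_def)
      also have "\<dots> \<le> (C + 1) * (r m + r n)" using r(1)[of m] r(1)[of n] by (intro mult_right_mono) auto
      also have "\<dots> < (C + 1) * (e / (2 * (C + 1)) + e / (2 * (C + 1)))"
        by (intro mult_strict_left_mono add_strict_mono N C1 \<open>N \<le> m\<close> \<open>N \<le> n\<close>)
      also have "\<dots> = e" using C1 by (simp add: divide_simps)
      finally show "dist (\<phi> (r m)) (\<phi> (r n)) < e" .
    qed
  qed
  then obtain d where d: "(\<lambda>n. \<phi> (r n)) \<longlonglongrightarrow> d" by (auto simp: Cauchy_convergent_iff convergent_def)
  have "\<bar>\<phi> t - d\<bar> \<le> C * \<bar>t\<bar>" if "t \<noteq> 0" "P t" for t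
  proof (rule LIMSEQ_le)
    show "(\<lambda>n. \<bar>\<phi> t - \<phi> (r n)\<bar>) \<longlonglongrightarrow> \<bar>\<phi> t - d\<bar>" by (intro tendsto_intros d)
    have "(\<lambda>n. C * (\<bar>t\<bar> + \<bar>r n\<bar>)) \<longlonglongrightarrow> C * (\<bar>t\<bar> + \<bar>0\<bar>)" by (intro tendsto_intros rlim)
    then show "(\<lambda>n. C * (\<bar>t\<bar> + \<bar>r n\<bar>)) \<longlonglongrightarrow> C * \<bar>t\<bar>" by simp
    show "\<exists>N. \<forall>n\<ge>N. \<bar>\<phi> t - \<phi> (r n)\<bar> \<le> C * (\<bar>t\<bar> + \<bar>r n\<bar>)"
    proof (intro exI allI impI)
      fix n show "\<bar>\<phi> t - \<phi> (r n)\<bar> \<le> C * (\<bar>t\<bar> + \<bar>r n\<bar>)"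
        using Q[of t "r n"] that r[of n] by simp
    qed
  qed
  then show ?thesis by (intro exI[of _ d] allI impI)
qed

lemma small_quadratic_eq_0:
  fixes d :: real
  assumes "\<rho> > 0" "\<And>t. 0 < t \<Longrightarrow> t < \<rho> \<Longrightarrow> \<bar>t * d\<bar> \<le> C * t\<^sup>2"
  shows "d = 0"
proof (rule ccontr)
  assume d: "d \<noteq> 0"
  define t where "t = min (\<rho> / 2) (\<bar>d\<bar> / (2 * (\<bar>C\<bar> + 1)))"
  have "t \<le> \<rho> / 2" unfolding t_def by (rule min.cobounded1)
  then have t: "0 < t" "t < \<rho>" using assms(1) d by (simp_all add: t_def)
  have "t * \<bar>d\<bar> \<le> t * (C * t)" using assms(2)[OF t] t by (simp add: abs_mult power2_eq_square mult.left_commute)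
  then have "\<bar>d\<bar> \<le> C * t" using t by simp
  also have "\<dots> \<le> (\<bar>C\<bar> + 1) * (\<bar>d\<bar> / (2 * (\<bar>C\<bar> + 1)))"
    using t by (intro mult_mono) (auto simp: t_def)
  also have "\<dots> = \<bar>d\<bar> / 2"
  proof -
    have "\<bar>C\<bar> + 1 \<noteq> 0" by linarith
    then show ?thesis by (simp add: divide_simps)
  qed
  finally show False using d by simp
qed

text \<open>Directional derivatives exist by \<open>limit_of_quotients\<close>, and since their
  error is quadratic, homogeneity and additivity can be tested on small increments. Only end points
  in \<open>\<Omega>\<close> are compared, never segments, so the Taylor estimate holds for all
  pairs of points even if \<open>\<Omega>\<close> is not convex.\<close>

lemma gradient_from_quotients:
  fixes g :: "'a::euclidean_space \<Rightarrow> real"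
  assumes \<Omega>: "open \<Omega>" and L: "L \<ge> 0"
    and Lip: "\<And>x y. x \<in> \<Omega> \<Longrightarrow> y \<in> \<Omega> \<Longrightarrow> \<bar>g x - g y\<bar> \<le> L * norm (x - y)"
    and Q: "\<And>x e t r. t \<noteq> 0 \<Longrightarrow> r \<noteq> 0 \<Longrightarrow> x \<in> \<Omega> \<Longrightarrow> x + t *\<^sub>R e \<in> \<Omega> \<Longrightarrow> x + r *\<^sub>R e \<in> \<Omega> \<Longrightarrow>
      \<bar>(g (x + t *\<^sub>R e) - g x) / t - (g (x + r *\<^sub>R e) - g x) / r\<bar> \<le> L * (norm e)\<^sup>2 * (\<bar>t\<bar> + \<bar>r\<bar>)"
  shows "\<exists>grad. \<forall>x\<in>\<Omega>. norm (grad x) \<le> L \<and> (\<forall>y\<in>\<Omega>. \<bar>g y - g x - grad x \<bullet> (y - x)\<bar> \<le> L * (norm (y - x))\<^sup>2)"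
proof -
  have "\<exists>v. norm v \<le> L \<and> (\<forall>y\<in>\<Omega>. \<bar>g y - g x - v \<bullet> (y - x)\<bar> \<le> L * (norm (y - x))\<^sup>2)" if x: "x \<in> \<Omega>" for x
  proof -
    obtain \<rho> where \<rho>: "\<rho> > 0" "ball x \<rho> \<subseteq> \<Omega>" using \<Omega> x open_contains_ball by blast
    have inb: "x + t *\<^sub>R e \<in> \<Omega>" if "\<bar>t\<bar> < \<rho> / (norm e + 1)" for t e
    proof -
      have "\<bar>t\<bar> * norm e \<le> \<bar>t\<bar> * (norm e + 1)" by (intro mult_left_mono) auto
      also have "\<dots> < \<rho>" using that by (simp add: pos_less_divide_eq add_nonneg_pos)
      finally show ?thesis using \<rho>(2) by (auto simp: dist_norm)
    qed
    define isD where "isD = (\<lambda>e d. \<forall>t. t \<noteq> 0 \<longrightarrow> x + t *\<^sub>R e \<in> \<Omega> \<longrightarrow> \<bar>(g (x + t *\<^sub>R e) - g x) / t - d\<bar> \<le> (L * (norm e)\<^sup>2) * \<bar>t\<bar>)"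
    have exD: "\<exists>d. isD e d" for e
      unfolding isD_def
    proof (rule limit_of_quotients[of "\<rho> / (norm e + 1)"])
      show "0 < \<rho> / (norm e + 1)" using \<rho>(1) by (simp add: add_nonneg_pos)
    qed (use L Q[OF _ _ x] inb in auto)
    define D where "D = (\<lambda>e. SOME d. isD e d)"
    have "isD e (D e)" for e unfolding D_def by (rule someI_ex[OF exD])
    then have D: "\<bar>(g (x + t *\<^sub>R e) - g x) / t - D e\<bar> \<le> (L * (norm e)\<^sup>2) * \<bar>t\<bar>" if "t \<noteq> 0" "x + t *\<^sub>R e \<in> \<Omega>" for e t
      using that unfolding isD_def by simp
    have D': "\<bar>g (x + t *\<^sub>R e) - g x - t * D e\<bar> \<le> L * (norm e)\<^sup>2 * t\<^sup>2" if "x + t *\<^sub>R e \<in> \<Omega>" for e t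
    proof (cases "t = 0")
      case False
      have "g (x + t *\<^sub>R e) - g x - t * D e = t * ((g (x + t *\<^sub>R e) - g x) / t - D e)"
        using False by (subst right_diff_distrib) simp
      then have "\<bar>g (x + t *\<^sub>R e) - g x - t * D e\<bar> = \<bar>t\<bar> * \<bar>(g (x + t *\<^sub>R e) - g x) / t - D e\<bar>"
        by (simp add: abs_mult)
      also have "\<dots> \<le> \<bar>t\<bar> * ((L * (norm e)\<^sup>2) * \<bar>t\<bar>)" using D[OF False that] by (intro mult_left_mono) auto
      also have "\<dots> = L * (norm e)\<^sup>2 * t\<^sup>2" by (simp add: power2_eq_square)
      finally show ?thesis .
    qed simp
    have diff_bound: "\<bar>p - q\<bar> \<le> a + b" if "\<bar>p\<bar> \<le> a" "\<bar>q\<bar> \<le> b" for p q a b :: real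
      using that by linarith
    have scale: "D (s *\<^sub>R e) = s * D e" for s e
    proof -
      have "D (s *\<^sub>R e) - s * D e = 0"
      proof (rule small_quadratic_eq_0)
        let ?\<rho> = "\<rho> / (norm (s *\<^sub>R e) + 1)"
        show "?\<rho> > 0" using \<rho>(1) by (simp add: add_nonneg_pos)
        fix t :: real assume t: "0 < t" "t < ?\<rho>"
        then have i: "x + t *\<^sub>R (s *\<^sub>R e) \<in> \<Omega>" by (intro inb) simp
        have "\<bar>t * (D (s *\<^sub>R e) - s * D e)\<bar> =
          \<bar>(g (x + (t * s) *\<^sub>R e) - g x - (t * s) * D e) - (g (x + t *\<^sub>R (s *\<^sub>R e)) - g x - t * D (s *\<^sub>R e))\<bar>"
          by (simp add: algebra_simps)
        also have "\<dots> \<le> L * (norm e)\<^sup>2 * (t * s)\<^sup>2 + L * (norm (s *\<^sub>R e))\<^sup>2 * t\<^sup>2"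
          using D'[OF i] D'[of "t * s" e] i by (intro diff_bound) simp_all
        also have "\<dots> = (L * (norm e)\<^sup>2 * s\<^sup>2 + L * (norm (s *\<^sub>R e))\<^sup>2) * t\<^sup>2"
          by (simp add: power_mult_distrib algebra_simps)
        finally show "\<bar>t * (D (s *\<^sub>R e) - s * D e)\<bar> \<le> (L * (norm e)\<^sup>2 * s\<^sup>2 + L * (norm (s *\<^sub>R e))\<^sup>2) * t\<^sup>2" .
      qed
      then show ?thesis by simp
    qed
    have add: "D (e1 + e2) = D e1 + D e2" for e1 e2
    proof -
      \<comment> \<open>Then \<open>e1 = m + w\<close> and \<open>e2 = m - w\<close>: the assumption
        at \<open>x + t *\<^sub>R m\<close> with increments 1 and -1 bounds a symmetric second
        difference and thereby \<open>D e1 + D e2 - 2 * D m\<close>.\<close>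
      define m where "m = (1/2) *\<^sub>R (e1 + e2)"
      define w where "w = (1/2) *\<^sub>R (e1 - e2)"
      define C where "C = 2 * (L * (norm w)\<^sup>2) + 2 * (L * (norm m)\<^sup>2) + L * (norm e1)\<^sup>2 + L * (norm e2)\<^sup>2"
      have "D e1 + D e2 - 2 * D m = 0"
      proof (rule small_quadratic_eq_0)
        let ?\<rho> = "min (\<rho> / (norm m + 1)) (min (\<rho> / (norm e1 + 1)) (\<rho> / (norm e2 + 1)))"
        show "?\<rho> > 0" using \<rho>(1) by (simp add: add_nonneg_pos)
        fix t :: real assume t: "0 < t" "t < ?\<rho>"
        then have i: "x + t *\<^sub>R m \<in> \<Omega>" "x + t *\<^sub>R e1 \<in> \<Omega>" "x + t *\<^sub>R e2 \<in> \<Omega>" by (auto intro!: inb)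
        have mw: "m + w = e1" "m - w = e2"
          by (simp_all add: m_def w_def scaleR_add_right[symmetric] scaleR_diff_right[symmetric] scaleR_2[symmetric])
        have eqs: "(x + t *\<^sub>R m) + 1 *\<^sub>R (t *\<^sub>R w) = x + t *\<^sub>R e1" "(x + t *\<^sub>R m) + (-1) *\<^sub>R (t *\<^sub>R w) = x + t *\<^sub>R e2"
          by (simp_all add: mw[symmetric] algebra_simps)
        have "\<bar>(g (x + t *\<^sub>R e1) - g (x + t *\<^sub>R m)) / 1 - (g (x + t *\<^sub>R e2) - g (x + t *\<^sub>R m)) / (-1)\<bar> \<le> L * (norm (t *\<^sub>R w))\<^sup>2 * (\<bar>1\<bar> + \<bar>-1\<bar>)"
          using Q[of 1 "-1" "x + t *\<^sub>R m" "t *\<^sub>R w"] i unfolding eqs by simp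
        then have "\<bar>g (x + t *\<^sub>R e1) + g (x + t *\<^sub>R e2) - 2 * g (x + t *\<^sub>R m)\<bar> \<le> 2 * (L * (norm w)\<^sup>2) * t\<^sup>2"
          by (simp add: power_mult_distrib algebra_simps)
        moreover have comb: "\<bar>p1 + p2 - 2 * p0\<bar> \<le> a + 2 * b0 + b1 + b2"
          if "\<bar>q1 + q2 - 2 * q0\<bar> \<le> a" "\<bar>q0 - q - p0\<bar> \<le> b0" "\<bar>q1 - q - p1\<bar> \<le> b1" "\<bar>q2 - q - p2\<bar> \<le> b2"
          for p0 p1 p2 q q0 q1 q2 a b0 b1 b2 :: real
          using that by linarith
        ultimately have "\<bar>t * D e1 + t * D e2 - 2 * (t * D m)\<bar> \<le> 2 * (L * (norm w)\<^sup>2) * t\<^sup>2 + 2 * (L * (norm m)\<^sup>2 * t\<^sup>2) + L * (norm e1)\<^sup>2 * t\<^sup>2 + L * (norm e2)\<^sup>2 * t\<^sup>2"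
          by (intro comb[OF _ D'[OF i(1)] D'[OF i(2)] D'[OF i(3)]])
        then show "\<bar>t * (D e1 + D e2 - 2 * D m)\<bar> \<le> C * t\<^sup>2"
          by (simp add: C_def algebra_simps)
      qed
      moreover have "D (2 *\<^sub>R m) = 2 * D m" by (rule scale)
      moreover have "2 *\<^sub>R m = e1 + e2" by (simp add: m_def)
      ultimately show ?thesis by simp
    qed
    have lin: "linear D" by (rule linearI) (auto simp: add scale)
    define v where "v = (\<Sum>b\<in>Basis. D b *\<^sub>R b)"
    have Dv: "D e = v \<bullet> e" for e
    proof -
      have "D e = D (\<Sum>b\<in>Basis. (e \<bullet> b) *\<^sub>R b)" by (simp add: euclidean_representation)
      also have "\<dots> = (\<Sum>b\<in>Basis. (e \<bullet> b) * D b)" using lin by (simp add: linear_sum linear_scale)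
      also have "\<dots> = v \<bullet> e" by (simp add: v_def inner_sum_left inner_sum_right mult.commute inner_commute[of e])
      finally show ?thesis .
    qed
    have ineq: "\<bar>g y - g x - v \<bullet> (y - x)\<bar> \<le> L * (norm (y - x))\<^sup>2" if "y \<in> \<Omega>" for y
      using D'[of 1 "y - x"] that by (simp add: Dv)
    have "norm v \<le> L"
    proof (rule ccontr)
      assume nv: "\<not> norm v \<le> L"
      \<comment> \<open>In the direction \<open>v\<close> itself the slope is
        \<open>(norm v)\<^sup>2\<close>, while the Lipschitz bound allows no more than
        \<open>L * norm v\<close>.\<close>
      have "(norm v - L) * norm v = 0"
      proof (rule small_quadratic_eq_0)
        show "\<rho> / (norm v + 1) > 0" using \<rho>(1) by (simp add: add_nonneg_pos)
        fix t :: real assume t: "0 < t" "t < \<rho> / (norm v + 1)"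
        then have i: "x + t *\<^sub>R v \<in> \<Omega>" by (intro inb) simp
        have "\<bar>g (x + t *\<^sub>R v) - g x\<bar> \<le> L * (t * norm v)" using Lip[OF i x] t by simp
        moreover have "D v = norm v * norm v" by (simp add: Dv power2_norm_eq_inner[symmetric] power2_eq_square)
        then have "t * ((norm v - L) * norm v) = t * D v - L * (t * norm v)" by (simp add: algebra_simps)
        ultimately have "t * ((norm v - L) * norm v) \<le> L * (norm v)\<^sup>2 * t\<^sup>2"
          using D'[OF i] by linarith
        moreover have "0 \<le> t * ((norm v - L) * norm v)" using t nv by simp
        ultimately show "\<bar>t * ((norm v - L) * norm v)\<bar> \<le> L * (norm v)\<^sup>2 * t\<^sup>2" by simp
      qed
      then show False using nv L by auto
    qed
    with ineq show ?thesis by blast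
  qed
  then have "\<forall>x\<in>\<Omega>. \<exists>v. norm v \<le> L \<and> (\<forall>y\<in>\<Omega>. \<bar>g y - g x - v \<bullet> (y - x)\<bar> \<le> L * (norm (y - x))\<^sup>2)" by simp
  from bchoice[OF this] show ?thesis .
qed

text \<open>The Taylor estimates from \<open>x\<close> and from \<open>y\<close> are compared at
  \<open>y + h\<close>, where \<open>h\<close> has the length of \<open>y - x\<close> and the
  direction of the gradient difference. The three remainders contribute 1, 4 and 1, hence the factor
  6. The radius \<open>\<rho> / 2\<close> keeps \<open>y + h\<close> inside the ball.\<close>

lemma gradient_Lipschitz:
  fixes g :: "'a::euclidean_space \<Rightarrow> real"
  assumes L: "L \<ge> 0"
    and D: "\<And>x y. x \<in> \<Omega> \<Longrightarrow> y \<in> \<Omega> \<Longrightarrow> \<bar>g y - g x - grad x \<bullet> (y - x)\<bar> \<le> L * (norm (y - x))\<^sup>2"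
    and x: "ball x \<rho> \<subseteq> \<Omega>" and y: "norm (y - x) < \<rho> / 2"
  shows "norm (grad y - grad x) \<le> 6 * L * norm (y - x)"
proof (cases "grad y = grad x \<or> y = x")
  case False
  define n where "n = norm (y - x)"
  have n: "n > 0" using False by (simp add: n_def)
  define h where "h = (n / norm (grad y - grad x)) *\<^sub>R (grad y - grad x)"
  have h: "norm h = n" using False n by (simp add: h_def)
  have \<rho>: "\<rho> > 0" using y norm_ge_zero[of "y - x"] by linarith
  have m: "norm (y + h - x) \<le> 2 * n" using norm_triangle_ineq[of "y - x" h] by (simp add: h n_def algebra_simps)
  have "x \<in> \<Omega>" using x \<rho> by auto
  moreover have "y \<in> \<Omega>"
    by (rule subsetD[OF x]) (use y \<rho> in \<open>auto simp: dist_norm norm_minus_commute\<close>)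
  moreover have "y + h \<in> \<Omega>"
    by (rule subsetD[OF x]) (use m y in \<open>auto simp: dist_norm norm_minus_commute n_def\<close>)
  ultimately have
    "\<bar>g (y + h) - g y - grad y \<bullet> h\<bar> \<le> L * n\<^sup>2" "\<bar>g (y + h) - g x - grad x \<bullet> (y + h - x)\<bar> \<le> L * (norm (y + h - x))\<^sup>2"
    "\<bar>g y - g x - grad x \<bullet> (y - x)\<bar> \<le> L * n\<^sup>2"
    using D[of y "y + h"] D[of x "y + h"] D[of x y] by (auto simp: h n_def)
  moreover have "L * (norm (y + h - x))\<^sup>2 \<le> L * (2 * n)\<^sup>2"
    using m L by (intro mult_left_mono power_mono) auto
  moreover have "grad x \<bullet> (y + h - x) = grad x \<bullet> (y - x) + grad x \<bullet> h" by (simp add: inner_add_right inner_diff_right)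
  ultimately have "(grad y - grad x) \<bullet> h \<le> 6 * L * n\<^sup>2"
    by (simp add: inner_diff_left power_mult_distrib abs_le_iff)
  moreover have "(grad y - grad x) \<bullet> h = n * norm (grad y - grad x)"
    using False by (simp add: h_def power2_norm_eq_inner[symmetric] power2_eq_square)
  ultimately show ?thesis using n by (simp add: power2_eq_square n_def[symmetric])
qed (use L in auto)

section \<open>The kernel near the diagonal\<close>

text \<open>The factor \<open>t\<close> in the one-sided derivative lets it extend to an odd
  function, which is the derivative of the even extension, including the point 0.\<close>

lemma DERIV_even_extension:
  fixes g :: "real \<Rightarrow> real"
  assumes d: "\<And>t. 0 \<le> t \<Longrightarrow> (g has_real_derivative t * k t) (at t within {0..})"
  shows "((\<lambda>t. g \<bar>t\<bar>) has_real_derivative t * k \<bar>t\<bar>) (at t)"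
proof -
  have right: "((\<lambda>t. g \<bar>t\<bar>) has_real_derivative t * k \<bar>t\<bar>) (at t within {0..})" if "0 \<le> t" for t
  proof -
    have "(g has_real_derivative t * k \<bar>t\<bar>) (at t within {0..})" using d[OF that] that by simp
    then show ?thesis by (rule has_field_derivative_transform_within[where d=1]) (use that in auto)
  qed
  have left: "((\<lambda>t. g \<bar>t\<bar>) has_real_derivative t * k \<bar>t\<bar>) (at t within {..0})" if "t \<le> 0" for t
  proof -
    have "(g \<circ> uminus has_real_derivative ((- t) * k (- t)) * (- 1)) (at t within {..0})"
    proof (rule DERIV_image_chain)
      have "uminus ` {..0::real} = {0..}" by auto
      then show "(g has_real_derivative (- t) * k (- t)) (at (- t) within uminus ` {..0})"
        using d[of "- t"] that by simp
      show "(uminus has_real_derivative - 1) (at t within {..0})" by (auto intro!: derivative_eq_intros)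
    qed
    then have "(g \<circ> uminus has_real_derivative t * k \<bar>t\<bar>) (at t within {..0})" using that by simp
    then show ?thesis by (rule has_field_derivative_transform_within[where d=1]) (use that in auto)
  qed
  consider "t > 0" | "t < 0" | "t = 0" by linarith
  then show ?thesis
  proof cases
    case 1
    then have "at t within {0..} = at t" by (intro at_within_interior) auto
    then show ?thesis using right[of t] 1 by simp
  next
    case 2
    then have "at t within {..0} = at t" by (intro at_within_interior) auto
    then show ?thesis using left[of t] 2 by simp
  next
    case 3
    have "((\<lambda>y. (g \<bar>y\<bar> - g \<bar>0\<bar>) / (y - 0)) \<longlongrightarrow> 0) (at 0 within {0..} \<union> {..0})"
      unfolding Lim_within_Un using right[of 0] left[of 0] by (simp add: has_field_derivative_iff)
    moreover have "{0..} \<union> {..0::real} = UNIV" by auto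
    ultimately show ?thesis using 3 by (simp add: has_field_derivative_iff)
  qed
qed

lemma wendland_even_DERIV:
  assumes "l > 0" "c > 0"
  shows "((\<lambda>t. wendland l (Suc k) (c * \<bar>t\<bar>)) has_real_derivative - (c\<^sup>2 * t * wendland l k (c * \<bar>t\<bar>))) (at t)"
proof -
  have "((\<lambda>t. wendland l (Suc k) (c * t)) has_real_derivative t * (- (c\<^sup>2) * wendland l k (c * t))) (at t within {0..})" if "0 \<le> t" for t
  proof -
    have "(wendland l (Suc k) \<circ> (*) c has_real_derivative (- ((c * t) * wendland l k (c * t))) * c) (at t within {0..})"
    proof (rule DERIV_image_chain)
      have "(*) c ` {0..} \<subseteq> {0..}" using assms by auto
      then show "(wendland l (Suc k) has_real_derivative - ((c * t) * wendland l k (c * t))) (at (c * t) within (*) c ` {0..})"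
        using assms that by (intro DERIV_subset[OF wendland_DERIV]) auto
      show "((*) c has_real_derivative c) (at t within {0..})" by (auto intro!: derivative_eq_intros)
    qed
    then show ?thesis by (simp add: comp_def power2_eq_square mult_ac del: wendland.simps)
  qed
  from DERIV_even_extension[where g="\<lambda>t. wendland l (Suc k) (c * t)" and k="\<lambda>t. - (c\<^sup>2) * wendland l k (c * t)", OF this]
  show ?thesis by (simp add: mult_ac del: wendland.simps)
qed

lemma wendland_bounded:
  assumes "l > 0"
  shows "\<exists>B\<ge>0. \<forall>r\<ge>0. \<bar>wendland l k r\<bar> \<le> B"
proof -
  have "compact (wendland l k ` {0..1})"
    by (intro compact_continuous_image continuous_on_subset[OF wendland_continuous[OF assms]]) auto
  then obtain B where B: "\<forall>y\<in>wendland l k ` {0..1}. norm y \<le> B" using compact_imp_bounded bounded_iff by metis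
  have "\<bar>wendland l k r\<bar> \<le> max B 0" if "0 \<le> r" for r
    using B that wendland_outside[OF assms, of r k] by (cases "r \<le> 1") (auto intro: le_max_iff_disj[THEN iffD2])
  then show ?thesis by (intro exI[of _ "max B 0"]) auto
qed

text \<open>Fourth-order information at the origin. Each derivative lowers the smoothness index by
  one, so \<open>Suc (Suc k)\<close> admits the two steps used here. The quadratic part is split off
  because it cancels in \<open>three_point_form\<close>; what counts is that \<open>q\<close> has
  order four and that its mixed difference has a factor
  \<open>\<bar>t\<bar> * \<bar>r\<bar>\<close>.\<close>

lemma wendland_profile:
  assumes l: "l > 0" and c: "c > 0"
  shows "\<exists>a D. 0 \<le> D \<and> (\<forall>t. \<bar>wendland l (Suc (Suc k)) (c * \<bar>t\<bar>) - wendland l (Suc (Suc k)) 0\<bar> \<le> D * t\<^sup>2) \<and>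
     (\<exists>q. (\<forall>t. wendland l (Suc (Suc k)) (c * \<bar>t\<bar>) = wendland l (Suc (Suc k)) 0 - a * t\<^sup>2 + q t) \<and>
       (\<forall>t. \<bar>q t\<bar> \<le> D * t ^ 4) \<and> (\<forall>t r. \<bar>q (t - r) - q t - q r\<bar> \<le> D * (\<bar>t\<bar> * \<bar>r\<bar> * (\<bar>t\<bar> + \<bar>r\<bar>)\<^sup>2)))"
proof -
  define p where "p = (\<lambda>t. wendland l (Suc (Suc k)) (c * \<bar>t\<bar>))"
  define p1 where "p1 = (\<lambda>t. wendland l (Suc k) (c * \<bar>t\<bar>))"
  define p2 where "p2 = (\<lambda>t. wendland l k (c * \<bar>t\<bar>))"
  have dp: "(p has_real_derivative - (c\<^sup>2 * t * p1 t)) (at t within S)" for t S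
    unfolding p_def p1_def by (rule has_field_derivative_at_within[OF wendland_even_DERIV[OF l c]])
  have dp1: "(p1 has_real_derivative - (c\<^sup>2 * t * p2 t)) (at t within S)" for t S
    unfolding p1_def p2_def by (rule has_field_derivative_at_within[OF wendland_even_DERIV[OF l c]])
  obtain B1 where B1': "B1 \<ge> 0" "\<forall>r\<ge>0. \<bar>wendland l (Suc k) r\<bar> \<le> B1"
    using wendland_bounded[OF l, of "Suc k"] by blast
  obtain B2 where B2': "B2 \<ge> 0" "\<forall>r\<ge>0. \<bar>wendland l k r\<bar> \<le> B2"
    using wendland_bounded[OF l, of k] by blast
  have B1: "B1 \<ge> 0" "\<bar>p1 t\<bar> \<le> B1" and B2: "B2 \<ge> 0" "\<bar>p2 t\<bar> \<le> B2" for t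
    using B1' B2' c by (simp_all add: p1_def p2_def del: wendland.simps)
  have mvt: "\<bar>F x - F y\<bar> \<le> B * \<bar>x - y\<bar>"
    if "\<And>t. (F has_real_derivative F' t) (at t)" "\<And>t. \<bar>t\<bar> \<le> m \<Longrightarrow> \<bar>F' t\<bar> \<le> B" "\<bar>x\<bar> \<le> m" "\<bar>y\<bar> \<le> m"
    for F F' :: "real \<Rightarrow> real" and B m x y
    using field_differentiable_bound[of "{- m..m}" F F' B x y] that
    by (auto simp: abs_le_iff intro: has_field_derivative_at_within)
  have p1_diff: "\<bar>p1 t - p1 0\<bar> \<le> c\<^sup>2 * B2 * t\<^sup>2" for t
  proof -
    have "\<bar>p1 t - p1 0\<bar> \<le> (c\<^sup>2 * \<bar>t\<bar> * B2) * \<bar>t - 0\<bar>"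
      by (rule mvt[OF dp1, of "\<bar>t\<bar>"]) (auto simp: abs_mult intro!: mult_mono B2)
    then show ?thesis by (simp add: power2_eq_square mult_ac)
  qed
  define D0 where "D0 = 2 * c ^ 4 * B2"
  have D0: "D0 \<ge> 0" using B2 by (simp add: D0_def)
  \<comment> \<open>Minus one half of the second derivative of \<open>p\<close> at 0.\<close>
  define a where "a = c\<^sup>2 * p1 0 / 2"
  define q where "q = (\<lambda>t. p t - p 0 + a * t\<^sup>2)"
  define q1 where "q1 = (\<lambda>t. - (c\<^sup>2 * t * p1 t) + 2 * a * t)"
  define q2 where "q2 = (\<lambda>t. - (c\<^sup>2 * p1 t) + c\<^sup>2 * t * (c\<^sup>2 * t * p2 t) + 2 * a)"
  have dq: "(q has_real_derivative q1 t) (at t)" for t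
    unfolding q_def q1_def by (auto intro!: derivative_eq_intros dp)
  have dq1: "(q1 has_real_derivative q2 t) (at t)" for t
    unfolding q1_def q2_def by (auto intro!: derivative_eq_intros dp1 simp: algebra_simps)
  have q2: "\<bar>q2 t\<bar> \<le> D0 * t\<^sup>2" for t
  proof -
    have "q2 t = - (c\<^sup>2) * (p1 t - p1 0) + c ^ 4 * t\<^sup>2 * p2 t"
      by (simp add: q2_def a_def algebra_simps power2_eq_square power4_eq_xxxx)
    also have "\<bar>\<dots>\<bar> \<le> c\<^sup>2 * \<bar>p1 t - p1 0\<bar> + c ^ 4 * t\<^sup>2 * \<bar>p2 t\<bar>"
      by (intro order_trans[OF abs_triangle_ineq] add_mono) (simp_all add: abs_mult)
    also have "\<dots> \<le> c\<^sup>2 * (c\<^sup>2 * B2 * t\<^sup>2) + c ^ 4 * t\<^sup>2 * B2"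
      by (intro add_mono mult_left_mono p1_diff B2) auto
    also have "\<dots> = D0 * t\<^sup>2" by (simp add: D0_def power2_eq_square power4_eq_xxxx algebra_simps)
    finally show ?thesis .
  qed
  have q1_diff: "\<bar>q1 x - q1 y\<bar> \<le> D0 * m\<^sup>2 * \<bar>x - y\<bar>" if "\<bar>x\<bar> \<le> m" "\<bar>y\<bar> \<le> m" for x y m
    by (rule mvt[OF dq1 _ that]) (auto intro!: order_trans[OF q2] mult_left_mono D0 simp: abs_le_square_iff[symmetric])
  have q1: "\<bar>q1 t\<bar> \<le> D0 * t\<^sup>2 * \<bar>t\<bar>" for t
    using q1_diff[of t "\<bar>t\<bar>" 0] by (simp add: q1_def)
  have q0: "\<bar>q t\<bar> \<le> D0 * t ^ 4" for t
  proof -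
    have "\<bar>q t - q 0\<bar> \<le> (D0 * t\<^sup>2 * \<bar>t\<bar>) * \<bar>t - 0\<bar>"
    proof (rule mvt[OF dq, of "\<bar>t\<bar>"])
      fix s assume "\<bar>s\<bar> \<le> \<bar>t\<bar>"
      then have "D0 * s\<^sup>2 * \<bar>s\<bar> \<le> D0 * t\<^sup>2 * \<bar>t\<bar>"
        using D0 by (intro mult_mono mult_left_mono) (auto simp: abs_le_square_iff[symmetric])
      with q1[of s] show "\<bar>q1 s\<bar> \<le> D0 * t\<^sup>2 * \<bar>t\<bar>" by linarith
    qed auto
    then show ?thesis by (simp add: q_def power2_eq_square power4_eq_xxxx mult_ac)
  qed
  have qmixed: "\<bar>q (t - r) - q t - q r\<bar> \<le> D0 * (\<bar>t\<bar> * \<bar>r\<bar> * (\<bar>t\<bar> + \<bar>r\<bar>)\<^sup>2)" for t r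
  proof -
    let ?z = "\<lambda>s. q (s - r) - q s" and ?m = "\<bar>t\<bar> + \<bar>r\<bar>"
    have "((\<lambda>s. q (s - r)) has_real_derivative q1 (s - r)) (at s)" for s
    proof -
      have "((\<lambda>s. s - r) has_real_derivative 1) (at s)" by (auto intro!: derivative_eq_intros)
      from DERIV_chain2[OF dq this] show ?thesis by simp
    qed
    then have dz: "(?z has_real_derivative q1 (s - r) - q1 s) (at s)" for s
      by (intro DERIV_diff dq)
    have "\<bar>?z t - ?z 0\<bar> \<le> (D0 * ?m\<^sup>2 * \<bar>r\<bar>) * \<bar>t - 0\<bar>"
    proof (rule mvt[OF dz, of "\<bar>t\<bar>"])
      fix s assume "\<bar>s\<bar> \<le> \<bar>t\<bar>"
      then show "\<bar>q1 (s - r) - q1 s\<bar> \<le> D0 * ?m\<^sup>2 * \<bar>r\<bar>" using q1_diff[of "s - r" ?m s] by simp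
    qed auto
    moreover have "?z 0 = q r" by (simp add: q_def p_def)
    ultimately show ?thesis by (simp add: mult_ac)
  qed
  define D where "D = D0 + c\<^sup>2 * B1"
  have D: "D0 \<le> D" "0 \<le> D" "c\<^sup>2 * B1 \<le> D" using D0 B1 by (auto simp: D_def)
  have p_diff: "\<bar>p t - p 0\<bar> \<le> D * t\<^sup>2" for t
  proof -
    have "\<bar>p t - p 0\<bar> \<le> (c\<^sup>2 * \<bar>t\<bar> * B1) * \<bar>t - 0\<bar>"
      by (rule mvt[OF dp, of "\<bar>t\<bar>"]) (auto simp: abs_mult intro!: mult_mono B1)
    also have "\<dots> = (c\<^sup>2 * B1) * t\<^sup>2" by (simp add: power2_eq_square mult_ac)
    also have "\<dots> \<le> D * t\<^sup>2" using D by (intro mult_right_mono) auto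
    finally show ?thesis .
  qed
  have e: "\<bar>q t\<bar> \<le> D * t ^ 4" for t
    using q0[of t] mult_right_mono[OF D(1), of "t ^ 4"] by simp
  have f: "\<bar>q (t - r) - q t - q r\<bar> \<le> D * (\<bar>t\<bar> * \<bar>r\<bar> * (\<bar>t\<bar> + \<bar>r\<bar>)\<^sup>2)" for t r
    using qmixed[of t r] mult_right_mono[OF D(1), of "\<bar>t\<bar> * \<bar>r\<bar> * (\<bar>t\<bar> + \<bar>r\<bar>)\<^sup>2"] by simp
  have p0: "p 0 = wendland l (Suc (Suc k)) 0" by (simp add: p_def del: wendland.simps)
  show ?thesis
    unfolding p0[symmetric] p_def[symmetric]
  proof (rule exI[of _ a], rule exI[of _ D], intro conjI allI exI[of _ q])
    show "wendland l (Suc (Suc k)) (c * \<bar>t\<bar>) = p 0 - a * t\<^sup>2 + q t" for t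
      by (simp add: q_def p_def del: wendland.simps)
    show "\<bar>wendland l (Suc (Suc k)) (c * \<bar>t\<bar>) - p 0\<bar> \<le> D * t\<^sup>2" for t
      using p_diff[of t] by (simp add: p_def del: wendland.simps)
  qed (use D e f in auto)
qed

text \<open>The coefficients \<open>1 / t\<close>, \<open>- (1 / r)\<close> and
  \<open>- (1 / t - 1 / r)\<close> at the points \<open>t\<close>, \<open>r\<close> and 0 annihilate
  affine functions. Therefore the constant and the quadratic part of the kernel drop out of its
  form, and only the remainder of order four is left.\<close>

lemma three_point_form:
  fixes t r n a p0 q01 q02 q12 :: real
  assumes "t \<noteq> 0" "r \<noteq> 0"
  shows "p0 * ((1 / t)\<^sup>2 + (1 / r)\<^sup>2 + (1 / t - 1 / r)\<^sup>2)
     - 2 * (1 / t) * (1 / r) * (p0 - a * ((t - r) * n)\<^sup>2 + q01)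
     - 2 * (1 / t) * (1 / t - 1 / r) * (p0 - a * (t * n)\<^sup>2 + q02)
     + 2 * (1 / r) * (1 / t - 1 / r) * (p0 - a * (r * n)\<^sup>2 + q12)
   = - 2 * (q01 - q02 - q12) / (t * r) - 2 * q02 / t\<^sup>2 - 2 * q12 / r\<^sup>2"
  using assms by (simp add: divide_simps) (simp add: algebra_simps power2_eq_square)

text \<open>In \<open>evaluation_bound\<close>, one point yields the bound on values, two points the
  Lipschitz bound, and a difference of two difference quotients the second-order bound. The function
  enters only through its norm, which is the source of all uniformity in the collocation
  set.\<close>

theorem rkhs_wendland_C11:
  fixes \<Omega> :: "(real^'n) set"
  assumes rk: "rkhs \<Omega> (wendland_kernel (Suc (Suc k)) c) H ip" and c: "c > 0" and \<Omega>: "open \<Omega>"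
  shows "\<exists>L\<ge>0. \<forall>g\<in>H. \<exists>grad. \<forall>x\<in>\<Omega>. \<bar>g x\<bar> \<le> L * sqrt (ip g g) \<and> norm (grad x) \<le> L * sqrt (ip g g) \<and>
     (\<forall>y\<in>\<Omega>. \<bar>g y - g x - grad x \<bullet> (y - x)\<bar> \<le> L * sqrt (ip g g) * (norm (y - x))\<^sup>2)"
proof -
  interpret reproducing_kernel_space \<Omega> "wendland_kernel (Suc (Suc k)) c" H ip by standard (rule rk)
  define l where "l = CARD('n) div 2 + Suc (Suc k) + 1"
  have l: "l > 0" by (simp add: l_def)
  define p where "p = (\<lambda>s. wendland l (Suc (Suc k)) (c * \<bar>s\<bar>))"
  define p0 where "p0 = wendland l (Suc (Suc k)) 0"
  obtain a D q where D: "0 \<le> D" "\<And>t. \<bar>p t - p0\<bar> \<le> D * t\<^sup>2" "\<And>t. p t = p0 - a * t\<^sup>2 + q t"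
    "\<And>t. \<bar>q t\<bar> \<le> D * t ^ 4" "\<And>t r. \<bar>q (t - r) - q t - q r\<bar> \<le> D * (\<bar>t\<bar> * \<bar>r\<bar> * (\<bar>t\<bar> + \<bar>r\<bar>)\<^sup>2)"
    using wendland_profile[OF l c, of k] unfolding p_def p0_def by (elim exE conjE) blast
  have K: "wendland_kernel (Suc (Suc k)) c x y = p (norm (x - y))" for x y :: "real^'n"
    by (simp add: wendland_kernel_def p_def l_def del: wendland.simps)
  have p00: "p 0 = p0" by (simp add: p_def p0_def del: wendland.simps)
  have p0_nn: "p0 \<ge> 0" unfolding p0_def by (rule wendland_nonneg[OF l]) simp
  have p_even: "p (- s) = p s" for s by (simp add: p_def del: wendland.simps)
  define L where "L = sqrt p0 + sqrt (2 * D) + sqrt (6 * D)"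
  have L: "L \<ge> 0" "sqrt p0 \<le> L" "sqrt (2 * D) \<le> L" "sqrt (6 * D) \<le> L"
    using p0_nn D(1) by (auto simp: L_def)
  have "\<exists>grad. \<forall>x\<in>\<Omega>. \<bar>g x\<bar> \<le> L * sqrt (ip g g) \<and> norm (grad x) \<le> L * sqrt (ip g g) \<and>
     (\<forall>y\<in>\<Omega>. \<bar>g y - g x - grad x \<bullet> (y - x)\<bar> \<le> L * sqrt (ip g g) * (norm (y - x))\<^sup>2)" if g: "g \<in> H" for g
  proof -
    define G where "G = sqrt (ip g g)"
    have G: "G \<ge> 0" "ip g g = G\<^sup>2" using ip_nonneg[OF g] by (auto simp: G_def)
    have root: "\<bar>y\<bar> \<le> L * G * z" if "y\<^sup>2 \<le> G\<^sup>2 * (B * z\<^sup>2)" "sqrt B \<le> L" "0 \<le> z" for y B z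
    proof -
      have "sqrt (y\<^sup>2) \<le> sqrt (G\<^sup>2 * (B * z\<^sup>2))" using that(1) by (rule real_sqrt_le_mono)
      then have "\<bar>y\<bar> \<le> sqrt B * (G * z)" using G(1) that(3) by (simp add: real_sqrt_mult mult_ac)
      also have "\<dots> \<le> L * (G * z)" using that G by (intro mult_right_mono) auto
      finally show ?thesis by (simp add: mult.assoc)
    qed
    have bnd: "\<bar>g x\<bar> \<le> L * G" if x: "x \<in> \<Omega>" for x
      using root[of "g x" p0 1] point_evaluation_bound[OF g x] L by (simp add: K p00 G(2))
    have Lip: "\<bar>g x - g y\<bar> \<le> L * G * norm (x - y)" if "x \<in> \<Omega>" "y \<in> \<Omega>" for x y
    proof (rule root[of _ "2 * D"])
      let ?X = "\<lambda>i::nat. if i = 0 then x else y" and ?a = "\<lambda>i::nat. if i = 0 then 1 else - 1 :: real"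
      have "(\<Sum>i\<in>{0,1}. ?a i * g (?X i))\<^sup>2 \<le> ip g g * (\<Sum>i\<in>{0,1}. \<Sum>j\<in>{0,1}. ?a i * ?a j * wendland_kernel (Suc (Suc k)) c (?X i) (?X j))"
        using that g by (intro evaluation_bound) auto
      then have "(g x - g y)\<^sup>2 \<le> G\<^sup>2 * (2 * (p0 - p (norm (x - y))))"
        by (simp add: K p00 norm_minus_commute[of y x] G(2))
      also have "\<dots> \<le> G\<^sup>2 * (2 * (D * (norm (x - y))\<^sup>2))"
        using D(2)[of "norm (x - y)"] by (intro mult_left_mono) auto
      finally show "(g x - g y)\<^sup>2 \<le> G\<^sup>2 * (2 * D * (norm (x - y))\<^sup>2)" by simp
    qed (use L in auto)
    have Q: "\<bar>(g (x + t *\<^sub>R e) - g x) / t - (g (x + r *\<^sub>R e) - g x) / r\<bar> \<le> L * G * (norm e)\<^sup>2 * (\<bar>t\<bar> + \<bar>r\<bar>)"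
      if tr: "t \<noteq> 0" "r \<noteq> 0" and i: "x \<in> \<Omega>" "x + t *\<^sub>R e \<in> \<Omega>" "x + r *\<^sub>R e \<in> \<Omega>" for x e t r
    proof -
      let ?y = "(g (x + t *\<^sub>R e) - g x) / t - (g (x + r *\<^sub>R e) - g x) / r"
      define n where "n = norm e"
      let ?X = "\<lambda>i::nat. if i = 0 then x + t *\<^sub>R e else if i = 1 then x + r *\<^sub>R e else x"
      let ?a = "\<lambda>i::nat. if i = 0 then 1 / t else if i = 1 then - (1 / r) else - (1 / t - 1 / r)"
      have "(\<Sum>i\<in>{0,1,2}. ?a i * g (?X i))\<^sup>2 \<le> ip g g * (\<Sum>i\<in>{0,1,2}. \<Sum>j\<in>{0,1,2}. ?a i * ?a j * wendland_kernel (Suc (Suc k)) c (?X i) (?X j))"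
        using i g by (intro evaluation_bound) auto
      moreover have "(\<Sum>i\<in>{0,1,2}. ?a i * g (?X i)) = ?y" by (simp add: diff_divide_distrib algebra_simps)
      moreover have "(\<Sum>i\<in>{0,1,2}. \<Sum>j\<in>{0,1,2}. ?a i * ?a j * wendland_kernel (Suc (Suc k)) c (?X i) (?X j))
        = p0 * ((1 / t)\<^sup>2 + (1 / r)\<^sup>2 + (1 / t - 1 / r)\<^sup>2)
          - 2 * (1 / t) * (1 / r) * p ((t - r) * n) - 2 * (1 / t) * (1 / t - 1 / r) * p (t * n)
          + 2 * (1 / r) * (1 / t - 1 / r) * p (r * n)"
      proof -
        have pn: "p (\<bar>s\<bar> * n) = p (s * n)" for s by (simp add: p_def n_def abs_mult del: wendland.simps)
        have k01: "wendland_kernel (Suc (Suc k)) c (x + t *\<^sub>R e) (x + r *\<^sub>R e) = p ((t - r) * n)"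
          and k10: "wendland_kernel (Suc (Suc k)) c (x + r *\<^sub>R e) (x + t *\<^sub>R e) = p ((t - r) * n)"
          and k02: "wendland_kernel (Suc (Suc k)) c (x + t *\<^sub>R e) x = p (t * n)"
          and k20: "wendland_kernel (Suc (Suc k)) c x (x + t *\<^sub>R e) = p (t * n)"
          and k12: "wendland_kernel (Suc (Suc k)) c (x + r *\<^sub>R e) x = p (r * n)"
          and k21: "wendland_kernel (Suc (Suc k)) c x (x + r *\<^sub>R e) = p (r * n)"
          and kd: "wendland_kernel (Suc (Suc k)) c z z = p0" for z :: "real^'n"
          using pn[of "t - r"] pn[of "r - t"] pn[of t] pn[of r] p_even[of "(t - r) * n"]
          by (simp_all add: K p00 scaleR_diff_left[symmetric] n_def[symmetric] minus_mult_left)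
        show ?thesis
          by (simp add: k01 k10 k02 k20 k12 k21 kd power2_eq_square) (simp add: algebra_simps diff_divide_distrib)
      qed
      ultimately have "?y\<^sup>2 \<le> G\<^sup>2 * (- 2 * (q ((t - r) * n) - q (t * n) - q (r * n)) / (t * r) - 2 * q (t * n) / t\<^sup>2 - 2 * q (r * n) / r\<^sup>2)"
        unfolding D(3)[of "(t - r) * n"] D(3)[of "t * n"] D(3)[of "r * n"] three_point_form[OF tr] G(2) by simp
      \<comment> \<open>The three remainders are each at most \<open>D * n ^ 4\<close> times the
        square of \<open>\<bar>t\<bar> + \<bar>r\<bar>\<close> and enter with the factor 2.\<close>
      also have "\<dots> \<le> G\<^sup>2 * (6 * D * (n\<^sup>2 * (\<bar>t\<bar> + \<bar>r\<bar>))\<^sup>2)"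
      proof (intro mult_left_mono)
        define m where "m = \<bar>t\<bar> + \<bar>r\<bar>"
        have n0: "n \<ge> 0" by (simp add: n_def)
        have b1: "\<bar>(q ((t - r) * n) - q (t * n) - q (r * n)) / (t * r)\<bar> \<le> D * n ^ 4 * m\<^sup>2"
        proof -
          have "\<bar>q (t * n - r * n) - q (t * n) - q (r * n)\<bar> \<le> D * (\<bar>t * n\<bar> * \<bar>r * n\<bar> * (\<bar>t * n\<bar> + \<bar>r * n\<bar>)\<^sup>2)" by (rule D(5))
          also have "\<dots> = (D * n ^ 4 * m\<^sup>2) * \<bar>t * r\<bar>"
            using n0 by (simp add: abs_mult m_def power2_eq_square power4_eq_xxxx algebra_simps)
          finally show ?thesis using tr by (simp add: left_diff_distrib abs_divide pos_divide_le_eq)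
        qed
        have b2: "\<bar>q (s * n) / s\<^sup>2\<bar> \<le> D * n ^ 4 * m\<^sup>2" if "s \<noteq> 0" "\<bar>s\<bar> \<le> m" for s
        proof -
          have "\<bar>q (s * n)\<bar> \<le> D * (s * n) ^ 4" by (rule D(4))
          also have "\<dots> = (D * n ^ 4 * s\<^sup>2) * s\<^sup>2" by (simp add: power_mult_distrib power2_eq_square power4_eq_xxxx)
          finally have "\<bar>q (s * n) / s\<^sup>2\<bar> \<le> D * n ^ 4 * s\<^sup>2" using that(1) by (simp add: abs_divide pos_divide_le_eq)
          also have "\<dots> \<le> D * n ^ 4 * m\<^sup>2"
            using that(2) D(1) by (intro mult_left_mono) (auto simp: abs_le_square_iff[symmetric])
          finally show ?thesis .
        qed
        have e: "6 * D * (n\<^sup>2 * m)\<^sup>2 = 6 * (D * n ^ 4 * m\<^sup>2)"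
          by (simp add: power_mult_distrib power2_eq_square power4_eq_xxxx)
        have c3: "- 2 * u / v - 2 * x1 / v1 - 2 * x2 / v2 \<le> 6 * B"
          if "\<bar>u / v\<bar> \<le> B" "\<bar>x1 / v1\<bar> \<le> B" "\<bar>x2 / v2\<bar> \<le> B" for u v x1 v1 x2 v2 B :: real
        proof -
          have "- 2 * u / v = - 2 * (u / v)" "2 * x1 / v1 = 2 * (x1 / v1)" "2 * x2 / v2 = 2 * (x2 / v2)" by simp_all
          then show ?thesis using that by linarith
        qed
        show "- 2 * (q ((t - r) * n) - q (t * n) - q (r * n)) / (t * r) - 2 * q (t * n) / t\<^sup>2 - 2 * q (r * n) / r\<^sup>2
           \<le> 6 * D * (n\<^sup>2 * (\<bar>t\<bar> + \<bar>r\<bar>))\<^sup>2"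
          unfolding m_def[symmetric] e by (rule c3[OF b1 b2[OF tr(1)] b2[OF tr(2)]]) (simp_all add: m_def)
      qed simp
      finally have "?y\<^sup>2 \<le> G\<^sup>2 * (6 * D * (n\<^sup>2 * (\<bar>t\<bar> + \<bar>r\<bar>))\<^sup>2)" .
      from root[OF this L(4)] show ?thesis by (simp add: n_def mult.assoc)
    qed
    from gradient_from_quotients[OF \<Omega> _ Lip Q] L G
    obtain grad where "\<forall>x\<in>\<Omega>. norm (grad x) \<le> L * G \<and> (\<forall>y\<in>\<Omega>. \<bar>g y - g x - grad x \<bullet> (y - x)\<bar> \<le> L * G * (norm (y - x))\<^sup>2)"
      by auto
    with bnd show ?thesis unfolding G_def by blast
  qed
  with L(1) show ?thesis by blast
qed

section \<open>Smooth functions in the native space\<close>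

lemma pdiff_eq: "(g has_derivative g') (at x) \<Longrightarrow> pdiff i g x = g' (axis i 1)"
  by (simp add: pdiff_def frechet_derivative_at[symmetric])

lemma pdiff_cong:
  assumes "open U" "x \<in> U" "\<And>y. y \<in> U \<Longrightarrow> g y = h y"
  shows "g differentiable (at x) \<longleftrightarrow> h differentiable (at x)" and "pdiff i g x = pdiff i h x"
proof -
  have *: "(g has_derivative D) (at x) \<longleftrightarrow> (h has_derivative D) (at x)" for D
    using has_derivative_transform_within_open[of g D x UNIV U h] has_derivative_transform_within_open[of h D x UNIV U g] assms by auto
  then show "g differentiable (at x) \<longleftrightarrow> h differentiable (at x)" by (simp add: differentiable_def)
  show "pdiff i g x = pdiff i h x" by (simp add: pdiff_def frechet_derivative_def *)
qed

lemma Ck_cong: "open U \<Longrightarrow> (\<And>x. x \<in> U \<Longrightarrow> g x = h x) \<Longrightarrow> Ck_on m g U \<longleftrightarrow> Ck_on m h U"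
proof (induction m arbitrary: g h)
  case 0
  then show ?case by (simp cong: continuous_on_cong)
next
  case (Suc m)
  have "Ck_on m (pdiff i g) U \<longleftrightarrow> Ck_on m (pdiff i h) U" for i
    by (rule Suc.IH[OF Suc.prems(1)]) (rule pdiff_cong(2)[OF Suc.prems(1) _ Suc.prems(2)])
  then show ?case using pdiff_cong(1)[OF Suc.prems(1) _ Suc.prems(2)] by auto
qed

lemma Ck_subset: "Ck_on m g U \<Longrightarrow> V \<subseteq> U \<Longrightarrow> Ck_on m g V"
  by (induction m arbitrary: g) (auto intro: continuous_on_subset)

lemma Ck_SucD: "Ck_on (Suc m) g U \<Longrightarrow> Ck_on m g U"
proof (induction m arbitrary: g)
  case 0
  then show ?case by (auto intro!: continuous_at_imp_continuous_on differentiable_imp_continuous_within)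
next
  case (Suc m)
  then show ?case by auto
qed

lemma Ck_continuous: "Ck_on m g U \<Longrightarrow> continuous_on U g"
  by (induction m) (auto dest: Ck_SucD simp del: Ck_on.simps(2))

lemma Ck_le: "Ck_on m g U \<Longrightarrow> k \<le> m \<Longrightarrow> Ck_on k g U"
  by (induction m) (auto simp: le_Suc_eq dest: Ck_SucD simp del: Ck_on.simps(2))

lemma Ck_const: "Ck_on m (\<lambda>x. c) (U :: (real^'n) set)"
proof (induction m arbitrary: c)
  case (Suc m)
  have "pdiff i (\<lambda>x :: real^'n. c) = (\<lambda>x. 0)" for i by (rule ext) (rule pdiff_eq[OF has_derivative_const])
  then show ?case using Suc by simp
qed simp

lemma Ck_coord: "Ck_on m (\<lambda>x. x $ j) (U :: (real^'n) set)"
proof (cases m)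
  case 0
  then show ?thesis by (simp add: continuous_intros)
next
  case (Suc m')
  have d: "((\<lambda>x. x $ j) has_derivative (\<lambda>x. x $ j)) (at x)" for x :: "real^'n"
    by (rule bounded_linear_imp_has_derivative[OF bounded_linear_vec_nth])
  have "pdiff i (\<lambda>x :: real^'n. x $ j) = (\<lambda>x. axis i 1 $ j)" for i by (rule ext) (rule pdiff_eq[OF d])
  then show ?thesis using d by (auto simp: Suc Ck_const differentiable_def)
qed

lemma has_derivative_Ck:
  "Ck_on (Suc m) g U \<Longrightarrow> x \<in> U \<Longrightarrow> (g has_derivative frechet_derivative g (at x)) (at x)"
  by (simp add: frechet_derivative_works)

text \<open>Off \<open>U\<close> the values of \<open>pdiff\<close> may be arbitrary; a formula for
  the partial derivatives on the open set \<open>U\<close> is all that can be supplied and all that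
  enters.\<close>

lemma Ck_SucI:
  assumes "open U" "\<And>x. x \<in> U \<Longrightarrow> (g has_derivative D x) (at x)"
    "\<And>i x. x \<in> U \<Longrightarrow> D x (axis i 1) = h i x" "\<And>i. Ck_on m (h i) U"
  shows "Ck_on (Suc m) g U"
proof -
  have "Ck_on m (pdiff i g) U" for i
    by (rule Ck_cong[THEN iffD2, OF assms(1) _ assms(4)]) (simp add: pdiff_eq[OF assms(2)] assms(3))
  then show ?thesis using assms(2) by (auto simp: differentiable_def)
qed

lemma Ck_add: "open U \<Longrightarrow> Ck_on m g U \<Longrightarrow> Ck_on m h U \<Longrightarrow> Ck_on m (\<lambda>x. g x + h x) U"
proof (induction m arbitrary: g h)
  case 0
  then show ?case by (simp add: continuous_intros)
next
  case (Suc m)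
  show ?case
  proof (rule Ck_SucI[OF Suc.prems(1) has_derivative_add[OF has_derivative_Ck[OF Suc.prems(2)] has_derivative_Ck[OF Suc.prems(3)]]])
    show "Ck_on m (\<lambda>x. pdiff i g x + pdiff i h x) U" for i using Suc by (intro Suc.IH) auto
  qed (simp_all add: pdiff_def)
qed

lemma Ck_mult: "open U \<Longrightarrow> Ck_on m g U \<Longrightarrow> Ck_on m h U \<Longrightarrow> Ck_on m (\<lambda>x. g x * h x) U"
proof (induction m arbitrary: g h)
  case 0
  then show ?case by (simp add: continuous_intros)
next
  case (Suc m)
  show ?case
  proof (rule Ck_SucI[OF Suc.prems(1) has_derivative_mult[OF has_derivative_Ck[OF Suc.prems(2)] has_derivative_Ck[OF Suc.prems(3)]]])
    show "Ck_on m (\<lambda>x. g x * pdiff i h x + pdiff i g x * h x) U" for i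
      using Suc.prems Ck_SucD[OF Suc.prems(2)] Ck_SucD[OF Suc.prems(3)] by (intro Ck_add Suc.IH) auto
  qed (simp_all add: pdiff_def)
qed

lemma Ck_sum: "finite I \<Longrightarrow> open U \<Longrightarrow> (\<And>i. i \<in> I \<Longrightarrow> Ck_on m (g i) U) \<Longrightarrow> Ck_on m (\<lambda>x. \<Sum>i\<in>I. g i x) U"
  by (induction I rule: finite_induct) (auto intro: Ck_const Ck_add)

lemma Ck_prod: "finite I \<Longrightarrow> open U \<Longrightarrow> (\<And>i. i \<in> I \<Longrightarrow> Ck_on m (g i) U) \<Longrightarrow> Ck_on m (\<lambda>x. \<Prod>i\<in>I. g i x) U"
  by (induction I rule: finite_induct) (auto intro: Ck_const Ck_mult)

lemma Ck_inverse: "open U \<Longrightarrow> (\<And>x. x \<in> U \<Longrightarrow> g x \<noteq> 0) \<Longrightarrow> Ck_on m g U \<Longrightarrow> Ck_on m (\<lambda>x. inverse (g x)) U"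
proof (induction m)
  case 0
  then show ?case by (auto intro: continuous_intros)
next
  case (Suc m)
  have d: "((\<lambda>x. inverse (g x)) has_derivative (\<lambda>h. - (inverse (g x) * frechet_derivative g (at x) h * inverse (g x)))) (at x)" if "x \<in> U" for x
    by (rule Deriv.has_derivative_inverse[OF Suc.prems(2)[OF that] has_derivative_Ck[OF Suc.prems(3) that]])
  show ?case
  proof (rule Ck_SucI[where h="\<lambda>i x. (- 1) * (inverse (g x) * (pdiff i g x * inverse (g x)))", OF Suc.prems(1) d])
    show "Ck_on m (\<lambda>x. (- 1) * (inverse (g x) * (pdiff i g x * inverse (g x)))) U" for i
      using Suc.prems Ck_SucD[OF Suc.prems(3)] by (intro Ck_mult Ck_const Suc.IH) auto
  qed (simp_all add: pdiff_def)
qed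

lemma pos_power_DERIV:
  "((\<lambda>t::real. max t 0 ^ Suc (Suc r)) has_real_derivative real (Suc (Suc r)) * max t 0 ^ Suc r) (at t)"
proof -
  consider "t > 0" | "t < 0" | "t = 0" by linarith
  then show ?thesis
  proof cases
    case 1
    have "((\<lambda>t::real. t ^ Suc (Suc r)) has_real_derivative real (Suc (Suc r)) * max t 0 ^ Suc r) (at t)"
      using DERIV_pow[of "Suc (Suc r)" t] 1 by simp
    then show ?thesis
      by (rule has_field_derivative_transform_within_open[where S="{0<..}"]) (use 1 in auto)
  next
    case 2
    have "((\<lambda>t::real. 0) has_real_derivative real (Suc (Suc r)) * max t 0 ^ Suc r) (at t)"
      using 2 by simp
    then show ?thesis
      by (rule has_field_derivative_transform_within_open[where S="{..<0}"]) (use 2 in auto)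
  next
    case 3
    have "((\<lambda>h::real. max h 0 ^ Suc (Suc r) / h) \<longlongrightarrow> 0) (at 0)"
    proof (rule Lim_null_comparison)
      show "\<forall>\<^sub>F h :: real in at 0. norm (max h 0 ^ Suc (Suc r) / h) \<le> \<bar>h\<bar> ^ Suc r"
      proof (intro always_eventually allI)
        fix h :: real show "norm (max h 0 ^ Suc (Suc r) / h) \<le> \<bar>h\<bar> ^ Suc r" by (cases "h > 0") (simp_all add: max_def del: power_Suc, simp)
      qed
      have "((\<lambda>h::real. \<bar>h\<bar> ^ Suc r) \<longlongrightarrow> \<bar>0\<bar> ^ Suc r) (at 0)" by (intro tendsto_intros)
      then show "((\<lambda>h::real. \<bar>h\<bar> ^ Suc r) \<longlongrightarrow> 0) (at 0)" by simp
    qed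
    then show ?thesis using 3 by (simp add: has_field_derivative_iff)
  qed
qed

text \<open>Truncated powers stand in for smooth bump functions. Each derivative lowers the exponent
  by one and the last one must still be continuous, hence the exponent \<open>Suc m\<close>.\<close>

lemma Ck_pos_power: "open U \<Longrightarrow> Ck_on m g U \<Longrightarrow> Ck_on m (\<lambda>x. max (g x) 0 ^ Suc m) U"
proof (induction m)
  case 0
  then show ?case by (auto intro!: continuous_intros)
next
  case (Suc m)
  have d: "((\<lambda>x. max (g x) 0 ^ Suc (Suc m)) has_derivative (\<lambda>h. frechet_derivative g (at x) h * (real (Suc (Suc m)) * max (g x) 0 ^ Suc m))) (at x)" if "x \<in> U" for x
    using DERIV_compose_FDERIV[OF pos_power_DERIV[of m "g x"] has_derivative_Ck[OF Suc.prems(2) that]] .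
  show ?case
  proof (rule Ck_SucI[where h="\<lambda>i x. pdiff i g x * (real (Suc (Suc m)) * max (g x) 0 ^ Suc m)", OF Suc.prems(1) d])
    show "Ck_on m (\<lambda>x. pdiff i g x * (real (Suc (Suc m)) * max (g x) 0 ^ Suc m)) U" for i
      using Suc.prems Ck_SucD[OF Suc.prems(2)] by (intro Ck_mult Ck_const Suc.IH) auto
  qed (simp_all add: pdiff_def)
qed

lemma Ck_Un: "open U \<Longrightarrow> open V \<Longrightarrow> Ck_on m g U \<Longrightarrow> Ck_on m g V \<Longrightarrow> Ck_on m g (U \<union> V)"
  by (induction m arbitrary: g) (auto intro: continuous_on_open_Un)

lemma Ck_sq_dist: "open U \<Longrightarrow> Ck_on m (\<lambda>x. c - (norm (x - p))\<^sup>2) (U :: (real^'n) set)"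
proof -
  assume U: "open U"
  have "c - (norm (x - p))\<^sup>2 = c + (\<Sum>i\<in>UNIV. (- 1) * ((x $ i + - (p $ i)) * (x $ i + - (p $ i))))" for x :: "real^'n"
    unfolding power2_norm_eq_inner by (simp add: inner_vec_def sum_negf)
  then show ?thesis
    by (simp only:) (intro Ck_add Ck_sum Ck_mult Ck_const Ck_coord U finite)
qed

section \<open>Cutoff and passage to odd dimension\<close>

text \<open>The cutoff is 1 on \<open>K\<close> and has its support in the compact subset
  \<open>W\<close> of \<open>U\<close>. It is a quotient of truncated powers formed from a sum
  \<open>s\<close> of bumps that is bounded below on \<open>K\<close> by some
  \<open>a > 0\<close>.\<close>

lemma cutoff_extension:
  fixes U K :: "(real^'n) set"
  assumes U: "open U" and K: "compact K" "K \<subseteq> U" and g: "Ck_on m g U"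
  shows "\<exists>G R. Ck_on m G UNIV \<and> (\<forall>x\<in>K. G x = g x) \<and> (\<forall>x. R < norm x \<longrightarrow> G x = 0)"
proof -
  have "\<forall>p\<in>K. \<exists>r>0. cball p r \<subseteq> U" using U K(2) open_contains_cball by blast
  from bchoice[OF this] obtain r where r: "\<And>p. p \<in> K \<Longrightarrow> r p > 0 \<and> cball p (r p) \<subseteq> U" by blast
  have "K \<subseteq> (\<Union>p\<in>K. ball p (r p))" using r by force
  then obtain F where F: "F \<subseteq> K" "finite F" "K \<subseteq> (\<Union>p\<in>F. ball p (r p))"
    using compactE_image[OF K(1), of K "\<lambda>p. ball p (r p)"] by auto
  define s where "s = (\<lambda>x. \<Sum>p\<in>F. max ((r p)\<^sup>2 - (norm (x - p))\<^sup>2) 0 ^ Suc m)"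
  define W where "W = (\<Union>p\<in>F. cball p (r p))"
  have W: "compact W" "W \<subseteq> U" using F r by (auto simp: W_def intro!: compact_UN)
  have s: "Ck_on m s UNIV" unfolding s_def by (intro Ck_sum Ck_pos_power Ck_sq_dist F(2)) auto
  have s_pos: "s x > 0" if "x \<in> K" for x
  proof -
    obtain p where p: "p \<in> F" "x \<in> ball p (r p)" using F(3) \<open>x \<in> K\<close> by blast
    then have "(norm (x - p))\<^sup>2 < (r p)\<^sup>2" by (intro power_strict_mono) (auto simp: dist_norm norm_minus_commute)
    then have "0 < max ((r p)\<^sup>2 - (norm (x - p))\<^sup>2) 0 ^ Suc m" by (intro zero_less_power) simp
    then show ?thesis unfolding s_def using p(1) F(2) by (intro sum_pos2[of F p]) auto
  qed
  have s_out: "s x = 0" if "x \<notin> W" for x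
    unfolding s_def
  proof (rule sum.neutral, intro ballI)
    fix p assume "p \<in> F"
    then have "r p < norm (x - p)" "0 < r p" using that r F(1) by (auto simp: W_def dist_norm norm_minus_commute not_le)
    then have "(r p)\<^sup>2 \<le> (norm (x - p))\<^sup>2" by (intro power_mono) auto
    then show "max ((r p)\<^sup>2 - (norm (x - p))\<^sup>2) 0 ^ Suc m = 0" by simp
  qed
  have "\<exists>a>0. \<forall>x\<in>K. a \<le> s x"
  proof (cases "K = {}")
    case False
    then obtain y where "y \<in> K" "\<forall>x\<in>K. s y \<le> s x"
      using continuous_attains_inf[OF K(1) False continuous_on_subset[OF Ck_continuous[OF s] subset_UNIV]] by blast
    then show ?thesis using s_pos by blast
  qed (auto intro: exI[of _ 1])
  then obtain a where a: "a > 0" "\<And>x. x \<in> K \<Longrightarrow> a \<le> s x" by blast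
  define N where "N = (\<lambda>x. max (s x) 0 ^ Suc m)"
  \<comment> \<open>The added term vanishes on \<open>K\<close>, where \<open>s x \<ge> a\<close>,
    and is positive where \<open>s x \<le> 0\<close>. Hence \<open>N / Q\<close> is 1 on
    \<open>K\<close>, and \<open>Q\<close> has no zero.\<close>
  define Q where "Q = (\<lambda>x. N x + max (a + (- 1) * s x) 0 ^ Suc m)"
  have N: "Ck_on m N UNIV" unfolding N_def by (intro Ck_pos_power s) auto
  have Q: "Ck_on m Q UNIV" unfolding Q_def by (intro Ck_add N Ck_pos_power Ck_mult Ck_const s) auto
  have Q0: "Q x \<noteq> 0" for x
  proof (cases "s x > 0")
    case True
    then have "N x > 0" by (simp add: N_def)
    then have "Q x > 0" unfolding Q_def by (intro add_pos_nonneg) auto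
    then show ?thesis by simp
  next
    case False
    then have "0 < max (a + (- 1) * s x) 0 ^ Suc m" using a(1) by (intro zero_less_power) auto
    then have "Q x > 0" unfolding Q_def by (intro add_nonneg_pos) (auto simp: N_def)
    then show ?thesis by simp
  qed
  define \<eta> where "\<eta> = (\<lambda>x. N x * inverse (Q x))"
  have \<eta>: "Ck_on m \<eta> UNIV" unfolding \<eta>_def using Q0 by (intro Ck_mult N Ck_inverse Q) auto
  have \<eta>_K: "\<eta> x = 1" if "x \<in> K" for x
  proof -
    have "Q x = N x" using a(2)[OF that] by (simp add: Q_def)
    then show ?thesis using Q0[of x] by (simp add: \<eta>_def)
  qed
  have \<eta>_out: "\<eta> x = 0" if "x \<notin> W" for x using s_out[OF that] by (simp add: \<eta>_def N_def)
  define G where "G = (\<lambda>x. if x \<in> U then \<eta> x * g x else 0)"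
  have "Ck_on m (\<lambda>x. \<eta> x * g x) U" by (intro Ck_mult U g Ck_subset[OF \<eta>]) auto
  then have "Ck_on m G U" using Ck_cong[OF U, of G "\<lambda>x. \<eta> x * g x"] by (simp add: G_def)
  moreover have oW: "open (- W)" using W(1) by (simp add: compact_imp_closed open_Compl)
  moreover have "Ck_on m G (- W)"
    using Ck_cong[OF oW, of G "\<lambda>x. 0"] Ck_const[of m 0 "- W"] \<eta>_out by (simp add: G_def)
  ultimately have "Ck_on m G (U \<union> - W)" by (intro Ck_Un U)
  moreover have "U \<union> - W = UNIV" using W(2) by auto
  ultimately have "Ck_on m G UNIV" by simp
  moreover have "\<forall>x\<in>K. G x = g x" using \<eta>_K K(2) by (auto simp: G_def)
  moreover obtain R where "\<forall>x\<in>W. norm x \<le> R" using W(1) compact_imp_bounded bounded_iff by blast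
  then have "\<forall>x. R < norm x \<longrightarrow> G x = 0" using \<eta>_out by (force simp: G_def)
  ultimately show ?thesis by blast
qed

text \<open>An injection \<open>e\<close> of index types identifies \<open>real^'n\<close> with a
  coordinate subspace of \<open>real^'m\<close>; \<open>axis_emb\<close> below is the isometric
  embedding and this is its left inverse.\<close>

definition axis_proj :: "('n \<Rightarrow> 'm) \<Rightarrow> real^'m \<Rightarrow> real^'n" where
  "axis_proj e y = (\<chi> i. y $ e i)"

definition axis_emb :: "('n \<Rightarrow> 'm) \<Rightarrow> real^'n \<Rightarrow> real^'m" where
  "axis_emb e x = (\<chi> j. if j \<in> range e then x $ inv e j else 0)"

lemma axis_proj_emb: "inj e \<Longrightarrow> axis_proj e (axis_emb e x) = x"
  by (simp add: axis_proj_def axis_emb_def vec_eq_iff)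

lemma axis_emb_diff_norm:
  assumes "inj e"
  shows "norm (axis_emb e x - axis_emb e y) = norm (x - y)"
proof -
  have "(\<Sum>j\<in>UNIV. ((axis_emb e x - axis_emb e y) $ j)\<^sup>2) = (\<Sum>j\<in>range e. ((axis_emb e x - axis_emb e y) $ j)\<^sup>2)"
    by (rule sum.mono_neutral_right) (auto simp: axis_emb_def)
  also have "\<dots> = (\<Sum>i\<in>UNIV. ((x - y) $ i)\<^sup>2)"
    using assms by (subst sum.reindex) (auto simp: axis_emb_def)
  finally show ?thesis by (simp add: norm_vec_def L2_set_def)
qed

lemma axis_emb_0: "axis_emb e 0 = 0"
  by (simp add: axis_emb_def vec_eq_iff)

lemma bounded_linear_axis_proj: "bounded_linear (axis_proj e)"
  by (intro linear_conv_bounded_linear[THEN iffD1] linearI) (simp_all add: axis_proj_def vec_eq_iff)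

lemma axis_proj_axis:
  assumes "inj e"
  shows "axis_proj e (axis j 1) = (if j \<in> range e then axis (inv e j) 1 else 0)"
  using assms by (auto simp: axis_proj_def vec_eq_iff axis_def inj_eq)

lemma Ck_axis_proj:
  fixes e :: "'n::finite \<Rightarrow> 'm::finite" and g :: "real^'n \<Rightarrow> real"
  assumes e: "inj e"
  shows "Ck_on m g UNIV \<Longrightarrow> Ck_on m (\<lambda>y. g (axis_proj e y)) UNIV"
proof (induction m arbitrary: g)
  case 0
  have "continuous_on UNIV (axis_proj e)" by (rule linear_continuous_on[OF bounded_linear_axis_proj])
  then show ?case using 0 by (auto intro: continuous_on_compose2[of UNIV g])
next
  case (Suc m)
  show ?case
  proof (rule Ck_SucI[where h="\<lambda>j y. if j \<in> range e then pdiff (inv e j) g (axis_proj e y) else 0"])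
    show "((\<lambda>y. g (axis_proj e y)) has_derivative (\<lambda>h. frechet_derivative g (at (axis_proj e y)) (axis_proj e h))) (at y)" for y
      by (rule has_derivative_compose[OF bounded_linear_imp_has_derivative[OF bounded_linear_axis_proj] has_derivative_Ck[OF Suc.prems]]) simp
    show "frechet_derivative g (at (axis_proj e y)) (axis_proj e (axis i 1)) = (if i \<in> range e then pdiff (inv e i) g (axis_proj e y) else 0)" for i y
    proof -
      have "linear (frechet_derivative g (at (axis_proj e y)))"
        by (rule has_derivative_linear[OF has_derivative_Ck[OF Suc.prems]]) simp
      then show ?thesis by (simp add: axis_proj_axis[OF e] pdiff_def linear_0)
    qed
    show "Ck_on m (\<lambda>y. if i \<in> range e then pdiff (inv e i) g (axis_proj e y) else 0) UNIV" for i
      using Suc.IH[of "pdiff (inv e i) g"] Suc.prems Ck_const[of m 0 UNIV] by (cases "i \<in> range e") auto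
  qed auto
qed

lemma Ck_iterated_pdiff: "Ck_on m g UNIV \<Longrightarrow> r \<le> m \<Longrightarrow> Ck_on (m - r) ((pdiff j ^^ r) g) UNIV"
proof (induction r)
  case (Suc r)
  then have "Ck_on (Suc (m - Suc r)) ((pdiff j ^^ r) g) UNIV" by (simp add: Suc_diff_Suc)
  then show ?case by simp
qed simp

lemma iterated_pdiff_eq_0:
  assumes "open V" "\<And>x. x \<in> V \<Longrightarrow> g x = 0"
  shows "x \<in> V \<Longrightarrow> (pdiff j ^^ r) g x = 0"
proof (induction r arbitrary: x)
  case (Suc r)
  have "pdiff j ((pdiff j ^^ r) g) x = pdiff j (\<lambda>x. 0) x"
    by (rule pdiff_cong(2)[OF assms(1) Suc.prems Suc.IH])
  also have "\<dots> = 0" using pdiff_eq[OF has_derivative_const[of "0::real" "at x"], of j] by simp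
  finally show ?case by simp
qed (use assms in simp)

lemma directional_pdiff:
  assumes "g differentiable (at x)"
  shows "((\<lambda>t. g (x + t *\<^sub>R axis j 1)) has_real_derivative pdiff j g x) (at 0)"
proof -
  let ?D = "frechet_derivative g (at x)"
  have D: "(g has_derivative ?D) (at x)" using assms by (simp add: frechet_derivative_works)
  have "((\<lambda>t. x + t *\<^sub>R axis j 1) has_derivative (\<lambda>t. t *\<^sub>R axis j 1)) (at (0::real))"
    by (auto intro!: derivative_eq_intros)
  moreover have "(g has_derivative ?D) (at (x + 0 *\<^sub>R axis j 1))" using D by simp
  ultimately have "((\<lambda>t. g (x + t *\<^sub>R axis j 1)) has_derivative (\<lambda>t. ?D (t *\<^sub>R axis j 1))) (at (0::real))"
    by (rule has_derivative_compose)
  moreover have "(\<lambda>t. ?D (t *\<^sub>R axis j 1)) = (*) (pdiff j g x)"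
    using linear_scale[OF has_derivative_linear[OF D]] by (auto simp: pdiff_def mult.commute)
  ultimately show ?thesis by (simp add: has_field_derivative_def)
qed

text \<open>The function is cut off, extended to the odd-dimensional space by truncated powers in
  the additional coordinates, and dominated there by \<open>fourier_domination\<close>. The kernel
  depends on distances only and \<open>CARD('n) div 2\<close> is unchanged, so the inequality
  restricts to \<open>\<Omega>\<close>, where \<open>membership\<close> applies.\<close>

lemma wendland_native_aux:
  fixes e :: "'n::finite \<Rightarrow> 'm::{finite,wellorder}" and \<Omega> U :: "(real^'n) set"
  assumes e: "inj e" and dim: "CARD('m) = 2 * (CARD('n) div 2) + 1"
    and rk: "rkhs \<Omega> (wendland_kernel (Suc k) c) H ip" and c: "c > 0"
    and \<Omega>: "bounded \<Omega>" and U: "open U" "closure \<Omega> \<subseteq> U"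
    and g: "Ck_on (CARD('n) div 2 + Suc k + 1) g U"
  shows "(\<lambda>x. if x \<in> \<Omega> then g x else 0) \<in> H"
proof -
  interpret reproducing_kernel_space \<Omega> "wendland_kernel (Suc k) c" H ip by standard (rule rk)
  define j where "j = CARD('n) div 2"
  define l where "l = j + Suc k + 1"
  have l: "l > 0" by (simp add: l_def)
  have cl: "compact (closure \<Omega>)" using \<Omega> by (simp add: compact_closure)
  have "Ck_on l g U" using g by (simp add: l_def j_def)
  from cutoff_extension[OF U(1) cl U(2) this] obtain G R0 where G: "Ck_on l G UNIV"
    "\<And>x. x \<in> closure \<Omega> \<Longrightarrow> G x = g x" "\<And>x. R0 < norm x \<Longrightarrow> G x = 0" by blast
  obtain B where B: "\<And>x. x \<in> \<Omega> \<Longrightarrow> norm x \<le> B" "B > 0" using \<Omega> bounded_pos by blast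
  define m where "m = max 1 \<bar>R0\<bar>"
  \<comment> \<open>A single radius for the support of \<open>GG\<close>, the support of the kernel
    and the set \<open>\<Omega>\<close>.\<close>
  define R where "R = real CARD('m) * m + 1 / c + B"
  have m1: "1 \<le> m" "R0 \<le> m" by (auto simp: m_def)
  have pm: "0 \<le> real CARD('m) * m" using m1 by simp
  have pc: "0 < 1 / c" using c by simp
  have R: "R > 0" "B \<le> R" "1 / c \<le> R" "real CARD('m) * m \<le> R"
    using B(2) pm pc unfolding R_def by linarith+
  \<comment> \<open>The factors in the additional coordinates are 1 on the embedded subspace and 0
    outside \<open>{-1..1}\<close>. If \<open>e\<close> is onto, the product is empty.\<close>
  define GG where "GG = (\<lambda>y. G (axis_proj e y) * (\<Prod>i\<in>- range e. max (1 + (- 1) * (y $ i * y $ i)) 0 ^ Suc l))"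
  have GG: "Ck_on l GG UNIV"
    unfolding GG_def
  proof (intro Ck_mult[OF open_UNIV] Ck_prod open_UNIV)
    show "Ck_on l (\<lambda>y. G (axis_proj e y)) UNIV" by (rule Ck_axis_proj[OF e G(1)])
    fix i
    have "Ck_on l (\<lambda>y :: (real, 'm) vec. 1 + (- 1) * (y $ i * y $ i)) UNIV"
      by (intro Ck_add Ck_mult Ck_const Ck_coord open_UNIV)
    then show "Ck_on l (\<lambda>y :: (real, 'm) vec. max (1 + (- 1) * (y $ i * y $ i)) 0 ^ Suc l) UNIV"
      by (rule Ck_pos_power[OF open_UNIV])
  qed simp
  have GG_out: "GG y = 0" if "R < norm y" for y
  proof (rule ccontr)
    assume nz: "GG y \<noteq> 0"
    then have "\<not> R0 < norm (axis_proj e y)" using G(3) by (auto simp: GG_def)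
    then have n: "norm (axis_proj e y) \<le> m" using m1 by linarith
    have "\<bar>y $ i\<bar> \<le> m" for i
    proof (cases "i \<in> range e")
      case True
      then obtain i' where "i = e i'" by auto
      then have "\<bar>y $ i\<bar> = \<bar>axis_proj e y $ i'\<bar>" by (simp add: axis_proj_def)
      also have "\<dots> \<le> norm (axis_proj e y)" by (rule component_le_norm_cart)
      finally show ?thesis using n by linarith
    next
      case False
      have "max (1 + (- 1) * (y $ i * y $ i)) 0 ^ Suc l \<noteq> 0"
        using nz False unfolding GG_def by (auto simp del: power_Suc)
      then have "y $ i * y $ i < 1" by (auto simp: max_def split: if_splits)
      then have "(y $ i)\<^sup>2 < 1" by (simp add: power2_eq_square)
      then have "\<bar>y $ i\<bar> < 1" by (simp add: abs_square_less_1)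
      then show ?thesis using m1 by linarith
    qed
    then have "(\<Sum>i\<in>UNIV. \<bar>y $ i\<bar>) \<le> (\<Sum>i\<in>(UNIV :: 'm set). m)" by (intro sum_mono)
    then have "norm y \<le> real CARD('m) * m" using norm_le_l1_cart[of y] by simp
    then show False using that R(4) by linarith
  qed
  \<comment> \<open>\<open>fourier_domination\<close> indexes derivatives by basis vectors,
    \<open>pdiff\<close> by coordinates; the description recovers the coordinate from the
    vector.\<close>
  define u where "u = (\<lambda>(b :: (real, 'm) vec) r. (pdiff (THE i. b = axis i 1) ^^ r) GG)"
  have u_axis: "u (axis i 1) r = (pdiff i ^^ r) GG" for i r
    by (simp add: u_def axis_eq_axis)
  have V: "open {y :: (real, 'm) vec. R < norm y}" by (intro open_Collect_less continuous_intros)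
  have ccs_u: "ccs R ((pdiff i ^^ r) GG)" if "r \<le> l" for i r
    unfolding ccs_def
    using Ck_continuous[OF Ck_iterated_pdiff[OF GG that]] iterated_pdiff_eq_0[OF V, of GG] GG_out by auto
  let ?\<phi> = "\<lambda>y :: (real, 'm) vec. wendland l (Suc k) (c * norm y)"
  have "\<exists>C. \<forall>(I :: nat set) X a. finite I \<and> (\<forall>i\<in>I. norm (X i) \<le> R) \<longrightarrow>
     (\<Sum>i\<in>I. a i * GG (X i))\<^sup>2 \<le> C * (\<Sum>i\<in>I. \<Sum>j\<in>I. a i * a j * ?\<phi> (X i - X j))"
  proof (rule fourier_domination[OF R(1), where u=u and l=l])
    show "ccs R ?\<phi>"
      unfolding ccs_def
    proof (intro conjI allI impI wendland_radial_continuous l c)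
      fix y :: "(real, 'm) vec" assume "R < norm y"
      then have "1 / c \<le> norm y" using R(3) by linarith
      then have "1 \<le> c * norm y" using c by (simp add: pos_divide_le_eq mult.commute)
      then show "?\<phi> y = 0" by (rule wendland_outside[OF l])
    qed
    show "\<exists>A>0. \<forall>\<kappa>. r0 \<le> norm \<kappa> \<longrightarrow> A / norm \<kappa> ^ (2 * l) \<le> cosT ?\<phi> \<kappa>" if "0 < r0" for r0
      using wendland_fourier_lower_bound[OF dim[folded j_def] l_def c that]
      by (simp add: cosT_def del: wendland.simps)
    show "0 < cosT ?\<phi> 0"
      using wendland_integral_pos[OF l c, where 'a="(real, 'm) vec"] by (simp add: cosT_def del: wendland.simps)
    show "ccs R GG" using ccs_u[of 0] by simp
    fix b :: "(real, 'm) vec" assume "b \<in> Basis"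
    then obtain i where b: "b = axis i 1" by (auto simp: Basis_vec_def)
    show "u b 0 = GG" by (simp add: u_def)
    show "ccs R (u b r)" if "r \<le> l" for r using ccs_u[OF that] by (simp add: b u_axis)
    show "((\<lambda>t. u b r (x + t *\<^sub>R b)) has_real_derivative u b (Suc r) x) (at 0)" if "r < l" for r x
    proof -
      have "Ck_on (Suc (l - Suc r)) ((pdiff i ^^ r) GG) UNIV"
        using Ck_iterated_pdiff[OF GG, of r i] that by (simp add: Suc_diff_Suc del: Ck_on.simps)
      then have "(pdiff i ^^ r) GG differentiable (at x)" by simp
      from directional_pdiff[OF this, of i] show ?thesis by (simp add: b u_axis)
    qed
  qed simp
  then obtain C where C: "\<And>(I :: nat set) X a. finite I \<Longrightarrow> (\<And>i. i \<in> I \<Longrightarrow> norm (X i) \<le> R) \<Longrightarrow>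
     (\<Sum>i\<in>I. a i * GG (X i))\<^sup>2 \<le> C * (\<Sum>i\<in>I. \<Sum>j\<in>I. a i * a j * ?\<phi> (X i - X j))"
  proof (elim exE)
    fix C assume *: "\<forall>(I :: nat set) X a. finite I \<and> (\<forall>i\<in>I. norm (X i) \<le> R) \<longrightarrow>
      (\<Sum>i\<in>I. a i * GG (X i))\<^sup>2 \<le> C * (\<Sum>i\<in>I. \<Sum>j\<in>I. a i * a j * ?\<phi> (X i - X j))"
    show thesis by (rule that[of C], rule *[rule_format], blast)
  qed
  show ?thesis
  proof (rule membership)
    fix n :: nat and X a assume X: "\<And>i. i < n \<Longrightarrow> X i \<in> \<Omega>"
    have GX: "GG (axis_emb e (X i)) = (if X i \<in> \<Omega> then g (X i) else 0)" if "i < n" for i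
    proof -
      have "(\<Prod>i'\<in>- range e. max (1 + (- 1) * (axis_emb e (X i) $ i' * axis_emb e (X i) $ i')) 0 ^ Suc l) = 1"
        by (rule prod.neutral) (simp add: axis_emb_def)
      moreover have "G (X i) = g (X i)" using X[OF that] closure_subset by (intro G(2)) auto
      ultimately show ?thesis using X[OF that] by (simp add: GG_def axis_proj_emb[OF e])
    qed
    have "(\<Sum>i<n. a i * GG (axis_emb e (X i)))\<^sup>2 \<le> C * (\<Sum>i<n. \<Sum>j<n. a i * a j * ?\<phi> (axis_emb e (X i) - axis_emb e (X j)))"
    proof (rule C)
      fix i assume "i \<in> {..<n}"
      then have "norm (X i) \<le> R" using B(1)[OF X[of i]] R(2) by simp
      then show "norm (axis_emb e (X i)) \<le> R"
        using axis_emb_diff_norm[OF e, of "X i" 0] by (simp add: axis_emb_0)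
    qed simp
    moreover have "(\<Sum>i<n. a i * GG (axis_emb e (X i))) = (\<Sum>i<n. a i * (if X i \<in> \<Omega> then g (X i) else 0))"
      by (intro sum.cong refl) (simp only: GX lessThan_iff)
    moreover have "?\<phi> (axis_emb e (X i) - axis_emb e (X i')) = wendland_kernel (Suc k) c (X i) (X i')" for i i'
      by (simp add: wendland_kernel_def axis_emb_diff_norm[OF e] l_def j_def del: wendland.simps)
    ultimately show "(\<Sum>i<n. a i * (if X i \<in> \<Omega> then g (X i) else 0))\<^sup>2
       \<le> C * (\<Sum>i<n. \<Sum>j<n. a i * a j * wendland_kernel (Suc k) c (X i) (X j))"
      by (simp only:)
  qed simp
qed

text \<open>For even \<open>n\<close> the same Wendland function is positive definite in dimension \<open>n + 1\<close>, so that only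
  odd dimensions need a Fourier estimate.\<close>

theorem wendland_native_contains:
  fixes \<Omega> U :: "(real^'n) set"
  assumes "rkhs \<Omega> (wendland_kernel (Suc k) c) H ip" "c > 0" "bounded \<Omega>" "open U" "closure \<Omega> \<subseteq> U"
    and "Ck_on (CARD('n) div 2 + Suc k + 1) g U"
  shows "(\<lambda>x. if x \<in> \<Omega> then g x else 0) \<in> H"
proof (cases "odd CARD('n)")
  case True
  have "inj (Abs_wo :: 'n \<Rightarrow> 'n wo)" by (rule injI) (simp add: Abs_wo_inject)
  moreover have "CARD('n wo) = 2 * (CARD('n) div 2) + 1" using True by (simp add: card_wo)
  ultimately show ?thesis by (rule wendland_native_aux) (rule assms)+
next
  case False
  have "inj ((Abs_wo :: 'n option \<Rightarrow> 'n option wo) \<circ> Some)" by (rule injI) (simp add: Abs_wo_inject)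
  moreover have "CARD('n option wo) = 2 * (CARD('n) div 2) + 1" using False by (simp add: card_wo)
  ultimately show ?thesis by (rule wendland_native_aux) (rule assms)+
qed

section \<open>The flow\<close>

lemma Ck_Lipschitz_on_ball:
  fixes g :: "real^'n \<Rightarrow> real"
  assumes g: "Ck_on 1 g UNIV"
  shows "\<exists>L\<ge>0. \<forall>x y. norm x \<le> R \<longrightarrow> norm y \<le> R \<longrightarrow> \<bar>g x - g y\<bar> \<le> L * norm (x - y)"
proof -
  have d: "(g has_derivative frechet_derivative g (at x)) (at x)" for x
    using has_derivative_Ck[of 0 g UNIV x] g by simp
  have "\<exists>B. \<forall>x\<in>cball 0 R. \<bar>pdiff i g x\<bar> \<le> B" for i
  proof -
    have "continuous_on UNIV (pdiff i g)" using g by simp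
    then have "continuous_on (cball 0 R) (pdiff i g)" by (rule continuous_on_subset) simp
    then have "bounded (pdiff i g ` cball 0 R)"
      by (intro compact_imp_bounded compact_continuous_image compact_cball)
    then show ?thesis by (auto simp: bounded_iff)
  qed
  then have "\<forall>i. \<exists>B. \<forall>x\<in>cball 0 R. \<bar>pdiff i g x\<bar> \<le> B" by blast
  from choice[OF this] obtain B where B: "\<And>i x. x \<in> cball 0 R \<Longrightarrow> \<bar>pdiff i g x\<bar> \<le> B i" by blast
  define L where "L = (\<Sum>i\<in>UNIV. \<bar>B i\<bar>)"
  have on: "onorm (frechet_derivative g (at x)) \<le> L" if x: "x \<in> cball 0 R" for x
  proof (rule onorm_le)
    fix h :: "real^'n"
    have lin: "linear (frechet_derivative g (at x))" by (rule has_derivative_linear[OF d])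
    have "frechet_derivative g (at x) h = frechet_derivative g (at x) (\<Sum>i\<in>UNIV. (h $ i) *\<^sub>R axis i 1)"
      using basis_expansion[of h] by (simp add: scalar_mult_eq_scaleR)
    also have "\<dots> = (\<Sum>i\<in>UNIV. h $ i * pdiff i g x)"
      by (simp add: linear_sum[OF lin] linear_scale[OF lin] pdiff_def)
    also have "norm \<dots> \<le> (\<Sum>i\<in>UNIV. \<bar>B i\<bar> * norm h)"
    proof (rule sum_norm_le)
      fix i
      have "\<bar>h $ i\<bar> * \<bar>pdiff i g x\<bar> \<le> norm h * \<bar>B i\<bar>"
        using B[OF x, of i] by (intro mult_mono component_le_norm_cart) auto
      then show "norm (h $ i * pdiff i g x) \<le> \<bar>B i\<bar> * norm h" by (simp add: abs_mult mult.commute)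
    qed
    finally show "norm (frechet_derivative g (at x) h) \<le> L * norm h" by (simp add: L_def sum_distrib_right)
  qed
  have "\<bar>g x - g y\<bar> \<le> L * norm (x - y)" if "norm x \<le> R" "norm y \<le> R" for x y
    using differentiable_bound[of "cball 0 R" g "\<lambda>x. frechet_derivative g (at x)" L x y]
      has_derivative_at_withinI[OF d] on that by simp
  moreover have "L \<ge> 0" by (simp add: L_def sum_nonneg)
  ultimately show ?thesis by blast
qed

lemma C1_Lipschitz_on_ball:
  fixes f :: "real^'n \<Rightarrow> real^'n"
  assumes f: "\<And>i. Ck_on 1 (\<lambda>x. f x $ i) UNIV"
  shows "\<exists>L\<ge>0. \<forall>x y. norm x \<le> R \<longrightarrow> norm y \<le> R \<longrightarrow> norm (f x - f y) \<le> L * norm (x - y)"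
proof -
  have "\<forall>i. \<exists>L\<ge>0. \<forall>x y. norm x \<le> R \<longrightarrow> norm y \<le> R \<longrightarrow> \<bar>f x $ i - f y $ i\<bar> \<le> L * norm (x - y)"
    using Ck_Lipschitz_on_ball[OF f] by blast
  then obtain L where L: "\<And>i. L i \<ge> 0" "\<And>i x y. norm x \<le> R \<Longrightarrow> norm y \<le> R \<Longrightarrow> \<bar>f x $ i - f y $ i\<bar> \<le> L i * norm (x - y)"
    using choice[of "\<lambda>i L. L \<ge> 0 \<and> (\<forall>x y. norm x \<le> R \<longrightarrow> norm y \<le> R \<longrightarrow> \<bar>f x $ i - f y $ i\<bar> \<le> L * norm (x - y))"] by blast
  have "norm (f x - f y) \<le> (\<Sum>i\<in>UNIV. L i) * norm (x - y)" if "norm x \<le> R" "norm y \<le> R" for x y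
  proof -
    have "norm (f x - f y) \<le> (\<Sum>i\<in>UNIV. \<bar>(f x - f y) $ i\<bar>)" by (rule norm_le_l1_cart)
    also have "\<dots> \<le> (\<Sum>i\<in>UNIV. L i * norm (x - y))" using L(2)[OF that] by (intro sum_mono) simp
    finally show ?thesis by (simp add: sum_distrib_right)
  qed
  moreover have "(\<Sum>i\<in>UNIV. L i) \<ge> 0" using L(1) by (simp add: sum_nonneg)
  ultimately show ?thesis by blast
qed

section \<open>Uniqueness and continuous dependence of trajectories\<close>

text \<open>Forward trajectories of the vector field, without reference to \<open>fl\<close>. The
  definition of \<open>solution_flow\<close> contains no semigroup law; what
  \<open>open_basin\<close> uses of it is recovered from \<open>solves_shift\<close> and
  \<open>solves_unique\<close>.\<close>

definition solves :: "('a::real_normed_vector \<Rightarrow> 'a) \<Rightarrow> (real \<Rightarrow> 'a) \<Rightarrow> bool" where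
  "solves f X \<longleftrightarrow> (\<forall>t\<ge>0. (X has_vector_derivative f (X t)) (at t within {0..}))"

lemma solves_continuous: "solves f X \<Longrightarrow> continuous_on {0..} X"
  by (auto simp: solves_def continuous_on_eq_continuous_within intro: has_vector_derivative_continuous)

lemma solves_shift:
  assumes "solves f X" "T \<ge> 0"
  shows "solves f (\<lambda>t. X (t + T))"
  unfolding solves_def
proof (intro allI impI)
  fix t :: real assume t: "t \<ge> 0"
  have "(X has_vector_derivative f (X (t + T))) (at (t + T) within {0..})"
    using assms t by (simp add: solves_def)
  then have "(X has_vector_derivative f (X (t + T))) (at (t + T) within (\<lambda>t. t + T) ` {0..})"
    by (rule has_vector_derivative_within_subset) (use assms in auto)
  moreover have "((\<lambda>t. t + T) has_vector_derivative 1) (at t within {0..})"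
    by (auto intro!: derivative_eq_intros)
  ultimately have "(X \<circ> (\<lambda>t. t + T) has_vector_derivative 1 *\<^sub>R f (X (t + T))) (at t within {0..})"
    by (intro vector_diff_chain_within)
  then show "((\<lambda>t. X (t + T)) has_vector_derivative f (X (t + T))) (at t within {0..})" by (simp add: o_def)
qed

text \<open>The squared distance times \<open>exp (- (2 * L * t))\<close> has a nonpositive
  derivative. The Lipschitz bound is asked only along the two trajectories, so that constants of
  balls can be used.\<close>

lemma Gronwall_distance:
  fixes X Y :: "real \<Rightarrow> 'a::real_inner"
  assumes X: "solves f X" and Y: "solves f Y" and T: "T \<ge> 0"
    and L: "\<And>t. 0 \<le> t \<Longrightarrow> t \<le> T \<Longrightarrow> norm (f (X t) - f (Y t)) \<le> L * norm (X t - Y t)"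
  shows "norm (X T - Y T) \<le> exp (L * T) * norm (X 0 - Y 0)"
proof -
  define u where "u t = ((X t - Y t) \<bullet> (X t - Y t)) * exp (- (2 * L * t))" for t
  define u' where "u' t = (2 * ((X t - Y t) \<bullet> (f (X t) - f (Y t))) - 2 * L * ((X t - Y t) \<bullet> (X t - Y t))) * exp (- (2 * L * t))" for t
  have d: "(u has_derivative (\<lambda>h. h * u' t)) (at t within {0..T})" if "t \<in> {0..T}" for t
  proof -
    have "(X has_derivative (\<lambda>h. h *\<^sub>R f (X t))) (at t within {0..T})" "(Y has_derivative (\<lambda>h. h *\<^sub>R f (Y t))) (at t within {0..T})"
      using X Y that by (auto simp: solves_def has_vector_derivative_def intro: has_derivative_subset)
    then show ?thesis unfolding u_def
      by (auto intro!: derivative_eq_intros simp: u'_def fun_eq_iff inner_commute algebra_simps)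
  qed
  have "u' t \<le> 0" if "t \<in> {0..T}" for t
  proof -
    have "(X t - Y t) \<bullet> (f (X t) - f (Y t)) \<le> norm (X t - Y t) * norm (f (X t) - f (Y t))" by (rule norm_cauchy_schwarz)
    also have "\<dots> \<le> norm (X t - Y t) * (L * norm (X t - Y t))" using L[of t] that by (intro mult_left_mono) auto
    also have "\<dots> = L * ((X t - Y t) \<bullet> (X t - Y t))" by (simp add: dot_square_norm power2_eq_square)
    finally show ?thesis by (auto simp: u'_def intro!: mult_nonpos_nonneg)
  qed
  moreover obtain t where "t \<in> {0..T}" "u T - u 0 = T * u' t"
    using mvt_very_simple[OF T d] by auto
  ultimately have "u T \<le> u 0"
    using mult_nonneg_nonpos[OF T, of "u' t"] by simp
  then have "(norm (X T - Y T))\<^sup>2 * exp (- (2 * L * T)) \<le> (norm (X 0 - Y 0))\<^sup>2" by (simp add: u_def dot_square_norm)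
  then have "(norm (X T - Y T))\<^sup>2 \<le> (norm (X 0 - Y 0))\<^sup>2 * exp (2 * L * T)"
    by (simp add: exp_minus divide_inverse[symmetric] pos_divide_le_eq)
  also have "\<dots> = (exp (L * T) * norm (X 0 - Y 0))\<^sup>2" by (simp add: power_mult_distrib exp_double mult.assoc)
  finally show ?thesis by (rule power2_le_imp_le) simp
qed

lemma solves_bounded:
  fixes X :: "real \<Rightarrow> 'a::real_normed_vector"
  assumes "solves f X"
  shows "\<exists>R>0. \<forall>t. 0 \<le> t \<and> t \<le> T \<longrightarrow> norm (X t) \<le> R"
proof -
  have "continuous_on {0..T} X" using solves_continuous[OF assms] by (rule continuous_on_subset) auto
  then have "bounded (X ` {0..T})" by (intro compact_imp_bounded compact_continuous_image) auto
  then show ?thesis by (auto simp: bounded_pos)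
qed

definition ball_Lipschitz :: "('a::real_normed_vector \<Rightarrow> 'a) \<Rightarrow> bool" where
  "ball_Lipschitz f \<longleftrightarrow> (\<forall>R. \<exists>L\<ge>0. \<forall>x y. norm x \<le> R \<longrightarrow> norm y \<le> R \<longrightarrow> norm (f x - f y) \<le> L * norm (x - y))"

lemma solves_unique:
  fixes X Y :: "real \<Rightarrow> 'a::real_inner"
  assumes f: "ball_Lipschitz f" and X: "solves f X" and Y: "solves f Y" and "X 0 = Y 0" "T \<ge> 0"
  shows "X T = Y T"
proof -
  obtain R1 where R1: "\<And>t. 0 \<le> t \<Longrightarrow> t \<le> T \<Longrightarrow> norm (X t) \<le> R1" using solves_bounded[OF X] by blast
  obtain R2 where R2: "\<And>t. 0 \<le> t \<Longrightarrow> t \<le> T \<Longrightarrow> norm (Y t) \<le> R2" using solves_bounded[OF Y] by blast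
  obtain L where L: "\<And>x y. norm x \<le> max R1 R2 \<Longrightarrow> norm y \<le> max R1 R2 \<Longrightarrow> norm (f x - f y) \<le> L * norm (x - y)"
    using f unfolding ball_Lipschitz_def by blast
  have "norm (X T - Y T) \<le> exp (L * T) * norm (X 0 - Y 0)"
    by (rule Gronwall_distance[OF X Y assms(5)]) (use R1 R2 L in \<open>simp add: le_max_iff_disj\<close>)
  then show ?thesis using assms by simp
qed

text \<open>The Lipschitz constant is valid on the ball of radius \<open>R + 1\<close> only, so the
  second trajectory must be kept inside it. At the first time at which the distance is 1 the
  Gronwall bound still holds and makes the distance smaller than 1, a contradiction.\<close>

lemma solves_continuous_dependence:
  fixes X :: "real \<Rightarrow> 'a::real_inner"
  assumes f: "ball_Lipschitz f" and X: "solves f X" and T: "T \<ge> 0" and e: "e > 0"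
  shows "\<exists>r>0. \<forall>Y. solves f Y \<and> norm (X 0 - Y 0) < r \<longrightarrow> norm (X T - Y T) < e"
proof -
  obtain R where R: "\<And>t. 0 \<le> t \<Longrightarrow> t \<le> T \<Longrightarrow> norm (X t) \<le> R" using solves_bounded[OF X] by blast
  obtain L where L0: "L \<ge> 0" and L: "\<And>x y. norm x \<le> R + 1 \<Longrightarrow> norm y \<le> R + 1 \<Longrightarrow> norm (f x - f y) \<le> L * norm (x - y)"
    using f unfolding ball_Lipschitz_def by blast
  have pair: "norm (X t - Y t) \<le> exp (L * T) * norm (X 0 - Y 0)"
    if Y: "solves f Y" and t: "0 \<le> t" "t \<le> T" and c: "\<And>s. 0 \<le> s \<Longrightarrow> s \<le> t \<Longrightarrow> norm (X s - Y s) \<le> 1" for Y t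
  proof -
    have "norm (X t - Y t) \<le> exp (L * t) * norm (X 0 - Y 0)"
    proof (rule Gronwall_distance[OF X Y t(1)])
      fix s assume s: "0 \<le> s" "s \<le> t"
      have "norm (Y s) \<le> norm (X s) + norm (X s - Y s)" using norm_triangle_sub[of "Y s" "X s"] by (simp add: norm_minus_commute)
      then show "norm (f (X s) - f (Y s)) \<le> L * norm (X s - Y s)"
        using R[of s] c[of s] s t by (intro L) auto
    qed
    also have "\<dots> \<le> exp (L * T) * norm (X 0 - Y 0)"
      using L0 t by (intro mult_right_mono) (auto intro: mult_left_mono)
    finally show ?thesis .
  qed
  \<comment> \<open>The 1 serves the continuation argument, \<open>e\<close> the conclusion; the
    exponential is the Gronwall factor.\<close>
  define r where "r = min 1 e / exp (L * T)"
  have r: "r > 0" using e by (simp add: r_def)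
  have "norm (X T - Y T) < e" if Y: "solves f Y" and r': "norm (X 0 - Y 0) < r" for Y
  proof -
    have m: "exp (L * T) * norm (X 0 - Y 0) < min 1 e"
      using r' by (simp add: r_def pos_less_divide_eq mult.commute)
    have cont: "continuous_on {0..b} (\<lambda>t. norm (X t - Y t))" for b
      using solves_continuous[OF X] solves_continuous[OF Y]
      by (intro continuous_intros) (auto intro: continuous_on_subset)
    have e1: "1 \<le> exp (L * T)" using L0 T by simp
    have "norm (X 0 - Y 0) \<le> exp (L * T) * norm (X 0 - Y 0)" using mult_right_mono[OF e1, of "norm (X 0 - Y 0)"] by simp
    then have start: "norm (X 0 - Y 0) < 1" using m by simp
    have "norm (X t - Y t) < 1" if t: "0 \<le> t" "t \<le> T" for t
    proof (rule ccontr)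
      assume "\<not> norm (X t - Y t) < 1"
      define A where "A = {s \<in> {0..t}. norm (X s - Y s) = 1}"
      have hit: "\<exists>s\<in>{0..b}. norm (X s - Y s) = 1" if "0 \<le> b" "1 \<le> norm (X b - Y b)" for b
        using IVT'[of "\<lambda>s. norm (X s - Y s)" 0 1 b] start that cont by auto
      have "A \<noteq> {}" using hit[of t] \<open>\<not> _\<close> t by (auto simp: A_def)
      moreover have "compact A"
      proof -
        have "closed ({0..t} \<inter> (\<lambda>s. norm (X s - Y s)) -` {1})"
          by (rule continuous_closed_preimage[OF cont]) auto
        moreover have "A = {0..t} \<inter> (\<lambda>s. norm (X s - Y s)) -` {1}" by (auto simp: A_def)
        moreover have "bounded A" by (rule bounded_subset[of "{0..t}"]) (auto simp: A_def)
        ultimately show ?thesis by (simp add: compact_eq_bounded_closed)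
      qed
      ultimately obtain b where b: "b \<in> A" "\<And>s. s \<in> A \<Longrightarrow> b \<le> s" using compact_attains_inf[of A] by auto
      have "norm (X s - Y s) \<le> 1" if s: "0 \<le> s" "s \<le> b" for s
      proof (rule ccontr)
        assume n: "\<not> norm (X s - Y s) \<le> 1"
        then obtain s' where "s' \<in> {0..s}" "norm (X s' - Y s') = 1" using hit[of s] s by auto
        moreover from this have "b \<le> s'" using b s by (auto simp: A_def)
        ultimately have "s = s'" using s by auto
        then show False using n \<open>norm (X s' - Y s') = 1\<close> by simp
      qed
      then have "norm (X b - Y b) \<le> exp (L * T) * norm (X 0 - Y 0)"
        using b(1) t by (intro pair[OF Y]) (auto simp: A_def)
      then show False using m b(1) by (simp add: A_def)
    qed
    then have "norm (X T - Y T) \<le> exp (L * T) * norm (X 0 - Y 0)"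
      using T by (intro pair[OF Y]) (auto intro: less_imp_le)
    then show ?thesis using m by simp
  qed
  with r show ?thesis by blast
qed

text \<open>A trajectory that has entered the ball of exponential stability at a finite time takes a
  neighbourhood of its starting point along, by continuous dependence. Openness is what leaves room
  for cutting off \<open>M\<close> around the closure of \<open>\<Omega>\<close>.\<close>

lemma open_basin:
  fixes f :: "real^'n \<Rightarrow> real^'n"
  assumes f: "ball_Lipschitz f" and fl: "solution_flow f fl" and st: "exp_stable_equilibrium f fl x0"
  shows "open (basin fl x0)"
proof (rule openI)
  have sol: "solves f (\<lambda>t. fl t y)" and fl0: "fl 0 y = y" for y using fl by (auto simp: solves_def solution_flow_def)
  fix y0 assume y0: "y0 \<in> basin fl x0"
  obtain \<alpha> \<beta> \<delta> where ab: "\<alpha> > 0" "\<beta> > 0" "\<delta> > 0"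
    and dec: "\<And>\<xi> t. norm (\<xi> - x0) < \<delta> \<Longrightarrow> 0 \<le> t \<Longrightarrow> norm (fl t \<xi> - x0) \<le> \<alpha> * norm (\<xi> - x0) * exp (- \<beta> * t)"
    using st unfolding exp_stable_equilibrium_def by blast
  have "\<forall>\<^sub>F t in at_top. dist (fl t y0) x0 < \<delta> / 2"
    using y0 ab(3) by (intro tendstoD) (auto simp: basin_def)
  then obtain N where N: "\<And>t. t \<ge> N \<Longrightarrow> dist (fl t y0) x0 < \<delta> / 2" by (auto simp: eventually_at_top_linorder)
  define T where "T = max N 0"
  have T: "T \<ge> 0" "norm (fl T y0 - x0) < \<delta> / 2" using N[of T] by (auto simp: T_def dist_norm)
  obtain r where r: "r > 0" "\<And>Y. solves f Y \<Longrightarrow> norm (fl 0 y0 - Y 0) < r \<Longrightarrow> norm (fl T y0 - Y T) < \<delta> / 2"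
    using solves_continuous_dependence[OF f sol[of y0] T(1), of "\<delta> / 2"] ab(3) by auto
  have "ball y0 r \<subseteq> basin fl x0"
  proof
    fix y assume "y \<in> ball y0 r"
    then have "norm (fl T y0 - fl T y) < \<delta> / 2" by (intro r(2)[OF sol]) (simp add: fl0 dist_norm)
    moreover have "norm (fl T y - x0) \<le> norm (fl T y0 - fl T y) + norm (fl T y0 - x0)"
      using norm_triangle_ineq4[of "fl T y0 - x0" "fl T y0 - fl T y"] by simp
    ultimately have near: "norm (fl T y - x0) < \<delta>" using T(2) by linarith
    have "filterlim (\<lambda>t. - \<beta> * t) at_bot at_top"
      by (rule filterlim_tendsto_neg_mult_at_bot[OF tendsto_const _ filterlim_ident]) (use ab(2) in simp)
    then have "((\<lambda>t. \<alpha> * norm (fl T y - x0) * exp (- \<beta> * t)) \<longlongrightarrow> 0) at_top"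
      by (intro tendsto_mult_right_zero filterlim_compose[OF exp_at_bot])
    moreover have "\<forall>\<^sub>F t in at_top. norm (fl t (fl T y) - x0) \<le> \<alpha> * norm (fl T y - x0) * exp (- \<beta> * t)"
      using eventually_ge_at_top[of 0] by eventually_elim (rule dec[OF near])
    ultimately have "((\<lambda>t. fl t (fl T y) - x0) \<longlongrightarrow> 0) at_top" by (rule Lim_null_comparison[rotated])
    then have lim: "((\<lambda>t. fl t (fl T y)) \<longlongrightarrow> x0) at_top" by (simp add: LIM_zero_iff)
    have "\<forall>\<^sub>F t in at_top. fl t (fl T y) = fl (t + T) y"
      using eventually_ge_at_top[of 0]
      by eventually_elim (rule solves_unique[OF f sol solves_shift[OF sol T(1)]], simp_all add: fl0)
    then have "((\<lambda>t. fl (t + T) y) \<longlongrightarrow> x0) at_top" using lim by (simp cong: filterlim_cong)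
    then have "((\<lambda>t. fl (t - T + T) y) \<longlongrightarrow> x0) at_top"
      by (rule filterlim_compose) (auto intro!: filterlim_at_top[THEN iffD2] simp: eventually_at_top_linorder le_diff_eq intro: exI[where x="_ + T"])
    then show "y \<in> basin fl x0" by (simp add: basin_def)
  qed
  with r(1) show "\<exists>T>0. ball y0 T \<subseteq> basin fl x0" by blast
qed

section \<open>Recovery of the contraction metric\<close>

lemma inner_transpose_vector: "v \<bullet> (transpose A *v w) = w \<bullet> (A *v v)" for A :: "real^'n^'n"
  by (metis dot_lmul_matrix inner_commute transpose_matrix_vector)

lemma symmetric_mat_inner: "symmetric_mat A \<Longrightarrow> v \<bullet> (A *v w) = w \<bullet> (A *v v)"
  using inner_transpose_vector[of v A w] by (simp add: symmetric_mat_def)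

lemma entries_vector_bound:
  fixes A :: "real^'n^'n"
  assumes "\<And>i j. \<bar>A $ i $ j\<bar> \<le> b"
  shows "norm (A *v v) \<le> (real CARD('n))\<^sup>2 * b * norm v"
proof -
  have "\<bar>(A *v v) $ i\<bar> \<le> real CARD('n) * (b * norm v)" for i
  proof -
    have "\<bar>A $ i $ j * v $ j\<bar> \<le> b * norm v" for j
      unfolding abs_mult
      using assms[of i j] by (intro mult_mono component_le_norm_cart) (auto intro: order_trans[OF abs_ge_zero])
    then have "norm (\<Sum>j\<in>UNIV. A $ i $ j * v $ j) \<le> (\<Sum>j\<in>(UNIV :: 'n set). b * norm v)"
      by (intro sum_norm_le) simp
    then have "\<bar>(A *v v) $ i\<bar> \<le> (\<Sum>j\<in>(UNIV :: 'n set). b * norm v)"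
      by (simp add: matrix_vector_mult_def)
    then show ?thesis by simp
  qed
  then have "(\<Sum>i\<in>UNIV. \<bar>(A *v v) $ i\<bar>) \<le> (\<Sum>i\<in>(UNIV :: 'n set). real CARD('n) * (b * norm v))"
    by (intro sum_mono)
  then show ?thesis using norm_le_l1_cart[of "A *v v"] by (simp add: power2_eq_square mult.assoc)
qed

lemma entries_form_bound:
  fixes A :: "real^'n^'n"
  assumes "\<And>i j. \<bar>A $ i $ j\<bar> \<le> b"
  shows "\<bar>v \<bullet> (A *v w)\<bar> \<le> (real CARD('n))\<^sup>2 * b * (norm v * norm w)"
proof -
  have "\<bar>v \<bullet> (A *v w)\<bar> \<le> norm v * norm (A *v w)" by (rule Cauchy_Schwarz_ineq2)
  also have "\<dots> \<le> norm v * ((real CARD('n))\<^sup>2 * b * norm w)" by (intro mult_left_mono entries_vector_bound assms) simp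
  finally show ?thesis by (simp add: mult_ac)
qed

lemma entries_form_le:
  fixes A :: "real^'n^'n"
  assumes "\<And>i j. \<bar>A $ i $ j\<bar> \<le> b" "norm v \<le> p" "norm w \<le> q"
  shows "v \<bullet> (A *v w) \<le> (real CARD('n))\<^sup>2 * b * (p * q)"
proof -
  have "0 \<le> b" using assms(1) abs_ge_zero order_trans by blast
  moreover have "norm v * norm w \<le> p * q"
    using assms(2,3) order_trans[OF norm_ge_zero assms(2)] by (intro mult_mono) auto
  ultimately have "(real CARD('n))\<^sup>2 * b * (norm v * norm w) \<le> (real CARD('n))\<^sup>2 * b * (p * q)"
    by (intro mult_left_mono) auto
  then show ?thesis using entries_form_bound[OF assms(1), of v w] by linarith
qed

text \<open>\<open>G\<close> holds the gradients of the entries. The Taylor estimate is demanded for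
  every pair of points of \<open>\<Omega>\<close>, which need not be convex. A recovery
  \<open>S\<close> enters the later constants only through \<open>\<Lambda>\<close>.\<close>

definition C11_on :: "real \<Rightarrow> (real^'n) set \<Rightarrow> (real^'n \<Rightarrow> real^'n^'n) \<Rightarrow> (real^'n \<Rightarrow> 'n \<Rightarrow> 'n \<Rightarrow> real^'n) \<Rightarrow> bool" where
  "C11_on \<Lambda> \<Omega> s G \<longleftrightarrow> 0 \<le> \<Lambda> \<and> (\<forall>x\<in>\<Omega>. symmetric_mat (s x) \<and>
     (\<forall>i j. \<bar>s x $ i $ j\<bar> \<le> \<Lambda> \<and> norm (G x i j) \<le> \<Lambda> \<and>
        (\<forall>y\<in>\<Omega>. \<bar>s y $ i $ j - s x $ i $ j - G x i j \<bullet> (y - x)\<bar> \<le> \<Lambda> * (norm (y - x))\<^sup>2)))"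

lemma C11_onD:
  assumes "C11_on \<Lambda> \<Omega> s G"
  shows "0 \<le> \<Lambda>" "x \<in> \<Omega> \<Longrightarrow> symmetric_mat (s x)" "x \<in> \<Omega> \<Longrightarrow> \<bar>s x $ i $ j\<bar> \<le> \<Lambda>" "x \<in> \<Omega> \<Longrightarrow> norm (G x i j) \<le> \<Lambda>"
    "x \<in> \<Omega> \<Longrightarrow> y \<in> \<Omega> \<Longrightarrow> \<bar>s y $ i $ j - s x $ i $ j - G x i j \<bullet> (y - x)\<bar> \<le> \<Lambda> * (norm (y - x))\<^sup>2"
  using assms by (auto simp: C11_on_def)

lemma C11_on_add_scaled:
  assumes s: "C11_on \<Lambda> \<Omega> s G" and s': "C11_on \<Lambda>' \<Omega> s' G'"
  shows "C11_on (\<Lambda> + \<bar>t\<bar> * \<Lambda>') \<Omega> (\<lambda>x. s x + t *\<^sub>R s' x) (\<lambda>x i j. G x i j + t *\<^sub>R G' x i j)"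
  unfolding C11_on_def
proof (intro conjI ballI allI)
  show "0 \<le> \<Lambda> + \<bar>t\<bar> * \<Lambda>'" using C11_onD(1)[OF s] C11_onD(1)[OF s'] by simp
  fix x assume x: "x \<in> \<Omega>"
  show "symmetric_mat (s x + t *\<^sub>R s' x)"
    using C11_onD(2)[OF s x] C11_onD(2)[OF s' x] by (simp add: symmetric_mat_def transpose_def vec_eq_iff)
  fix i j
  have "\<bar>t * s' x $ i $ j\<bar> \<le> \<bar>t\<bar> * \<Lambda>'" using C11_onD(3)[OF s' x, of i j] by (simp add: abs_mult mult_left_mono)
  then show "\<bar>(s x + t *\<^sub>R s' x) $ i $ j\<bar> \<le> \<Lambda> + \<bar>t\<bar> * \<Lambda>'" using C11_onD(3)[OF s x, of i j] by simp
  have "norm (t *\<^sub>R G' x i j) \<le> \<bar>t\<bar> * \<Lambda>'" using C11_onD(4)[OF s' x, of i j] by (simp add: mult_left_mono)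
  then show "norm (G x i j + t *\<^sub>R G' x i j) \<le> \<Lambda> + \<bar>t\<bar> * \<Lambda>'"
    using C11_onD(4)[OF s x, of i j] norm_triangle_ineq[of "G x i j" "t *\<^sub>R G' x i j"] by linarith
  fix y assume y: "y \<in> \<Omega>"
  have "\<bar>t * (s' y $ i $ j - s' x $ i $ j - G' x i j \<bullet> (y - x))\<bar> \<le> \<bar>t\<bar> * (\<Lambda>' * (norm (y - x))\<^sup>2)"
    using C11_onD(5)[OF s' x y, of i j] by (simp add: abs_mult mult_left_mono)
  moreover have "(s y + t *\<^sub>R s' y) $ i $ j - (s x + t *\<^sub>R s' x) $ i $ j - (G x i j + t *\<^sub>R G' x i j) \<bullet> (y - x)
     = (s y $ i $ j - s x $ i $ j - G x i j \<bullet> (y - x)) + t * (s' y $ i $ j - s' x $ i $ j - G' x i j \<bullet> (y - x))"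
    by (simp add: inner_add_left algebra_simps)
  ultimately show "\<bar>(s y + t *\<^sub>R s' y) $ i $ j - (s x + t *\<^sub>R s' x) $ i $ j - (G x i j + t *\<^sub>R G' x i j) \<bullet> (y - x)\<bar>
     \<le> (\<Lambda> + \<bar>t\<bar> * \<Lambda>') * (norm (y - x))\<^sup>2"
    using C11_onD(5)[OF s x y, of i j] by (simp add: distrib_right)
qed

definition dir_mat :: "(real^'n \<Rightarrow> 'n \<Rightarrow> 'n \<Rightarrow> real^'n) \<Rightarrow> real^'n \<Rightarrow> real^'n \<Rightarrow> real^'n^'n" where
  "dir_mat G x w = (\<chi> i j. G x i j \<bullet> w)"

lemma flow_quotient:
  assumes "solution_flow f fl"
  shows "((\<lambda>h. (fl h x - x) /\<^sub>R h) \<longlongrightarrow> f x) (at_right 0)" "((\<lambda>h. fl h x) \<longlongrightarrow> x) (at_right 0)"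
proof -
  have 0: "fl 0 x = x" using assms by (simp add: solution_flow_def)
  have "((\<lambda>u. fl u x) has_vector_derivative f (fl 0 x)) (at 0 within {0..})"
    using assms unfolding solution_flow_def by blast
  then have d: "((\<lambda>u. fl u x) has_vector_derivative f x) (at_right 0)"
    by (simp add: 0 at_within_Ici_at_right)
  show "((\<lambda>h. (fl h x - x) /\<^sub>R h) \<longlongrightarrow> f x) (at_right 0)"
  proof -
    have "((\<lambda>h. (1 / norm (h - 0)) *\<^sub>R (fl h x - (fl 0 x + (h - 0) *\<^sub>R f x))) \<longlongrightarrow> 0) (at_right 0)"
      using d unfolding has_vector_derivative_def has_derivative_within by blast
    moreover have "\<forall>\<^sub>F h in at_right 0. (1 / norm (h - 0)) *\<^sub>R (fl h x - (fl 0 x + (h - 0) *\<^sub>R f x)) = (fl h x - x) /\<^sub>R h - f x"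
      using eventually_at_right_less[of 0]
      by eventually_elim (simp add: 0 scaleR_right_diff_distrib scaleR_right_distrib divide_inverse)
    ultimately have "((\<lambda>h. (fl h x - x) /\<^sub>R h - f x) \<longlongrightarrow> 0) (at_right 0)" by (rule Lim_transform_eventually)
    then show ?thesis by (simp add: LIM_zero_iff)
  qed
  show "((\<lambda>h. fl h x) \<longlongrightarrow> x) (at_right 0)"
    using has_vector_derivative_continuous[OF d] 0 by (simp add: continuous_within)
qed

lemma orbital_derivative_eqI:
  assumes "\<And>i j. ((\<lambda>h. (s (fl h x) $ i $ j - s x $ i $ j) / h) \<longlongrightarrow> Q $ i $ j) (at_right 0)"
  shows "orbital_derivative fl s x = Q"
proof -
  have "Limsup (at_right 0) (\<lambda>h. ereal ((s (fl h x) $ i $ j - s x $ i $ j) / h)) = ereal (Q $ i $ j)" for i j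
    using assms[of i j] by (intro lim_imp_Limsup) (simp_all add: trivial_limit_at_right_real)
  then show ?thesis by (simp add: orbital_derivative_def vec_eq_iff)
qed

lemma orbital_derivative_cong:
  assumes "\<forall>\<^sub>F h in at_right 0. s (fl h x) = s' (fl h x)" "s x = s' x"
  shows "orbital_derivative fl s x = orbital_derivative fl s' x"
proof -
  have "Limsup (at_right 0) (\<lambda>h. ereal ((s (fl h x) $ i $ j - s x $ i $ j) / h))
      = Limsup (at_right 0) (\<lambda>h. ereal ((s' (fl h x) $ i $ j - s' x $ i $ j) / h))" for i j
    by (rule Limsup_eq, use assms(1) in eventually_elim) (simp add: assms(2))
  then show ?thesis by (simp add: orbital_derivative_def)
qed

text \<open>The Taylor estimate along the trajectory makes the difference quotients converge, so the
  limsup is a limit, namely the directional derivative along \<open>f x\<close>.\<close>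

lemma orbital_derivative_C11:
  assumes fl: "solution_flow f fl" and \<Omega>: "open \<Omega>" "x \<in> \<Omega>" and s: "C11_on \<Lambda> \<Omega> s G"
  shows "orbital_derivative fl s x = dir_mat G x (f x)"
proof (rule orbital_derivative_eqI)
  fix i j
  note fq = flow_quotient[OF fl, of x]
  have ev: "\<forall>\<^sub>F h in at_right 0. fl h x \<in> \<Omega>" by (rule topological_tendstoD[OF fq(2) \<Omega>])
  have pos: "\<forall>\<^sub>F h :: real in at_right 0. h > 0" by (simp add: eventually_at_right_less)
  have lin: "((\<lambda>h. G x i j \<bullet> ((fl h x - x) /\<^sub>R h)) \<longlongrightarrow> G x i j \<bullet> f x) (at_right 0)"
    by (intro tendsto_intros fq)
  have "((\<lambda>h. \<Lambda> * (norm ((fl h x - x) /\<^sub>R h) * norm (fl h x - x))) \<longlongrightarrow> \<Lambda> * (norm (f x) * norm (x - x))) (at_right 0)"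
    by (intro tendsto_intros fq)
  then have z: "((\<lambda>h. \<Lambda> * (norm ((fl h x - x) /\<^sub>R h) * norm (fl h x - x))) \<longlongrightarrow> 0) (at_right 0)" by simp
  have "((\<lambda>h. (s (fl h x) $ i $ j - s x $ i $ j) / h - G x i j \<bullet> ((fl h x - x) /\<^sub>R h)) \<longlongrightarrow> 0) (at_right 0)"
  proof (rule Lim_null_comparison[OF _ z])
    show "\<forall>\<^sub>F h in at_right 0. norm ((s (fl h x) $ i $ j - s x $ i $ j) / h - G x i j \<bullet> ((fl h x - x) /\<^sub>R h))
        \<le> \<Lambda> * (norm ((fl h x - x) /\<^sub>R h) * norm (fl h x - x))"
      using ev pos
    proof eventually_elim
      case (elim h)
      have eq: "(s (fl h x) $ i $ j - s x $ i $ j) / h - G x i j \<bullet> ((fl h x - x) /\<^sub>R h)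
         = (s (fl h x) $ i $ j - s x $ i $ j - G x i j \<bullet> (fl h x - x)) / h"
        by (simp add: divide_inverse algebra_simps)
      have "norm ((s (fl h x) $ i $ j - s x $ i $ j - G x i j \<bullet> (fl h x - x)) / h) \<le> \<Lambda> * (norm (fl h x - x))\<^sup>2 / h"
        using C11_onD(5)[OF s \<Omega>(2) elim(1)] elim(2) by (simp add: abs_divide divide_right_mono)
      also have "\<dots> = \<Lambda> * (norm ((fl h x - x) /\<^sub>R h) * norm (fl h x - x))"
        using elim(2) by (simp add: power2_eq_square divide_inverse mult_ac)
      finally show ?case unfolding eq .
    qed
  qed
  from tendsto_add[OF this lin] show "((\<lambda>h. (s (fl h x) $ i $ j - s x $ i $ j) / h) \<longlongrightarrow> dir_mat G x (f x) $ i $ j) (at_right 0)"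
    by (simp add: dir_mat_def)
qed

text \<open>The quadratic form of the operator \<open>F\<close> for symmetric \<open>N\<close>, with
  \<open>A\<close> as the Jacobian and \<open>Q\<close> as the orbital derivative; both products
  with \<open>A\<close> then give the same form. It is linear in the pair of \<open>N\<close> and
  \<open>Q\<close>.\<close>

definition Fform :: "real^'n^'n \<Rightarrow> real^'n^'n \<Rightarrow> real^'n^'n \<Rightarrow> real^'n \<Rightarrow> real" where
  "Fform A N Q v = 2 * (v \<bullet> (N *v (A *v v))) + v \<bullet> (Q *v v)"

lemma Fform_eq:
  assumes "symmetric_mat N"
  shows "v \<bullet> ((transpose A ** N + N ** A + Q) *v v) = Fform A N Q v"
proof -
  have "v \<bullet> ((transpose A ** N) *v v) = (N *v v) \<bullet> (A *v v)"
    by (simp only: matrix_vector_mul_assoc[symmetric] inner_transpose_vector)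
  also have "\<dots> = v \<bullet> (N *v (A *v v))" using symmetric_mat_inner[OF assms, of "A *v v" v] by (simp add: inner_commute)
  finally show ?thesis
    by (simp add: Fform_def matrix_vector_mult_add_rdistrib inner_add_right matrix_vector_mul_assoc[symmetric])
qed

lemma Fform_add_scaled:
  "Fform A (N + t *\<^sub>R N') (Q + t *\<^sub>R Q') v = Fform A N Q v + t * Fform A N' Q' v"
  by (simp add: Fform_def matrix_vector_mult_add_rdistrib scaleR_matrix_vector_assoc[symmetric] inner_add_right algebra_simps)

lemma dir_mat_add_scaled:
  "dir_mat (\<lambda>x i j. G x i j + t *\<^sub>R G' x i j) x w = dir_mat G x w + t *\<^sub>R dir_mat G' x w"
  by (simp add: dir_mat_def vec_eq_iff inner_add_left)

lemma dir_mat_bound: "(\<And>i j. norm (G x i j) \<le> \<Lambda>) \<Longrightarrow> norm w \<le> b \<Longrightarrow> \<bar>dir_mat G x w $ i $ j\<bar> \<le> \<Lambda> * b"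
  using Cauchy_Schwarz_ineq2[of "G x i j" w] mult_mono[of "norm (G x i j)" \<Lambda> "norm w" b] norm_ge_zero[of "G x i j"]
    order_trans[OF norm_ge_zero, of "G x i j" \<Lambda>]
  by (force simp: dir_mat_def)

lemma derivative_norm_bound:
  fixes g :: "real \<Rightarrow> 'a::real_normed_vector"
  assumes "\<And>t. 0 \<le> t \<Longrightarrow> t \<le> h \<Longrightarrow> (g has_vector_derivative g' t) (at t within {0..})"
    and "\<And>t. 0 \<le> t \<Longrightarrow> t \<le> h \<Longrightarrow> norm (g' t) \<le> B" and h: "0 \<le> h"
  shows "norm (g h - g 0) \<le> B * h"
proof -
  have "norm (g h - g 0) \<le> B * norm (h - 0)"
  proof (rule differentiable_bound[where S="{0..h}" and f'="\<lambda>t s. s *\<^sub>R g' t"])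
    fix t assume t: "t \<in> {0..h}"
    show "(g has_derivative (\<lambda>s. s *\<^sub>R g' t)) (at t within {0..h})"
      using assms(1)[of t] t by (auto simp: has_vector_derivative_def intro: has_derivative_subset)
    show "onorm (\<lambda>s. s *\<^sub>R g' t) \<le> B"
    proof (rule onorm_le)
      fix s :: real show "norm (s *\<^sub>R g' t) \<le> B * norm s"
        using mult_left_mono[of "norm (g' t)" B "\<bar>s\<bar>"] assms(2)[of t] t by (simp add: mult.commute)
    qed
  qed (use h in auto)
  then show ?thesis using h by simp
qed

section \<open>The Lyapunov argument on the invariant set\<close>

locale invariant_domain =
  fixes f :: "real^'n \<Rightarrow> real^'n" and fl and \<Omega> D :: "(real^'n) set" and b L :: real
  assumes flow: "solution_flow f fl" and D: "D \<subseteq> \<Omega>" and inv: "positively_invariant fl D"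
    and b: "0 \<le> b" "\<And>x. x \<in> D \<Longrightarrow> norm (f x) \<le> b" "\<And>x i j. x \<in> D \<Longrightarrow> \<bar>Df f x $ i $ j\<bar> \<le> b"
    and L: "0 \<le> L" "\<And>x y. x \<in> D \<Longrightarrow> y \<in> D \<Longrightarrow> norm (f x - f y) \<le> L * norm (x - y)"
begin

lemma flow_step:
  assumes x: "x \<in> D" and h: "0 \<le> h"
  shows "fl h x \<in> D" "norm (fl h x - x) \<le> b * h" "norm (fl h x - x - h *\<^sub>R f x) \<le> L * b * h\<^sup>2"
proof -
  have fd: "((\<lambda>u. fl u x) has_vector_derivative f (fl t x)) (at t within {0..})" if "0 \<le> t" for t
    using flow that by (simp add: solution_flow_def)
  have 0: "fl 0 x = x" using flow by (simp add: solution_flow_def)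
  have i: "fl t x \<in> D" if "0 \<le> t" for t using inv x that by (simp add: positively_invariant_def)
  show "fl h x \<in> D" by (rule i[OF h])
  have s: "norm (fl t x - x) \<le> b * t" if "0 \<le> t" for t
    using derivative_norm_bound[of t "\<lambda>u. fl u x" "\<lambda>u. f (fl u x)" b] fd b(2) i that 0 by simp
  show "norm (fl h x - x) \<le> b * h" by (rule s[OF h])
  have "norm ((fl h x - h *\<^sub>R f x) - (fl 0 x - 0 *\<^sub>R f x)) \<le> (L * (b * h)) * h"
  proof (rule derivative_norm_bound[where g'="\<lambda>u. f (fl u x) - f x", OF _ _ h])
    fix t :: real assume t: "0 \<le> t" "t \<le> h"
    show "((\<lambda>u. fl u x - u *\<^sub>R f x) has_vector_derivative f (fl t x) - f x) (at t within {0..})"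
      using fd[OF t(1)] by (auto intro!: derivative_eq_intros)
    have "norm (f (fl t x) - f x) \<le> L * norm (fl t x - x)" by (rule L(2)[OF i[OF t(1)] x])
    also have "\<dots> \<le> L * (b * h)"
      using s[OF t(1)] mult_left_mono[OF t(2) b(1)] L(1) by (intro mult_left_mono) auto
    finally show "norm (f (fl t x) - f x) \<le> L * (b * h)" .
  qed
  then show "norm (fl h x - x - h *\<^sub>R f x) \<le> L * b * h\<^sup>2"
    by (simp add: 0 power2_eq_square algebra_simps)
qed

text \<open>If the quadratic form were close to 0 in a direction \<open>v\<close> at \<open>x\<close>, then an Euler step along the flow
  would make it negative.\<close>

lemma strict_improvement:
  assumes N: "C11_on \<Lambda> \<Omega> N G" and pos: "\<And>x v. x \<in> D \<Longrightarrow> 0 \<le> v \<bullet> (N x *v v)" and \<kappa>: "\<kappa> > 0"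
    and F: "\<And>x v. x \<in> D \<Longrightarrow> Fform (Df f x) (N x) (dir_mat G x (f x)) v \<le> - \<kappa> * (norm v)\<^sup>2"
  shows "\<exists>\<eta>>0. \<forall>x\<in>D. \<forall>v. \<eta> * (norm v)\<^sup>2 \<le> v \<bullet> (N x *v v)"
proof -
  define n where "n = (real CARD('n))\<^sup>2"
  have n: "n \<ge> 0" by (simp add: n_def)
  define a where "a = n * b"
  define q where "q = \<Lambda> * b"
  define r where "r = \<Lambda> * (b\<^sup>2 + L * b)"
  have \<Lambda>: "\<Lambda> \<ge> 0" by (rule C11_onD(1)[OF N])
  have nn: "a \<ge> 0" "q \<ge> 0" "r \<ge> 0" using n b(1) L(1) \<Lambda> by (auto simp: a_def q_def r_def)
  \<comment> \<open>Collects the coefficients of all terms of order \<open>h\<^sup>2\<close>; the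
    summand 1 makes it positive.\<close>
  define c where "c = n * \<Lambda> * a\<^sup>2 + 2 * n * q * a + n * q * a\<^sup>2 + n * r * (1 + a)\<^sup>2 + 1"
  have c: "c > 0" unfolding c_def using n nn \<Lambda> by (intro add_nonneg_pos add_nonneg_nonneg mult_nonneg_nonneg) auto
  \<comment> \<open>With this step size the second-order terms use up at most half of the decrease
    \<open>h * \<kappa>\<close>.\<close>
  define h where "h = min 1 (\<kappa> / (2 * c))"
  have h: "0 < h" "h \<le> 1" "h * c \<le> \<kappa> / 2" using \<kappa> c by (auto simp: h_def min_def field_simps)
  have "h * \<kappa> / 2 * (norm v)\<^sup>2 \<le> v \<bullet> (N x *v v)" if x: "x \<in> D" for x v
  proof -
    have x\<Omega>: "x \<in> \<Omega>" using x D by auto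
    define y where "y = fl h x"
    note st = flow_step[OF x, of h, folded y_def]
    have y: "y \<in> D" "y \<in> \<Omega>" using st(1) h(1) D by auto
    define w where "w = Df f x *v v"
    \<comment> \<open>An Euler step of the linearised equation: to first order in \<open>h\<close>,
      the form of \<open>N y\<close> at \<open>u\<close> is the form of \<open>N x\<close> at
      \<open>v\<close> plus \<open>h\<close> times \<open>Fform\<close>.\<close>
    define u where "u = v + h *\<^sub>R w"
    define Q where "Q = dir_mat G x (f x)"
    define R where "R = N y - N x - h *\<^sub>R Q"
    have w: "norm w \<le> a * norm v" unfolding w_def a_def n_def by (rule entries_vector_bound[OF b(3)[OF x]])
    have u: "norm u \<le> (1 + a) * norm v"
    proof -
      have "norm u \<le> norm v + h * norm w" unfolding u_def using norm_triangle_ineq[of v "h *\<^sub>R w"] h(1) by simp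
      also have "h * norm w \<le> 1 * (a * norm v)" using w h by (intro mult_mono) auto
      finally show ?thesis by (simp add: algebra_simps)
    qed
    have Qb: "\<bar>Q $ i $ j\<bar> \<le> q" for i j
      unfolding Q_def q_def by (rule dir_mat_bound[where G=G and x=x and w="f x", OF C11_onD(4)[OF N x\<Omega>] b(2)[OF x]])
    have Rb: "\<bar>R $ i $ j\<bar> \<le> r * h\<^sup>2" for i j
    proof -
      have "R $ i $ j = (N y $ i $ j - N x $ i $ j - G x i j \<bullet> (y - x)) + G x i j \<bullet> (y - x - h *\<^sub>R f x)"
        by (simp add: R_def Q_def dir_mat_def inner_diff_right)
      moreover have "\<bar>N y $ i $ j - N x $ i $ j - G x i j \<bullet> (y - x)\<bar> \<le> \<Lambda> * (b * h)\<^sup>2"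
      proof -
        have "(norm (y - x))\<^sup>2 \<le> (b * h)\<^sup>2" using st(2) h(1) by (intro power_mono) auto
        then show ?thesis
          using C11_onD(5)[OF N x\<Omega> y(2), of i j] mult_left_mono[OF _ \<Lambda>, of "(norm (y - x))\<^sup>2" "(b * h)\<^sup>2"] by linarith
      qed
      moreover have "\<bar>G x i j \<bullet> (y - x - h *\<^sub>R f x)\<bar> \<le> \<Lambda> * (L * b * h\<^sup>2)"
        using Cauchy_Schwarz_ineq2[of "G x i j" "y - x - h *\<^sub>R f x"]
          mult_mono[OF C11_onD(4)[OF N x\<Omega>, of i j] st(3) \<Lambda>] h(1) by simp
      ultimately have "\<bar>R $ i $ j\<bar> \<le> \<Lambda> * (b * h)\<^sup>2 + \<Lambda> * (L * b * h\<^sup>2)" by linarith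
      then show ?thesis by (simp add: r_def power_mult_distrib algebra_simps)
    qed
    have "0 \<le> u \<bullet> (N y *v u)" by (rule pos[OF y(1)])
    also have "N y = N x + h *\<^sub>R Q + R" by (simp add: R_def)
    also have "u \<bullet> ((N x + h *\<^sub>R Q + R) *v u) = u \<bullet> (N x *v u) + h * (u \<bullet> (Q *v u)) + u \<bullet> (R *v u)"
      by (simp add: matrix_vector_mult_add_rdistrib scaleR_matrix_vector_assoc[symmetric] inner_add_right)
    also have "u \<bullet> (N x *v u) = v \<bullet> (N x *v v) + h * (2 * (v \<bullet> (N x *v w))) + h\<^sup>2 * (w \<bullet> (N x *v w))"
      using symmetric_mat_inner[OF C11_onD(2)[OF N x\<Omega>], of w v]
      by (simp add: u_def matrix_vector_right_distrib matrix_vector_mult_scaleR inner_add_left inner_add_right power2_eq_square algebra_simps)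
    also have "u \<bullet> (Q *v u) = v \<bullet> (Q *v v) + h * (v \<bullet> (Q *v w) + w \<bullet> (Q *v v)) + h\<^sup>2 * (w \<bullet> (Q *v w))"
      by (simp add: u_def matrix_vector_right_distrib matrix_vector_mult_scaleR inner_add_left inner_add_right power2_eq_square algebra_simps)
    finally have "0 \<le> v \<bullet> (N x *v v) + h * Fform (Df f x) (N x) Q v
        + (h\<^sup>2 * (w \<bullet> (N x *v w)) + h\<^sup>2 * (v \<bullet> (Q *v w) + w \<bullet> (Q *v v)) + h\<^sup>2 * (h * (w \<bullet> (Q *v w))) + u \<bullet> (R *v u))"
      by (simp add: Fform_def w_def power2_eq_square algebra_simps)
    moreover have "h * Fform (Df f x) (N x) Q v \<le> h * (- \<kappa> * (norm v)\<^sup>2)"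
      using F[OF x, of v] h(1) unfolding Q_def by (intro mult_left_mono) auto
    moreover have "h\<^sup>2 * (w \<bullet> (N x *v w)) + h\<^sup>2 * (v \<bullet> (Q *v w) + w \<bullet> (Q *v v)) + h\<^sup>2 * (h * (w \<bullet> (Q *v w))) + u \<bullet> (R *v u)
       \<le> h\<^sup>2 * c * (norm v)\<^sup>2"
    proof -
      have e1: "w \<bullet> (N x *v w) \<le> n * \<Lambda> * ((a * norm v) * (a * norm v))"
        unfolding n_def by (rule entries_form_le[OF C11_onD(3)[OF N x\<Omega>] w w])
      have e2: "v \<bullet> (Q *v w) \<le> n * q * (norm v * (a * norm v))"
        unfolding n_def by (rule entries_form_le[OF Qb order_refl w])
      have e3: "w \<bullet> (Q *v v) \<le> n * q * (norm v * (a * norm v))"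
        unfolding n_def using entries_form_le[OF Qb w order_refl] by (simp add: mult.commute)
      have e4: "h * (w \<bullet> (Q *v w)) \<le> n * q * ((a * norm v) * (a * norm v))"
      proof -
        have "w \<bullet> (Q *v w) \<le> n * q * ((a * norm v) * (a * norm v))"
          unfolding n_def by (rule entries_form_le[OF Qb w w])
        moreover have "0 \<le> n * q * ((a * norm v) * (a * norm v))" using n nn by simp
        ultimately show ?thesis
          using mult_left_mono[of "w \<bullet> (Q *v w)" "n * q * ((a * norm v) * (a * norm v))" h]
            mult_right_mono[OF h(2), of "n * q * ((a * norm v) * (a * norm v))"] h(1) by linarith
      qed
      have e5: "u \<bullet> (R *v u) \<le> h\<^sup>2 * (n * r * (((1 + a) * norm v) * ((1 + a) * norm v)))"
        using entries_form_le[OF Rb u u] by (simp add: n_def mult_ac)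
      have "h\<^sup>2 * (w \<bullet> (N x *v w)) + h\<^sup>2 * (v \<bullet> (Q *v w) + w \<bullet> (Q *v v)) + h\<^sup>2 * (h * (w \<bullet> (Q *v w))) + u \<bullet> (R *v u)
        \<le> h\<^sup>2 * (n * \<Lambda> * ((a * norm v) * (a * norm v))) + h\<^sup>2 * (n * q * (norm v * (a * norm v)) + n * q * (norm v * (a * norm v)))
          + h\<^sup>2 * (n * q * ((a * norm v) * (a * norm v))) + h\<^sup>2 * (n * r * (((1 + a) * norm v) * ((1 + a) * norm v)))"
        by (intro add_mono mult_left_mono e1 e2 e3 e4 e5) auto
      also have "\<dots> = h\<^sup>2 * (c - 1) * (norm v)\<^sup>2" by (simp add: c_def power2_eq_square algebra_simps)
      also have "\<dots> \<le> h\<^sup>2 * c * (norm v)\<^sup>2" by (intro mult_right_mono mult_left_mono) auto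
      finally show ?thesis .
    qed
    moreover have "h\<^sup>2 * c * (norm v)\<^sup>2 \<le> h * (\<kappa> / 2) * (norm v)\<^sup>2"
      using h by (intro mult_right_mono) (auto simp: power2_eq_square mult.assoc intro: mult_left_mono)
    ultimately show ?thesis by (simp add: algebra_simps)
  qed
  moreover have "h * \<kappa> / 2 > 0" using h(1) \<kappa> by simp
  ultimately show ?thesis by blast
qed

text \<open>Let \<open>\<tau>\<close> be the least \<open>t \<ge> 0\<close> for which
  \<open>W + t M\<close> is positive semidefinite on all of \<open>D\<close>. If it were positive,
  \<open>F(W + \<tau> M)\<close> would be uniformly negative there, and
  \<open>strict_improvement\<close> would leave room for a smaller \<open>t\<close>. In this form no
  trajectory is followed up to the equilibrium.\<close>

lemma Lyapunov_nonneg: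
  assumes W: "C11_on \<Lambda> \<Omega> W G" and M: "C11_on \<Lambda>' \<Omega> M G'"
    and \<mu>: "\<mu> > 0" "\<And>x v. x \<in> D \<Longrightarrow> \<mu> * (norm v)\<^sup>2 \<le> v \<bullet> (M x *v v)"
    and FM: "\<kappa> > 0" "\<And>x v. x \<in> D \<Longrightarrow> Fform (Df f x) (M x) (dir_mat G' x (f x)) v \<le> - \<kappa> * (norm v)\<^sup>2"
    and FW: "\<And>x v. x \<in> D \<Longrightarrow> Fform (Df f x) (W x) (dir_mat G x (f x)) v \<le> 0"
    and x: "x \<in> D"
  shows "0 \<le> v \<bullet> (W x *v v)"
proof -
  define n where "n = (real CARD('n))\<^sup>2"
  have n: "n \<ge> 0" by (simp add: n_def)
  have \<Lambda>: "\<Lambda> \<ge> 0" "\<Lambda>' \<ge> 0" using C11_onD(1) W M by blast+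
  have nb: "\<bar>v \<bullet> (s x *v v)\<bar> \<le> n * l * (norm v)\<^sup>2" if "C11_on l \<Omega> s g" "x \<in> D" for l s g x v
    using entries_form_bound[OF C11_onD(3)[OF that(1)], of x v v] that(2) D by (auto simp: n_def power2_eq_square)
  define T where "T = {t. 0 \<le> t \<and> (\<forall>x\<in>D. \<forall>v. 0 \<le> v \<bullet> (W x *v v) + t * (v \<bullet> (M x *v v)))}"
  \<comment> \<open>The form of \<open>W\<close> is bounded by \<open>n * \<Lambda>\<close> and that
    of \<open>M\<close> is at least \<open>\<mu>\<close>, so a large multiple of \<open>M\<close>
    dominates.\<close>
  have "n * \<Lambda> / \<mu> \<in> T"
    unfolding T_def
  proof (intro CollectI conjI ballI allI)
    fix x v assume x: "x \<in> D"
    have "n * \<Lambda> / \<mu> * (v \<bullet> (M x *v v)) \<ge> n * \<Lambda> / \<mu> * (\<mu> * (norm v)\<^sup>2)"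
      using \<mu> n \<Lambda> x by (intro mult_left_mono) auto
    then show "0 \<le> v \<bullet> (W x *v v) + n * \<Lambda> / \<mu> * (v \<bullet> (M x *v v))"
      using nb[OF W x, of v] \<mu>(1) by simp
  qed (use n \<Lambda> \<mu> in auto)
  then have ne: "T \<noteq> {}" by auto
  have bdd: "bdd_below T" by (rule bdd_belowI[of _ 0]) (simp add: T_def)
  define \<tau> where "\<tau> = Inf T"
  have \<tau>0: "\<tau> \<ge> 0" unfolding \<tau>_def by (rule cInf_greatest[OF ne]) (simp add: T_def)
  have Mpos: "0 \<le> v \<bullet> (M x *v v)" if "x \<in> D" for x v
  proof -
    have "0 \<le> \<mu> * (norm v)\<^sup>2" using \<mu>(1) by simp
    then show ?thesis using \<mu>(2)[OF that, of v] by linarith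
  qed
  have \<tau>: "0 \<le> v \<bullet> (W x *v v) + \<tau> * (v \<bullet> (M x *v v))" if x: "x \<in> D" for x v
  proof (cases "v = 0")
    case False
    then have "0 < \<mu> * (norm v)\<^sup>2" using \<mu>(1) by simp
    then have m: "0 < v \<bullet> (M x *v v)" using \<mu>(2)[OF x, of v] by linarith
    have "- (v \<bullet> (W x *v v)) / (v \<bullet> (M x *v v)) \<le> \<tau>"
      unfolding \<tau>_def
    proof (rule cInf_greatest[OF ne])
      fix t assume "t \<in> T"
      then have "0 \<le> v \<bullet> (W x *v v) + t * (v \<bullet> (M x *v v))" using x by (simp add: T_def)
      then show "- (v \<bullet> (W x *v v)) / (v \<bullet> (M x *v v)) \<le> t" using m unfolding pos_divide_le_eq[OF m] by linarith
    qed
    then show ?thesis unfolding pos_divide_le_eq[OF m] by linarith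
  qed simp
  have "\<tau> = 0"
  proof (rule ccontr)
    assume "\<tau> \<noteq> 0"
    then have \<tau>p: "\<tau> > 0" using \<tau>0 by simp
    have "\<exists>\<eta>>0. \<forall>x\<in>D. \<forall>v. \<eta> * (norm v)\<^sup>2 \<le> v \<bullet> ((W x + \<tau> *\<^sub>R M x) *v v)"
    proof (rule strict_improvement[OF C11_on_add_scaled[OF W M]])
      show "\<tau> * \<kappa> > 0" using \<tau>p FM(1) by simp
      fix x v assume x: "x \<in> D"
      show "0 \<le> v \<bullet> ((W x + \<tau> *\<^sub>R M x) *v v)"
        using \<tau>[OF x, of v] by (simp add: matrix_vector_mult_add_rdistrib scaleR_matrix_vector_assoc[symmetric] inner_add_right)
      show "Fform (Df f x) (W x + \<tau> *\<^sub>R M x) (dir_mat (\<lambda>x i j. G x i j + \<tau> *\<^sub>R G' x i j) x (f x)) v \<le> - (\<tau> * \<kappa>) * (norm v)\<^sup>2"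
        using FW[OF x, of v] mult_left_mono[OF FM(2)[OF x, of v] \<tau>0]
        by (simp add: dir_mat_add_scaled Fform_add_scaled mult.assoc)
    qed
    then obtain \<eta> where \<eta>: "\<eta> > 0" "\<And>x v. x \<in> D \<Longrightarrow> \<eta> * (norm v)\<^sup>2 \<le> v \<bullet> ((W x + \<tau> *\<^sub>R M x) *v v)" by blast
    \<comment> \<open>Lowering \<open>\<tau>\<close> by \<open>e\<close> costs at most
      \<open>e * (n * \<Lambda>')\<close> in the form, which \<open>\<eta>\<close> can pay; the
      bound \<open>\<tau>\<close> keeps the new parameter nonnegative.\<close>
    define e where "e = min \<tau> (\<eta> / (n * \<Lambda>' + 1))"
    have n1: "n * \<Lambda>' + 1 > 0" using n \<Lambda> by (simp add: add_nonneg_pos)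
    have e: "0 < e" "e \<le> \<tau>" "e * (n * \<Lambda>') \<le> \<eta>"
    proof -
      show "0 < e" using \<tau>p \<eta> n1 by (simp add: e_def)
      show "e \<le> \<tau>" by (simp add: e_def)
      have "e * (n * \<Lambda>' + 1) \<le> \<eta>" using n1 by (simp add: e_def min_def pos_le_divide_eq[symmetric])
      then show "e * (n * \<Lambda>') \<le> \<eta>" using \<open>0 < e\<close> by (simp add: distrib_left)
    qed
    have "\<tau> - e \<in> T"
      unfolding T_def
    proof (intro CollectI conjI ballI allI)
      fix x v assume x: "x \<in> D"
      have "e * (v \<bullet> (M x *v v)) \<le> e * (n * \<Lambda>' * (norm v)\<^sup>2)"
        using nb[OF M x, of v] e(1) by (intro mult_left_mono) auto
      also have "\<dots> \<le> \<eta> * (norm v)\<^sup>2" using mult_right_mono[OF e(3), of "(norm v)\<^sup>2"] by (simp add: mult.assoc)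
      also have "\<dots> \<le> v \<bullet> ((W x + \<tau> *\<^sub>R M x) *v v)" by (rule \<eta>(2)[OF x])
      finally show "0 \<le> v \<bullet> (W x *v v) + (\<tau> - e) * (v \<bullet> (M x *v v))"
        by (simp add: matrix_vector_mult_add_rdistrib scaleR_matrix_vector_assoc[symmetric] inner_add_right left_diff_distrib)
    qed (use e in simp)
    then have "\<tau> \<le> \<tau> - e" unfolding \<tau>_def by (rule cInf_lower[OF _ bdd])
    then show False using e(1) by simp
  qed
  then show ?thesis using \<tau>[OF x, of v] by simp
qed

end

section \<open>Uniform estimates for the optimal recovery\<close>

lemma Df_entry:
  assumes "\<And>i. Ck_on (Suc m) (\<lambda>x. f x $ i) UNIV"
  shows "Df f x $ i $ j = pdiff j (\<lambda>y. f y $ i) x"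
proof -
  have "\<forall>i\<in>Basis. (\<lambda>x. f x \<bullet> i) differentiable (at x)"
    using assms by (auto simp: Basis_vec_def inner_axis)
  then have "f differentiable (at x)" by (simp add: differentiable_componentwise_within[of f])
  then have "(f has_derivative frechet_derivative f (at x)) (at x)" by (simp add: frechet_derivative_works)
  from pdiff_eq[OF bounded_linear.has_derivative[OF bounded_linear_vec_nth this], of j i]
  show ?thesis by (simp add: Df_def jacobian_def matrix_def)
qed

lemma C2_bounds_on_ball:
  fixes f :: "real^'n \<Rightarrow> real^'n"
  assumes f: "\<And>i. Ck_on 2 (\<lambda>x. f x $ i) UNIV" and R: "R \<ge> 0"
  shows "\<exists>b\<ge>0. \<exists>L\<ge>0. \<forall>x. norm x \<le> R \<longrightarrow> norm (f x) \<le> b \<and> (\<forall>i j. \<bar>Df f x $ i $ j\<bar> \<le> b) \<and>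
    (\<forall>y. norm y \<le> R \<longrightarrow> norm (f x - f y) \<le> L * norm (x - y) \<and> (\<forall>i j. \<bar>Df f x $ i $ j - Df f y $ i $ j\<bar> \<le> L * norm (x - y)))"
proof -
  have f1: "Ck_on 1 (\<lambda>x. f x $ i) UNIV" for i by (rule Ck_le[OF f]) simp
  have f2: "Ck_on (Suc 1) (\<lambda>x. f x $ i) UNIV" for i using f by (simp add: numeral_2_eq_2 del: Ck_on.simps)
  have D: "Df f x $ i $ j = pdiff j (\<lambda>y. f y $ i) x" for x i j by (rule Df_entry[OF f2])
  have "\<exists>L\<ge>0. \<forall>x y. norm x \<le> R \<longrightarrow> norm y \<le> R \<longrightarrow> \<bar>Df f x $ fst p $ snd p - Df f y $ fst p $ snd p\<bar> \<le> L * norm (x - y)" for p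
    unfolding D using f2[of "fst p"] by (intro Ck_Lipschitz_on_ball) simp
  then have "\<forall>p. \<exists>L. L \<ge> 0 \<and> (\<forall>x y. norm x \<le> R \<longrightarrow> norm y \<le> R \<longrightarrow> \<bar>Df f x $ fst p $ snd p - Df f y $ fst p $ snd p\<bar> \<le> L * norm (x - y))" by blast
  from choice[OF this] obtain l where l: "\<And>p. l p \<ge> 0"
    "\<And>p x y. norm x \<le> R \<Longrightarrow> norm y \<le> R \<Longrightarrow> \<bar>Df f x $ fst p $ snd p - Df f y $ fst p $ snd p\<bar> \<le> l p * norm (x - y)" by blast
  obtain L0 where L0: "L0 \<ge> 0" "\<And>x y. norm x \<le> R \<Longrightarrow> norm y \<le> R \<Longrightarrow> norm (f x - f y) \<le> L0 * norm (x - y)"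
    using C1_Lipschitz_on_ball[OF f1] by blast
  define L where "L = L0 + (\<Sum>p\<in>UNIV. l p)"
  have lL: "l p \<le> L" for p
    using member_le_sum[of p UNIV l] l(1) L0(1) by (simp add: L_def add_increasing)
  have L0L: "L0 \<le> L" using l(1) by (simp add: L_def sum_nonneg)
  define b where "b = norm (f 0) + (\<Sum>p\<in>UNIV. \<bar>Df f 0 $ fst p $ snd p\<bar>) + L * R"
  have s0: "0 \<le> (\<Sum>p\<in>UNIV. \<bar>Df f 0 $ fst p $ snd p\<bar>)" by (simp add: sum_nonneg)
  have Lp: "0 \<le> L" using L0L L0(1) by simp
  have lip: "norm (f x - f y) \<le> L * norm (x - y)" if "norm x \<le> R" "norm y \<le> R" for x y
    using L0(2)[OF that] mult_right_mono[OF L0L norm_ge_zero[of "x - y"]] by linarith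
  have lipD: "\<bar>Df f x $ i $ j - Df f y $ i $ j\<bar> \<le> L * norm (x - y)" if "norm x \<le> R" "norm y \<le> R" for x y i j
    using l(2)[OF that, of "(i, j)"] mult_right_mono[OF lL[of "(i, j)"] norm_ge_zero[of "x - y"]] by simp
  have "norm (f x) \<le> b" if "norm x \<le> R" for x
  proof -
    have "norm (f x) \<le> norm (f x - f 0) + norm (f 0)" using norm_triangle_ineq[of "f x - f 0" "f 0"] by simp
    moreover have "L * norm x \<le> L * R" using that Lp by (intro mult_left_mono)
    moreover have "norm (f x - f 0) \<le> L * norm x" using lip[of x 0] that R by simp
    ultimately show ?thesis using s0 unfolding b_def by linarith
  qed
  moreover have "\<bar>Df f x $ i $ j\<bar> \<le> b" if "norm x \<le> R" for x i j
  proof -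
    have "\<bar>Df f 0 $ i $ j\<bar> \<le> (\<Sum>p\<in>UNIV. \<bar>Df f 0 $ fst p $ snd p\<bar>)"
      using member_le_sum[of "(i, j)" UNIV "\<lambda>p. \<bar>Df f 0 $ fst p $ snd p\<bar>"] by simp
    moreover have "L * norm x \<le> L * R" using that Lp by (intro mult_left_mono)
    moreover have "\<bar>Df f x $ i $ j - Df f 0 $ i $ j\<bar> \<le> L * norm x" using lipD[of x 0 i j] that R by simp
    ultimately show ?thesis using norm_ge_zero[of "f 0"] unfolding b_def by linarith
  qed
  moreover have "b \<ge> 0" using s0 Lp R by (simp add: b_def)
  ultimately show ?thesis using Lp lip lipD by blast
qed

lemma product_difference: "\<bar>x\<bar> \<le> p \<Longrightarrow> \<bar>y'\<bar> \<le> q \<Longrightarrow> \<bar>x - x'\<bar> \<le> e \<Longrightarrow> \<bar>y - y'\<bar> \<le> e' \<Longrightarrow> \<bar>x * y - x' * y'\<bar> \<le> p * e' + e * q"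
  for x y x' y' p q e e' :: real
proof -
  assume a: "\<bar>x\<bar> \<le> p" "\<bar>y'\<bar> \<le> q" "\<bar>x - x'\<bar> \<le> e" "\<bar>y - y'\<bar> \<le> e'"
  have "x * y - x' * y' = x * (y - y') + (x - x') * y'" by (simp add: algebra_simps)
  moreover have "\<bar>x * (y - y')\<bar> \<le> p * e'" unfolding abs_mult using a by (intro mult_mono) auto
  moreover have "\<bar>(x - x') * y'\<bar> \<le> e * q" unfolding abs_mult using a by (intro mult_mono) auto
  ultimately show ?thesis by linarith
qed

text \<open>Within distance 1 the quadratic remainder is absorbed into the linear term, which
  doubles the constant.\<close>

lemma C11_Lipschitz:
  assumes s: "C11_on \<Lambda> \<Omega> s G" and xy: "x \<in> \<Omega>" "y \<in> \<Omega>" "norm (y - x) \<le> 1"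
  shows "\<bar>s y $ i $ j - s x $ i $ j\<bar> \<le> 2 * \<Lambda> * norm (y - x)"
proof -
  have \<Lambda>: "0 \<le> \<Lambda>" by (rule C11_onD(1)[OF s])
  have "\<bar>G x i j \<bullet> (y - x)\<bar> \<le> \<Lambda> * norm (y - x)"
    using Cauchy_Schwarz_ineq2[of "G x i j" "y - x"] mult_right_mono[OF C11_onD(4)[OF s xy(1)] norm_ge_zero[of "y - x"], of i j]
    by linarith
  moreover have "\<Lambda> * (norm (y - x))\<^sup>2 \<le> \<Lambda> * norm (y - x)"
    using mult_right_mono[OF xy(3) norm_ge_zero[of "y - x"]] \<Lambda> by (intro mult_left_mono) (auto simp: power2_eq_square)
  ultimately show ?thesis using C11_onD(5)[OF s xy(1,2), of i j] by linarith
qed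

text \<open>The operator \<open>F\<close> with the orbital derivative expressed by gradients, a form
  in which two points can be compared.\<close>

definition Fmat :: "(real^'n \<Rightarrow> real^'n) \<Rightarrow> (real^'n \<Rightarrow> real^'n^'n) \<Rightarrow> (real^'n \<Rightarrow> 'n \<Rightarrow> 'n \<Rightarrow> real^'n) \<Rightarrow> real^'n \<Rightarrow> real^'n^'n" where
  "Fmat f s G x = transpose (Df f x) ** s x + s x ** Df f x + dir_mat G x (f x)"

text \<open>Product rule for differences: each of the two matrix products contributes
  \<open>n * (2 * b + L) * \<Lambda>\<close> with \<open>n = CARD('n)\<close>, the directional
  derivative \<open>(6 * b + L) * \<Lambda>\<close>, where the 6 is that of
  \<open>gradient_Lipschitz\<close>.\<close>

lemma Fmat_Lipschitz:
  fixes f :: "real^'n \<Rightarrow> real^'n"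
  assumes s: "C11_on \<Lambda> \<Omega> s G" and ball: "ball x \<rho> \<subseteq> \<Omega>"
    and y: "norm (y - x) < \<rho> / 2" "norm (y - x) \<le> 1"
    and b: "norm (f x) \<le> b" "norm (f y) \<le> b" "\<And>i j. \<bar>Df f x $ i $ j\<bar> \<le> b" "\<And>i j. \<bar>Df f y $ i $ j\<bar> \<le> b"
    and L: "norm (f y - f x) \<le> L * norm (y - x)" "\<And>i j. \<bar>Df f y $ i $ j - Df f x $ i $ j\<bar> \<le> L * norm (y - x)"
  shows "\<bar>Fmat f s G y $ i $ j - Fmat f s G x $ i $ j\<bar> \<le> \<Lambda> * (real CARD('n) * (4 * b + 2 * L) + 6 * b + L) * norm (y - x)"
proof -
  define n where "n = norm (y - x)"
  have \<Lambda>: "0 \<le> \<Lambda>" by (rule C11_onD(1)[OF s])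
  have \<rho>: "\<rho> > 0" using y(1) norm_ge_zero[of "y - x"] by linarith
  have x\<Omega>: "x \<in> \<Omega>" "y \<in> \<Omega>" using ball \<rho> y(1) by (auto simp: subset_iff dist_norm norm_minus_commute)
  have b0: "b \<ge> 0" using b(1) norm_ge_zero order_trans by blast
  have sl: "\<bar>s y $ i $ j - s x $ i $ j\<bar> \<le> 2 * \<Lambda> * n" for i j
    unfolding n_def by (rule C11_Lipschitz[OF s x\<Omega> y(2)])
  have p: "\<bar>Df f y $ p $ q * s y $ r $ t - Df f x $ p $ q * s x $ r $ t\<bar> \<le> b * (2 * \<Lambda> * n) + (L * n) * \<Lambda>" for p q r t
    using product_difference[OF b(4)[of p q] C11_onD(3)[OF s x\<Omega>(1)] L(2) sl, of r t] by (simp add: n_def)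
  have "\<bar>G y i j \<bullet> f y - G x i j \<bullet> f x\<bar> \<le> \<Lambda> * (L * n) + (6 * \<Lambda> * n) * b"
  proof -
    have "G y i j \<bullet> f y - G x i j \<bullet> f x = G y i j \<bullet> (f y - f x) + (G y i j - G x i j) \<bullet> f x"
      by (simp add: inner_diff_left inner_diff_right)
    moreover have "\<bar>G y i j \<bullet> (f y - f x)\<bar> \<le> \<Lambda> * (L * n)"
      using Cauchy_Schwarz_ineq2[of "G y i j" "f y - f x"] mult_mono[OF C11_onD(4)[OF s x\<Omega>(2)] L(1) \<Lambda> norm_ge_zero, of i j]
      unfolding n_def by linarith
    moreover have "\<bar>(G y i j - G x i j) \<bullet> f x\<bar> \<le> (6 * \<Lambda> * n) * b"
    proof -
      have "norm (G y i j - G x i j) \<le> 6 * \<Lambda> * n"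
        unfolding n_def by (rule gradient_Lipschitz[OF \<Lambda> C11_onD(5)[OF s, of _ _ i j] ball y(1)])
      then have "norm (G y i j - G x i j) * norm (f x) \<le> (6 * \<Lambda> * n) * b"
        using b(1) \<Lambda> by (intro mult_mono) (auto simp: n_def)
      then show ?thesis using Cauchy_Schwarz_ineq2[of "G y i j - G x i j" "f x"] by linarith
    qed
    ultimately show ?thesis by linarith
  qed
  moreover have "\<bar>(\<Sum>m\<in>UNIV. Df f y $ m $ i * s y $ m $ j) - (\<Sum>m\<in>UNIV. Df f x $ m $ i * s x $ m $ j)\<bar>
      \<le> real CARD('n) * (b * (2 * \<Lambda> * n) + (L * n) * \<Lambda>)"
    unfolding sum_subtractf[symmetric] using sum_norm_le[of UNIV "\<lambda>m. Df f y $ m $ i * s y $ m $ j - Df f x $ m $ i * s x $ m $ j" "\<lambda>_. b * (2 * \<Lambda> * n) + (L * n) * \<Lambda>"] p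
    by simp
  moreover have "\<bar>(\<Sum>m\<in>UNIV. Df f y $ m $ j * s y $ i $ m) - (\<Sum>m\<in>UNIV. Df f x $ m $ j * s x $ i $ m)\<bar>
      \<le> real CARD('n) * (b * (2 * \<Lambda> * n) + (L * n) * \<Lambda>)"
    unfolding sum_subtractf[symmetric] using sum_norm_le[of UNIV "\<lambda>m. Df f y $ m $ j * s y $ i $ m - Df f x $ m $ j * s x $ i $ m" "\<lambda>_. b * (2 * \<Lambda> * n) + (L * n) * \<Lambda>"] p
    by simp
  moreover have entry: "Fmat f s G z $ i $ j = (\<Sum>m\<in>UNIV. Df f z $ m $ i * s z $ m $ j) + (\<Sum>m\<in>UNIV. Df f z $ m $ j * s z $ i $ m) + G z i j \<bullet> f z" for z
    by (simp add: Fmat_def dir_mat_def matrix_matrix_mult_def transpose_def mult.commute)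
  ultimately have "\<bar>Fmat f s G y $ i $ j - Fmat f s G x $ i $ j\<bar>
     \<le> real CARD('n) * (b * (2 * \<Lambda> * n) + (L * n) * \<Lambda>) + real CARD('n) * (b * (2 * \<Lambda> * n) + (L * n) * \<Lambda>) + (\<Lambda> * (L * n) + (6 * \<Lambda> * n) * b)"
    unfolding entry by linarith
  also have "\<dots> = \<Lambda> * (real CARD('n) * (4 * b + 2 * L) + 6 * b + L) * n" by (simp add: algebra_simps)
  finally show ?thesis by (simp only: n_def)
qed

text \<open>Boundedness of \<open>\<Omega>\<close> makes the supremum an upper bound of the minimal
  distances, and for a finite nonempty \<open>X\<close> the minimum is attained.\<close>

lemma fill_distance_witness:
  assumes X: "finite X" "X \<noteq> {}" and \<Omega>: "bounded \<Omega>" and x: "x \<in> \<Omega>"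
  shows "\<exists>y\<in>X. norm (x - y) \<le> fill_distance X \<Omega>"
proof -
  obtain z where z: "z \<in> X" using X by blast
  obtain R where R: "\<And>x. x \<in> \<Omega> \<Longrightarrow> norm x \<le> R" using \<Omega> by (auto simp: bounded_iff)
  let ?m = "\<lambda>x. Min ((\<lambda>y. norm (x - y)) ` X)"
  have "?m x \<le> fill_distance X \<Omega>"
    unfolding fill_distance_def
  proof (rule cSUP_upper[OF x bdd_aboveI2])
    fix x assume "x \<in> \<Omega>"
    have "?m x \<le> norm (x - z)" using X z by (intro Min_le) auto
    also have "\<dots> \<le> R + norm z" using norm_triangle_ineq4[of x z] R[OF \<open>x \<in> \<Omega>\<close>] by linarith
    finally show "?m x \<le> R + norm z" .
  qed
  moreover have "?m x \<in> (\<lambda>y. norm (x - y)) ` X" using X by (intro Min_in) auto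
  ultimately show ?thesis by auto
qed

lemma pos_def_lower_bound:
  assumes "pos_def (C :: real^'n^'n)"
  shows "\<exists>lam>0. \<forall>v. lam * (norm v)\<^sup>2 \<le> v \<bullet> (C *v v)"
proof -
  have "continuous_on (sphere 0 1) (\<lambda>v. v \<bullet> (C *v v))"
    by (intro continuous_intros linear_continuous_on matrix_vector_mul_bounded_linear)
  moreover have "sphere (0 :: real^'n) 1 \<noteq> {}" by simp
  ultimately obtain u where u: "u \<in> sphere 0 1" "\<And>v. v \<in> sphere 0 1 \<Longrightarrow> u \<bullet> (C *v u) \<le> v \<bullet> (C *v v)"
    using continuous_attains_inf[OF compact_sphere[of "0 :: real^'n" 1]] by blast
  have "u \<noteq> 0" using u(1) by auto
  then have "0 < u \<bullet> (C *v u)" using assms by (simp add: pos_def_def)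
  moreover have "u \<bullet> (C *v u) * (norm v)\<^sup>2 \<le> v \<bullet> (C *v v)" for v
  proof (cases "v = 0")
    case False
    have "u \<bullet> (C *v u) \<le> (v /\<^sub>R norm v) \<bullet> (C *v (v /\<^sub>R norm v))" using False by (intro u(2)) simp
    also have "\<dots> = v \<bullet> (C *v v) / (norm v)\<^sup>2"
      by (simp add: matrix_vector_mult_scaleR power2_eq_square divide_inverse)
    finally show ?thesis using False by (simp add: pos_le_divide_eq)
  qed simp
  ultimately show ?thesis by blast
qed

lemma loewner_le_matD:
  fixes A :: "real^'n^'n"
  shows "mat \<mu> \<preceq>\<^sub>L A \<Longrightarrow> \<mu> * (norm v)\<^sup>2 \<le> v \<bullet> (A *v v)"
proof -
  assume "mat \<mu> \<preceq>\<^sub>L A"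
  then have "v \<bullet> ((mat \<mu> - A) *v v) \<le> 0" by (simp add: loewner_le_def neg_semidef_def)
  moreover have "mat \<mu> *v v = \<mu> *\<^sub>R v"
    by (simp add: mat_def matrix_vector_mult_def vec_eq_iff if_distrib[where f="\<lambda>x. x * _"] cong: if_cong)
  ultimately show ?thesis by (simp add: matrix_vector_mult_diff_rdistrib inner_diff_right dot_square_norm)
qed

text \<open>\<open>hX\<close> and \<open>\<Lambda>\<close> are chosen before \<open>X\<close>,
  \<open>S\<close> and \<open>\<mu>\<close>. This is possible because \<open>M\<close>, restricted
  to \<open>\<Omega>\<close>, satisfies the interpolation conditions for every \<open>X\<close>; by
  minimality its norm bounds that of \<open>S\<close>, and \<open>rkhs_wendland_C11\<close> turns
  the norm into \<open>\<Lambda>\<close>.\<close>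

theorem optimal_recovery_estimate:
  fixes f :: "real^'n \<Rightarrow> real^'n" and M :: "real^'n \<Rightarrow> real^'n^'n"
  assumes k: "k \<ge> 2" and f: "\<And>i. Ck_on 2 (\<lambda>x. f x $ i) UNIV"
    and flow: "solution_flow f fl" and x0: "exp_stable_equilibrium f fl x0" and C: "pos_def C"
    and M_sym: "\<And>x. x \<in> basin fl x0 \<Longrightarrow> symmetric_mat (M x)"
    and M_smooth: "\<And>i j. Ck_on (CARD('n) div 2 + k + 1) (\<lambda>x. M x $ i $ j) (basin fl x0)"
    and M_eq: "\<And>x. x \<in> basin fl x0 \<Longrightarrow> F_op f fl M x = - C"
    and \<Omega>: "open \<Omega>" "bounded \<Omega>" "closure \<Omega> \<subseteq> basin fl x0"
    and inv_D: "positively_invariant fl D" "closure D \<subseteq> \<Omega>"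
    and c: "c > 0" and H: "rkhs \<Omega> (wendland_kernel k c) H ip"
  shows "\<exists>hX>0. \<exists>\<Lambda>\<ge>0. \<forall>X S \<mu>. finite X \<and> X \<noteq> {} \<and> X \<subseteq> \<Omega> \<and> fill_distance X \<Omega> \<le> hX \<and>
     optimal_recovery f fl C H ip X S \<and> \<mu> > 0 \<and> (\<forall>x\<in>closure \<Omega>. mat \<mu> \<preceq>\<^sub>L M x) \<longrightarrow>
     (\<exists>G. C11_on \<Lambda> \<Omega> S G \<and> (\<forall>x\<in>D. \<forall>v. \<mu> / 2 * (norm v)\<^sup>2 \<le> v \<bullet> (S x *v v) \<and>
        Fform (Df f x) (S x) (dir_mat G x (f x)) v \<le> - (v \<bullet> (C *v v)) / 2))"
proof -
  define k' where "k' = k - 2"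
  have k': "k = Suc (Suc k')" using k by (simp add: k'_def)
  interpret reproducing_kernel_space \<Omega> "wendland_kernel k c" H ip by standard (rule H)
  have f1: "Ck_on 1 (\<lambda>x. f x $ i) UNIV" for i by (rule Ck_le[OF f]) simp
  have ob: "open (basin fl x0)"
    by (rule open_basin[OF _ flow x0]) (unfold ball_Lipschitz_def, intro allI C1_Lipschitz_on_ball f1)
  have cl: "\<Omega> \<subseteq> closure \<Omega>" "D \<subseteq> closure D" by (rule closure_subset)+
  have D\<Omega>: "D \<subseteq> \<Omega>" using cl(2) inv_D(2) by blast
  \<comment> \<open>Elements of the native space are 0 outside \<open>\<Omega>\<close>. On the open
    set \<open>\<Omega>\<close> the orbital derivatives of \<open>m\<close> and \<open>M\<close>
    agree, because trajectories stay in \<open>\<Omega>\<close> for a short time.\<close>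
  define m where "m = (\<lambda>x. if x \<in> \<Omega> then M x else 0)"
  have m_H: "m \<in> mat_space H"
    unfolding mat_space_def
  proof (intro CollectI conjI allI)
    show "symmetric_mat (m x)" for x
      using M_sym[of x] \<Omega>(3) cl(1) by (auto simp: m_def symmetric_mat_def transpose_def vec_eq_iff)
    have "(\<lambda>x. if x \<in> \<Omega> then M x $ i $ j else 0) \<in> H" for i j
      using M_smooth[of i j] by (intro wendland_native_contains[OF H[unfolded k'] c \<Omega>(2) ob \<Omega>(3)]) (simp add: k')
    moreover have "(\<lambda>x. m x $ i $ j) = (\<lambda>x. if x \<in> \<Omega> then M x $ i $ j else 0)" for i j
      by (auto simp: m_def fun_eq_iff)
    ultimately show "(\<lambda>x. m x $ i $ j) \<in> H" for i j by simp
  qed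
  have m_eq: "F_op f fl m x = - C" if x: "x \<in> \<Omega>" for x
  proof -
    have "\<forall>\<^sub>F h in at_right 0. fl h x \<in> \<Omega>"
      by (rule topological_tendstoD[OF flow_quotient(2)[OF flow] \<Omega>(1) x])
    then have "orbital_derivative fl m x = orbital_derivative fl M x"
      by (intro orbital_derivative_cong) (auto simp: m_def x elim: eventually_mono)
    then show ?thesis using M_eq[of x] x \<Omega>(3) cl(1) by (auto simp: F_op_def m_def)
  qed
  obtain Lc where Lc: "Lc \<ge> 0" "\<And>g. g \<in> H \<Longrightarrow> \<exists>grad. \<forall>x\<in>\<Omega>. \<bar>g x\<bar> \<le> Lc * sqrt (ip g g) \<and> norm (grad x) \<le> Lc * sqrt (ip g g) \<and>
     (\<forall>y\<in>\<Omega>. \<bar>g y - g x - grad x \<bullet> (y - x)\<bar> \<le> Lc * sqrt (ip g g) * (norm (y - x))\<^sup>2)"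
    using rkhs_wendland_C11[OF H[unfolded k'] c \<Omega>(1)] by blast
  define \<Lambda> where "\<Lambda> = Lc * sqrt (mat_ip ip m m)"
  have C11: "\<exists>G. C11_on \<Lambda> \<Omega> s G" if s: "s \<in> mat_space H" "sqrt (mat_ip ip s s) \<le> sqrt (mat_ip ip m m)" for s
  proof -
    have sH: "(\<lambda>x. s x $ i $ j) \<in> H" for i j using s(1) by (simp add: mat_space_def)
    have nn: "0 \<le> ip (\<lambda>x. s x $ i $ j) (\<lambda>x. s x $ i $ j)" for i j by (rule ip_nonneg[OF sH])
    have le: "Lc * sqrt (ip (\<lambda>x. s x $ i $ j) (\<lambda>x. s x $ i $ j)) \<le> \<Lambda>" for i j
    proof -
      have "ip (\<lambda>x. s x $ i $ j) (\<lambda>x. s x $ i $ j) \<le> (\<Sum>j\<in>UNIV. ip (\<lambda>x. s x $ i $ j) (\<lambda>x. s x $ i $ j))"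
        by (rule member_le_sum) (auto simp: nn)
      also have "\<dots> \<le> mat_ip ip s s"
        unfolding mat_ip_def
        by (rule member_le_sum[where f="\<lambda>i. \<Sum>j\<in>UNIV. ip (\<lambda>x. s x $ i $ j) (\<lambda>x. s x $ i $ j)"]) (auto intro!: sum_nonneg nn)
      finally have "sqrt (ip (\<lambda>x. s x $ i $ j) (\<lambda>x. s x $ i $ j)) \<le> sqrt (mat_ip ip m m)"
        using s(2) by (meson order_trans real_sqrt_le_mono)
      then show ?thesis unfolding \<Lambda>_def using Lc(1) by (intro mult_left_mono)
    qed
    have \<Lambda>0: "0 \<le> \<Lambda>" using le[of undefined undefined] Lc(1) nn[of undefined undefined]
      by (smt (verit) mult_nonneg_nonneg real_sqrt_ge_zero)
    have "\<exists>grad. \<forall>x\<in>\<Omega>. \<bar>s x $ fst p $ snd p\<bar> \<le> \<Lambda> \<and> norm (grad x) \<le> \<Lambda> \<and>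
       (\<forall>y\<in>\<Omega>. \<bar>s y $ fst p $ snd p - s x $ fst p $ snd p - grad x \<bullet> (y - x)\<bar> \<le> \<Lambda> * (norm (y - x))\<^sup>2)" for p
    proof -
      obtain grad where g: "\<forall>x\<in>\<Omega>. \<bar>s x $ fst p $ snd p\<bar> \<le> Lc * sqrt (ip (\<lambda>x. s x $ fst p $ snd p) (\<lambda>x. s x $ fst p $ snd p))
          \<and> norm (grad x) \<le> Lc * sqrt (ip (\<lambda>x. s x $ fst p $ snd p) (\<lambda>x. s x $ fst p $ snd p)) \<and>
          (\<forall>y\<in>\<Omega>. \<bar>s y $ fst p $ snd p - s x $ fst p $ snd p - grad x \<bullet> (y - x)\<bar>
             \<le> Lc * sqrt (ip (\<lambda>x. s x $ fst p $ snd p) (\<lambda>x. s x $ fst p $ snd p)) * (norm (y - x))\<^sup>2)"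
        using Lc(2)[OF sH[of "fst p" "snd p"]] by blast
      show ?thesis
      proof (intro exI[of _ grad] ballI conjI)
        fix x assume x: "x \<in> \<Omega>"
        show "\<bar>s x $ fst p $ snd p\<bar> \<le> \<Lambda>" "norm (grad x) \<le> \<Lambda>"
          by (rule order_trans[OF _ le[of "fst p" "snd p"]], use g x in blast)+
        fix y assume y: "y \<in> \<Omega>"
        show "\<bar>s y $ fst p $ snd p - s x $ fst p $ snd p - grad x \<bullet> (y - x)\<bar> \<le> \<Lambda> * (norm (y - x))\<^sup>2"
          by (rule order_trans[OF _ mult_right_mono[OF le[of "fst p" "snd p"]]]) (use g x y in \<open>blast, simp\<close>)
      qed
    qed
    then have "\<forall>p. \<exists>grad. \<forall>x\<in>\<Omega>. \<bar>s x $ fst p $ snd p\<bar> \<le> \<Lambda> \<and> norm (grad x) \<le> \<Lambda> \<and>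
       (\<forall>y\<in>\<Omega>. \<bar>s y $ fst p $ snd p - s x $ fst p $ snd p - grad x \<bullet> (y - x)\<bar> \<le> \<Lambda> * (norm (y - x))\<^sup>2)" by blast
    from choice[OF this] obtain g where g: "\<And>p. \<forall>x\<in>\<Omega>. \<bar>s x $ fst p $ snd p\<bar> \<le> \<Lambda> \<and> norm (g p x) \<le> \<Lambda> \<and>
       (\<forall>y\<in>\<Omega>. \<bar>s y $ fst p $ snd p - s x $ fst p $ snd p - g p x \<bullet> (y - x)\<bar> \<le> \<Lambda> * (norm (y - x))\<^sup>2)" by blast
    have "C11_on \<Lambda> \<Omega> s (\<lambda>x i j. g (i, j) x)"
      unfolding C11_on_def
    proof (intro conjI ballI allI \<Lambda>0)
      fix x assume "x \<in> \<Omega>"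
      show "symmetric_mat (s x)" using s(1) by (simp add: mat_space_def)
      fix i j
      show "\<bar>s x $ i $ j\<bar> \<le> \<Lambda>" "norm (g (i, j) x) \<le> \<Lambda>" using g[of "(i, j)"] \<open>x \<in> \<Omega>\<close> by auto
      fix y assume "y \<in> \<Omega>"
      then show "\<bar>s y $ i $ j - s x $ i $ j - g (i, j) x \<bullet> (y - x)\<bar> \<le> \<Lambda> * (norm (y - x))\<^sup>2"
        using g[of "(i, j)"] \<open>x \<in> \<Omega>\<close> by auto
    qed
    then show ?thesis by blast
  qed
  obtain Gm where Gm: "C11_on \<Lambda> \<Omega> m Gm" using C11[OF m_H] by blast
  have \<Lambda>0: "0 \<le> \<Lambda>" by (rule C11_onD(1)[OF Gm])
  have F_form: "Fform (Df f x) (s x) (dir_mat G x (f x)) v = v \<bullet> (F_op f fl s x *v v)" "Fmat f s G x = F_op f fl s x"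
    if "C11_on \<Lambda> \<Omega> s G" "x \<in> \<Omega>" for s G x v
    using Fform_eq[OF C11_onD(2)[OF that], of v] orbital_derivative_C11[OF flow \<Omega>(1) that(2,1)] by (simp_all add: F_op_def Fmat_def)
  obtain R where R: "R > 0" "\<And>x. x \<in> \<Omega> \<Longrightarrow> norm x \<le> R" using \<Omega>(2) bounded_pos by blast
  obtain b L where b0: "b \<ge> 0" and L0: "L \<ge> 0" and bL: "\<And>x. norm x \<le> R \<Longrightarrow> norm (f x) \<le> b \<and> (\<forall>i j. \<bar>Df f x $ i $ j\<bar> \<le> b) \<and>
    (\<forall>y. norm y \<le> R \<longrightarrow> norm (f x - f y) \<le> L * norm (x - y) \<and> (\<forall>i j. \<bar>Df f x $ i $ j - Df f y $ i $ j\<bar> \<le> L * norm (x - y)))"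
    using C2_bounds_on_ball[OF f less_imp_le[OF R(1)]] by blast
  interpret invariant_domain f fl \<Omega> D b L
    using flow D\<Omega> inv_D(1) b0 L0 bL R(2) by unfold_locales blast+
  obtain lam where lam: "lam > 0" "\<And>v. lam * (norm v)\<^sup>2 \<le> v \<bullet> (C *v v)" using pos_def_lower_bound[OF C] by blast
  \<comment> \<open>A uniform radius: every point of \<open>D\<close> is the centre of a ball of
    radius \<open>\<rho>\<close> in \<open>\<Omega>\<close>, as the Lipschitz estimate of gradients
    requires.\<close>
  have "compact (closure D)" using bounded_subset[OF \<Omega>(2) D\<Omega>] by (simp add: compact_closure)
  then obtain \<rho> where \<rho>: "\<rho> > 0" "(\<Union>x\<in>closure D. ball x \<rho>) \<subseteq> \<Omega>"
    using compact_subset_open_imp_ball_epsilon_subset[OF _ \<Omega>(1) inv_D(2)] by blast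
  define c0 where "c0 = (real CARD('n))\<^sup>2 * (\<Lambda> * (real CARD('n) * (4 * b + 2 * L) + 6 * b + L))"
  have c00: "c0 \<ge> 0" using \<Lambda>0 b0 L0 by (simp add: c0_def)
  \<comment> \<open>The bounds 1 and \<open>\<rho> / 3\<close> make \<open>Fmat_Lipschitz\<close>
    applicable; the last one keeps the change of \<open>F(S)\<close> between a point and the nearest
    collocation point below \<open>lam / 2\<close>.\<close>
  define hX where "hX = min 1 (min (\<rho> / 3) (lam / (2 * (c0 + 1))))"
  have hX: "hX > 0" "hX \<le> 1" "hX < \<rho> / 2"
  proof -
    show "hX > 0" using \<rho>(1) lam(1) c00 by (simp add: hX_def)
    show "hX \<le> 1" by (simp add: hX_def)
    have "hX \<le> \<rho> / 3" unfolding hX_def by (rule order_trans[OF min.cobounded2 min.cobounded1])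
    then show "hX < \<rho> / 2" using \<rho>(1) by linarith
  qed
  have hXc: "c0 * hX \<le> lam / 2"
  proof -
    have "c0 * hX \<le> (c0 + 1) * (lam / (2 * (c0 + 1)))" using c00 hX(1) by (intro mult_mono) (auto simp: hX_def min_le_iff_disj)
    also have "\<dots> = lam / 2" using c00 by (simp add: field_simps)
    finally show ?thesis .
  qed
  have main: "\<exists>G. C11_on \<Lambda> \<Omega> S G \<and> (\<forall>x\<in>D. \<forall>v. \<mu> / 2 * (norm v)\<^sup>2 \<le> v \<bullet> (S x *v v) \<and>
        Fform (Df f x) (S x) (dir_mat G x (f x)) v \<le> - (v \<bullet> (C *v v)) / 2)"
    if X: "finite X" "X \<noteq> {}" "X \<subseteq> \<Omega>" "fill_distance X \<Omega> \<le> hX" and S: "optimal_recovery f fl C H ip X S"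
      and \<mu>: "\<mu> > 0" "\<And>x. x \<in> closure \<Omega> \<Longrightarrow> mat \<mu> \<preceq>\<^sub>L M x" for X S \<mu>
  proof -
    have SH: "S \<in> mat_space H" and Seq: "\<And>x. x \<in> X \<Longrightarrow> F_op f fl S x = - C"
      and min: "\<And>s. s \<in> mat_space H \<Longrightarrow> (\<forall>x\<in>X. F_op f fl s x = - C) \<Longrightarrow> \<not> sqrt (mat_ip ip s s) < sqrt (mat_ip ip S S)"
      using S by (auto simp: optimal_recovery_def is_arg_min_def)
    have "sqrt (mat_ip ip S S) \<le> sqrt (mat_ip ip m m)" using min[OF m_H] m_eq X(3) by force
    then obtain G where G: "C11_on \<Lambda> \<Omega> S G" using C11[OF SH] by blast
    have FS: "Fform (Df f x) (S x) (dir_mat G x (f x)) v \<le> - (v \<bullet> (C *v v)) / 2" if x: "x \<in> D" for x v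
    proof -
      have x\<Omega>: "x \<in> \<Omega>" using x D\<Omega> by blast
      obtain y where y: "y \<in> X" "norm (x - y) \<le> fill_distance X \<Omega>"
        using fill_distance_witness[OF X(1,2) \<Omega>(2) x\<Omega>] by blast
      have y\<Omega>: "y \<in> \<Omega>" using y(1) X(3) by blast
      have yx: "norm (y - x) \<le> hX" using y(2) X(4) by (simp add: norm_minus_commute)
      have ball: "ball x \<rho> \<subseteq> \<Omega>" using \<rho>(2) x cl(2) by blast
      have e: "\<bar>Fmat f S G y $ i $ j - Fmat f S G x $ i $ j\<bar> \<le> \<Lambda> * (real CARD('n) * (4 * b + 2 * L) + 6 * b + L) * hX" for i j
      proof -
        have "\<bar>Fmat f S G y $ i $ j - Fmat f S G x $ i $ j\<bar> \<le> \<Lambda> * (real CARD('n) * (4 * b + 2 * L) + 6 * b + L) * norm (y - x)"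
          by (rule Fmat_Lipschitz[OF G ball]) (use yx hX bL R(2) x\<Omega> y\<Omega> in auto)
        also have "\<dots> \<le> \<Lambda> * (real CARD('n) * (4 * b + 2 * L) + 6 * b + L) * hX"
          using yx \<Lambda>0 b0 L0 by (intro mult_left_mono) auto
        finally show ?thesis .
      qed
      have "\<bar>v \<bullet> ((Fmat f S G y - Fmat f S G x) *v v)\<bar> \<le> (real CARD('n))\<^sup>2 * (\<Lambda> * (real CARD('n) * (4 * b + 2 * L) + 6 * b + L) * hX) * (norm v * norm v)"
        by (rule entries_form_bound) (use e in simp)
      also have "\<dots> = (c0 * hX) * (norm v)\<^sup>2" by (simp add: c0_def power2_eq_square mult_ac)
      also have "\<dots> \<le> (lam / 2) * (norm v)\<^sup>2" by (intro mult_right_mono hXc) simp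
      also have "\<dots> \<le> v \<bullet> (C *v v) / 2" using lam(2)[of v] by simp
      finally have "v \<bullet> (Fmat f S G x *v v) \<le> v \<bullet> (Fmat f S G y *v v) + v \<bullet> (C *v v) / 2"
        unfolding matrix_vector_mult_diff_rdistrib inner_diff_right by linarith
      moreover have "v \<bullet> (Fmat f S G y *v v) = - (v \<bullet> (C *v v))"
        using F_form(2)[OF G y\<Omega>] Seq[OF y(1)] matrix_vector_mult_diff_rdistrib[of 0 C v] by simp
      ultimately show ?thesis using F_form(1)[OF G x\<Omega>, of v] F_form(2)[OF G x\<Omega>] by simp
    qed
    have Fm: "Fform (Df f x) (m x) (dir_mat Gm x (f x)) v = - (v \<bullet> (C *v v))" if x: "x \<in> D" for x v
      using F_form(1)[OF Gm, of x v] m_eq[of x] x D\<Omega> matrix_vector_mult_diff_rdistrib[of 0 C v] by auto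
    have m_low: "\<mu> * (norm v)\<^sup>2 \<le> v \<bullet> (m x *v v)" if x: "x \<in> D" for x v
      using loewner_le_matD[OF \<mu>(2), of x v] x D\<Omega> cl(1) by (auto simp: m_def)
    have "\<mu> / 2 * (norm v)\<^sup>2 \<le> v \<bullet> (S x *v v)" if x: "x \<in> D" for x v
    proof -
      \<comment> \<open>The form of \<open>F(S - M/2)\<close> is at most that of
        \<open>- C/2 + C/2\<close>, so the Lyapunov argument applies with \<open>M\<close> as
        comparison function.\<close>
      have "0 \<le> v \<bullet> ((S x + (- (1 / 2)) *\<^sub>R m x) *v v)"
      proof (rule Lyapunov_nonneg[OF C11_on_add_scaled[OF G Gm] Gm \<mu>(1) m_low lam(1) _ _ x])
        show "Fform (Df f x) (m x) (dir_mat Gm x (f x)) v \<le> - lam * (norm v)\<^sup>2" if "x \<in> D" for x v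
          using Fm[OF that, of v] lam(2)[of v] by simp
        show "Fform (Df f x) (S x + (- (1 / 2)) *\<^sub>R m x) (dir_mat (\<lambda>x i j. G x i j + (- (1 / 2)) *\<^sub>R Gm x i j) x (f x)) v \<le> 0"
          if "x \<in> D" for x v
          using Fm[OF that, of v] FS[OF that, of v] unfolding dir_mat_add_scaled Fform_add_scaled by simp
      qed
      then have "1 / 2 * (v \<bullet> (m x *v v)) \<le> v \<bullet> (S x *v v)"
        unfolding matrix_vector_mult_add_rdistrib scaleR_matrix_vector_assoc[symmetric] inner_add_right by simp
      then show ?thesis using m_low[OF x, of v] by simp
    qed
    with G FS show ?thesis by blast
  qed
  show ?thesis
    by (rule exI[of _ hX], intro conjI hX(1), rule exI[of _ \<Lambda>], intro conjI \<Lambda>0 allI impI, elim conjE, rule main, simp_all)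
qed

section \<open>Interpolation on a triangulation\<close>

lemma norm1_le_norm: "norm1 (v :: real^'n) \<le> real CARD('n) * norm v"
  using sum_bounded_above[of UNIV "\<lambda>i. \<bar>v $ i\<bar>" "norm v"] component_le_norm_cart[of v] by (simp add: norm1_def)

lemma norm_le_norm1: "norm (v :: real^'n) \<le> norm1 v"
  using norm_le_l1_cart[of v] by (simp add: norm1_def)

lemma norm1_nonneg: "0 \<le> norm1 v"
  by (simp add: norm1_def sum_nonneg)

text \<open>The defining supremum bounds each quotient because the quotients are bounded above, by
  comparison with the Euclidean norm.\<close>

lemma mat_norm1_bound: "norm1 (A *v v) \<le> mat_norm1 A * norm1 v" for A :: "real^'n^'n"
proof (cases "v = 0")
  case True
  then show ?thesis by (simp add: norm1_def)
next
  case False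
  then have v: "norm1 v > 0" using norm_le_norm1[of v] by (simp add: less_le_trans[of 0 "norm v"])
  obtain B where B: "\<And>v. norm (A *v v) \<le> norm v * B" "B \<ge> 0"
    using bounded_linear.nonneg_bounded[OF matrix_vector_mul_bounded_linear[of A]] by blast
  have "norm1 (A *v v) / norm1 v \<le> mat_norm1 A"
    unfolding mat_norm1_def
  proof (rule cSUP_upper)
    show "bdd_above ((\<lambda>v. norm1 (A *v v) / norm1 v) ` {v. v \<noteq> 0})"
    proof (rule bdd_aboveI2)
      fix u :: "real^'n" assume "u \<in> {v. v \<noteq> 0}"
      then have u: "norm1 u > 0" using norm_le_norm1[of u] by (simp add: less_le_trans[of 0 "norm u"])
      have "norm1 (A *v u) \<le> real CARD('n) * (norm u * B)"
        by (rule order_trans[OF norm1_le_norm mult_left_mono[OF B(1)]]) simp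
      also have "\<dots> \<le> real CARD('n) * (norm1 u * B)"
        using norm_le_norm1[of u] B(2) by (intro mult_left_mono mult_right_mono) auto
      finally show "norm1 (A *v u) / norm1 u \<le> real CARD('n) * B" using u by (simp add: pos_divide_le_eq mult_ac)
    qed
  qed (use False in simp)
  then show ?thesis using v by (simp add: pos_divide_le_eq)
qed

lemma mat_vector: "mat a *v v = a *\<^sub>R v" for v :: "real^'n"
  by (simp add: mat_def matrix_vector_mult_def vec_eq_iff if_distrib[where f="\<lambda>x. x * _"] cong: if_cong)

lemma symmetric_mat_mat: "symmetric_mat (mat a)"
  by (simp add: symmetric_mat_def)

lemma symmetric_mat_add: "symmetric_mat A \<Longrightarrow> symmetric_mat B \<Longrightarrow> symmetric_mat (A + B)"
  by (simp add: symmetric_mat_def transpose_def vec_eq_iff)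

lemma symmetric_mat_diff: "symmetric_mat A \<Longrightarrow> symmetric_mat B \<Longrightarrow> symmetric_mat (A - B)"
  by (simp add: symmetric_mat_def transpose_def vec_eq_iff)

lemma loewner_leI:
  "symmetric_mat A \<Longrightarrow> symmetric_mat B \<Longrightarrow> (\<And>v. v \<bullet> (A *v v) \<le> v \<bullet> (B *v v)) \<Longrightarrow> A \<preceq>\<^sub>L B"
  by (simp add: loewner_le_def neg_semidef_def symmetric_mat_diff matrix_vector_mult_diff_rdistrib inner_diff_right)

text \<open>For an affine matrix function the set of points with both properties is convex, so it
  contains the hull as soon as it contains the vertices.\<close>

lemma convex_hull_lower_form:
  fixes L :: "real^'n \<Rightarrow> real^'n^'n"
  assumes L: "linear L" and V: "\<And>y. y \<in> V \<Longrightarrow> symmetric_mat (L y + B)" "\<And>y v. y \<in> V \<Longrightarrow> m * (norm v)\<^sup>2 \<le> v \<bullet> ((L y + B) *v v)"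
    and x: "x \<in> convex hull V"
  shows "symmetric_mat (L x + B)" "m * (norm v)\<^sup>2 \<le> v \<bullet> ((L x + B) *v v)"
proof -
  let ?Z = "{x. symmetric_mat (L x + B) \<and> (\<forall>v. m * (norm v)\<^sup>2 \<le> v \<bullet> ((L x + B) *v v))}"
  have "convex ?Z"
    unfolding convex_def
  proof (intro ballI allI impI CollectI conjI)
    fix x y :: "real^'n" and u t :: real assume xy: "x \<in> ?Z" "y \<in> ?Z" and ut: "0 \<le> u" "0 \<le> t" "u + t = 1"
    have "u *\<^sub>R B + t *\<^sub>R B = B" using ut(3) by (simp add: scaleR_left_distrib[symmetric])
    then have e: "L (u *\<^sub>R x + t *\<^sub>R y) + B = u *\<^sub>R (L x + B) + t *\<^sub>R (L y + B)"
      by (simp add: linear_add[OF L] linear_scale[OF L] scaleR_right_distrib algebra_simps)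
    show "symmetric_mat (L (u *\<^sub>R x + t *\<^sub>R y) + B)"
      unfolding e using xy by (simp add: symmetric_mat_def transpose_def vec_eq_iff)
    fix v :: "real^'n"
    have "u * (m * (norm v)\<^sup>2) + t * (m * (norm v)\<^sup>2) \<le> u * (v \<bullet> ((L x + B) *v v)) + t * (v \<bullet> ((L y + B) *v v))"
      using xy ut by (intro add_mono mult_left_mono) auto
    moreover have "u * (m * (norm v)\<^sup>2) + t * (m * (norm v)\<^sup>2) = m * (norm v)\<^sup>2"
      using ut(3) by (simp add: distrib_right[symmetric])
    moreover have "v \<bullet> ((u *\<^sub>R (L x + B) + t *\<^sub>R (L y + B)) *v v) = u * (v \<bullet> ((L x + B) *v v)) + t * (v \<bullet> ((L y + B) *v v))"
      unfolding matrix_vector_mult_add_rdistrib[of "u *\<^sub>R (L x + B)"] scaleR_matrix_vector_assoc[symmetric] inner_add_right inner_scaleR_right ..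
    ultimately show "m * (norm v)\<^sup>2 \<le> v \<bullet> ((L (u *\<^sub>R x + t *\<^sub>R y) + B) *v v)" unfolding e by simp
  qed
  then have "convex hull V \<subseteq> ?Z" using V by (intro hull_minimal) auto
  then have "x \<in> ?Z" using x by blast
  then show "symmetric_mat (L x + B)" "m * (norm v)\<^sup>2 \<le> v \<bullet> ((L x + B) *v v)" by auto
qed

section \<open>Interpolation on a single simplex\<close>

text \<open>The balls of radius \<open>\<rho>\<close> are there for
  \<open>gradient_Lipschitz\<close>, which compares gradients at two points of the simplex. In
  \<open>c1\<close> the summand with \<open>d\<close> is the error at a base vertex and the 6 pays
  for moving away from it.\<close>

locale simplex_interpolation =
  fixes \<nu> :: "(real^'n) set" and P S :: "real^'n \<Rightarrow> real^'n^'n" and G \<Lambda> \<Omega> d \<rho> c1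
  assumes simplex: "int CARD('n) simplex \<nu>"
    and shape: "\<exists>v. bij_betw v UNIV (verts \<nu>) \<and> diameter \<nu> * mat_norm1 (matrix_inv (shape_matrix v)) \<le> d"
    and affine: "\<exists>L B. linear L \<and> (\<forall>x\<in>\<nu>. P x = L x + B)"
    and vals: "\<And>y. y \<in> verts \<nu> \<Longrightarrow> P y = S y"
    and S: "C11_on \<Lambda> \<Omega> S G"
    and ball: "\<And>x. x \<in> \<nu> \<Longrightarrow> ball x \<rho> \<subseteq> \<Omega>"
    and small: "diameter \<nu> < \<rho> / 2" "diameter \<nu> \<le> 1" and d: "0 \<le> d"
    and c1_def: "c1 = (d * real CARD('n) + 6) * \<Lambda>"
begin

lemma hull: "\<nu> = convex hull (verts \<nu>)" "finite (verts \<nu>)" "verts \<nu> \<noteq> {}" "affine hull (verts \<nu>) = UNIV"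
proof -
  obtain V where V: "\<not> affine_dependent V" "int (card V) = int CARD('n) + 1" "\<nu> = convex hull V"
    using simplex by (auto simp: simplex_def)
  have v: "verts \<nu> = V"
    using extreme_point_of_convex_hull_affine_independent[OF V(1)] by (auto simp: verts_def V(3))
  show "\<nu> = convex hull (verts \<nu>)" using V(3) v by simp
  show "finite (verts \<nu>)" "verts \<nu> \<noteq> {}" using V(2) v by (auto intro: card_ge_0_finite)
  have "aff_dim V = int DIM(real^'n)" using aff_dim_affine_independent[OF V(1)] V(2) by simp
  then show "affine hull (verts \<nu>) = UNIV" by (simp only: v aff_dim_eq_full)
qed

lemma verts_subset: "verts \<nu> \<subseteq> \<nu>"
  by (auto simp: verts_def extreme_point_of_def)

lemma compact_simplex: "compact \<nu>" and convex_simplex: "convex \<nu>"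
  using hull finite_imp_compact_convex_hull by (metis, metis convex_convex_hull)

lemma diam: "x \<in> \<nu> \<Longrightarrow> y \<in> \<nu> \<Longrightarrow> norm (x - y) \<le> diameter \<nu>" "0 \<le> diameter \<nu>"
  using diameter_bounded_bound[OF compact_imp_bounded[OF compact_simplex]] diameter_ge_0[OF compact_imp_bounded[OF compact_simplex]]
  by (auto simp: dist_norm)

lemma rho: "0 < \<rho>"
  using small diam(2) by simp

lemma subset_domain: "\<nu> \<subseteq> \<Omega>"
  using ball rho by (meson centre_in_ball subset_iff)

text \<open>The vertices of an \<open>n\<close>-simplex span the whole space affinely. This makes
  \<open>cpa_gradient\<close> well defined and the shape matrix invertible.\<close>

lemma orthogonal_zero:
  assumes "\<And>y. y \<in> verts \<nu> \<Longrightarrow> z \<bullet> (y - a) = 0"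
  shows "z = 0"
proof -
  have "affine hull (verts \<nu>) \<subseteq> {y. z \<bullet> y = z \<bullet> a}"
    using assms by (intro hull_minimal affine_hyperplane) (auto simp: inner_diff_right)
  then have "z \<bullet> (a + z) = z \<bullet> a" using hull(4) by blast
  then show ?thesis by (simp add: inner_add_right)
qed

lemma gradient:
  assumes "x \<in> \<nu>" "y \<in> \<nu>"
  shows "P x $ i $ j - P y $ i $ j = cpa_gradient P \<nu> i j \<bullet> (x - y)"
proof -
  obtain L B where L: "linear L" "\<And>x. x \<in> \<nu> \<Longrightarrow> P x = L x + B" using affine by blast
  define w where "w = (\<chi> m. L (axis m 1) $ i $ j)"
  have w: "P x $ i $ j - P y $ i $ j = w \<bullet> (x - y)" if "x \<in> \<nu>" "y \<in> \<nu>" for x y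
  proof -
    have "P x - P y = L (x - y)" using that by (simp add: L(2) linear_diff[OF L(1)])
    also have "\<dots> = L (\<Sum>m\<in>UNIV. (x - y) $ m *\<^sub>R axis m 1)" using basis_expansion[of "x - y"] by (simp add: scalar_mult_eq_scaleR)
    also have "\<dots> = (\<Sum>m\<in>UNIV. (x - y) $ m *\<^sub>R L (axis m 1))" by (simp add: linear_sum[OF L(1)] linear_scale[OF L(1)])
    finally have "(P x - P y) $ i $ j = (\<Sum>m\<in>UNIV. (x - y) $ m *\<^sub>R L (axis m 1)) $ i $ j" by simp
    then show ?thesis by (simp add: w_def inner_vec_def mult.commute)
  qed
  have "\<forall>x\<in>\<nu>. \<forall>y\<in>\<nu>. P x $ i $ j - P y $ i $ j = cpa_gradient P \<nu> i j \<bullet> (x - y)"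
    unfolding cpa_gradient_def
  proof (rule theI[where a=w])
    show "\<forall>x\<in>\<nu>. \<forall>y\<in>\<nu>. P x $ i $ j - P y $ i $ j = w \<bullet> (x - y)" using w by blast
    fix w' assume w': "\<forall>x\<in>\<nu>. \<forall>y\<in>\<nu>. P x $ i $ j - P y $ i $ j = w' \<bullet> (x - y)"
    obtain a where a: "a \<in> verts \<nu>" using hull(3) by blast
    have "w' - w = 0"
    proof (rule orthogonal_zero)
      fix y assume "y \<in> verts \<nu>"
      then have "y \<in> \<nu>" "a \<in> \<nu>" using verts_subset a by auto
      then have "w' \<bullet> (y - a) = w \<bullet> (y - a)" using w[of y a] w' by simp
      then show "(w' - w) \<bullet> (y - a) = 0" by (simp add: inner_diff_left)
    qed
    then show "w' = w" by simp
  qed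
  then show ?thesis using assms by blast
qed

lemma Lam: "0 \<le> \<Lambda>" and c1_nonneg: "0 \<le> c1"
  using C11_onD(1)[OF S] d by (auto simp: c1_def)

text \<open>The shape matrix maps the gradient difference at a base vertex to Taylor remainders of
  \<open>S\<close>, which are at most \<open>\<Lambda>\<close> times the squared diameter. Its
  inverse costs \<open>d\<close> divided by the diameter, so one power of the diameter
  remains.\<close>

lemma gradient_error:
  assumes x: "x \<in> \<nu>"
  shows "norm (cpa_gradient P \<nu> i j - G x i j) \<le> c1 * diameter \<nu>"
proof -
  obtain v where v: "bij_betw v UNIV (verts \<nu>)" "diameter \<nu> * mat_norm1 (matrix_inv (shape_matrix v)) \<le> d"
    using shape by blast
  define A where "A = shape_matrix v"
  define a where "a = v None"
  have vV: "v p \<in> verts \<nu>" for p using v(1) by (auto simp: bij_betw_def)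
  then have v\<nu>: "v p \<in> \<nu>" for p using verts_subset by blast
  have a: "a \<in> \<nu>" "a \<in> verts \<nu>" using v\<nu> vV by (auto simp: a_def)
  have A_nth: "(A *v z) $ m = z \<bullet> (v (Some m) - a)" for z m
    by (simp add: A_def a_def shape_matrix_def matrix_vector_mult_def inner_vec_def mult.commute)
  have "z = 0" if "A *v z = 0" for z
  proof (rule orthogonal_zero)
    fix y assume "y \<in> verts \<nu>"
    then obtain p where p: "y = v p" using v(1) by (auto simp: bij_betw_def)
    have "z \<bullet> (v (Some m) - a) = 0" for m using A_nth[of z m] that by simp
    then show "z \<bullet> (y - a) = 0" unfolding p by (cases p) (simp_all add: a_def)
  qed
  then have "invertible A" by (simp add: invertible_left_inverse matrix_left_invertible_ker)
  then have "\<exists>A'. A ** A' = mat 1 \<and> A' ** A = mat 1" by (simp add: invertible_def)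
  then have inv: "matrix_inv A ** A = mat 1" unfolding matrix_inv_def by (rule someI2_ex) simp
  define z where "z = cpa_gradient P \<nu> i j - G a i j"
  have "\<bar>(A *v z) $ m\<bar> \<le> \<Lambda> * (diameter \<nu>)\<^sup>2" for m
  proof -
    have "(A *v z) $ m = S (v (Some m)) $ i $ j - S a $ i $ j - G a i j \<bullet> (v (Some m) - a)"
      using gradient[OF v\<nu>[of "Some m"] a(1), of i j] by (simp add: A_nth z_def inner_diff_left vals vV a)
    also have "\<bar>\<dots>\<bar> \<le> \<Lambda> * (norm (v (Some m) - a))\<^sup>2"
      using C11_onD(5)[OF S, of a "v (Some m)"] a(1) v\<nu> subset_domain by blast
    also have "\<dots> \<le> \<Lambda> * (diameter \<nu>)\<^sup>2" by (intro mult_left_mono power_mono diam v\<nu> a Lam) simp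
    finally show ?thesis .
  qed
  then have "norm1 (A *v z) \<le> real CARD('n) * (\<Lambda> * (diameter \<nu>)\<^sup>2)"
    unfolding norm1_def using sum_bounded_above[of UNIV "\<lambda>m. \<bar>(A *v z) $ m\<bar>"] by simp
  \<comment> \<open>The sign of \<open>mat_norm1\<close> is read off from
    \<open>mat_norm1_bound\<close>: a negative value would force \<open>A *v z\<close> to have norm
    0.\<close>
  have m0: "0 \<le> mat_norm1 (matrix_inv A) \<or> norm1 (A *v z) = 0"
    using mat_norm1_bound[of "matrix_inv A" "A *v z"] norm1_nonneg[of "matrix_inv A *v (A *v z)"] norm1_nonneg[of "A *v z"]
    by (metis linorder_not_le mult_neg_pos order_le_less order_trans)
  have "norm z \<le> norm1 (matrix_inv A *v (A *v z))"
    using norm_le_norm1[of z] inv by (simp add: matrix_vector_mul_assoc)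
  also have "\<dots> \<le> mat_norm1 (matrix_inv A) * norm1 (A *v z)" by (rule mat_norm1_bound)
  also have "\<dots> \<le> d * real CARD('n) * \<Lambda> * diameter \<nu>"
  proof (cases "0 \<le> mat_norm1 (matrix_inv A)")
    case True
    then have "mat_norm1 (matrix_inv A) * norm1 (A *v z) \<le> mat_norm1 (matrix_inv A) * (real CARD('n) * (\<Lambda> * (diameter \<nu>)\<^sup>2))"
      by (intro mult_left_mono \<open>norm1 (A *v z) \<le> _\<close>)
    also have "\<dots> = (diameter \<nu> * mat_norm1 (matrix_inv A)) * (real CARD('n) * \<Lambda> * diameter \<nu>)"
      by (simp add: power2_eq_square)
    also have "\<dots> \<le> d * (real CARD('n) * \<Lambda> * diameter \<nu>)"
      using v(2) Lam diam(2) by (intro mult_right_mono) (auto simp: A_def)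
    finally show ?thesis by (simp add: mult.assoc)
  next
    case False
    then have "norm1 (A *v z) = 0" using m0 by blast
    then show ?thesis using d Lam diam(2) by simp
  qed
  finally have "norm (cpa_gradient P \<nu> i j - G a i j) \<le> d * real CARD('n) * \<Lambda> * diameter \<nu>" by (simp add: z_def)
  moreover have "norm (G x i j - G a i j) \<le> 6 * \<Lambda> * diameter \<nu>"
  proof -
    have xa: "norm (x - a) < \<rho> / 2" using diam(1)[OF x a(1)] small(1) by simp
    have "norm (G x i j - G a i j) \<le> 6 * \<Lambda> * norm (x - a)"
      by (rule gradient_Lipschitz[OF Lam C11_onD(5)[OF S, of _ _ i j] ball[OF a(1)] xa])
    also have "\<dots> \<le> 6 * \<Lambda> * diameter \<nu>" using diam(1)[OF x a(1)] Lam by (intro mult_left_mono) auto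
    finally show ?thesis .
  qed
  moreover have "norm (cpa_gradient P \<nu> i j - G x i j) \<le> norm (cpa_gradient P \<nu> i j - G a i j) + norm (G x i j - G a i j)"
    using norm_triangle_ineq4[of "cpa_gradient P \<nu> i j - G a i j" "G x i j - G a i j"] by simp
  ultimately show ?thesis unfolding c1_def by (simp add: distrib_right distrib_left mult_ac)
qed

lemma gradient_norm: "norm (cpa_gradient P \<nu> i j) \<le> \<Lambda> + c1"
proof -
  obtain x where x: "x \<in> \<nu>" using hull(3) verts_subset by blast
  have "c1 * diameter \<nu> \<le> c1 * 1" using small(2) c1_nonneg by (intro mult_left_mono)
  moreover have "norm (cpa_gradient P \<nu> i j) \<le> norm (cpa_gradient P \<nu> i j - G x i j) + norm (G x i j)"
    using norm_triangle_ineq[of "cpa_gradient P \<nu> i j - G x i j" "G x i j"] by simp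
  moreover have "norm (G x i j) \<le> \<Lambda>" using C11_onD(4)[OF S] x subset_domain by blast
  ultimately show ?thesis using gradient_error[OF x, of i j] by linarith
qed

text \<open>At a vertex the values agree. On the way to \<open>x\<close>, \<open>P\<close> changes
  by its gradient, of norm at most \<open>\<Lambda> + c1\<close>, and \<open>S\<close> by its
  Lipschitz constant \<open>2 * \<Lambda>\<close>.\<close>

lemma value_error:
  assumes x: "x \<in> \<nu>"
  shows "\<bar>P x $ i $ j - S x $ i $ j\<bar> \<le> (3 * \<Lambda> + c1) * diameter \<nu>"
proof -
  obtain a where a: "a \<in> verts \<nu>" "a \<in> \<nu>" using hull(3) verts_subset by blast
  have xa: "norm (x - a) \<le> diameter \<nu>" by (rule diam(1)[OF x a(2)])
  have "\<bar>cpa_gradient P \<nu> i j \<bullet> (x - a)\<bar> \<le> (\<Lambda> + c1) * diameter \<nu>"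
    using Cauchy_Schwarz_ineq2[of "cpa_gradient P \<nu> i j" "x - a"]
      mult_mono[OF gradient_norm xa, of i j] Lam c1_nonneg by simp
  moreover have "\<bar>S x $ i $ j - S a $ i $ j\<bar> \<le> 2 * \<Lambda> * diameter \<nu>"
  proof -
    have "\<bar>S x $ i $ j - S a $ i $ j\<bar> \<le> 2 * \<Lambda> * norm (x - a)"
      using C11_Lipschitz[OF S, of a x] x a xa small(2) subset_domain by auto
    also have "\<dots> \<le> 2 * \<Lambda> * diameter \<nu>" using xa Lam by (intro mult_left_mono) auto
    finally show ?thesis .
  qed
  moreover have "P x $ i $ j - S x $ i $ j = cpa_gradient P \<nu> i j \<bullet> (x - a) - (S x $ i $ j - S a $ i $ j)"
    using gradient[OF x a(2), of i j] vals[OF a(1)] by simp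
  ultimately show ?thesis by (simp add: algebra_simps)
qed

lemma value_bound:
  assumes x: "x \<in> \<nu>"
  shows "\<bar>P x $ i $ j\<bar> \<le> 4 * \<Lambda> + c1"
proof -
  have "(3 * \<Lambda> + c1) * diameter \<nu> \<le> (3 * \<Lambda> + c1) * 1" using small(2) Lam c1_nonneg by (intro mult_left_mono) auto
  moreover have "\<bar>S x $ i $ j\<bar> \<le> \<Lambda>" using C11_onD(3)[OF S] x subset_domain by blast
  moreover have "(3 * \<Lambda> + c1) * 1 = 3 * \<Lambda> + c1" by simp
  moreover have "\<bar>P x $ i $ j\<bar> \<le> \<bar>P x $ i $ j - S x $ i $ j\<bar> + \<bar>S x $ i $ j\<bar>" by linarith
  ultimately show ?thesis using value_error[OF x, of i j] by linarith
qed

lemma lower_form: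
  assumes low: "\<And>y v. y \<in> verts \<nu> \<Longrightarrow> m * (norm v)\<^sup>2 \<le> v \<bullet> (S y *v v)" and x: "x \<in> \<nu>"
  shows "symmetric_mat (P x)" "m * (norm v)\<^sup>2 \<le> v \<bullet> (P x *v v)"
proof -
  obtain L B where L: "linear L" "\<And>x. x \<in> \<nu> \<Longrightarrow> P x = L x + B" using affine by blast
  have V: "L y + B = S y" "symmetric_mat (S y)" if "y \<in> verts \<nu>" for y
    using L(2)[of y] vals[OF that] that verts_subset C11_onD(2)[OF S, of y] subset_domain by auto
  have xh: "x \<in> convex hull (verts \<nu>)" using x hull(1) by simp
  have "symmetric_mat (L x + B)" "m * (norm v)\<^sup>2 \<le> v \<bullet> ((L x + B) *v v)"
    by (rule convex_hull_lower_form[OF L(1) _ _ xh, of B m], use V low in simp_all)+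
  then show "symmetric_mat (P x)" "m * (norm v)\<^sup>2 \<le> v \<bullet> (P x *v v)" using L(2)[OF x] by simp_all
qed

lemma gradient_sym:
  assumes "\<And>x. x \<in> \<nu> \<Longrightarrow> symmetric_mat (P x)"
  shows "cpa_gradient P \<nu> i j = cpa_gradient P \<nu> j i"
proof -
  have "P x $ i $ j = P x $ j $ i" if "x \<in> \<nu>" for x
  proof -
    have "transpose (P x) $ i $ j = P x $ i $ j" using assms[OF that] by (simp add: symmetric_mat_def)
    then show ?thesis by (simp add: transpose_def)
  qed
  then show ?thesis unfolding cpa_gradient_def by (simp cong: ball_cong)
qed

lemma Lipschitz: "\<exists>l\<ge>0. \<forall>x\<in>\<nu>. \<forall>y\<in>\<nu>. norm (P x - P y) \<le> l * norm (x - y)"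
proof -
  obtain L B where L: "linear L" "\<And>x. x \<in> \<nu> \<Longrightarrow> P x = L x + B" using affine by blast
  obtain K where K: "K \<ge> 0" "\<And>x. norm (L x) \<le> norm x * K"
    using bounded_linear.nonneg_bounded L(1) linear_conv_bounded_linear by blast
  have "norm (P x - P y) \<le> K * norm (x - y)" if "x \<in> \<nu>" "y \<in> \<nu>" for x y
    using K(2)[of "x - y"] that by (simp add: L(2) linear_diff[OF L(1)] mult.commute)
  with K(1) show ?thesis by blast
qed

text \<open>Value and gradient errors are both of the order of the diameter, and so is the error of
  \<open>F\<close>. Every matrix that is bounded entrywise costs a factor \<open>n\<^sup>2\<close>
  with \<open>n = CARD('n)\<close>; the product with \<open>A\<close> involves two of them, hence
  the fourth power.\<close>

lemma form_error:
  fixes A :: "real^'n^'n"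
  assumes x: "x \<in> \<nu>" and A: "\<And>i j. \<bar>A $ i $ j\<bar> \<le> b" and w: "norm w \<le> b"
  shows "Fform A (P x) (\<chi> i j. cpa_gradient P \<nu> i j \<bullet> w) v
    \<le> Fform A (S x) (dir_mat G x w) v + (2 * (real CARD('n))^4 * (3 * \<Lambda> + c1) * b + (real CARD('n))\<^sup>2 * c1 * b) * diameter \<nu> * (norm v)\<^sup>2"
proof -
  have b: "b \<ge> 0" using w norm_ge_zero order_trans by blast
  let ?N = "P x - S x" and ?Q = "(\<chi> i j. cpa_gradient P \<nu> i j \<bullet> w) - dir_mat G x w"
  have "v \<bullet> (?N *v (A *v v)) \<le> (real CARD('n))\<^sup>2 * ((3 * \<Lambda> + c1) * diameter \<nu>) * (norm v * ((real CARD('n))\<^sup>2 * b * norm v))"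
    by (rule entries_form_le[OF _ order_refl entries_vector_bound[OF A]]) (use value_error[OF x] in simp)
  moreover have "v \<bullet> (?Q *v v) \<le> (real CARD('n))\<^sup>2 * (c1 * diameter \<nu> * b) * (norm v * norm v)"
  proof (rule entries_form_le[OF _ order_refl order_refl])
    fix i j
    have "?Q $ i $ j = (cpa_gradient P \<nu> i j - G x i j) \<bullet> w" by (simp add: dir_mat_def inner_diff_left)
    also have "\<bar>\<dots>\<bar> \<le> norm (cpa_gradient P \<nu> i j - G x i j) * norm w" by (rule Cauchy_Schwarz_ineq2)
    also have "\<dots> \<le> c1 * diameter \<nu> * b"
      using gradient_error[OF x, of i j] w c1_nonneg diam(2) by (intro mult_mono) auto
    finally show "\<bar>?Q $ i $ j\<bar> \<le> c1 * diameter \<nu> * b" .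
  qed
  moreover have "Fform A (P x) (\<chi> i j. cpa_gradient P \<nu> i j \<bullet> w) v
     = Fform A (S x) (dir_mat G x w) v + (2 * (v \<bullet> (?N *v (A *v v))) + v \<bullet> (?Q *v v))"
    unfolding Fform_def matrix_vector_mult_diff_rdistrib inner_diff_right by simp
  ultimately have "Fform A (P x) (\<chi> i j. cpa_gradient P \<nu> i j \<bullet> w) v \<le> Fform A (S x) (dir_mat G x w) v
     + (2 * ((real CARD('n))\<^sup>2 * ((3 * \<Lambda> + c1) * diameter \<nu>) * (norm v * ((real CARD('n))\<^sup>2 * b * norm v)))
        + (real CARD('n))\<^sup>2 * (c1 * diameter \<nu> * b) * (norm v * norm v))"
    by linarith
  also have "\<dots> = Fform A (S x) (dir_mat G x w) v + (2 * (real CARD('n))^4 * (3 * \<Lambda> + c1) * b + (real CARD('n))\<^sup>2 * c1 * b) * diameter \<nu> * (norm v)\<^sup>2"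
    by (simp add: power2_eq_square power4_eq_xxxx algebra_simps)
  finally show ?thesis .
qed

end

section \<open>The piecewise affine metric along the flow\<close>

text \<open>The preimages of the pieces form a finite closed cover of the parameter interval of the
  segment, and a common Lipschitz constant on the members of such a cover is one on the
  interval.\<close>

lemma piecewise_Lipschitz:
  fixes P :: "'a::real_normed_vector \<Rightarrow> 'b::real_normed_vector"
  assumes T: "finite T" "\<And>s. s \<in> T \<Longrightarrow> closed s" and l: "l \<ge> 0"
    and P: "\<And>s x y. s \<in> T \<Longrightarrow> x \<in> s \<Longrightarrow> y \<in> s \<Longrightarrow> norm (P x - P y) \<le> l * norm (x - y)"
    and seg: "closed_segment x y \<subseteq> \<Union>T"
  shows "norm (P x - P y) \<le> l * norm (x - y)"
proof -
  define \<gamma> where "\<gamma> t = x + t *\<^sub>R (y - x)" for t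
  have d: "\<gamma> s - \<gamma> t = (s - t) *\<^sub>R (y - x)" for s t by (simp add: \<gamma>_def algebra_simps)
  have "(l * norm (y - x))-lipschitz_on {0..1} (\<lambda>t. P (\<gamma> t))"
  proof (rule lipschitz_on_closed_Union[where I=T and U="\<lambda>s. \<gamma> -` s"])
    fix s assume s: "s \<in> T"
    show "closed (\<gamma> -` s)"
      unfolding \<gamma>_def by (intro continuous_closed_vimage T(2)[OF s]) (auto intro!: continuous_intros)
    show "(l * norm (y - x))-lipschitz_on (\<gamma> -` s) (\<lambda>t. P (\<gamma> t))"
    proof (rule lipschitz_onI)
      fix t r assume "t \<in> \<gamma> -` s" "r \<in> \<gamma> -` s"
      then show "dist (P (\<gamma> t)) (P (\<gamma> r)) \<le> l * norm (y - x) * dist t r"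
        using P[OF s, of "\<gamma> t" "\<gamma> r"] by (simp add: dist_norm d mult_ac)
    qed (use l in simp)
  next
    show "{0..1} \<subseteq> (\<Union>s\<in>T. \<gamma> -` s)"
    proof
      fix t :: real assume "t \<in> {0..1}"
      then have "\<gamma> t \<in> closed_segment x y"
        by (auto simp: \<gamma>_def closed_segment_def algebra_simps intro!: exI[of _ t])
      then show "t \<in> (\<Union>s\<in>T. \<gamma> -` s)" using seg by auto
    qed
  qed (use T l in auto)
  from lipschitz_onD[OF this, of 0 1] show ?thesis by (simp add: \<gamma>_def dist_norm norm_minus_commute)
qed

text \<open>A point may lie on a common face of several simplices. A ray from an interior point of
  the union meets one of the finitely many closed pieces at arbitrarily small times, and convexity
  then yields an initial segment. In the direction \<open>f x\<close> this selects a simplex whose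
  gradients determine the orbital derivative.\<close>

lemma ray_in_piece:
  fixes x w :: "'a::real_normed_vector"
  assumes T: "finite T" "\<And>s. s \<in> T \<Longrightarrow> closed s" "\<And>s. s \<in> T \<Longrightarrow> convex s" and x: "x \<in> interior (\<Union>T)"
  shows "\<exists>s\<in>T. x \<in> s \<and> (\<exists>h0>0. \<forall>h. 0 \<le> h \<and> h \<le> h0 \<longrightarrow> x + h *\<^sub>R w \<in> s)"
proof -
  have "((\<lambda>h. x + h *\<^sub>R w) \<longlongrightarrow> x + 0 *\<^sub>R w) (at_right 0)" by (intro tendsto_intros)
  then have ev: "\<forall>\<^sub>F h in at_right 0. x + h *\<^sub>R w \<in> interior (\<Union>T)"
    using x by (intro topological_tendstoD) auto
  have "\<exists>s\<in>T. \<not> (\<forall>\<^sub>F h in at_right 0. x + h *\<^sub>R w \<notin> s)"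
  proof (rule ccontr)
    assume "\<not> ?thesis"
    then have "\<forall>\<^sub>F h in at_right 0. \<forall>s\<in>T. x + h *\<^sub>R w \<notin> s" using T(1) by (simp add: eventually_ball_finite)
    with ev have "\<forall>\<^sub>F h :: real in at_right 0. False"
      by eventually_elim (use interior_subset in blast)
    then show False by simp
  qed
  then obtain s where s: "s \<in> T" "\<not> (\<forall>\<^sub>F h in at_right 0. x + h *\<^sub>R w \<notin> s)" by blast
  have near: "\<exists>h>0. h < e \<and> x + h *\<^sub>R w \<in> s" if "e > 0" for e :: real
    using s(2) that by (auto simp: eventually_at_right_field)
  have "x \<in> closure s"
    unfolding closure_approachable
  proof (intro allI impI)
    fix e :: real assume e: "e > 0"
    obtain h where h: "h > 0" "h < e / (norm w + 1)" "x + h *\<^sub>R w \<in> s"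
      using near[of "e / (norm w + 1)"] e by (auto simp: add_nonneg_pos)
    have "h * norm w \<le> h * (norm w + 1)" using h(1) by simp
    also have "\<dots> < e" using h(2) by (simp add: pos_less_divide_eq add_nonneg_pos)
    finally show "\<exists>y\<in>s. dist y x < e" using h(1,3) by (intro bexI[of _ "x + h *\<^sub>R w"]) (auto simp: dist_norm)
  qed
  then have xs: "x \<in> s" using T(2)[OF s(1)] by simp
  obtain h0 where h0: "h0 > 0" "x + h0 *\<^sub>R w \<in> s" using near[of 1] by auto
  have "x + h *\<^sub>R w \<in> s" if h: "0 \<le> h" "h \<le> h0" for h
  proof -
    have "(1 - h / h0) *\<^sub>R x + (h / h0) *\<^sub>R (x + h0 *\<^sub>R w) \<in> s"
      using h h0 by (intro convexD[OF T(3)[OF s(1)] xs h0(2)]) auto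
    also have "(1 - h / h0) *\<^sub>R x + (h / h0) *\<^sub>R (x + h0 *\<^sub>R w) = x + h *\<^sub>R w"
      using h0(1) by (simp add: algebra_simps)
    finally show ?thesis .
  qed
  with xs s(1) h0(1) show ?thesis by blast
qed

text \<open>The trajectory deviates from its tangent ray by \<open>o(h)\<close>, which a Lipschitz
  function does not notice to first order. Hence the limsup is a limit and equals the slope along
  the ray.\<close>

lemma orbital_derivative_Lipschitz:
  fixes P :: "real^'n \<Rightarrow> real^'n^'n"
  assumes fl: "solution_flow f fl" and U: "open U" "x \<in> U"
    and l: "\<And>y z. y \<in> U \<Longrightarrow> z \<in> U \<Longrightarrow> norm (P y - P z) \<le> l * norm (y - z)"
    and ray: "h0 > 0" "\<And>h i j. 0 < h \<Longrightarrow> h < h0 \<Longrightarrow> P (x + h *\<^sub>R f x) $ i $ j - P x $ i $ j = h * Q $ i $ j"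
  shows "orbital_derivative fl P x = Q"
proof (rule orbital_derivative_eqI)
  fix i j
  note fq = flow_quotient[OF fl, of x]
  have "((\<lambda>h. x + h *\<^sub>R f x) \<longlongrightarrow> x + 0 *\<^sub>R f x) (at_right 0)" by (intro tendsto_intros)
  then have e1: "\<forall>\<^sub>F h in at_right 0. x + h *\<^sub>R f x \<in> U" using U by (intro topological_tendstoD) auto
  have e2: "\<forall>\<^sub>F h in at_right 0. fl h x \<in> U" by (rule topological_tendstoD[OF fq(2) U])
  have e3: "\<forall>\<^sub>F h in at_right 0. 0 < h \<and> h < h0"
    using ray(1) by (auto simp: eventually_at_right_field intro!: exI[of _ h0])
  have "((\<lambda>h. l * norm ((fl h x - x) /\<^sub>R h - f x)) \<longlongrightarrow> l * norm (f x - f x)) (at_right 0)" by (intro tendsto_intros fq)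
  then have z: "((\<lambda>h. l * norm ((fl h x - x) /\<^sub>R h - f x)) \<longlongrightarrow> 0) (at_right 0)" by simp
  have "((\<lambda>h. (P (fl h x) $ i $ j - P x $ i $ j) / h - Q $ i $ j) \<longlongrightarrow> 0) (at_right 0)"
  proof (rule Lim_null_comparison[OF _ z])
    show "\<forall>\<^sub>F h in at_right 0. norm ((P (fl h x) $ i $ j - P x $ i $ j) / h - Q $ i $ j) \<le> l * norm ((fl h x - x) /\<^sub>R h - f x)"
      using e1 e2 e3
    proof eventually_elim
      case (elim h)
      then have h: "h > 0" "h < h0" by auto
      have "(P (fl h x) $ i $ j - P x $ i $ j) / h - Q $ i $ j = (P (fl h x) $ i $ j - P (x + h *\<^sub>R f x) $ i $ j) / h"
        using ray(2)[OF h, of i j] h(1) by (simp add: field_simps)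
      also have "norm \<dots> \<le> norm (P (fl h x) - P (x + h *\<^sub>R f x)) / h"
        using h(1) component_le_norm_cart[of "(P (fl h x) - P (x + h *\<^sub>R f x)) $ i" j]
          Finite_Cartesian_Product.norm_nth_le[of "P (fl h x) - P (x + h *\<^sub>R f x)" i]
        by (simp add: abs_divide divide_right_mono)
      also have "\<dots> \<le> l * norm (fl h x - (x + h *\<^sub>R f x)) / h"
        using l[OF elim(2,1)] h(1) by (intro divide_right_mono) auto
      also have "fl h x - (x + h *\<^sub>R f x) = h *\<^sub>R ((fl h x - x) /\<^sub>R h - f x)"
        using h(1) by (simp add: scaleR_diff_right)
      finally show ?case using h(1) by simp
    qed
  qed
  then show "((\<lambda>h. (P (fl h x) $ i $ j - P x $ i $ j) / h) \<longlongrightarrow> Q $ i $ j) (at_right 0)" by (simp add: LIM_zero_iff)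
qed

text \<open>For even \<open>n\<close> the order is a half-integer and gets rounded up. For both
  parities the result is the number of derivatives in
  \<open>wendland_native_contains\<close>.\<close>

lemma ceiling_smoothness: "nat \<lceil>real k + (real n + 1) / 2\<rceil> = n div 2 + k + 1"
proof -
  have "real n = real (2 * (n div 2) + n mod 2)" by simp
  also have "\<dots> = 2 * real (n div 2) + real (n mod 2)" by (simp only: of_nat_add of_nat_mult of_nat_numeral)
  finally have n: "real n = 2 * real (n div 2) + real (n mod 2)" .
  have "n mod 2 = 0 \<or> n mod 2 = 1" by auto
  then have "\<lceil>real k + (real n + 1) / 2\<rceil> = int (n div 2 + k + 1)"
    by (intro ceiling_unique; elim disjE; simp only: n; simp)
  then show ?thesis by simp
qed

lemma symmetric_mat_Lyapunov:
  fixes A N Q :: "real^'n^'n"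
  assumes "symmetric_mat N" "symmetric_mat Q"
  shows "symmetric_mat (N ** A + transpose A ** N + Q)"
proof -
  have *: "transpose (N ** A) = transpose A ** N" "transpose (transpose A ** N) = N ** A" "transpose Q = Q"
    using assms by (simp_all add: matrix_transpose_mul symmetric_mat_def)
  have plus: "transpose (X + Y) = transpose X + transpose Y" for X Y :: "real^'n^'n"
    by (simp add: transpose_def vec_eq_iff)
  have "transpose (N ** A + transpose A ** N + Q) = transpose A ** N + N ** A + Q"
    by (simp only: plus *)
  also have "\<dots> = N ** A + transpose A ** N + Q" by (simp only: add.commute[of "transpose A ** N"])
  finally show ?thesis by (simp only: symmetric_mat_def)
qed

lemma form_le_mat_norm2: "v \<bullet> (A *v v) \<le> mat_norm2 A * (norm v)\<^sup>2" for A :: "real^'n^'n"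
proof -
  have "v \<bullet> (A *v v) \<le> norm v * norm (A *v v)" by (rule norm_cauchy_schwarz)
  also have "\<dots> \<le> norm v * (mat_norm2 A * norm v)"
    unfolding mat_norm2_def by (intro mult_left_mono onorm matrix_vector_mul_bounded_linear norm_ge_zero)
  finally show ?thesis by (simp add: power2_eq_square mult_ac)
qed

text \<open>\<open>hXstar\<close> is the constant of \<open>optimal_recovery_estimate\<close>. The
  second constant is computed from \<open>\<Lambda>\<close> and from bounds on
  \<open>closure D\<close>, hence before the collocation points and the triangulation are
  known.\<close>

theorem theorem4p12:
  fixes f :: "real^'n \<Rightarrow> real^'n"
    and fl :: "real \<Rightarrow> real^'n \<Rightarrow> real^'n"
    and x0 :: "real^'n"
    and C :: "real^'n^'n"
    and M :: "real^'n \<Rightarrow> real^'n^'n"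
    and \<Omega> D K :: "(real^'n) set"
    and H :: "(real^'n \<Rightarrow> real) set"
    and ip :: "(real^'n \<Rightarrow> real) \<Rightarrow> (real^'n \<Rightarrow> real) \<Rightarrow> real"
    and k :: nat
    and \<sigma> c d Bstar B3star :: real
  assumes k: "if odd CARD('n) then k \<ge> 2 else k \<ge> 3"
    and \<sigma>: "\<sigma> = real k + (real CARD('n) + 1) / 2"
    and f_smooth: "\<And>i. class_C (\<sigma> + 1) (\<lambda>x. f x $ i) UNIV"
    and flow: "solution_flow f fl"
    and x0: "exp_stable_equilibrium f fl x0"
    and C: "pos_def C"
    and M_sym: "\<And>x. x \<in> basin fl x0 \<Longrightarrow> symmetric_mat (M x)"
    and M_smooth: "\<And>i j. class_C \<sigma> (\<lambda>x. M x $ i $ j) (basin fl x0)"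
    and M_eq: "\<And>x. x \<in> basin fl x0 \<Longrightarrow> F_op f fl M x = - C"
    and \<Omega>: "open \<Omega>" "bounded \<Omega>" "Lipschitz_boundary \<Omega>" "closure \<Omega> \<subseteq> basin fl x0"
    and D: "positively_invariant fl D" "open D" "C1_boundary D" "x0 \<in> D" "closure D \<subseteq> \<Omega>"
    and K: "compact K" "K \<subseteq> D"
    and d: "d \<ge> 2 * sqrt (real CARD('n))"
    and Bstar: "\<And>x i j m. x \<in> closure D \<Longrightarrow> \<bar>pdiff i (pdiff j (\<lambda>y. f y $ m)) x\<bar> \<le> Bstar"
    and B3star: "\<And>x i j m p. x \<in> closure D \<Longrightarrow>
                   \<bar>pdiff i (pdiff j (pdiff m (\<lambda>y. f y $ p))) x\<bar> \<le> B3star"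
    and c: "c > 0"
    and H: "rkhs \<Omega> (wendland_kernel k c) H ip"
  shows "\<exists>hXstar>0. \<exists>hstar>0. \<forall>X \<T> h S P \<mu>0 \<mu>1 \<epsilon>0 B B3 Cc Dd.
           finite X \<and> X \<noteq> {} \<and> X \<subseteq> \<Omega> \<and> fill_distance X \<Omega> \<le> hXstar \<and>
           n_triangulation \<T> \<and> hd_bounded h d \<T> \<and>
           K \<subseteq> interior (\<Union>\<T>) \<and> \<Union>\<T> \<subseteq> D \<and> h < hstar \<and>
           optimal_recovery f fl C H ip X S \<and>
           cpa_interpolation \<T> S P \<and>
           (\<forall>\<nu>\<in>\<T>. Cc \<nu> = Max ((\<lambda>x. mat_norm2 (P x)) ` verts \<nu>)) \<and>
           (\<forall>\<nu>\<in>\<T>. Dd \<nu> = Max {norm1 (cpa_gradient P \<nu> i j) | i j. True}) \<and>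
           (\<forall>\<nu>\<in>\<T>. B \<nu> \<le> Bstar \<and>
              (\<forall>x\<in>\<nu>. \<forall>i j m. \<bar>pdiff i (pdiff j (\<lambda>y. f y $ m)) x\<bar> \<le> B \<nu>)) \<and>
           (\<forall>\<nu>\<in>\<T>. B3 \<nu> \<le> B3star \<and>
              (\<forall>x\<in>\<nu>. \<forall>i j m p. \<bar>pdiff i (pdiff j (pdiff m (\<lambda>y. f y $ p))) x\<bar> \<le> B3 \<nu>)) \<and>
           (\<forall>x\<in>closure \<Omega>. mat \<mu>0 \<preceq>\<^sub>L M x) \<and> mat \<mu>1 \<preceq>\<^sub>L C \<and>
           \<epsilon>0 = 1/3 * min \<mu>0 \<mu>1 \<and> \<epsilon>0 > 0
           \<longrightarrow> verification_constraints f \<T> P \<epsilon>0 B B3 Cc Dd \<and>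
               contraction_metric f fl (interior (\<Union>\<T>)) K P"
proof -
  have k2: "2 \<le> k" using k by (simp split: if_splits)
  have Msm: "Ck_on (CARD('n) div 2 + k + 1) (\<lambda>x. M x $ i $ j) (basin fl x0)" for i j
    using M_smooth[of i j] unfolding class_C_def \<sigma> ceiling_smoothness .
  have f2: "Ck_on 2 (\<lambda>x. f x $ i) UNIV" for i
  proof (rule Ck_le)
    show "Ck_on (nat \<lceil>\<sigma> + 1\<rceil>) (\<lambda>x. f x $ i) UNIV" using f_smooth[of i] by (simp add: class_C_def)
    have "\<lceil>2 :: real\<rceil> \<le> \<lceil>\<sigma> + 1\<rceil>" using k2 by (intro ceiling_mono) (simp add: \<sigma> field_simps)
    then have "nat 2 \<le> nat \<lceil>\<sigma> + 1\<rceil>" unfolding ceiling_numeral by (rule nat_mono)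
    then show "2 \<le> nat \<lceil>\<sigma> + 1\<rceil>" by (simp only: nat_numeral)
  qed
  obtain hX \<Lambda> where hX: "hX > 0" and \<Lambda>: "\<Lambda> \<ge> 0" and
    est0: "\<forall>X S \<mu>. finite X \<and> X \<noteq> {} \<and> X \<subseteq> \<Omega> \<and> fill_distance X \<Omega> \<le> hX \<and>
     optimal_recovery f fl C H ip X S \<and> \<mu> > 0 \<and> (\<forall>x\<in>closure \<Omega>. mat \<mu> \<preceq>\<^sub>L M x) \<longrightarrow>
     (\<exists>G. C11_on \<Lambda> \<Omega> S G \<and> (\<forall>x\<in>D. \<forall>v. \<mu> / 2 * (norm v)\<^sup>2 \<le> v \<bullet> (S x *v v) \<and>
        Fform (Df f x) (S x) (dir_mat G x (f x)) v \<le> - (v \<bullet> (C *v v)) / 2))"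
    by (rule exE[OF optimal_recovery_estimate[OF k2 f2 flow x0 C M_sym Msm M_eq \<Omega>(1,2,4) D(1,5) c H]],
        assumption, assumption, elim exE conjE, rule that)
  have D\<Omega>: "D \<subseteq> \<Omega>" using closure_subset D(5) by blast
  obtain R where R: "R > 0" "\<And>x. x \<in> \<Omega> \<Longrightarrow> norm x \<le> R" using \<Omega>(2) bounded_pos by blast
  obtain b where b: "b \<ge> 0" "\<And>x. x \<in> D \<Longrightarrow> norm (f x) \<le> b" "\<And>x i j. x \<in> D \<Longrightarrow> \<bar>Df f x $ i $ j\<bar> \<le> b"
  proof -
    obtain b L where "b \<ge> 0" and bL: "\<forall>x. norm x \<le> R \<longrightarrow> norm (f x) \<le> b \<and> (\<forall>i j. \<bar>Df f x $ i $ j\<bar> \<le> b) \<and>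
      (\<forall>y. norm y \<le> R \<longrightarrow> norm (f x - f y) \<le> L * norm (x - y) \<and> (\<forall>i j. \<bar>Df f x $ i $ j - Df f y $ i $ j\<bar> \<le> L * norm (x - y)))"
      using C2_bounds_on_ball[OF f2 less_imp_le[OF R(1)]] by (elim exE conjE) (rule that)
    moreover have "norm x \<le> R" if "x \<in> D" for x using R(2) D\<Omega> that by blast
    ultimately show thesis using that[of b] by simp
  qed
  obtain lam where lam: "lam > 0" "\<And>v. lam * (norm v)\<^sup>2 \<le> v \<bullet> (C *v v)" using pos_def_lower_bound[OF C] by blast
  have "compact (closure D)" using bounded_subset[OF \<Omega>(2) D\<Omega>] by (simp add: compact_closure)
  then obtain \<rho> where \<rho>: "\<rho> > 0" "(\<Union>x\<in>closure D. ball x \<rho>) \<subseteq> \<Omega>"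
    using compact_subset_open_imp_ball_epsilon_subset[OF _ \<Omega>(1) D(5)] by blast
  have d0: "0 \<le> d" by (rule order_trans[OF _ d]) simp
  define n where "n = real CARD('n)"
  have n: "n \<ge> 0" by (simp add: n_def)
  define c1 where "c1 = (d * n + 6) * \<Lambda>"
  have c1: "c1 \<ge> 0" using d0 n \<Lambda> by (simp add: c1_def)
  have Bs: "0 \<le> Bstar" "0 \<le> B3star"
    using order_trans[OF abs_ge_zero Bstar] order_trans[OF abs_ge_zero B3star] D(4) closure_subset by blast+
  define p where "p = 4 * \<Lambda> + c1"
  \<comment> \<open>Bounds \<open>E_const\<close> on every simplex: \<open>Dd\<close> is at most
    \<open>n * (\<Lambda> + c1)\<close> by \<open>gradient_norm\<close>, and \<open>Cc\<close> is at
    most \<open>n\<^sup>2 * \<Lambda>\<close> because the values at the vertices are those of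
    \<open>S\<close>.\<close>
  define Emax where "Emax = n\<^sup>2 * (1 + 4 * sqrt n) * (Bstar * (n * (\<Lambda> + c1))) + 2 * n^3 * (B3star * (n\<^sup>2 * \<Lambda>))"
  have Emax: "Emax \<ge> 0" using n Bs \<Lambda> c1 by (simp add: Emax_def)
  define c2 where "c2 = 2 * n^4 * (3 * \<Lambda> + c1) * b + n\<^sup>2 * c1 * b"
  have c2: "c2 \<ge> 0" using n \<Lambda> c1 b(1) by (simp add: c2_def)
  \<comment> \<open>The first two bounds make the estimates on a simplex available. With the third,
    the interpolation error and the term with \<open>E_const\<close> together cost at most
    \<open>lam / 6\<close>.\<close>
  define hs where "hs = min 1 (min (\<rho> / 2) (lam / (6 * (c2 + Emax + 1))))"
  have hs: "hs > 0" using \<rho>(1) lam(1) c2 Emax by (simp add: hs_def)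
  have hs1: "hs \<le> 1" unfolding hs_def by (rule min.cobounded1)
  have hs2: "hs \<le> \<rho> / 2" unfolding hs_def by (rule order_trans[OF min.cobounded2 min.cobounded1])
  have hs3: "(c2 + Emax) * hs \<le> lam / 6"
  proof -
    have "hs \<le> lam / (6 * (c2 + Emax + 1))" unfolding hs_def by (rule order_trans[OF min.cobounded2 min.cobounded2])
    then have "(c2 + Emax) * hs \<le> (c2 + Emax + 1) * (lam / (6 * (c2 + Emax + 1)))"
      using c2 Emax hs by (intro mult_mono) auto
    also have "\<dots> = lam / 6" using c2 Emax by (simp add: field_simps)
    finally show ?thesis .
  qed
  have "verification_constraints f \<T> P \<epsilon>0 B B3 Cc Dd \<and> contraction_metric f fl (interior (\<Union>\<T>)) K P"
    if X: "finite X" "X \<noteq> {}" "X \<subseteq> \<Omega>" "fill_distance X \<Omega> \<le> hX"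
      and T: "n_triangulation \<T>" "hd_bounded h d \<T>" "K \<subseteq> interior (\<Union>\<T>)" "\<Union>\<T> \<subseteq> D" and h: "h < hs"
      and S: "optimal_recovery f fl C H ip X S" and P: "cpa_interpolation \<T> S P"
      and Cc': "\<forall>\<nu>\<in>\<T>. Cc \<nu> = Max ((\<lambda>x. mat_norm2 (P x)) ` verts \<nu>)"
      and Dd': "\<forall>\<nu>\<in>\<T>. Dd \<nu> = Max {norm1 (cpa_gradient P \<nu> i j) | i j. True}"
      and B': "\<forall>\<nu>\<in>\<T>. B \<nu> \<le> Bstar \<and> (\<forall>x\<in>\<nu>. \<forall>i j m. \<bar>pdiff i (pdiff j (\<lambda>y. f y $ m)) x\<bar> \<le> B \<nu>)"
      and B3': "\<forall>\<nu>\<in>\<T>. B3 \<nu> \<le> B3star \<and> (\<forall>x\<in>\<nu>. \<forall>i j m p. \<bar>pdiff i (pdiff j (pdiff m (\<lambda>y. f y $ p))) x\<bar> \<le> B3 \<nu>)"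
      and \<mu>: "\<forall>x\<in>closure \<Omega>. mat \<mu>0 \<preceq>\<^sub>L M x" "mat \<mu>1 \<preceq>\<^sub>L C" "\<epsilon>0 = 1/3 * min \<mu>0 \<mu>1" "\<epsilon>0 > 0"
    for X \<T> h S P \<mu>0 \<mu>1 \<epsilon>0 B B3 Cc Dd
  proof -
    have Cc: "Cc \<nu> = Max ((\<lambda>x. mat_norm2 (P x)) ` verts \<nu>)" and Dd: "Dd \<nu> = Max {norm1 (cpa_gradient P \<nu> i j) | i j. True}"
      if "\<nu> \<in> \<T>" for \<nu> using Cc' Dd' that by blast+
    have B: "B \<nu> \<le> Bstar" "x \<in> \<nu> \<Longrightarrow> \<bar>pdiff i (pdiff j (\<lambda>y. f y $ m)) x\<bar> \<le> B \<nu>" if "\<nu> \<in> \<T>" for \<nu> x i j m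
      using bspec[OF B' that] by simp_all
    have B3: "B3 \<nu> \<le> B3star" "x \<in> \<nu> \<Longrightarrow> \<bar>pdiff i (pdiff j (pdiff m (\<lambda>y. f y $ p))) x\<bar> \<le> B3 \<nu>" if "\<nu> \<in> \<T>" for \<nu> x i j m p
      using bspec[OF B3' that] by simp_all
    have \<mu>0: "\<mu>0 > 0" "\<epsilon>0 \<le> \<mu>0 / 3" "\<epsilon>0 \<le> \<mu>1 / 3" using \<mu>(3,4) by auto
    have "finite X \<and> X \<noteq> {} \<and> X \<subseteq> \<Omega> \<and> fill_distance X \<Omega> \<le> hX \<and>
     optimal_recovery f fl C H ip X S \<and> \<mu>0 > 0 \<and> (\<forall>x\<in>closure \<Omega>. mat \<mu>0 \<preceq>\<^sub>L M x)"
      by (intro conjI X S \<mu>0(1) \<mu>(1))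
    from est0[THEN spec, THEN spec, THEN spec, THEN mp, OF this]
    obtain G where G: "C11_on \<Lambda> \<Omega> S G" and S_low: "\<And>x v. x \<in> D \<Longrightarrow> \<mu>0 / 2 * (norm v)\<^sup>2 \<le> v \<bullet> (S x *v v)"
      and FS: "\<And>x v. x \<in> D \<Longrightarrow> Fform (Df f x) (S x) (dir_mat G x (f x)) v \<le> - (v \<bullet> (C *v v)) / 2"
      by blast
    have SI: "simplex_interpolation \<nu> P S G \<Lambda> \<Omega> d \<rho> c1" if \<nu>: "\<nu> \<in> \<T>" for \<nu>
    proof
      show "int CARD('n) simplex \<nu>" using T(1) \<nu> by (simp add: n_triangulation_def)
      show "\<exists>v. bij_betw v UNIV (verts \<nu>) \<and> diameter \<nu> * mat_norm1 (matrix_inv (shape_matrix v)) \<le> d"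
        using T(2) \<nu> by (simp add: hd_bounded_def)
      show "\<exists>L B. linear L \<and> (\<forall>x\<in>\<nu>. P x = L x + B)" using P \<nu> by (simp add: cpa_interpolation_def)
      show "P y = S y" if "y \<in> verts \<nu>" for y using P \<nu> that by (simp add: cpa_interpolation_def)
      show "ball x \<rho> \<subseteq> \<Omega>" if "x \<in> \<nu>" for x
      proof -
        have "x \<in> closure D" using that \<nu> T(4) closure_subset by blast
        then show ?thesis using \<rho>(2) by blast
      qed
      have "diameter \<nu> < h" using T(2) \<nu> by (simp add: hd_bounded_def)
      then show "diameter \<nu> < \<rho> / 2" "diameter \<nu> \<le> 1" using h hs1 hs2 by auto
    qed (use G d0 c1_def n_def in auto)
    have \<nu>D: "x \<in> D" if "\<nu> \<in> \<T>" "x \<in> \<nu>" for \<nu> x using that T(4) by blast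
    have dh: "diameter \<nu> < hs" if "\<nu> \<in> \<T>" for \<nu> using T(2) that h by (auto simp: hd_bounded_def)
    have diam0: "0 \<le> diameter \<nu>" "diameter \<nu> \<le> 1" if "\<nu> \<in> \<T>" for \<nu>
      using simplex_interpolation.diam(2)[OF SI[OF that]] dh[OF that] hs1 by auto
    have c2E: "c2 * diameter \<nu> + (diameter \<nu>)\<^sup>2 * Emax \<le> lam / 6" if "\<nu> \<in> \<T>" for \<nu>
    proof -
      have "(diameter \<nu>)\<^sup>2 \<le> diameter \<nu>" using diam0[OF that] by (simp add: power2_eq_square mult_left_le)
      then have "c2 * diameter \<nu> + (diameter \<nu>)\<^sup>2 * Emax \<le> c2 * diameter \<nu> + diameter \<nu> * Emax"
        using Emax by (intro add_left_mono mult_right_mono)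
      also have "\<dots> = (c2 + Emax) * diameter \<nu>" by (simp add: algebra_simps)
      also have "\<dots> \<le> (c2 + Emax) * hs" using dh[OF that] c2 Emax by (intro mult_left_mono) auto
      finally show ?thesis using hs3 by linarith
    qed
    define W where "W \<nu> x = (\<chi> i j. cpa_gradient P \<nu> i j \<bullet> f x)" for \<nu> x
    have FP: "Fform (Df f x) (P x) (W \<nu> x) v \<le> - (v \<bullet> (C *v v)) / 2 + c2 * diameter \<nu> * (norm v)\<^sup>2"
      if "\<nu> \<in> \<T>" "x \<in> \<nu>" for \<nu> x v
      using simplex_interpolation.form_error[OF SI[OF that(1)] that(2) b(3)[OF \<nu>D[OF that]] b(2)[OF \<nu>D[OF that]], of v]
        FS[OF \<nu>D[OF that], of v] unfolding W_def c2_def n_def by linarith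
    have P_sym: "symmetric_mat (P x)" and P_low: "\<mu>0 / 2 * (norm v)\<^sup>2 \<le> v \<bullet> (P x *v v)" if "\<nu> \<in> \<T>" "x \<in> \<nu>" for \<nu> x v
    proof -
      have "\<mu>0 / 2 * (norm v)\<^sup>2 \<le> v \<bullet> (S y *v v)" if "y \<in> verts \<nu>" for y v
        using S_low[of y v] simplex_interpolation.verts_subset[OF SI[OF \<open>\<nu> \<in> \<T>\<close>]] \<nu>D[OF \<open>\<nu> \<in> \<T>\<close>] that by blast
      note * = simplex_interpolation.lower_form[OF SI[OF that(1)] this that(2)]
      show "symmetric_mat (P x)" "\<mu>0 / 2 * (norm v)\<^sup>2 \<le> v \<bullet> (P x *v v)" by (rule *(1), simp, rule *(2), simp)
    qed
    have W_sym: "symmetric_mat (W \<nu> x)" if "\<nu> \<in> \<T>" for \<nu> x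
    proof -
      have "cpa_gradient P \<nu> i j = cpa_gradient P \<nu> j i" for i j
        by (rule simplex_interpolation.gradient_sym[OF SI[OF that] P_sym[OF that]])
      then have "cpa_gradient P \<nu> i j \<bullet> f x = cpa_gradient P \<nu> j i \<bullet> f x" for i j by simp
      then show ?thesis by (simp add: W_def symmetric_mat_def transpose_def)
    qed
    have "verification_constraints f \<T> P \<epsilon>0 B B3 Cc Dd"
      unfolding verification_constraints_def
    proof (intro conjI ballI allI)
      fix \<nu> assume \<nu>: "\<nu> \<in> \<T>"
      note si = SI[OF \<nu>]
      have fin: "finite (verts \<nu>)" "verts \<nu> \<noteq> {}" and vs: "\<And>y. y \<in> verts \<nu> \<Longrightarrow> y \<in> \<nu>"
        using simplex_interpolation.hull[OF si] simplex_interpolation.verts_subset[OF si] by auto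
      have PS: "P y = S y" if "y \<in> verts \<nu>" for y using P \<nu> that by (simp add: cpa_interpolation_def)
      have gset: "{norm1 (cpa_gradient P \<nu> i j) | i j. True} = (\<lambda>q. norm1 (cpa_gradient P \<nu> (fst q) (snd q))) ` UNIV"
        by (auto simp: image_def)
      have g_le: "norm1 (cpa_gradient P \<nu> i j) \<le> Dd \<nu>" for i j
        unfolding Dd[OF \<nu>] gset by (rule Max_ge[OF finite_imageI]) (simp, rule image_eqI[of _ _ "(i, j)"], simp_all)
      have Dd0: "0 \<le> Dd \<nu>" using g_le[of undefined undefined] norm1_nonneg order_trans by blast
      have Dd_le: "Dd \<nu> \<le> n * (\<Lambda> + c1)"
        unfolding Dd[OF \<nu>] gset
      proof (intro Max.boundedI)
        fix r assume "r \<in> (\<lambda>q. norm1 (cpa_gradient P \<nu> (fst q) (snd q))) ` UNIV"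
        then obtain i j where "r = norm1 (cpa_gradient P \<nu> i j)" by auto
        also have "\<dots> \<le> n * norm (cpa_gradient P \<nu> i j)" unfolding n_def by (rule norm1_le_norm)
        also have "\<dots> \<le> n * (\<Lambda> + c1)" by (intro mult_left_mono n simplex_interpolation.gradient_norm[OF si])
        finally show "r \<le> n * (\<Lambda> + c1)" .
      qed auto
      have C_le: "mat_norm2 (P y) \<le> Cc \<nu>" if "y \<in> verts \<nu>" for y
        unfolding Cc[OF \<nu>] using fin that by (intro Max_ge) auto
      have "0 \<le> mat_norm2 A" for A :: "real^'n^'n"
        unfolding mat_norm2_def by (rule onorm_pos_le[OF matrix_vector_mul_bounded_linear])
      then have Cc0: "0 \<le> Cc \<nu>" using C_le fin(2) order_trans by blast
      have Cc_le: "Cc \<nu> \<le> n\<^sup>2 * \<Lambda>"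
        unfolding Cc[OF \<nu>]
      proof (intro Max.boundedI)
        fix r assume "r \<in> (\<lambda>x. mat_norm2 (P x)) ` verts \<nu>"
        then obtain y where y: "y \<in> verts \<nu>" "r = mat_norm2 (S y)" using PS by auto
        have y\<Omega>: "y \<in> \<Omega>" using vs[OF y(1)] \<nu>D[OF \<nu>] D\<Omega> by blast
        show "r \<le> n\<^sup>2 * \<Lambda>"
          unfolding y(2) mat_norm2_def n_def
          by (rule onorm_le) (rule entries_vector_bound[OF C11_onD(3)[OF G y\<Omega>]])
      qed (use fin in auto)
      show "0 \<le> Cc \<nu>" "0 \<le> Dd \<nu>" by fact+
      show "norm1 (cpa_gradient P \<nu> i j) \<le> Dd \<nu>" for i j by (rule g_le)
      obtain y0 where y0: "y0 \<in> \<nu>" using fin(2) vs by blast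
      have B0: "0 \<le> B \<nu>" "0 \<le> B3 \<nu>"
        using order_trans[OF abs_ge_zero B(2)[OF \<nu> y0]] order_trans[OF abs_ge_zero B3(2)[OF \<nu> y0]] by blast+
      have E: "E_const (real CARD('n)) (B \<nu>) (B3 \<nu>) (Cc \<nu>) (Dd \<nu>) \<le> Emax"
      proof -
        have "B \<nu> * Dd \<nu> \<le> Bstar * (n * (\<Lambda> + c1))" using B(1)[OF \<nu>] Dd_le Bs Dd0 by (intro mult_mono) auto
        moreover have "B3 \<nu> * Cc \<nu> \<le> B3star * (n\<^sup>2 * \<Lambda>)" using B3(1)[OF \<nu>] Cc_le Bs Cc0 by (intro mult_mono) auto
        ultimately have "n\<^sup>2 * (1 + 4 * sqrt n) * (B \<nu> * Dd \<nu>) + 2 * n^3 * (B3 \<nu> * Cc \<nu>) \<le> Emax"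
          unfolding Emax_def using n by (intro add_mono mult_left_mono) auto
        then show ?thesis by (simp add: E_const_def n_def mult_ac)
      qed
      fix y assume y: "y \<in> verts \<nu>"
      note y\<nu> = vs[OF y]
      note Psy = P_sym[OF \<nu> y\<nu>]
      show "mat \<epsilon>0 \<preceq>\<^sub>L P y"
      proof (rule loewner_leI[OF symmetric_mat_mat Psy])
        fix v :: "real^'n"
        have "\<epsilon>0 * (norm v)\<^sup>2 \<le> \<mu>0 / 2 * (norm v)\<^sup>2" using \<mu>0 by (intro mult_right_mono) auto
        then show "v \<bullet> (mat \<epsilon>0 *v v) \<le> v \<bullet> (P y *v v)"
          using P_low[OF \<nu> y\<nu>, of v] by (simp add: mat_vector dot_square_norm)
      qed
      show "P y \<preceq>\<^sub>L mat (Cc \<nu>)"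
      proof (rule loewner_leI[OF Psy symmetric_mat_mat])
        fix v :: "real^'n"
        have "mat_norm2 (P y) * (norm v)\<^sup>2 \<le> Cc \<nu> * (norm v)\<^sup>2" by (intro mult_right_mono C_le y) simp
        then show "v \<bullet> (P y *v v) \<le> v \<bullet> (mat (Cc \<nu>) *v v)"
          using form_le_mat_norm2[of v "P y"] by (simp add: mat_vector dot_square_norm)
      qed
      show "A_mat f P \<nu> y + mat ((diameter \<nu>)\<^sup>2 * E_const (real CARD('n)) (B \<nu>) (B3 \<nu>) (Cc \<nu>) (Dd \<nu>)) \<preceq>\<^sub>L mat (- \<epsilon>0)"
      proof (rule loewner_leI[OF symmetric_mat_add[OF _ symmetric_mat_mat] symmetric_mat_mat])
        have A: "A_mat f P \<nu> y = P y ** Df f y + transpose (Df f y) ** P y + W \<nu> y" by (simp add: A_mat_def W_def)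
        show "symmetric_mat (A_mat f P \<nu> y)" unfolding A by (rule symmetric_mat_Lyapunov[OF Psy W_sym[OF \<nu>]])
        fix v :: "real^'n"
        define e where "e = E_const (real CARD('n)) (B \<nu>) (B3 \<nu>) (Cc \<nu>) (Dd \<nu>)"
        have "v \<bullet> (A_mat f P \<nu> y *v v) = Fform (Df f y) (P y) (W \<nu> y) v"
          unfolding A using Fform_eq[OF Psy, of v "Df f y" "W \<nu> y"] by (simp only: add.commute[of "P y ** Df f y"])
        also have "\<dots> \<le> - (v \<bullet> (C *v v)) / 2 + c2 * diameter \<nu> * (norm v)\<^sup>2" by (rule FP[OF \<nu> y\<nu>])
        finally have "v \<bullet> (A_mat f P \<nu> y *v v) + ((diameter \<nu>)\<^sup>2 * e) * (norm v)\<^sup>2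
            \<le> - (v \<bullet> (C *v v)) / 2 + (c2 * diameter \<nu> + (diameter \<nu>)\<^sup>2 * e) * (norm v)\<^sup>2"
          by (simp add: distrib_right)
        also have "(c2 * diameter \<nu> + (diameter \<nu>)\<^sup>2 * e) * (norm v)\<^sup>2 \<le> lam / 6 * (norm v)\<^sup>2"
          using mult_left_mono[OF E, of "(diameter \<nu>)\<^sup>2"] c2E[OF \<nu>] by (intro mult_right_mono) (auto simp: e_def)
        \<comment> \<open>One half minus one sixth leaves a third of \<open>C\<close>, and
          \<open>\<epsilon>0\<close> is at most a third of \<open>\<mu>1\<close>.\<close>
        also have "lam / 6 * (norm v)\<^sup>2 \<le> v \<bullet> (C *v v) / 6" using lam(2)[of v] by simp
        finally have "v \<bullet> (A_mat f P \<nu> y *v v) + ((diameter \<nu>)\<^sup>2 * e) * (norm v)\<^sup>2 \<le> - (v \<bullet> (C *v v)) / 3" by linarith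
        moreover have "\<mu>1 * (norm v)\<^sup>2 \<le> v \<bullet> (C *v v)" by (rule loewner_le_matD[OF \<mu>(2)])
        moreover have "\<epsilon>0 * (norm v)\<^sup>2 \<le> \<mu>1 / 3 * (norm v)\<^sup>2" using \<mu>0(3) by (intro mult_right_mono) auto
        ultimately have "v \<bullet> (A_mat f P \<nu> y *v v) + ((diameter \<nu>)\<^sup>2 * e) * (norm v)\<^sup>2 \<le> - \<epsilon>0 * (norm v)\<^sup>2" by linarith
        then show "v \<bullet> ((A_mat f P \<nu> y + mat ((diameter \<nu>)\<^sup>2 * E_const (real CARD('n)) (B \<nu>) (B3 \<nu>) (Cc \<nu>) (Dd \<nu>))) *v v) \<le> v \<bullet> (mat (- \<epsilon>0) *v v)"
          unfolding matrix_vector_mult_add_rdistrib mat_vector e_def by (simp add: inner_add_right dot_square_norm)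
      qed
    qed
    moreover have "contraction_metric f fl (interior (\<Union>\<T>)) K P"
    proof -
      have finT: "finite \<T>" using T(1) by (simp add: n_triangulation_def triangulation_def)
      have closT: "closed s" and convT: "convex s" if "s \<in> \<T>" for s
        using simplex_interpolation.compact_simplex[OF SI[OF that]] simplex_interpolation.convex_simplex[OF SI[OF that]]
        by (auto intro: compact_imp_closed)
      have "\<forall>s\<in>\<T>. \<exists>l. l \<ge> 0 \<and> (\<forall>x\<in>s. \<forall>y\<in>s. norm (P x - P y) \<le> l * norm (x - y))"
        using simplex_interpolation.Lipschitz[OF SI] by blast
      from bchoice[OF this] obtain ls where ls: "\<And>s. s \<in> \<T> \<Longrightarrow> ls s \<ge> 0"
        "\<And>s x y. s \<in> \<T> \<Longrightarrow> x \<in> s \<Longrightarrow> y \<in> s \<Longrightarrow> norm (P x - P y) \<le> ls s * norm (x - y)" by blast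
      define l where "l = sum ls \<T>"
      have l0: "l \<ge> 0" unfolding l_def by (rule sum_nonneg) (rule ls(1))
      have l: "norm (P x - P y) \<le> l * norm (x - y)" if "s \<in> \<T>" "x \<in> s" "y \<in> s" for s x y
      proof -
        have "ls s \<le> l" unfolding l_def using finT that(1) ls(1) by (intro member_le_sum) auto
        then show ?thesis using ls(2)[OF that] mult_right_mono[of "ls s" l "norm (x - y)"] by simp
      qed
      \<comment> \<open>Stated on convex subsets of the interior, as the segment between the two
        points has to stay in the union of the simplices.\<close>
      have Lip: "norm (P y - P z) \<le> l * norm (y - z)" if U: "convex U" "U \<subseteq> interior (\<Union>\<T>)" "y \<in> U" "z \<in> U" for U y z
      proof (rule piecewise_Lipschitz[OF finT closT l0 l])
        show "closed_segment y z \<subseteq> \<Union>\<T>"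
          using closed_segment_subset[OF U(3,4,1)] U(2) interior_subset by blast
      qed
      have "riemannian_metric (interior (\<Union>\<T>)) P"
        unfolding riemannian_metric_def
      proof (intro conjI ballI open_interior)
        fix x assume x: "x \<in> interior (\<Union>\<T>)"
        then obtain \<nu> where \<nu>: "\<nu> \<in> \<T>" "x \<in> \<nu>" using interior_subset by blast
        have "0 < v \<bullet> (P x *v v)" if "v \<noteq> 0" for v
        proof -
          have "0 < \<mu>0 / 2 * (norm v)\<^sup>2" using that \<mu>0(1) by simp
          then show ?thesis using P_low[OF \<nu>, of v] by linarith
        qed
        then show "pos_def (P x)" using P_sym[OF \<nu>] by (simp add: pos_def_def)
        obtain u where u: "u > 0" "cball x u \<subseteq> interior (\<Union>\<T>)" using x open_contains_cball[of "interior (\<Union>\<T>)"] by auto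
        have "l-lipschitz_on (cball x u \<inter> interior (\<Union>\<T>)) P"
          by (rule lipschitz_onI) (use Lip[OF convex_cball u(2)] l0 in \<open>auto simp: dist_norm\<close>)
        then show "\<exists>u>0. \<exists>L. L-lipschitz_on (cball x u \<inter> interior (\<Union>\<T>)) P" using u(1) by blast
      qed
      moreover have "\<exists>\<nu>>0. \<forall>x\<in>K. \<forall>v. v \<bullet> (P x *v v) = 1 \<longrightarrow> 1/2 * (v \<bullet> (F_op f fl P x *v v)) \<le> - \<nu>"
      \<comment> \<open>\<open>v\<close> is normalised by the form of \<open>P\<close>, whose
        entries are at most \<open>p\<close>, so \<open>(norm v)\<^sup>2\<close> is at least
        \<open>1 / (n\<^sup>2 * p + 1)\<close>; the rest is half of the decay rate
        \<open>lam / 3\<close> of \<open>F(P)\<close>.\<close>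
      proof (intro exI[of _ "lam / (6 * (n\<^sup>2 * p + 1))"] conjI ballI allI impI)
        have np: "n\<^sup>2 * p + 1 > 0" using n \<Lambda> c1 by (simp add: p_def add_nonneg_pos)
        then show "0 < lam / (6 * (n\<^sup>2 * p + 1))" using lam(1) by simp
        fix x v assume x: "x \<in> K" and v: "v \<bullet> (P x *v v) = 1"
        have xi: "x \<in> interior (\<Union>\<T>)" using x T(3) by blast
        obtain \<nu> h0 where \<nu>: "\<nu> \<in> \<T>" "x \<in> \<nu>" and h0: "h0 > 0" "\<And>t. 0 \<le> t \<Longrightarrow> t \<le> h0 \<Longrightarrow> x + t *\<^sub>R f x \<in> \<nu>"
          using ray_in_piece[OF finT closT convT xi, of "f x"] by blast
        obtain u where u: "u > 0" "ball x u \<subseteq> interior (\<Union>\<T>)" using xi open_contains_ball[of "interior (\<Union>\<T>)"] by auto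
        have "orbital_derivative fl P x = W \<nu> x"
        proof (rule orbital_derivative_Lipschitz[OF flow open_ball _ _ h0(1)])
          show "x \<in> ball x u" using u(1) by simp
          show "norm (P y - P z) \<le> l * norm (y - z)" if "y \<in> ball x u" "z \<in> ball x u" for y z
            by (rule Lip[OF convex_ball u(2) that])
          show "P (x + t *\<^sub>R f x) $ i $ j - P x $ i $ j = t * W \<nu> x $ i $ j" if "0 < t" "t < h0" for t i j
            using simplex_interpolation.gradient[OF SI[OF \<nu>(1)] h0(2)[of t] \<nu>(2), of i j] that by (simp add: W_def)
        qed
        then have "v \<bullet> (F_op f fl P x *v v) = Fform (Df f x) (P x) (W \<nu> x) v"
          using Fform_eq[OF P_sym[OF \<nu>], of v "Df f x" "W \<nu> x"] by (simp add: F_op_def)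
        also have "\<dots> \<le> - (v \<bullet> (C *v v)) / 2 + c2 * diameter \<nu> * (norm v)\<^sup>2" by (rule FP[OF \<nu>])
        also have "c2 * diameter \<nu> * (norm v)\<^sup>2 \<le> lam / 6 * (norm v)\<^sup>2"
        proof (intro mult_right_mono)
          have "0 \<le> (diameter \<nu>)\<^sup>2 * Emax" using Emax by simp
          then show "c2 * diameter \<nu> \<le> lam / 6" using c2E[OF \<nu>(1)] by linarith
        qed simp
        finally have F: "v \<bullet> (F_op f fl P x *v v) \<le> - (lam / 3 * (norm v)\<^sup>2)" using lam(2)[of v] by linarith
        have "1 \<le> n\<^sup>2 * p * (norm v * norm v)"
          using entries_form_le[OF simplex_interpolation.value_bound[OF SI[OF \<nu>(1)] \<nu>(2)] order_refl order_refl, of v v] v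
          by (simp add: n_def p_def)
        also have "\<dots> \<le> (n\<^sup>2 * p + 1) * (norm v)\<^sup>2" by (simp add: distrib_right power2_eq_square)
        finally have "1 / (n\<^sup>2 * p + 1) \<le> (norm v)\<^sup>2" using np by (simp add: pos_divide_le_eq mult.commute)
        then have "lam / 6 * (1 / (n\<^sup>2 * p + 1)) \<le> lam / 6 * (norm v)\<^sup>2" using lam(1) by (intro mult_left_mono) auto
        moreover have "lam / 6 * (1 / (n\<^sup>2 * p + 1)) = lam / (6 * (n\<^sup>2 * p + 1))" by simp
        ultimately show "1/2 * (v \<bullet> (F_op f fl P x *v v)) \<le> - (lam / (6 * (n\<^sup>2 * p + 1)))" using F by linarith
      qed
      ultimately show ?thesis using K(1) T(3) by (simp add: contraction_metric_def)
    qed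
    ultimately show ?thesis by blast
  qed
  note main = this
  show ?thesis
    by (rule exI[of _ hX], rule conjI[OF hX], rule exI[of _ hs], rule conjI[OF hs], intro allI impI, elim conjE)
      (rule main; assumption)
qed

end
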